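(* For every finite connected weighted graph $G=(V,(c_{xy})_{x,y\in V})$, all positive site weights $\alpha=(\alpha_x)_{x\in V}$, and all non-negative site weights $\omega=(\omega_x)_{x\in V}$ with $\omega\neq0$ (not identically zero), $${\rm gap}_{\rm BEP}(G,\alpha,\omega,\varrho)={\rm gap}_{\rm RW}(G,\alpha,\omega),\qquad\text{for all }\varrho>0.$$
   Context: $G$ is a finite graph with symmetric conductances $c_{xy}=c_{yx}\ge 0$, $c_{xx}=0$, connected (any two distinct sites are joined by a sequence of sites with positive consecutive conductances). For $\varrho>0$, the non-conservative Brownian energy process with constant reservoir parameter $\theta\equiv\varrho$ is the diffusion on $[0,\infty)^V$ with generator $$\mathcal L_{G,\alpha,\omega,\varrho}=\frac12\sum_{x,y\in V}c_{xy}\Big\{-(\alpha_y\zeta_x-\alpha_x\zeta_y)(\partial_{\zeta_x}-\partial_{\zeta_y})+\zeta_x\zeta_y(\partial_{\zeta_x}-\partial_{\zeta_y})^2\Big\}+\sum_{x\in V}\omega_x\Big\{(\alpha_x\varrho-\zeta_x)\partial_{\zeta_x}+\varrho\,\zeta_x\,\partial_{\zeta_x}^2\Big\}.$$ When $\omega\ne0$, its unique reversible probability measure is the product measure $\gamma_{\alpha,\varrho}=\bigotimes_{x\in V}{\rm Gamma}(\alpha_x,\varrho)$, where ${\rm Gamma}(\alpha_x,\varrho)$ has shape $\alpha_x$ and scale $\varrho$ (density proportional to $z^{\alpha_x-1}e^{-z/\varrho}$ on $(0,\infty)$). $\mathcal L_{G,\alpha,\omega,\varrho}$ is regarded as the self-adjoint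 generator of the associated Markov semigroup on $L^2(\gamma_{\alpha,\varrho})$, and ${\rm gap}_{\rm BEP}(G,\alpha,\omega,\varrho)$ is its spectral gap, i.e. the infimum of the spectrum of $-\mathcal L_{G,\alpha,\omega,\varrho}$ with the eigenvalue $0$ removed. ${\rm gap}_{\rm RW}(G,\alpha,\omega)$ is the smallest eigenvalue of minus the generator of the random walk on $V$ with killing, i.e. of the operator on $\mathbb R^V$ given by $f\mapsto-\sum_{y\in V}c_{xy}\alpha_y(f(y)-f(x))+\omega_xf(x)$, $x\in V$. *)

theory Defs
  imports "HOL-Analysis.Analysis"
begin

section \<open>Operators and Markov semigroups on the real space L2(M)\<close>

text \<open>
  Elements of L2(M) are represented by square-integrable functions, so all identities hold
  M-almost everywhere. A possibly unbounded operator is represented by its graph; a graph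
  contains all representatives of each of its points.
\<close>

definition L2_fun :: "'a measure \<Rightarrow> ('a \<Rightarrow> real) set" where
  "L2_fun M = {f \<in> borel_measurable M. integrable M (\<lambda>z. (f z)\<^sup>2)}"

definition L2_nrm :: "'a measure \<Rightarrow> ('a \<Rightarrow> real) \<Rightarrow> real" where
  "L2_nrm M f = sqrt (\<integral>z. (f z)\<^sup>2 \<partial>M)"

text \<open>
  A strongly continuous semigroup of M-symmetric Markov operators (positivity preserving,
  mass preserving contractions) on L2(M). The values at negative times are irrelevant.
\<close>

definition symmetric_markov_semigroup ::
    "'a measure \<Rightarrow> (real \<Rightarrow> ('a \<Rightarrow> real) \<Rightarrow> 'a \<Rightarrow> real) \<Rightarrow> bool" where
  "symmetric_markov_semigroup M P \<longleftrightarrow>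
     (\<forall>t\<ge>0. \<forall>f\<in>L2_fun M. P t f \<in> L2_fun M \<and> L2_nrm M (P t f) \<le> L2_nrm M f) \<and>
     (\<forall>t\<ge>0. \<forall>f\<in>L2_fun M. \<forall>g\<in>L2_fun M.
        (AE z in M. f z = g z) \<longrightarrow> (AE z in M. P t f z = P t g z)) \<and>
     (\<forall>t\<ge>0. \<forall>f\<in>L2_fun M. \<forall>g\<in>L2_fun M. \<forall>a b.
        AE z in M. P t (\<lambda>u. a * f u + b * g u) z = a * P t f z + b * P t g z) \<and>
     (\<forall>f\<in>L2_fun M. AE z in M. P 0 f z = f z) \<and>
     (\<forall>s\<ge>0. \<forall>t\<ge>0. \<forall>f\<in>L2_fun M. AE z in M. P (s + t) f z = P s (P t f) z) \<and>
     (\<forall>f\<in>L2_fun M. ((\<lambda>t. L2_nrm M (\<lambda>z. P t f z - f z)) \<longlongrightarrow> 0) (at_right 0)) \<and>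
     (\<forall>t\<ge>0. \<forall>f\<in>L2_fun M. (AE z in M. 0 \<le> f z) \<longrightarrow> (AE z in M. 0 \<le> P t f z)) \<and>
     (\<forall>t\<ge>0. AE z in M. P t (\<lambda>_. 1) z = 1) \<and>
     (\<forall>t\<ge>0. \<forall>f\<in>L2_fun M. \<forall>g\<in>L2_fun M.
        (\<integral>z. P t f z * g z \<partial>M) = (\<integral>z. f z * P t g z \<partial>M))"

definition L2_generator ::
    "'a measure \<Rightarrow> (real \<Rightarrow> ('a \<Rightarrow> real) \<Rightarrow> 'a \<Rightarrow> real) \<Rightarrow> (('a \<Rightarrow> real) \<times> ('a \<Rightarrow> real)) set" where
  "L2_generator M P = {(f, g). f \<in> L2_fun M \<and> g \<in> L2_fun M \<and>
     ((\<lambda>t. L2_nrm M (\<lambda>z. (P t f z - f z) / t - g z)) \<longlongrightarrow> 0) (at_right 0)}"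

definition op_neg :: "(('a \<Rightarrow> real) \<times> ('a \<Rightarrow> real)) set \<Rightarrow> (('a \<Rightarrow> real) \<times> ('a \<Rightarrow> real)) set" where
  "op_neg A = {(f, \<lambda>z. - g z) | f g. (f, g) \<in> A}"

text \<open>
  The resolvent set of a linear operator: l - B is injective and onto L2(M), with bounded
  inverse. Only self-adjoint operators are considered below; their spectrum is real, so
  real scalars suffice.
\<close>

definition L2_resolvent_set ::
    "'a measure \<Rightarrow> (('a \<Rightarrow> real) \<times> ('a \<Rightarrow> real)) set \<Rightarrow> real set" where
  "L2_resolvent_set M B = {l.
     (\<forall>(f, g)\<in>B. (AE z in M. l * f z - g z = 0) \<longrightarrow> (AE z in M. f z = 0)) \<and>
     (\<exists>C. \<forall>h\<in>L2_fun M. \<exists>(f, g)\<in>B.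
        (AE z in M. l * f z - g z = h z) \<and> L2_nrm M f \<le> C * L2_nrm M h)}"

definition L2_spectrum ::
    "'a measure \<Rightarrow> (('a \<Rightarrow> real) \<times> ('a \<Rightarrow> real)) set \<Rightarrow> real set" where
  "L2_spectrum M B = - L2_resolvent_set M B"


section \<open>The non-conservative Brownian energy process\<close>

definition connected_conductances :: "('v \<Rightarrow> 'v \<Rightarrow> real) \<Rightarrow> bool" where
  "connected_conductances c \<longleftrightarrow>
     (\<forall>x y. c x y = c y x) \<and> (\<forall>x y. 0 \<le> c x y) \<and> (\<forall>x. c x x = 0) \<and>
     (\<forall>x y. x \<noteq> y \<longrightarrow> (\<lambda>u v. 0 < c u v)\<^sup>*\<^sup>* x y)"

definition gamma_distr :: "real \<Rightarrow> real \<Rightarrow> real measure" where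
  "gamma_distr a r = density lborel
     (\<lambda>z. ennreal (if 0 < z then z powr (a - 1) * exp (- z / r) / (Gamma a * r powr a) else 0))"

text \<open>
  The product measure is set on all of R^V, but it is carried by [0,oo)^V (even by the
  open orthant), so its L2-space is that of the state space [0,oo)^V.
\<close>

definition gamma_product :: "('v::finite \<Rightarrow> real) \<Rightarrow> real \<Rightarrow> ('v \<Rightarrow> real) measure" where
  "gamma_product \<alpha> \<rho> = PiM UNIV (\<lambda>x. gamma_distr (\<alpha> x) \<rho>)"

definition pderiv_at :: "'v \<Rightarrow> (('v \<Rightarrow> real) \<Rightarrow> real) \<Rightarrow> ('v \<Rightarrow> real) \<Rightarrow> real" where
  "pderiv_at x f \<zeta> = deriv (\<lambda>t. f (\<zeta>(x := t))) (\<zeta> x)"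

definition pderiv_diff :: "'v \<Rightarrow> 'v \<Rightarrow> (('v \<Rightarrow> real) \<Rightarrow> real) \<Rightarrow> ('v \<Rightarrow> real) \<Rightarrow> real" where
  "pderiv_diff x y f \<zeta> = pderiv_at x f \<zeta> - pderiv_at y f \<zeta>"

definition bep_operator ::
    "('v::finite \<Rightarrow> 'v \<Rightarrow> real) \<Rightarrow> ('v \<Rightarrow> real) \<Rightarrow> ('v \<Rightarrow> real) \<Rightarrow> real
       \<Rightarrow> (('v \<Rightarrow> real) \<Rightarrow> real) \<Rightarrow> ('v \<Rightarrow> real) \<Rightarrow> real" where
  "bep_operator c \<alpha> \<omega> \<rho> f \<zeta> =
     1 / 2 * (\<Sum>x\<in>UNIV. \<Sum>y\<in>UNIV. c x y *
        (- (\<alpha> y * \<zeta> x - \<alpha> x * \<zeta> y) * pderiv_diff x y f \<zeta>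
          + \<zeta> x * \<zeta> y * pderiv_diff x y (pderiv_diff x y f) \<zeta>))
     + (\<Sum>x\<in>UNIV. \<omega> x *
        ((\<alpha> x * \<rho> - \<zeta> x) * pderiv_at x f \<zeta> + \<rho> * \<zeta> x * pderiv_at x (pderiv_at x f) \<zeta>))"

definition C1_fun :: "(('v::finite \<Rightarrow> real) \<Rightarrow> real) \<Rightarrow> bool" where
  "C1_fun f \<longleftrightarrow> continuous_on UNIV f \<and>
     (\<forall>x. (\<forall>\<zeta>. (\<lambda>t. f (\<zeta>(x := t))) field_differentiable at (\<zeta> x)) \<and>
          continuous_on UNIV (pderiv_at x f))"

definition poly_growth :: "(('v::finite \<Rightarrow> real) \<Rightarrow> real) \<Rightarrow> bool" where
  "poly_growth f \<longleftrightarrow> (\<exists>C n. \<forall>\<zeta>. (\<forall>x. 0 \<le> \<zeta> x) \<longrightarrow> \<bar>f \<zeta>\<bar> \<le> C * (1 + (\<Sum>x\<in>UNIV. \<zeta> x)) ^ n)"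

text \<open>
  The test functions on which the generator of the diffusion is given by the differential
  expression: (restrictions to the closed orthant of) C2 functions which, with their
  derivatives up to order two, grow at most polynomially. They include all polynomials and
  all compactly supported C2 functions, without any condition at the boundary.
\<close>

definition bep_test_functions :: "(('v::finite \<Rightarrow> real) \<Rightarrow> real) set" where
  "bep_test_functions = {f. C1_fun f \<and> (\<forall>x. C1_fun (pderiv_at x f)) \<and> poly_growth f \<and>
     (\<forall>x. poly_growth (pderiv_at x f)) \<and> (\<forall>x y. poly_growth (pderiv_at y (pderiv_at x f)))}"

text \<open>
  The L2-generator of the Markov semigroup of the diffusion. The description is definite:
  the differential operator leaves the polynomials of degree at most n invariant and
  polynomials are dense in L2, so the prescription on test functions determines the
  semigroup.
\<close>

definition bep_generator ::
    "('v::finite \<Rightarrow> 'v \<Rightarrow> real) \<Rightarrow> ('v \<Rightarrow> real) \<Rightarrow> ('v \<Rightarrow> real) \<Rightarrow> real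
       \<Rightarrow> ((('v \<Rightarrow> real) \<Rightarrow> real) \<times> (('v \<Rightarrow> real) \<Rightarrow> real)) set" where
  "bep_generator c \<alpha> \<omega> \<rho> = (THE A. \<exists>P.
     symmetric_markov_semigroup (gamma_product \<alpha> \<rho>) P \<and>
     A = L2_generator (gamma_product \<alpha> \<rho>) P \<and>
     (\<forall>f\<in>bep_test_functions. (f, bep_operator c \<alpha> \<omega> \<rho> f) \<in> A))"

definition gap_BEP ::
    "('v::finite \<Rightarrow> 'v \<Rightarrow> real) \<Rightarrow> ('v \<Rightarrow> real) \<Rightarrow> ('v \<Rightarrow> real) \<Rightarrow> real \<Rightarrow> real" where
  "gap_BEP c \<alpha> \<omega> \<rho> =
     Inf (L2_spectrum (gamma_product \<alpha> \<rho>) (op_neg (bep_generator c \<alpha> \<omega> \<rho>)) - {0})"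


section \<open>The random walk with killing\<close>

definition rw_operator ::
    "('v::finite \<Rightarrow> 'v \<Rightarrow> real) \<Rightarrow> ('v \<Rightarrow> real) \<Rightarrow> ('v \<Rightarrow> real) \<Rightarrow> ('v \<Rightarrow> real) \<Rightarrow> 'v \<Rightarrow> real" where
  "rw_operator c \<alpha> \<omega> f x = - (\<Sum>y\<in>UNIV. c x y * \<alpha> y * (f y - f x)) + \<omega> x * f x"

text \<open>
  The operator is symmetric for the inner product weighted by \<open>\<alpha>\<close>, so it has real
  eigenvalues, finitely many and at least one.
\<close>

definition gap_RW :: "('v::finite \<Rightarrow> 'v \<Rightarrow> real) \<Rightarrow> ('v \<Rightarrow> real) \<Rightarrow> ('v \<Rightarrow> real) \<Rightarrow> real" where
  "gap_RW c \<alpha> \<omega> = Min {l. \<exists>f. f \<noteq> (\<lambda>_. 0) \<and> (\<forall>x. rw_operator c \<alpha> \<omega> f x = l * f x)}"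

end

theory Submission
  imports Defs "HOL-Library.Function_Algebras"
    "HOL-Computational_Algebra.Fundamental_Theorem_Algebra"
    "HOL-Probability.Infinite_Product_Measure" "HOL-Real_Asymp.Real_Asymp"
begin

text \<open>
  Write \<open>L\<close> for the generator of the Brownian energy process, \<open>T\<close> for minus the generator of the
  walk with killing and \<open>lam\<close> for the lowest eigenvalue of \<open>T\<close>. The operator \<open>L\<close> does not raise the
  degree of a polynomial; polynomials are dense in L2 of a product of Gamma laws, because these
  have exponential moments (\<open>Polys_dense\<close>); and \<open>L\<close> is symmetric there, by integration by parts
  (\<open>bep_ibp\<close>). The finite-dimensional spectral theorem, applied degree by degree, therefore yields
  an orthonormal basis of eigenpolynomials (\<open>orthonormal_eigenbasis\<close>), and the gap is the smallest
  nonzero eigenvalue of \<open>- L\<close> on polynomials.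

  One inequality comes from degree one: if \<open>T a = lam a\<close>, then \<open>\<Sum>x. a x * \<zeta> x\<close> minus a suitable
  constant is an eigenfunction of \<open>- L\<close> with eigenvalue \<open>lam\<close> (\<open>lam_in_spectrum\<close>).

  The other inequality says that no eigenpolynomial of degree \<open>n > 0\<close> decays more slowly
  (\<open>eigenpolynomial_gap\<close>). The only terms of \<open>L\<close> that lower the degree are those that carry the
  factor \<open>\<rho>\<close>. Hence the homogeneous part \<open>F\<close> of top degree is an eigenfunction, with the same
  eigenvalue \<open>- l\<close>, of the operator \<open>bulk - killing\<close> made of the exchanges along the edges and the
  first-order loss \<open>\<Sum>x. \<omega> x * \<zeta> x * \<partial>\<^sub>x\<close>. Let \<open>a\<close> be the ground state of \<open>T\<close>, which is
  positive by connectedness, let \<open>s\<close> be the total mass and let \<open>H = (\<Sum>x. a x * \<zeta> x) * s ^ (n - 1)\<close>.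
  The exchanges conserve \<open>s\<close>, so they act on the linear factor only, and the loss of the factor
  \<open>s ^ (n - 1)\<close> has a sign: \<open>bulk H - killing H \<le> - lam * H\<close> (\<open>supersolution\<close>). Now touch \<open>F\<close> (or
  \<open>- F\<close>) from above by the smallest multiple \<open>k * H\<close>. At a touching point the minimum principle
  gives \<open>0 \<le> (bulk - killing) (k * H - F) \<le> (l - lam) * k * H\<close>, that is, \<open>lam \<le> l\<close>. Homogeneity
  makes the touching point exist, since it reduces the comparison to the compact simplex \<open>s = 1\<close>.

  It remains to see that the generator of the process is the operator which is diagonal in this
  basis. It generates the semigroup \<open>S\<close> that multiplies each basis element by \<open>exp (- \<mu> t)\<close>, and
  the action on eigenpolynomials determines a contraction semigroup (\<open>generator_unique\<close>). The only
  property of \<open>S\<close> that is not formal is that it preserves positivity. A parabolic minimum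
  principle for polynomials (\<open>heat_flow_nonneg\<close>) shows that \<open>S t (p\<^sup>2)\<close> is nonnegative on the
  orthant for each polynomial \<open>p\<close>. By symmetry \<open>S t f\<close>, for \<open>f \<ge> 0\<close>, has a nonnegative integral
  against every \<open>p\<^sup>2\<close>, and density of polynomials in weighted L2-spaces turns this into
  \<open>S t f \<ge> 0\<close> (\<open>nonneg_if_nonneg_on_squares\<close>).
\<close>

section \<open>Symmetric operators in finite dimension\<close>

text \<open>
  A named scalar multiplication, at which the locale of vector spaces can be interpreted: spans and
  dependence of functions are then available.
\<close>

definition scl :: "real \<Rightarrow> ('a \<Rightarrow> real) \<Rightarrow> 'a \<Rightarrow> real" where
  "scl r f = (\<lambda>z. r * f z)"

lemma scl_apply [simp]: "scl r f z = r * f z"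
  by (simp add: scl_def)

lemma scl_simps [simp]: "scl r 0 = 0" "scl 0 f = 0" "scl 1 f = f" "scl r (scl s f) = scl (r * s) f"
  by (auto simp: fun_eq_iff)

interpretation FV: vector_space "scl :: real \<Rightarrow> ('a \<Rightarrow> real) \<Rightarrow> 'a \<Rightarrow> real"
  by unfold_locales (auto simp: fun_eq_iff algebra_simps)

lemma sum_fun_apply: "(\<Sum>i\<in>I. f i) z = (\<Sum>i\<in>I. f i z)"
  for f :: "'i \<Rightarrow> 'a \<Rightarrow> 'b::comm_monoid_add"
  by (induction I rule: infinite_finite_induct) auto

text \<open>
  The operator and the form live on a subspace \<open>V\<close> of a function space, and nothing is asked of
  them outside \<open>V\<close>; \<open>B\<close> only witnesses that \<open>V\<close> has finite dimension. This covers the random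
  walk, with \<open>V\<close> the full space, and the diffusion on the polynomials of bounded degree.
\<close>

locale symmetric_operator =
  fixes V :: "('a \<Rightarrow> real) set" and B :: "('a \<Rightarrow> real) set"
    and T :: "('a \<Rightarrow> real) \<Rightarrow> ('a \<Rightarrow> real)"
    and ip :: "('a \<Rightarrow> real) \<Rightarrow> ('a \<Rightarrow> real) \<Rightarrow> real"
  assumes V: "FV.subspace V" and finB: "finite B" and VB: "V \<subseteq> FV.span B"
    and T_V: "f \<in> V \<Longrightarrow> T f \<in> V"
    and T_add: "f \<in> V \<Longrightarrow> g \<in> V \<Longrightarrow> T (f + g) = T f + T g"
    and T_scl: "f \<in> V \<Longrightarrow> T (scl r f) = scl r (T f)"
    and ip_sym: "f \<in> V \<Longrightarrow> g \<in> V \<Longrightarrow> ip f g = ip g f"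
    and ip_add: "f \<in> V \<Longrightarrow> g \<in> V \<Longrightarrow> h \<in> V \<Longrightarrow> ip (f + g) h = ip f h + ip g h"
    and ip_scl: "f \<in> V \<Longrightarrow> h \<in> V \<Longrightarrow> ip (scl r f) h = r * ip f h"
    and ip_pos: "f \<in> V \<Longrightarrow> 0 \<le> ip f f"
    and ip_def: "f \<in> V \<Longrightarrow> ip f f = 0 \<Longrightarrow> f = 0"
    and T_sym: "f \<in> V \<Longrightarrow> g \<in> V \<Longrightarrow> ip (T f) g = ip f (T g)"
begin

lemma V0: "0 \<in> V" and V_add: "f \<in> V \<Longrightarrow> g \<in> V \<Longrightarrow> f + g \<in> V"
  and V_scl: "f \<in> V \<Longrightarrow> scl r f \<in> V" and V_diff: "f \<in> V \<Longrightarrow> g \<in> V \<Longrightarrow> f - g \<in> V"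
  and V_sum: "(\<And>i. i \<in> I \<Longrightarrow> h i \<in> V) \<Longrightarrow> sum h I \<in> V"
  using V by (auto intro: FV.subspace_0 FV.subspace_add FV.subspace_scale FV.subspace_diff FV.subspace_sum)

lemma T_0: "T 0 = 0" using T_scl[OF V0, of 0] by simp

lemma T_diff: "f \<in> V \<Longrightarrow> g \<in> V \<Longrightarrow> T (f - g) = T f - T g"
  using T_add[of "f - g" g] V_diff[of f g] by (simp add: eq_diff_eq)

lemma T_sum: "(\<And>i. i \<in> I \<Longrightarrow> h i \<in> V) \<Longrightarrow> T (sum h I) = (\<Sum>i\<in>I. T (h i))"
  by (induction I rule: infinite_finite_induct) (auto simp: T_0 T_add V_sum)

lemma ip_diff: "f \<in> V \<Longrightarrow> g \<in> V \<Longrightarrow> h \<in> V \<Longrightarrow> ip (f - g) h = ip f h - ip g h"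
  using ip_add[of "f - g" g h] V_diff[of f g] by simp

lemma ip_0: "h \<in> V \<Longrightarrow> ip 0 h = 0"
  using ip_scl[OF V0, of h 0] by simp

lemma ip_sum: "(\<And>i. i \<in> I \<Longrightarrow> k i \<in> V) \<Longrightarrow> h \<in> V \<Longrightarrow> ip (sum k I) h = (\<Sum>i\<in>I. ip (k i) h)"
  by (induction I rule: infinite_finite_induct) (auto simp: ip_0 ip_add V_sum)

lemma eigen_orthogonal:
  assumes "f \<in> V" "g \<in> V" "T f = scl a f" "T g = scl b g" "a \<noteq> b"
  shows "ip f g = 0"
proof -
  have "a * ip f g = ip (T f) g" using assms by (simp add: ip_scl)
  also have "\<dots> = ip f (T g)" by (rule T_sym[OF assms(1,2)])
  also have "\<dots> = ip (T g) f" using assms(1,2) by (intro ip_sym T_V)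
  also have "\<dots> = b * ip f g" using assms by (simp add: ip_scl ip_sym)
  finally show ?thesis using assms by auto
qed

definition pT :: "real poly \<Rightarrow> ('a \<Rightarrow> real) \<Rightarrow> 'a \<Rightarrow> real" where
  "pT p f = (\<Sum>i\<le>degree p. scl (coeff p i) ((T ^^ i) f))"

lemma Tpow_V: "f \<in> V \<Longrightarrow> (T ^^ i) f \<in> V"
  by (induction i) (auto intro: T_V)

lemma pT_V: "f \<in> V \<Longrightarrow> pT p f \<in> V"
  unfolding pT_def by (intro V_sum V_scl Tpow_V)

lemma pT_bound: "degree p \<le> N \<Longrightarrow> pT p f = (\<Sum>i\<le>N. scl (coeff p i) ((T ^^ i) f))"
  unfolding pT_def by (rule sum.mono_neutral_left) (auto simp: coeff_eq_0 not_le)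

lemma pT_pCons:
  assumes "f \<in> V" shows "pT (pCons c q) f = scl c f + T (pT q f)"
proof -
  have "pT (pCons c q) f = (\<Sum>i\<le>Suc (degree q). scl (coeff (pCons c q) i) ((T ^^ i) f))"
    by (rule pT_bound) (simp add: degree_pCons_le)
  also have "\<dots> = scl c f + (\<Sum>i\<le>degree q. scl (coeff q i) (T ((T ^^ i) f)))"
    by (subst sum.atMost_Suc_shift) simp
  also have "(\<Sum>i\<le>degree q. scl (coeff q i) (T ((T ^^ i) f))) = T (pT q f)"
    unfolding pT_def using assms by (subst T_sum) (auto intro!: V_scl Tpow_V simp: T_scl Tpow_V)
  finally show ?thesis .
qed

lemma pT_add: "pT (p + q) f = pT p f + pT q f"
proof -
  let ?N = "max (degree p) (degree q)"
  have "pT (p + q) f = (\<Sum>i\<le>?N. scl (coeff (p + q) i) ((T ^^ i) f))"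
    by (rule pT_bound) (simp add: degree_add_le_max)
  also have "\<dots> = (\<Sum>i\<le>?N. scl (coeff p i) ((T ^^ i) f)) + (\<Sum>i\<le>?N. scl (coeff q i) ((T ^^ i) f))"
    unfolding sum.distrib[symmetric] by (rule sum.cong) (auto simp: fun_eq_iff algebra_simps)
  finally show ?thesis by (simp add: pT_bound[of p ?N] pT_bound[of q ?N])
qed

lemma pT_smult: "pT (smult c p) f = scl c (pT p f)"
proof -
  have "pT (smult c p) f = (\<Sum>i\<le>degree p. scl (coeff (smult c p) i) ((T ^^ i) f))"
    by (rule pT_bound) simp
  then show ?thesis unfolding pT_def
    by (simp add: fun_eq_iff sum_fun_apply sum_distrib_left mult.assoc)
qed

lemma pT_0: "pT 0 f = 0"
  by (simp add: pT_def)

lemma pT_mult: "f \<in> V \<Longrightarrow> pT (p * q) f = pT p (pT q f)"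
proof (induction p)
  case 0 then show ?case by (simp add: pT_0)
next
  case (pCons c r)
  then show ?case
    by (simp add: pT_add pT_smult pT_pCons pT_V)
qed

text \<open>
  A real or a pair of conjugate complex roots: if \<open>p\<close> vanishes at \<open>a + i b\<close> with \<open>b \<noteq> 0\<close>, so does
  its remainder modulo the corresponding real quadratic, and a real polynomial of degree at most
  one has no such zero unless it is 0.
\<close>

lemma real_poly_factor:
  fixes p :: "real poly"
  assumes "degree p > 0"
  shows "(\<exists>a q. p = [:-a, 1:] * q) \<or> (\<exists>a b q. b \<noteq> 0 \<and> p = [:a\<^sup>2 + b\<^sup>2, -2*a, 1:] * q)"
proof -
  let ?P = "map_poly complex_of_real p"
  have "degree ?P = degree p" by (simp add: degree_map_poly)
  then have "\<not> constant (poly ?P)" using assms by (simp add: constant_degree)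
  then obtain z where z: "poly ?P z = 0" using fundamental_theorem_of_algebra by blast
  define a b where "a = Re z" and "b = Im z"
  show ?thesis
  proof (cases "b = 0")
    case True
    then have "z = complex_of_real a" by (simp add: a_def b_def complex_eq_iff)
    moreover have "poly ?P (of_real a) = of_real (poly p a)"
      by (induction p) (auto simp: map_poly_pCons)
    ultimately have "poly p a = 0" using z by simp
    then show ?thesis by (auto simp: poly_eq_0_iff_dvd dvd_def)
  next
    case False
    define m where "m = [:a\<^sup>2 + b\<^sup>2, -2*a, 1:]"
    define r where "r = p mod m"
    have "m \<noteq> 0" "degree m = 2" by (simp_all add: m_def)
    then have "degree r < 2" unfolding r_def using degree_mod_less[of m p] by auto
    then obtain c d where r: "r = [:c, d:]"
      by (metis One_nat_def degree_eq_zeroE degree_pCons_eq_if less_2_cases_iff old.nat.inject pCons_0_0 pCons_cases)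
    have pz: "poly (map_poly complex_of_real (p div m * m + r)) z = 0" using z by (simp add: r_def)
    have mm: "map_poly complex_of_real m = [:of_real (a\<^sup>2 + b\<^sup>2), of_real (-2*a), 1:]"
      by (simp add: m_def map_poly_pCons)
    have "poly (map_poly complex_of_real m) z = 0"
      unfolding mm by (simp add: a_def b_def complex_eq_iff power2_eq_square algebra_simps)
    moreover have "map_poly complex_of_real (p div m * m + r)
        = map_poly complex_of_real (p div m) * map_poly complex_of_real m + map_poly complex_of_real r"
      by (simp add: poly_eq_iff coeff_map_poly coeff_mult)
    ultimately have "poly (map_poly complex_of_real r) z = 0" using pz by simp
    then have "of_real c + z * of_real d = 0" by (simp add: r map_poly_pCons)
    then have "d = 0" "c = 0" using False by (auto simp: complex_eq_iff b_def)
    then have "p = m * (p div m)" using r r_def by (metis add.right_neutral mult.commute mult_div_mod_eq pCons_0_0)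
    then show ?thesis using False unfolding m_def by blast
  qed
qed

definition eigen_sum :: "('a \<Rightarrow> real) \<Rightarrow> bool" where
  "eigen_sum f \<longleftrightarrow> (\<exists>E g. finite E \<and> (\<forall>l\<in>E. g l \<in> V \<and> T (g l) = scl l (g l)) \<and> f = sum g E)"

text \<open>
  The roots of the annihilating polynomial are split off one by one. An irreducible quadratic
  factor \<open>(X - a)\<^sup>2 + b\<^sup>2\<close> can be dropped, because its value in \<open>T\<close> is injective:
  \<open>\<langle>((T - a)\<^sup>2 + b\<^sup>2) u, u\<rangle> = |(T - a) u|\<^sup>2 + b\<^sup>2 |u|\<^sup>2\<close>. For a linear factor \<open>X - a\<close> the
  induction hypothesis decomposes \<open>(T - a) f\<close>, and \<open>f\<close> is recovered by dividing the component of
  eigenvalue \<open>l\<close> by \<open>l - a\<close>. The component of eigenvalue \<open>a\<close> vanishes by symmetry, as it is both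
  in the image and in the kernel of \<open>T - a\<close>.
\<close>

lemma eigen_sum_of_annihilated:
  assumes "f \<in> V" "p \<noteq> 0" "pT p f = 0"
  shows "eigen_sum f"
  using assms
proof (induction "degree p" arbitrary: p f rule: less_induct)
  case less
  show ?case
  proof (cases "degree p = 0")
    case True
    then obtain c where "p = [:c:]" using degree_eq_zeroE by blast
    then have c: "p = [:c:]" "c \<noteq> 0" using less.prems(2) by auto
    have "scl c f = 0" using less.prems by (simp add: c pT_pCons pT_0 T_0)
    then have "f = 0" using c by (auto simp: fun_eq_iff)
    then show ?thesis unfolding eigen_sum_def by (intro exI[of _ "{}"]) auto
  next
    case False
    then consider a q where "p = [:-a, 1:] * q" | a b q where "b \<noteq> 0" "p = [:a\<^sup>2 + b\<^sup>2, -2*a, 1:] * q"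
      using real_poly_factor by blast
    then show ?thesis
    proof cases
      case (1 a q)
      have q: "q \<noteq> 0" using 1 less.prems by auto
      have "degree p = degree [:-a, 1:] + degree q" unfolding 1 using q by (intro degree_mult_eq) auto
      then have dq: "degree q < degree p" by simp
      define h where "h = T f - scl a f"
      have hV: "h \<in> V" using less.prems by (auto simp: h_def intro!: V_diff V_scl T_V)
      have "pT [:-a, 1:] f = h"
        using less.prems by (simp add: pT_pCons pT_0 T_0 h_def V_scl)
      then have "pT q h = 0" using less.prems(1,3) 1 pT_mult[of f q "[:-a,1:]"] by (simp add: mult.commute)
      from less.hyps[OF dq hV q this] obtain E g where E: "finite E"
        and g: "\<And>l. l \<in> E \<Longrightarrow> g l \<in> V" "\<And>l. l \<in> E \<Longrightarrow> T (g l) = scl l (g l)" and hs: "h = sum g E"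
        unfolding eigen_sum_def by blast
      let ?k = "\<lambda>l. scl (1 / (l - a)) (g l)"
      (* u solves (T - a) u = h up to the component of eigenvalue a, and w is the remainder *)
      define u where "u = sum ?k (E - {a})"
      define w where "w = f - u"
      have uV: "u \<in> V" unfolding u_def using g by (auto intro!: V_sum V_scl)
      have wV: "w \<in> V" using uV less.prems by (auto simp: w_def intro!: V_diff)
      have Tu: "T u - scl a u = sum g (E - {a})"
      proof -
        have "T u = (\<Sum>l\<in>E - {a}. T (?k l))" unfolding u_def using g by (intro T_sum) (auto intro: V_scl)
        also have "\<dots> = (\<Sum>l\<in>E - {a}. scl (1 / (l - a)) (scl l (g l)))"
          using g by (intro sum.cong) (auto simp: T_scl)
        finally have "T u - scl a u = (\<Sum>l\<in>E - {a}. scl (1 / (l - a)) (scl l (g l))) - scl a u" by simp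
        also have "\<dots> = sum g (E - {a})"
        proof
          fix x
          have "l * g l x / (l - a) - a * (g l x / (l - a)) = g l x" if "l \<noteq> a" for l
            using that by (simp add: diff_divide_distrib[symmetric] left_diff_distrib[symmetric])
          then show "((\<Sum>l\<in>E - {a}. scl (1 / (l - a)) (scl l (g l))) - scl a u) x = sum g (E - {a}) x"
            by (simp add: u_def sum_fun_apply sum_distrib_left sum_subtractf[symmetric])
        qed
        finally show ?thesis .
      qed
      define d where "d = h - sum g (E - {a})"
      have Tw: "T w - scl a w = d"
        using Tu uV less.prems(1) by (simp add: w_def T_diff d_def h_def fun_eq_iff algebra_simps)
      have d: "d = (if a \<in> E then g a else 0)"
        unfolding d_def hs using E by (auto simp: sum_diff1 )
      have dV: "d \<in> V" unfolding d using g V0 by auto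
      have Td: "T d = scl a d" unfolding d using g T_0 by auto
      (* d lies in the image and in the kernel of T - a *)
      have "ip d d = ip (T w) d - a * ip w d"
        using wV dV unfolding Tw[symmetric] by (simp add: ip_diff ip_scl V_scl T_V V_diff)
      also have "\<dots> = 0"
        using wV dV Td by (simp add: T_sym ip_sym[of w] ip_scl V_scl)
      finally have "d = 0" using ip_def dV by blast
      then have Tw': "T w = scl a w" using Tw by simp
      define g' where "g' l = (if l = a then w else ?k l)" for l
      have "f = w + u" by (simp add: w_def)
      also have "\<dots> = sum g' (insert a (E - {a}))"
        using E by (subst sum.insert) (auto simp: u_def g'_def intro!: sum.cong)
      finally have "f = sum g' (insert a (E - {a}))" .
      moreover have "g' l \<in> V \<and> T (g' l) = scl l (g' l)" if "l \<in> insert a (E - {a})" for l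
        using that g wV Tw' by (auto simp: g'_def V_scl T_scl mult.commute)
      ultimately show ?thesis unfolding eigen_sum_def using E by (intro exI[of _ "insert a (E - {a})"]) blast
    next
      case (2 a b q)
      have q: "q \<noteq> 0" using 2 less.prems by auto
      have "degree p = degree [:a\<^sup>2 + b\<^sup>2, -2*a, 1:] + degree q"
        unfolding 2 using q by (intro degree_mult_eq) auto
      then have dq: "degree q < degree p" by simp
      define u where "u = pT q f"
      have uV: "u \<in> V" using less.prems by (simp add: u_def pT_V)
      have 0: "pT [:a\<^sup>2 + b\<^sup>2, -2*a, 1:] u = 0"
        using less.prems(3) unfolding 2(2) u_def pT_mult[OF less.prems(1)] .
      define k where "k = T u - scl a u"
      have kV: "k \<in> V" using uV by (auto simp: k_def intro!: V_diff V_scl T_V)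
      have "pT [:a\<^sup>2 + b\<^sup>2, -2*a, 1:] u = T k - scl a k + scl (b\<^sup>2) u"
        using uV by (simp add: pT_pCons pT_0 T_0 k_def T_add T_diff T_scl V_scl T_V V_add)
          (simp add: fun_eq_iff algebra_simps power2_eq_square)
      then have z: "T k - scl a k + scl (b\<^sup>2) u = 0" using 0 by simp
      have "0 = ip (T k - scl a k + scl (b\<^sup>2) u) u" unfolding z using uV by (simp add: ip_0)
      also have "\<dots> = ip (T k) u - a * ip k u + b\<^sup>2 * ip u u"
        using uV kV by (simp add: ip_add ip_diff ip_scl V_diff V_scl T_V)
      also have "ip (T k) u - a * ip k u = ip (T u - scl a u) k"
        using uV kV by (simp add: T_sym ip_diff ip_scl V_scl T_V ip_sym[of k])
      finally have "0 = ip k k + b\<^sup>2 * ip u u" by (simp add: k_def)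
      moreover have "ip k k \<ge> 0" "ip u u \<ge> 0" using ip_pos uV kV by auto
      ultimately have "b\<^sup>2 * ip u u = 0" by (smt (verit) zero_le_mult_iff zero_le_power2)
      then have "u = 0" using ip_def uV 2 by auto
      then show ?thesis using less.hyps[OF dq less.prems(1) q] by (simp add: u_def)
    qed
  qed
qed

text \<open>
  The iterates \<open>f, T f, T\<^sup>2 f, \<dots>\<close> cannot all be independent in a finite-dimensional space.
\<close>

lemma annihilated:
  assumes "f \<in> V" shows "\<exists>p. p \<noteq> 0 \<and> pT p f = 0"
proof -
  let ?g = "\<lambda>i. (T ^^ i) f"
  let ?d = "card B"
  have gV: "?g i \<in> V" for i using assms by (rule Tpow_V)
  show ?thesis
  proof (cases "inj_on ?g {..?d}")
    case False
    then obtain i j where ij: "i < j" "?g i = ?g j"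
      unfolding inj_on_def by (metis (no_types) linorder_neqE_nat)
    (* a repetition among the iterates is itself a linear relation *)
    let ?p = "monom 1 i - monom (1::real) j"
    have c: "coeff ?p k = (if k = i then 1 else if k = j then -1 else 0)" for k using ij by auto
    then have "?p \<noteq> 0" by (metis coeff_0 one_neq_zero)
    moreover have "pT ?p f = 0"
    proof -
      have "degree ?p \<le> j" using ij by (intro degree_diff_le) (auto intro: order_trans[OF degree_monom_le])
      then have "pT ?p f = (\<Sum>k\<le>j. scl (coeff ?p k) (?g k))" by (rule pT_bound)
      also have "\<dots> = (\<Sum>k\<in>{i,j}. scl (coeff ?p k) (?g k))"
        using ij by (intro sum.mono_neutral_right) (auto simp: c)
      also have "\<dots> = 0" using ij by (simp add: c fun_eq_iff)
      finally show ?thesis .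
    qed
    ultimately show ?thesis by blast
  next
    case True
    have "FV.dependent (?g ` {..?d})"
    proof (rule ccontr)
      assume "\<not> FV.dependent (?g ` {..?d})"
      moreover have "?g ` {..?d} \<subseteq> FV.span B" using gV VB by auto
      ultimately have "card (?g ` {..?d}) \<le> ?d" using FV.independent_span_bound[OF finB] by blast
      then show False using card_image[OF True] by simp
    qed
    then obtain u v where v: "v \<in> ?g ` {..?d}" "u v \<noteq> 0"
      and s: "(\<Sum>v\<in>?g ` {..?d}. scl (u v) v) = 0"
      using FV.dependent_finite[of "?g ` {..?d}"] by auto
    define p where "p = (\<Sum>i\<le>?d. monom (u (?g i)) i)"
    have c: "coeff p i = (if i \<le> ?d then u (?g i) else 0)" for i
      by (simp add: p_def coeff_sum)
    obtain i where "i \<le> ?d" "v = ?g i" using v(1) by auto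
    then have "coeff p i \<noteq> 0" using c[of i] v(2) by simp
    then have "p \<noteq> 0" by auto
    moreover have "degree p \<le> ?d" by (rule degree_le) (simp add: c)
    then have "pT p f = (\<Sum>i\<le>?d. scl (u (?g i)) (?g i))"
      by (subst pT_bound[of _ "?d"]) (auto simp: c intro!: sum.cong)
    then have "pT p f = 0" using s by (simp add: sum.reindex[OF True])
    ultimately show ?thesis by blast
  qed
qed

text \<open>
  The spectral theorem in a form without bases: each vector is a finite sum of eigenvectors,
  indexed by their eigenvalues.
\<close>

theorem spectral_decomposition:
  assumes "f \<in> V"
  obtains E g where "finite E" "\<And>l. l \<in> E \<Longrightarrow> g l \<in> V"
    "\<And>l. l \<in> E \<Longrightarrow> T (g l) = scl l (g l)" "f = sum g E"
proof -
  obtain p where "p \<noteq> 0" "pT p f = 0" using annihilated[OF assms] by blast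
  then have "eigen_sum f" by (rule eigen_sum_of_annihilated[OF assms])
  then show ?thesis using that unfolding eigen_sum_def by metis
qed

end

section \<open>The inner product of L2 and completeness\<close>

definition L2_ip :: "'a measure \<Rightarrow> ('a \<Rightarrow> real) \<Rightarrow> ('a \<Rightarrow> real) \<Rightarrow> real" where
  "L2_ip M f g = (\<integral>z. f z * g z \<partial>M)"

lemma L2_meas: "f \<in> L2_fun M \<Longrightarrow> f \<in> borel_measurable M"
  and L2_int: "f \<in> L2_fun M \<Longrightarrow> integrable M (\<lambda>z. (f z)\<^sup>2)"
  by (auto simp: L2_fun_def)

lemma L2_prod_int:
  assumes "f \<in> L2_fun M" "g \<in> L2_fun M"
  shows "integrable M (\<lambda>z. f z * g z)"
proof (rule Bochner_Integration.integrable_bound)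
  show "integrable M (\<lambda>z. (f z)\<^sup>2 + (g z)\<^sup>2)" using assms by (auto simp: L2_fun_def)
  show "(\<lambda>z. f z * g z) \<in> borel_measurable M" using assms by (auto simp: L2_fun_def)
  have "norm (f z * g z) \<le> norm ((f z)\<^sup>2 + (g z)\<^sup>2)" for z
  proof -
    have "0 \<le> (\<bar>f z\<bar> - \<bar>g z\<bar>)\<^sup>2" by simp
    then have "2 * (\<bar>f z\<bar> * \<bar>g z\<bar>) \<le> (f z)\<^sup>2 + (g z)\<^sup>2" by (simp add: power2_diff)
    moreover have "0 \<le> \<bar>f z\<bar> * \<bar>g z\<bar>" by simp
    ultimately have "\<bar>f z\<bar> * \<bar>g z\<bar> \<le> (f z)\<^sup>2 + (g z)\<^sup>2" by linarith
    then show ?thesis by (simp add: abs_mult)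
  qed
  then show "AE z in M. norm (f z * g z) \<le> norm ((f z)\<^sup>2 + (g z)\<^sup>2)" by simp
qed

lemma L2_add: "f \<in> L2_fun M \<Longrightarrow> g \<in> L2_fun M \<Longrightarrow> (\<lambda>z. f z + g z) \<in> L2_fun M"
  using L2_prod_int[of f M g] by (auto simp: L2_fun_def power2_sum mult.assoc)

lemma L2_cmult: "f \<in> L2_fun M \<Longrightarrow> (\<lambda>z. c * f z) \<in> L2_fun M"
  by (auto simp: L2_fun_def power_mult_distrib)

lemma L2_uminus: "f \<in> L2_fun M \<Longrightarrow> (\<lambda>z. - f z) \<in> L2_fun M"
  by (auto simp: L2_fun_def)

lemma L2_diff: "f \<in> L2_fun M \<Longrightarrow> g \<in> L2_fun M \<Longrightarrow> (\<lambda>z. f z - g z) \<in> L2_fun M"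
  using L2_add[of f M "\<lambda>z. - g z"] L2_uminus[of g M] by simp

lemma L2_zero: "(\<lambda>z. 0) \<in> L2_fun M"
  by (auto simp: L2_fun_def)

lemma L2_sum: "(\<And>i. i \<in> I \<Longrightarrow> h i \<in> L2_fun M) \<Longrightarrow> (\<lambda>z. \<Sum>i\<in>I. h i z) \<in> L2_fun M"
  by (induction I rule: infinite_finite_induct) (auto simp: L2_zero L2_add)

lemma L2_ip_sym: "L2_ip M f g = L2_ip M g f"
  by (simp add: L2_ip_def mult.commute)

lemma L2_ip_add: "f \<in> L2_fun M \<Longrightarrow> g \<in> L2_fun M \<Longrightarrow> h \<in> L2_fun M \<Longrightarrow>
    L2_ip M (\<lambda>z. f z + g z) h = L2_ip M f h + L2_ip M g h"
  by (simp add: L2_ip_def distrib_right L2_prod_int)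

lemma L2_ip_diff: "f \<in> L2_fun M \<Longrightarrow> g \<in> L2_fun M \<Longrightarrow> h \<in> L2_fun M \<Longrightarrow>
    L2_ip M (\<lambda>z. f z - g z) h = L2_ip M f h - L2_ip M g h"
  by (simp add: L2_ip_def left_diff_distrib L2_prod_int)

lemma L2_ip_cmult: "L2_ip M (\<lambda>z. c * f z) h = c * L2_ip M f h"
  by (simp add: L2_ip_def mult.assoc)

lemma L2_ip_sum: "(\<And>i. i \<in> I \<Longrightarrow> k i \<in> L2_fun M) \<Longrightarrow> h \<in> L2_fun M \<Longrightarrow>
    L2_ip M (\<lambda>z. \<Sum>i\<in>I. k i z) h = (\<Sum>i\<in>I. L2_ip M (k i) h)"
proof (induction I rule: infinite_finite_induct)
  case (insert x F)
  then show ?case using L2_ip_add[of "k x" M "\<lambda>z. \<Sum>i\<in>F. k i z" h] by (simp add: L2_sum)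
qed (simp_all add: L2_ip_def)

lemma L2_ip_square_diff:
  assumes "f \<in> L2_fun M" "g \<in> L2_fun M"
  shows "L2_ip M (\<lambda>z. f z - g z) (\<lambda>z. f z - g z) = L2_ip M f f - 2 * L2_ip M f g + L2_ip M g g"
  using assms
  by (simp add: L2_ip_diff[OF assms L2_diff[OF assms]] L2_ip_sym[of M f "\<lambda>z. f z - g z"]
      L2_ip_sym[of M g "\<lambda>z. f z - g z"] L2_ip_diff L2_ip_sym[of M g f])

lemma L2_ip_cong_AE:
  assumes "f \<in> L2_fun M" "f' \<in> L2_fun M" "h \<in> L2_fun M" "AE z in M. f z = f' z"
  shows "L2_ip M f h = L2_ip M f' h"
  unfolding L2_ip_def using assms
  by (intro integral_cong_AE) (auto simp: L2_fun_def)

lemma L2_nrm_ge0: "0 \<le> L2_nrm M f"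
  by (simp add: L2_nrm_def)

lemma L2_nrm_sq: "(L2_nrm M f)\<^sup>2 = L2_ip M f f"
  unfolding L2_nrm_def L2_ip_def power2_eq_square[symmetric] by (simp add: integral_nonneg_AE)

lemma L2_nrm_sq_integral: "(L2_nrm M f)\<^sup>2 = (\<integral>z. (f z)\<^sup>2 \<partial>M)"
  unfolding L2_nrm_def by (simp add: integral_nonneg_AE)

lemma L2_nrm_cong_AE:
  assumes "f \<in> borel_measurable M" "g \<in> borel_measurable M" "AE z in M. f z = g z"
  shows "L2_nrm M f = L2_nrm M g"
proof -
  have "(\<integral>z. (f z)\<^sup>2 \<partial>M) = (\<integral>z. (g z)\<^sup>2 \<partial>M)"
    using assms by (intro integral_cong_AE) auto
  then show ?thesis by (simp add: L2_nrm_def)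
qed

lemma L2_nrm_cmult: "L2_nrm M (\<lambda>z. c * f z) = \<bar>c\<bar> * L2_nrm M f"
  by (simp add: L2_nrm_def power_mult_distrib real_sqrt_mult)

lemma L2_nrm_eq_0:
  assumes "f \<in> L2_fun M" shows "L2_nrm M f = 0 \<longleftrightarrow> (AE z in M. f z = 0)"
  using integral_nonneg_eq_0_iff_AE[OF L2_int[OF assms]] by (simp add: L2_nrm_def)

text \<open>
  The form is only positive semidefinite on functions, so the case of a null function \<open>g\<close> is
  treated apart: then \<open>|f - t g|\<^sup>2\<close> is affine in \<open>t\<close> and bounded below.
\<close>

lemma L2_Cauchy_Schwarz:
  assumes "f \<in> L2_fun M" "g \<in> L2_fun M"
  shows "\<bar>L2_ip M f g\<bar> \<le> L2_nrm M f * L2_nrm M g"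
proof -
  let ?A = "L2_ip M f f" and ?B = "L2_ip M g g" and ?C = "L2_ip M f g"
  have q: "0 \<le> ?A - 2 * t * ?C + t\<^sup>2 * ?B" for t
  proof -
    have "L2_ip M (\<lambda>z. f z - t * g z) (\<lambda>z. f z - t * g z) = ?A - 2 * t * ?C + t\<^sup>2 * ?B"
      using L2_ip_square_diff[OF assms(1) L2_cmult[OF assms(2), of t]]
      by (simp add: L2_ip_sym[of M f "\<lambda>z. t * g z"] L2_ip_cmult L2_ip_sym[of M g "\<lambda>z. t * g z"]
          L2_ip_sym[of M g f] power2_eq_square)
    moreover have "0 \<le> L2_ip M (\<lambda>z. f z - t * g z) (\<lambda>z. f z - t * g z)"
      unfolding L2_ip_def by (rule integral_nonneg_AE) auto
    ultimately show ?thesis by simp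
  qed
  have "?C\<^sup>2 \<le> ?A * ?B"
  proof (cases "?B = 0")
    case True
    have "?C = 0"
    proof (rule ccontr)
      assume c: "?C \<noteq> 0"
      have "0 \<le> ?A - 2 * ((?A + 1) / (2 * ?C)) * ?C" using q[of "(?A + 1) / (2 * ?C)"] True by simp
      also have "\<dots> = -1" using c by (simp add: field_simps)
      finally show False by simp
    qed
    then show ?thesis using True by simp
  next
    case False
    have "?B \<ge> 0" by (metis L2_nrm_sq zero_le_power2)
    then have B: "?B > 0" using False by simp
    (* the minimiser in t *)
    have "0 \<le> ?A - 2 * (?C / ?B) * ?C + (?C / ?B)\<^sup>2 * ?B" by (rule q)
    also have "\<dots> = ?A - ?C\<^sup>2 / ?B" using B by (simp add: power2_eq_square field_simps)
    finally show ?thesis using B by (simp add: field_simps)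
  qed
  then have "\<bar>?C\<bar>\<^sup>2 \<le> (L2_nrm M f * L2_nrm M g)\<^sup>2"
    by (simp add: power_mult_distrib L2_nrm_sq)
  then show ?thesis by (rule power2_le_imp_le) (simp add: L2_nrm_ge0)
qed

lemma L2_nrm_square_add:
  assumes "f \<in> L2_fun M" "g \<in> L2_fun M"
  shows "(L2_nrm M (\<lambda>z. f z + g z))\<^sup>2 = (L2_nrm M f)\<^sup>2 + 2 * L2_ip M f g + (L2_nrm M g)\<^sup>2"
  using L2_ip_square_diff[OF assms(1) L2_uminus[OF assms(2)]]
    L2_ip_cmult[of M "-1" g "\<lambda>z. - g z"] L2_ip_cmult[of M "-1" g g] L2_ip_cmult[of M "-1" g f]
  by (simp add: L2_nrm_sq L2_ip_sym[of M f "\<lambda>z. - g z"] L2_ip_sym[of M g f] L2_ip_sym[of M g "\<lambda>z. - g z"])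

lemma L2_triangle:
  assumes "f \<in> L2_fun M" "g \<in> L2_fun M"
  shows "L2_nrm M (\<lambda>z. f z + g z) \<le> L2_nrm M f + L2_nrm M g"
proof (rule power2_le_imp_le)
  have "(L2_nrm M (\<lambda>z. f z + g z))\<^sup>2 = (L2_nrm M f)\<^sup>2 + 2 * L2_ip M f g + (L2_nrm M g)\<^sup>2"
    by (rule L2_nrm_square_add[OF assms])
  also have "\<dots> \<le> (L2_nrm M f)\<^sup>2 + 2 * (L2_nrm M f * L2_nrm M g) + (L2_nrm M g)\<^sup>2"
    using L2_Cauchy_Schwarz[OF assms] by simp
  finally show "(L2_nrm M (\<lambda>z. f z + g z))\<^sup>2 \<le> (L2_nrm M f + L2_nrm M g)\<^sup>2"
    by (simp add: power2_sum)
qed (simp add: L2_nrm_ge0)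

lemma L2_triangle_diff:
  assumes "f \<in> L2_fun M" "g \<in> L2_fun M" "h \<in> L2_fun M"
  shows "L2_nrm M (\<lambda>z. f z - h z) \<le> L2_nrm M (\<lambda>z. f z - g z) + L2_nrm M (\<lambda>z. g z - h z)"
  using L2_triangle[of "\<lambda>z. f z - g z" M "\<lambda>z. g z - h z"] assms by (simp add: L2_diff)

lemma tendsto_zero_squeeze:
  fixes f g :: "'b \<Rightarrow> real"
  assumes "(g \<longlongrightarrow> 0) F" "\<And>x. 0 \<le> f x" "eventually (\<lambda>x. f x \<le> g x) F"
  shows "(f \<longlongrightarrow> 0) F"
  by (rule tendsto_sandwich[OF _ assms(3) tendsto_const assms(1)]) (simp add: assms(2))

lemma (in prob_space) L2_const: "(\<lambda>_. c) \<in> L2_fun M"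
  by (auto simp: L2_fun_def)

text \<open>
  The increments have summable L1-norms, since M is a probability measure; so the sequence
  converges almost everywhere, and Fatou's lemma bounds the L2-distance to the limit.
\<close>

lemma (in prob_space) L2_Riesz_Fischer:
  assumes s: "\<And>n. s n \<in> L2_fun M"
    and fast: "\<And>n. L2_nrm M (\<lambda>z. s (Suc n) z - s n z) \<le> (1/2) ^ n"
  obtains F where "F \<in> L2_fun M" "(\<lambda>n. L2_nrm M (\<lambda>z. F z - s n z)) \<longlonglongrightarrow> 0"
proof -
  have [measurable]: "s n \<in> borel_measurable M" for n using s by (auto simp: L2_fun_def)
  let ?d = "\<lambda>n z. s (Suc n) z - s n z"
  have dL: "?d n \<in> L2_fun M" for n using s by (auto intro: L2_diff)
  have absL: "(\<lambda>z. \<bar>?d n z\<bar>) \<in> L2_fun M" for n using dL[of n] by (auto simp: L2_fun_def)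
  have di: "integrable M (\<lambda>z. \<bar>?d n z\<bar>)" for n
    using L2_prod_int[OF absL L2_const[of 1]] by simp
  have ib: "(\<integral>z. \<bar>?d n z\<bar> \<partial>M) \<le> (1/2)^n" for n
  proof -
    have "L2_ip M (\<lambda>z. \<bar>?d n z\<bar>) (\<lambda>_. 1) \<le> L2_nrm M (\<lambda>z. \<bar>?d n z\<bar>) * L2_nrm M (\<lambda>_. 1)"
      using L2_Cauchy_Schwarz[OF absL L2_const[of 1], of n] by simp
    also have "L2_nrm M (\<lambda>_. 1) = 1" by (simp add: L2_nrm_def prob_space)
    also have "L2_nrm M (\<lambda>z. \<bar>?d n z\<bar>) = L2_nrm M (?d n)" by (simp add: L2_nrm_def)
    finally show ?thesis using fast[of n] by (simp add: L2_ip_def)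
  qed
  have "(\<integral>\<^sup>+z. (\<Sum>n. ennreal \<bar>?d n z\<bar>) \<partial>M) = (\<Sum>n. \<integral>\<^sup>+z. ennreal \<bar>?d n z\<bar> \<partial>M)"
    by (rule nn_integral_suminf) auto
  also have "\<dots> = (\<Sum>n. ennreal (\<integral>z. \<bar>?d n z\<bar> \<partial>M))"
    using di by (simp add: nn_integral_eq_integral)
  also have "\<dots> \<le> (\<Sum>n. ennreal ((1/2)^n))"
    using ib by (intro suminf_le ennreal_leI) auto
  also have "\<dots> < top"
  proof -
    have "summable (\<lambda>n. (1/2::real)^n)" by (rule summable_geometric) simp
    then have "(\<Sum>n. ennreal ((1/2)^n)) \<noteq> top" by (rule ennreal_suminf_neq_top) (rule zero_le_power, simp)
    then show ?thesis by (simp only: less_top)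
  qed
  finally have "(\<integral>\<^sup>+z. (\<Sum>n. ennreal \<bar>?d n z\<bar>) \<partial>M) \<noteq> \<infinity>" by simp
  then have "AE z in M. (\<Sum>n. ennreal \<bar>?d n z\<bar>) \<noteq> \<infinity>"
    by (intro nn_integral_PInf_AE) auto
  then have conv: "AE z in M. convergent (\<lambda>n. s n z)"
  proof eventually_elim
    case (elim z)
    then have "summable (\<lambda>n. \<bar>?d n z\<bar>)" by (intro summable_suminf_not_top) auto
    then have "summable (\<lambda>n. ?d n z)" by (rule summable_rabs_cancel)
    then have "convergent (\<lambda>n. \<Sum>i<n. ?d i z)" by (simp add: summable_iff_convergent)
    then have "convergent (\<lambda>n. s n z - s 0 z)" by (simp add: sum_lessThan_telescope[of "\<lambda>n. s n z"])
    then have "convergent (\<lambda>n. (s n z - s 0 z) + s 0 z)" by (intro convergent_add convergent_const)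
    then show ?case by simp
  qed
  define F where "F z = lim (\<lambda>n. s n z)" for z
  have [measurable]: "F \<in> borel_measurable M"
    unfolding F_def by (intro borel_measurable_lim_metric) auto
  have lim: "AE z in M. (\<lambda>n. s n z) \<longlonglongrightarrow> F z"
    using conv by eventually_elim (simp add: F_def convergent_LIMSEQ_iff)
  (* telescoping of the geometric bounds *)
  have far: "L2_nrm M (\<lambda>z. s (n + k) z - s n z) \<le> 2 * (1/2)^n - 2 * (1/2)^(n + k)" for n k
  proof (induction k)
    case 0 then show ?case by (simp add: L2_nrm_def)
  next
    case (Suc k)
    have "L2_nrm M (\<lambda>z. s (n + Suc k) z - s n z)
        \<le> L2_nrm M (\<lambda>z. s (n + Suc k) z - s (n + k) z) + L2_nrm M (\<lambda>z. s (n + k) z - s n z)"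
      by (rule L2_triangle_diff) (use s in auto)
    also have "\<dots> \<le> (1/2)^(n + k) + (2 * (1/2)^n - 2 * (1/2)^(n + k))"
      using fast[of "n + k"] Suc by simp
    finally show ?case by simp
  qed
  have fatou: "(\<integral>\<^sup>+z. ennreal ((F z - s n z)\<^sup>2) \<partial>M) \<le> ennreal ((2 * (1/2)^n)\<^sup>2)" for n
  proof -
    have "(\<integral>\<^sup>+z. ennreal ((F z - s n z)\<^sup>2) \<partial>M)
        = (\<integral>\<^sup>+z. liminf (\<lambda>k. ennreal ((s (n + k) z - s n z)\<^sup>2)) \<partial>M)"
    proof (rule nn_integral_cong_AE)
      show "AE z in M. ennreal ((F z - s n z)\<^sup>2) = liminf (\<lambda>k. ennreal ((s (n + k) z - s n z)\<^sup>2))"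
        using lim
      proof eventually_elim
        case (elim z)
        then have "(\<lambda>k. s (n + k) z) \<longlonglongrightarrow> F z"
          using LIMSEQ_ignore_initial_segment[of "\<lambda>k. s k z" "F z" n] by (simp add: add.commute)
        then have "(\<lambda>k. ennreal ((s (n + k) z - s n z)\<^sup>2)) \<longlonglongrightarrow> ennreal ((F z - s n z)\<^sup>2)"
          by (intro tendsto_intros)
        then show ?case using lim_imp_Liminf[OF sequentially_bot] by metis
      qed
    qed
    also have "\<dots> \<le> liminf (\<lambda>k. \<integral>\<^sup>+z. ennreal ((s (n + k) z - s n z)\<^sup>2) \<partial>M)"
      by (rule nn_integral_liminf) auto
    also have "\<dots> \<le> ennreal ((2 * (1/2)^n)\<^sup>2)"
    proof (rule Liminf_le)
      have "(\<integral>\<^sup>+z. ennreal ((s (n + k) z - s n z)\<^sup>2) \<partial>M) \<le> ennreal ((2 * (1/2)^n)\<^sup>2)" for k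
      proof -
        have "(\<integral>\<^sup>+z. ennreal ((s (n + k) z - s n z)\<^sup>2) \<partial>M) = ennreal ((L2_nrm M (\<lambda>z. s (n + k) z - s n z))\<^sup>2)"
          using L2_int[OF L2_diff[OF s s], of "n + k" n]
          by (simp add: nn_integral_eq_integral L2_nrm_sq_integral)
        also have "\<dots> \<le> ennreal ((2 * (1/2)^n)\<^sup>2)"
        proof -
          have "0 \<le> (1/2::real) ^ (n + k)" by simp
          then have "L2_nrm M (\<lambda>z. s (n + k) z - s n z) \<le> 2 * (1/2)^n" using far[of n k] by linarith
          then show ?thesis by (intro ennreal_leI power_mono) (auto simp: L2_nrm_ge0)
        qed
        finally show ?thesis .
      qed
      then show "\<forall>\<^sub>F k in sequentially. (\<integral>\<^sup>+z. ennreal ((s (n + k) z - s n z)\<^sup>2) \<partial>M) \<le> ennreal ((2 * (1/2)^n)\<^sup>2)"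
        by simp
    qed simp
    finally show ?thesis .
  qed
  have FsL: "(\<lambda>z. F z - s n z) \<in> L2_fun M" for n
  proof -
    have "integrable M (\<lambda>z. (F z - s n z)\<^sup>2)"
    proof (rule integrableI_bounded)
      show "(\<integral>\<^sup>+z. ennreal (norm ((F z - s n z)\<^sup>2)) \<partial>M) < \<infinity>"
        using le_less_trans[OF fatou[of n] ennreal_less_top] by simp
    qed simp
    then show ?thesis by (auto simp: L2_fun_def)
  qed
  have FL: "F \<in> L2_fun M" using L2_add[OF FsL[of 0] s[of 0]] by simp
  have "L2_nrm M (\<lambda>z. F z - s n z) \<le> 2 * (1/2)^n" for n
  proof (rule power2_le_imp_le)
    have "ennreal ((L2_nrm M (\<lambda>z. F z - s n z))\<^sup>2) \<le> ennreal ((2 * (1/2)^n)\<^sup>2)"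
      using fatou[of n] L2_int[OF FsL[of n]]
      by (simp add: nn_integral_eq_integral L2_nrm_sq_integral)
    then show "(L2_nrm M (\<lambda>z. F z - s n z))\<^sup>2 \<le> (2 * (1/2)^n)\<^sup>2"
      by (subst (asm) ennreal_le_iff) auto
  qed simp
  moreover have "(\<lambda>n. 2 * (1/2::real)^n) \<longlonglongrightarrow> 0"
    by (intro tendsto_mult_right_zero LIMSEQ_power_zero) auto
  ultimately have "(\<lambda>n. L2_nrm M (\<lambda>z. F z - s n z)) \<longlonglongrightarrow> 0"
    using tendsto_zero_squeeze[of "\<lambda>n. 2 * (1/2::real)^n" sequentially "\<lambda>n. L2_nrm M (\<lambda>z. F z - s n z)"]
    by (simp only: L2_nrm_ge0 eventually_True)
  then show ?thesis using that FL by blast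
qed

section \<open>Orthonormal systems and diagonal operators\<close>

text \<open>
  Null vectors are admitted, so that the Gram-Schmidt process can be run on a dependent family
  without reindexing. They have vanishing coefficients and drop out of every formula.
\<close>

locale orthonormal_system = prob_space +
  fixes e :: "nat \<Rightarrow> 'a \<Rightarrow> real"
  assumes e_L2: "e k \<in> L2_fun M"
    and e_orth: "j \<noteq> k \<Longrightarrow> L2_ip M (e j) (e k) = 0"
    and e_nrm: "L2_ip M (e k) (e k) \<in> {0, 1}"
    and total: "f \<in> L2_fun M \<Longrightarrow> 0 < \<epsilon> \<Longrightarrow> \<exists>N a. L2_nrm M (\<lambda>z. f z - (\<Sum>k<N. a k * e k z)) < \<epsilon>"
begin

definition coe :: "('a \<Rightarrow> real) \<Rightarrow> nat \<Rightarrow> real" where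
  "coe f k = L2_ip M f (e k)"

abbreviation psum :: "(nat \<Rightarrow> real) \<Rightarrow> nat \<Rightarrow> 'a \<Rightarrow> real" where
  "psum a N \<equiv> (\<lambda>z. \<Sum>k<N. a k * e k z)"

lemma psum_L2: "psum a N \<in> L2_fun M"
  by (intro L2_sum L2_cmult e_L2)

lemma coe_add: "f \<in> L2_fun M \<Longrightarrow> g \<in> L2_fun M \<Longrightarrow> coe (\<lambda>z. f z + g z) k = coe f k + coe g k"
  and coe_diff: "f \<in> L2_fun M \<Longrightarrow> g \<in> L2_fun M \<Longrightarrow> coe (\<lambda>z. f z - g z) k = coe f k - coe g k"
  and coe_cmult: "coe (\<lambda>z. c * f z) k = c * coe f k"
  and coe_cong: "f \<in> L2_fun M \<Longrightarrow> g \<in> L2_fun M \<Longrightarrow> AE z in M. f z = g z \<Longrightarrow> coe f k = coe g k"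
  by (auto simp: coe_def L2_ip_add L2_ip_diff L2_ip_cmult e_L2 intro: L2_ip_cong_AE)

lemma coe_psum: "coe (psum a N) j = (if j < N then a j * L2_ip M (e j) (e j) else 0)"
proof -
  have "coe (psum a N) j = (\<Sum>k<N. a k * L2_ip M (e k) (e j))"
    unfolding coe_def by (subst L2_ip_sum) (auto simp: L2_cmult e_L2 L2_ip_cmult)
  also have "\<dots> = (\<Sum>k<N. if k = j then a j * L2_ip M (e j) (e j) else 0)"
    by (rule sum.cong) (auto simp: e_orth)
  finally show ?thesis by simp
qed

lemma coe_bound: "f \<in> L2_fun M \<Longrightarrow> \<bar>coe f k\<bar> \<le> L2_nrm M f"
proof -
  assume f: "f \<in> L2_fun M"
  have "(L2_nrm M (e k))\<^sup>2 \<le> 1\<^sup>2" using e_nrm[of k] by (auto simp: L2_nrm_sq)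
  then have "L2_nrm M (e k) \<le> 1" by (rule power2_le_imp_le) simp
  then show ?thesis
    using L2_Cauchy_Schwarz[OF f e_L2[of k]] mult_left_mono[of "L2_nrm M (e k)" 1 "L2_nrm M f"]
    by (simp add: coe_def L2_nrm_ge0)
qed

lemma coe_null:
  assumes "f \<in> L2_fun M" "L2_ip M (e k) (e k) = 0" shows "coe f k = 0"
  using L2_Cauchy_Schwarz[OF assms(1) e_L2[of k]] assms(2)
  by (simp add: coe_def L2_nrm_def L2_ip_def power2_eq_square)

lemma coe_nrm: "f \<in> L2_fun M \<Longrightarrow> coe f k * L2_ip M (e k) (e k) = coe f k"
  using coe_null[of f k] e_nrm[of k] by auto

lemma nrm_psum: "(L2_nrm M (psum a N))\<^sup>2 = (\<Sum>k<N. (a k)\<^sup>2 * L2_ip M (e k) (e k))"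
proof -
  have "L2_ip M (psum a N) (psum a N) = (\<Sum>k<N. a k * coe (psum a N) k)"
    unfolding coe_def L2_ip_sym[of M "psum a N" "e _"]
    by (subst L2_ip_sum) (auto simp: L2_cmult e_L2 L2_ip_cmult psum_L2)
  then show ?thesis unfolding L2_nrm_sq coe_psum by (simp add: power2_eq_square mult.assoc)
qed

text \<open>
  Pythagoras: the Fourier coefficients are the best choice for every truncation.
\<close>

lemma nrm_minus_psum:
  assumes f: "f \<in> L2_fun M"
  shows "(L2_nrm M (\<lambda>z. f z - psum a N z))\<^sup>2 =
    (L2_nrm M f)\<^sup>2 - (\<Sum>k<N. (coe f k)\<^sup>2) + (\<Sum>k<N. (a k - coe f k)\<^sup>2 * L2_ip M (e k) (e k))"
proof -
  have fp: "L2_ip M f (psum a N) = (\<Sum>k<N. a k * coe f k)"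
    unfolding L2_ip_sym[of M f] coe_def
    by (subst L2_ip_sum) (auto simp: L2_cmult e_L2 L2_ip_cmult f)
  have t: "(a k - coe f k)\<^sup>2 * L2_ip M (e k) (e k) =
      (a k)\<^sup>2 * L2_ip M (e k) (e k) - 2 * (a k * coe f k) + (coe f k)\<^sup>2" for k
  proof -
    have "(a k - coe f k)\<^sup>2 * L2_ip M (e k) (e k) = (a k)\<^sup>2 * L2_ip M (e k) (e k)
        - 2 * a k * (coe f k * L2_ip M (e k) (e k)) + coe f k * (coe f k * L2_ip M (e k) (e k))"
      by (simp add: power2_eq_square algebra_simps)
    then show ?thesis using coe_nrm[OF f, of k] by (simp add: power2_eq_square)
  qed
  have "(L2_nrm M (\<lambda>z. f z - psum a N z))\<^sup>2 = (L2_nrm M f)\<^sup>2 - 2 * L2_ip M f (psum a N) + (L2_nrm M (psum a N))\<^sup>2"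
    using L2_ip_square_diff[OF f psum_L2[of a N]] by (simp add: L2_nrm_sq)
  then show ?thesis
    by (simp add: fp nrm_psum t sum.distrib sum_subtractf sum_distrib_left)
qed

lemma nrm_minus_fourier:
  assumes f: "f \<in> L2_fun M"
  shows "(L2_nrm M (\<lambda>z. f z - psum (coe f) N z))\<^sup>2 = (L2_nrm M f)\<^sup>2 - (\<Sum>k<N. (coe f k)\<^sup>2)"
  using nrm_minus_psum[OF f, of "coe f" N] by simp

lemma parseval: assumes f: "f \<in> L2_fun M" shows "(\<lambda>k. (coe f k)\<^sup>2) sums (L2_nrm M f)\<^sup>2"
  unfolding sums_def
proof (rule LIMSEQ_I)
  fix r :: real assume "0 < r"
  then obtain N a where N: "L2_nrm M (\<lambda>z. f z - psum a N z) < sqrt r"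
    using total[OF f, of "sqrt r"] by auto
  have "norm ((\<Sum>k<n. (coe f k)\<^sup>2) - (L2_nrm M f)\<^sup>2) < r" if "n \<ge> N" for n
  proof -
    have 1: "(\<Sum>k<N. (coe f k)\<^sup>2) \<le> (\<Sum>k<n. (coe f k)\<^sup>2)" using that by (intro sum_mono2) auto
    have 2: "(\<Sum>k<n. (coe f k)\<^sup>2) \<le> (L2_nrm M f)\<^sup>2"
      using nrm_minus_fourier[OF f, of n] zero_le_power2[of "L2_nrm M (\<lambda>z. f z - psum (coe f) n z)"] by linarith
    have "0 \<le> (\<Sum>k<N. (a k - coe f k)\<^sup>2 * L2_ip M (e k) (e k))"
      using e_nrm by (intro sum_nonneg mult_nonneg_nonneg) (auto, metis order.refl zero_le_one)
    then have "(L2_nrm M f)\<^sup>2 - (\<Sum>k<N. (coe f k)\<^sup>2) \<le> (L2_nrm M (\<lambda>z. f z - psum a N z))\<^sup>2"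
      using nrm_minus_psum[OF f, of a N] by linarith
    also have "\<dots> < (sqrt r)\<^sup>2" using N by (intro power_strict_mono) (auto simp: L2_nrm_ge0)
    finally show ?thesis using 1 2 \<open>0 < r\<close> by simp
  qed
  then show "\<exists>no. \<forall>n\<ge>no. norm ((\<Sum>k<n. (coe f k)\<^sup>2) - (L2_nrm M f)\<^sup>2) < r" by blast
qed

lemma coe_square_summable: "f \<in> L2_fun M \<Longrightarrow> summable (\<lambda>k. (coe f k)\<^sup>2)"
  and nrm_suminf: "f \<in> L2_fun M \<Longrightarrow> (L2_nrm M f)\<^sup>2 = (\<Sum>k. (coe f k)\<^sup>2)"
  using parseval by (auto simp: sums_iff)

lemma eq_AE_if_coe:
  assumes "f \<in> L2_fun M" "g \<in> L2_fun M" "\<And>k. coe f k = coe g k"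
  shows "AE z in M. f z = g z"
proof -
  have "(L2_nrm M (\<lambda>z. f z - g z))\<^sup>2 = 0"
    using nrm_suminf[OF L2_diff[OF assms(1,2)]] assms by (simp add: coe_diff)
  then have "AE z in M. f z - g z = 0" using L2_nrm_eq_0[OF L2_diff[OF assms(1,2)]] by simp
  then show ?thesis by simp
qed

text \<open>
  Polarisation of Parseval's identity.
\<close>

lemma ip_sums:
  assumes f: "f \<in> L2_fun M" and g: "g \<in> L2_fun M"
  shows "(\<lambda>k. coe f k * coe g k) sums L2_ip M f g"
proof -
  have "(\<lambda>k. ((coe (\<lambda>z. f z + g z) k)\<^sup>2 - (coe f k)\<^sup>2 - (coe g k)\<^sup>2) / 2) sums
     (((L2_nrm M (\<lambda>z. f z + g z))\<^sup>2 - (L2_nrm M f)\<^sup>2 - (L2_nrm M g)\<^sup>2) / 2)"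
    by (intro sums_divide sums_diff parseval L2_add f g)
  moreover have "(L2_nrm M (\<lambda>z. f z + g z))\<^sup>2 = (L2_nrm M f)\<^sup>2 + 2 * L2_ip M f g + (L2_nrm M g)\<^sup>2"
    by (rule L2_nrm_square_add[OF f g])
  ultimately show ?thesis
    by (simp add: coe_add f g power2_sum)
qed

text \<open>
  The partial sums form a Cauchy sequence; along a subsequence for which the tails decay
  geometrically the limit is supplied by \<open>L2_Riesz_Fischer\<close>. Coefficients on null vectors have to
  vanish.
\<close>

lemma fourier_exists:
  assumes c: "summable (\<lambda>k. (c k)\<^sup>2)" and n: "\<And>k. L2_ip M (e k) (e k) = 0 \<Longrightarrow> c k = 0"
  shows "\<exists>F\<in>L2_fun M. \<forall>k. coe F k = c k"
proof -
  have "\<exists>N. \<forall>n\<ge>N. (\<Sum>k<n. (c k)\<^sup>2) > (\<Sum>k. (c k)\<^sup>2) - (1/4)^m" for m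
  proof -
    have "(\<lambda>n. \<Sum>k<n. (c k)\<^sup>2) \<longlonglongrightarrow> (\<Sum>k. (c k)\<^sup>2)" using c by (rule summable_LIMSEQ)
    then have "\<forall>\<^sub>F n in sequentially. (\<Sum>k<n. (c k)\<^sup>2) > (\<Sum>k. (c k)\<^sup>2) - (1/4)^m"
      by (rule order_tendstoD) simp
    then show ?thesis by (simp add: eventually_sequentially)
  qed
  then obtain N where N: "\<And>m n. n \<ge> N m \<Longrightarrow> (\<Sum>k<n. (c k)\<^sup>2) > (\<Sum>k. (c k)\<^sup>2) - (1/4)^m" by metis
  define r where "r m = (\<Sum>i\<le>m. N i)" for m
  have rN: "r m \<ge> N m" for m unfolding r_def by (rule member_le_sum) auto
  have rmono: "r m \<le> r (Suc m)" for m by (simp add: r_def)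
  (* increasing, beyond N m, and unbounded *)
  define q where "q m = r m + m" for m
  have qN: "q m \<ge> N m" and qmono: "q m \<le> q (Suc m)" and qm: "q m \<ge> m" for m
    using rN[of m] rmono[of m] by (auto simp: q_def)
  have diff: "(L2_nrm M (\<lambda>z. psum c n' z - psum c n z))\<^sup>2 \<le> (\<Sum>k<n'. (c k)\<^sup>2) - (\<Sum>k<n. (c k)\<^sup>2)" if "n \<le> n'" for n n'
  proof -
    have "psum c n' z - psum c n z = psum (\<lambda>k. if k < n then 0 else c k) n' z" for z
    proof -
      have "psum c n z = psum (\<lambda>k. if k < n then c k else 0) n' z"
        using that by (intro sum.mono_neutral_cong_left) auto
      then have "psum c n' z - psum c n z = (\<Sum>k<n'. c k * e k z - (if k < n then c k else 0) * e k z)"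
        by (simp add: sum_subtractf)
      also have "\<dots> = psum (\<lambda>k. if k < n then 0 else c k) n' z" by (rule sum.cong) auto
      finally show ?thesis .
    qed
    then have "(L2_nrm M (\<lambda>z. psum c n' z - psum c n z))\<^sup>2 = (\<Sum>k<n'. (if k < n then 0 else c k)\<^sup>2 * L2_ip M (e k) (e k))"
      by (simp add: nrm_psum)
    also have "\<dots> \<le> (\<Sum>k<n'. (c k)\<^sup>2 - (if k < n then (c k)\<^sup>2 else 0))"
    proof (rule sum_mono)
      fix k show "(if k < n then 0 else c k)\<^sup>2 * L2_ip M (e k) (e k) \<le> (c k)\<^sup>2 - (if k < n then (c k)\<^sup>2 else 0)"
        using e_nrm[of k] by auto
    qed
    also have "\<dots> = (\<Sum>k<n'. (c k)\<^sup>2) - (\<Sum>k<n'. (if k < n then (c k)\<^sup>2 else 0))" by (rule sum_subtractf)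
    also have "(\<Sum>k<n'. (if k < n then (c k)\<^sup>2 else 0)) = (\<Sum>k<n. (c k)\<^sup>2)"
      using that by (intro sum.mono_neutral_cong_right) auto
    finally show ?thesis .
  qed
  have "L2_nrm M (\<lambda>z. psum c (q (Suc m)) z - psum c (q m) z) \<le> (1/2)^m" for m
  proof (rule power2_le_imp_le)
    have "(\<Sum>k<q (Suc m). (c k)\<^sup>2) \<le> (\<Sum>k. (c k)\<^sup>2)" by (rule sum_le_suminf[OF c]) auto
    then have "(L2_nrm M (\<lambda>z. psum c (q (Suc m)) z - psum c (q m) z))\<^sup>2 \<le> (1/4)^m"
      using diff[OF qmono[of m]] N[OF qN[of m]] by linarith
    also have "(1/4::real)^m = ((1/2)^m)\<^sup>2" by (simp add: power2_eq_square power_mult_distrib[symmetric])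
    finally show "(L2_nrm M (\<lambda>z. psum c (q (Suc m)) z - psum c (q m) z))\<^sup>2 \<le> ((1/2)^m)\<^sup>2" .
  qed simp
  then obtain F where F: "F \<in> L2_fun M" "(\<lambda>m. L2_nrm M (\<lambda>z. F z - psum c (q m) z)) \<longlonglongrightarrow> 0"
    by (rule L2_Riesz_Fischer[of "\<lambda>m. psum c (q m)", OF psum_L2])
  have "coe F k = c k" for k
  proof -
    have "\<bar>coe F k - c k\<bar> \<le> L2_nrm M (\<lambda>z. F z - psum c (q m) z)" if "m > k" for m
    proof -
      have "L2_ip M (e k) (e k) = 1 \<or> c k = 0" using n[of k] e_nrm[of k] by auto
      then have "coe (psum c (q m)) k = c k" using qm[of m] that by (auto simp: coe_psum)
      then show ?thesis
        using coe_bound[OF L2_diff[OF F(1) psum_L2[of c "q m"]], of k] coe_diff[OF F(1) psum_L2[of c "q m"], of k]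
        by simp
    qed
    then have "\<forall>\<^sub>F m in sequentially. \<bar>coe F k - c k\<bar> \<le> L2_nrm M (\<lambda>z. F z - psum c (q m) z)"
      using eventually_gt_at_top[of k] by (rule eventually_mono[rotated]) auto
    then have "\<bar>coe F k - c k\<bar> \<le> 0" by (rule tendsto_lowerbound[OF F(2)]) simp
    then show ?thesis by simp
  qed
  then show ?thesis using F(1) by blast
qed

text \<open>
  The functional calculus: multiplication of the \<open>k\<close>-th coefficient by \<open>m k\<close>. Elements of L2 are
  determined up to null sets only, so a representative is chosen.
\<close>

definition diag :: "(nat \<Rightarrow> real) \<Rightarrow> ('a \<Rightarrow> real) \<Rightarrow> 'a \<Rightarrow> real" where
  "diag m f = (SOME F. F \<in> L2_fun M \<and> (\<forall>k. coe F k = m k * coe f k))"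

lemma diag:
  assumes f: "f \<in> L2_fun M" and m: "\<And>k. \<bar>m k\<bar> \<le> C"
  shows "diag m f \<in> L2_fun M" "coe (diag m f) k = m k * coe f k"
    "L2_nrm M (diag m f) \<le> C * L2_nrm M f"
proof -
  have le: "(m k * coe f k)\<^sup>2 \<le> C\<^sup>2 * (coe f k)\<^sup>2" for k
  proof -
    have "\<bar>m k\<bar>\<^sup>2 \<le> C\<^sup>2" using m[of k] by (intro power_mono) auto
    then show ?thesis by (simp add: power_mult_distrib mult_right_mono)
  qed
  have s: "summable (\<lambda>k. C\<^sup>2 * (coe f k)\<^sup>2)" by (intro summable_mult coe_square_summable f)
  have s': "summable (\<lambda>k. (m k * coe f k)\<^sup>2)"
    by (rule summable_comparison_test[OF _ s]) (use le in auto)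
  have "\<exists>F. F \<in> L2_fun M \<and> (\<forall>k. coe F k = m k * coe f k)"
    using fourier_exists[OF s'] coe_null[OF f] by auto
  then have *: "diag m f \<in> L2_fun M \<and> (\<forall>k. coe (diag m f) k = m k * coe f k)"
    unfolding diag_def by (rule someI_ex)
  then show "diag m f \<in> L2_fun M" "coe (diag m f) k = m k * coe f k" by auto
  have "(L2_nrm M (diag m f))\<^sup>2 = (\<Sum>k. (m k * coe f k)\<^sup>2)" using nrm_suminf * by simp
  also have "\<dots> \<le> (\<Sum>k. C\<^sup>2 * (coe f k)\<^sup>2)" by (rule suminf_le[OF le s' s])
  also have "\<dots> = (C * L2_nrm M f)\<^sup>2"
    using coe_square_summable[OF f] by (simp add: suminf_mult nrm_suminf[OF f] power_mult_distrib)
  finally have "(L2_nrm M (diag m f))\<^sup>2 \<le> (C * L2_nrm M f)\<^sup>2" .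
  moreover have "0 \<le> C * L2_nrm M f"
    using order_trans[OF abs_ge_zero m] L2_nrm_ge0 by (rule mult_nonneg_nonneg)
  ultimately show "L2_nrm M (diag m f) \<le> C * L2_nrm M f" by (rule power2_le_imp_le)
qed

end

section \<open>Diagonal semigroups: generator, uniqueness, spectrum\<close>

locale spectral_semigroup = orthonormal_system +
  fixes \<mu> :: "nat \<Rightarrow> real"
  assumes mu_nonneg: "0 \<le> \<mu> k"
begin

definition S :: "real \<Rightarrow> ('a \<Rightarrow> real) \<Rightarrow> 'a \<Rightarrow> real" where
  "S t = diag (\<lambda>k. exp (- \<mu> k * t))"

lemma S:
  assumes "0 \<le> t" "f \<in> L2_fun M"
  shows S_L2: "S t f \<in> L2_fun M" and coe_S: "coe (S t f) k = exp (- \<mu> k * t) * coe f k"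
    and S_contraction: "L2_nrm M (S t f) \<le> L2_nrm M f"
proof -
  have "\<bar>exp (- \<mu> k * t)\<bar> \<le> 1" for k using mu_nonneg[of k] assms(1) by simp
  from diag[OF assms(2) this] show "S t f \<in> L2_fun M" "coe (S t f) k = exp (- \<mu> k * t) * coe f k"
    "L2_nrm M (S t f) \<le> L2_nrm M f"
    unfolding S_def by auto
qed

lemma S_cong:
  assumes "0 \<le> t" "f \<in> L2_fun M" "g \<in> L2_fun M" "AE z in M. f z = g z"
  shows "AE z in M. S t f z = S t g z"
  using assms coe_cong[OF assms(2-4)] by (intro eq_AE_if_coe) (simp_all add: S)

lemma S_linear:
  assumes "0 \<le> t" "f \<in> L2_fun M" "g \<in> L2_fun M"
  shows "AE z in M. S t (\<lambda>u. a * f u + b * g u) z = a * S t f z + b * S t g z"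
  using assms by (intro eq_AE_if_coe) (auto simp: S coe_add coe_cmult L2_add L2_cmult algebra_simps)

lemma S_0: "f \<in> L2_fun M \<Longrightarrow> AE z in M. S 0 f z = f z"
  by (intro eq_AE_if_coe) (simp_all add: S)

lemma S_add:
  assumes "0 \<le> s" "0 \<le> t" "f \<in> L2_fun M"
  shows "AE z in M. S (s + t) f z = S s (S t f) z"
proof (rule eq_AE_if_coe)
  fix k
  have "exp (- \<mu> k * (s + t)) = exp (- \<mu> k * s) * exp (- \<mu> k * t)"
    unfolding exp_add[symmetric] by (simp add: algebra_simps)
  then show "coe (S (s + t) f) k = coe (S s (S t f)) k" using assms by (simp add: S)
qed (use assms in \<open>simp_all add: S\<close>)

lemma S_sym:
  assumes "0 \<le> t" "f \<in> L2_fun M" "g \<in> L2_fun M"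
  shows "L2_ip M (S t f) g = L2_ip M f (S t g)"
proof -
  have "(\<lambda>k. coe (S t f) k * coe g k) sums L2_ip M (S t f) g" using assms by (intro ip_sums S)
  moreover have "(\<lambda>k. coe f k * coe (S t g) k) sums L2_ip M f (S t g)" using assms by (intro ip_sums S)
  ultimately show ?thesis using assms by (simp add: S ac_simps sums_iff)
qed

text \<open>
  Dominated convergence for the sum over the spectrum, as \<open>t\<close> decreases to 0 (Tannery).
\<close>

lemma tendsto_suminf_dominated:
  fixes h :: "real \<Rightarrow> nat \<Rightarrow> real"
  assumes lim: "\<And>k. ((\<lambda>t. h t k) \<longlongrightarrow> 0) (at_right 0)"
    and bd: "\<And>k t. 0 < t \<Longrightarrow> \<bar>h t k\<bar> \<le> 1" and c: "summable c" "\<And>k. 0 \<le> c k"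
  shows "((\<lambda>t. \<Sum>k. h t k * c k) \<longlongrightarrow> 0) (at_right 0)"
proof -
  have "\<forall>\<^sub>F t in at_right (0::real). 0 < t" by (rule eventually_at_right_less)
  then have ev: "\<forall>\<^sub>F (k, t) in at_top \<times>\<^sub>F at_right 0. norm (h t k * c k) \<le> c k"
    by (auto simp: eventually_prod_filter abs_mult c(2) intro!: exI[of _ "\<lambda>_. True"]
        exI[of _ "\<lambda>t. 0 < t"] mult_left_le_one_le bd)
  have "((\<lambda>t. \<Sum>k. h t k * c k) \<longlongrightarrow> (\<Sum>k. 0 * c k)) (at_right 0)"
    using tannerys_theorem[of "\<lambda>k t. h t k * c k" "\<lambda>k. 0 * c k" "at_right 0" c,
        OF tendsto_mult_right[OF lim] ev c(1)] by simp
  then show ?thesis by simp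
qed

lemma nrm_tendsto_0:
  fixes F :: "real \<Rightarrow> 'a \<Rightarrow> real" and h :: "real \<Rightarrow> nat \<Rightarrow> real"
  assumes F: "\<And>t. 0 < t \<Longrightarrow> F t \<in> L2_fun M" and g: "g \<in> L2_fun M"
    and coe: "\<And>t k. 0 < t \<Longrightarrow> coe (F t) k = h t k * coe g k"
    and lim: "\<And>k. ((\<lambda>t. h t k) \<longlongrightarrow> 0) (at_right 0)"
    and bd: "\<And>k t. 0 < t \<Longrightarrow> \<bar>h t k\<bar> \<le> 1"
  shows "((\<lambda>t. L2_nrm M (F t)) \<longlongrightarrow> 0) (at_right 0)"
proof -
  have "((\<lambda>t. \<Sum>k. (h t k)\<^sup>2 * (coe g k)\<^sup>2) \<longlongrightarrow> 0) (at_right 0)"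
  proof (rule tendsto_suminf_dominated[where h = "\<lambda>t k. (h t k)\<^sup>2" and c = "\<lambda>k. (coe g k)\<^sup>2"])
    show "((\<lambda>t. (h t k)\<^sup>2) \<longlongrightarrow> 0) (at_right 0)" for k using tendsto_power[OF lim[of k], of 2] by simp
    show "\<bar>(h t k)\<^sup>2\<bar> \<le> 1" if "0 < t" for t k using bd[OF that] by (simp add: abs_square_le_1)
  qed (use coe_square_summable[OF g] in auto)
  then have "((\<lambda>t. (L2_nrm M (F t))\<^sup>2) \<longlongrightarrow> 0) (at_right 0)"
    by (rule tendsto_cong[THEN iffD1, rotated])
      (auto intro!: eventually_mono[OF eventually_at_right_less[of "0::real"]] simp: nrm_suminf F coe power_mult_distrib)
  then have "((\<lambda>t. sqrt ((L2_nrm M (F t))\<^sup>2)) \<longlongrightarrow> sqrt 0) (at_right 0)" by (rule tendsto_real_sqrt)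
  then show ?thesis by (simp add: L2_nrm_ge0)
qed

lemma S_continuous:
  assumes f: "f \<in> L2_fun M"
  shows "((\<lambda>t. L2_nrm M (\<lambda>z. S t f z - f z)) \<longlongrightarrow> 0) (at_right 0)"
proof (rule nrm_tendsto_0[OF _ f, where h = "\<lambda>t k. exp (- \<mu> k * t) - 1"])
  show "((\<lambda>t. exp (- \<mu> k * t) - 1) \<longlongrightarrow> 0) (at_right 0)" for k
    by (rule tendsto_eq_intros refl | simp)+
  show "\<bar>exp (- \<mu> k * t) - 1\<bar> \<le> 1" if "0 < t" for k t
    using that mu_nonneg[of k] exp_gt_zero[of "- \<mu> k * t"] by (simp add: abs_le_iff)
qed (auto simp: S f L2_diff coe_diff algebra_simps)

lemma exp_quotient_tendsto: "((\<lambda>t. (exp (- a * t) - 1) / t) \<longlongrightarrow> - a) (at_right (0::real))"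
proof -
  have "((\<lambda>t. exp (- a * t)) has_real_derivative - a) (at 0)"
    by (auto intro!: derivative_eq_intros)
  then have "((\<lambda>t. (exp (- a * t) - 1) / t) \<longlongrightarrow> - a) (at 0)"
    by (simp add: has_field_derivative_iff)
  then show ?thesis by (rule tendsto_mono[rotated]) (simp add: at_le)
qed

text \<open>
  The domain consists of the \<open>f\<close> for which \<open>- \<mu> k * coe f k\<close> are the coefficients of an element
  of L2. Convergence of the difference quotients reduces to each coefficient, because
  \<open>(1 - exp (- \<mu> t)) / t\<close> lies between 0 and \<open>\<mu>\<close>.
\<close>

lemma generator_iff:
  "(f, g) \<in> L2_generator M S \<longleftrightarrow> f \<in> L2_fun M \<and> g \<in> L2_fun M \<and> (\<forall>k. coe g k = - \<mu> k * coe f k)"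
proof (intro iffI conjI allI)
  assume A: "(f, g) \<in> L2_generator M S"
  then show f: "f \<in> L2_fun M" and g: "g \<in> L2_fun M" by (auto simp: L2_generator_def)
  fix k
  let ?r = "\<lambda>t z. (S t f z - f z) / t - g z"
  have lim: "((\<lambda>t. L2_nrm M (?r t)) \<longlongrightarrow> 0) (at_right 0)" using A by (auto simp: L2_generator_def)
  have rL: "?r t \<in> L2_fun M" and rc: "coe (?r t) k = (exp (- \<mu> k * t) - 1) / t * coe f k - coe g k" if "0 < t" for t
  proof -
    have e: "?r t = (\<lambda>z. (1 / t) * (S t f z - f z) - g z)" by auto
    have L: "(\<lambda>z. (1 / t) * (S t f z - f z)) \<in> L2_fun M"
      using that f by (intro L2_cmult L2_diff S) auto
    show "?r t \<in> L2_fun M" unfolding e by (intro L2_diff L g)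
    show "coe (?r t) k = (exp (- \<mu> k * t) - 1) / t * coe f k - coe g k"
      unfolding e coe_diff[OF L g] coe_cmult using that f by (simp add: coe_diff S diff_divide_distrib left_diff_distrib)
  qed
  have "((\<lambda>t. (exp (- \<mu> k * t) - 1) / t * coe f k - coe g k) \<longlongrightarrow> - \<mu> k * coe f k - coe g k) (at_right 0)"
    by (intro tendsto_intros exp_quotient_tendsto)
  moreover have "((\<lambda>t. (exp (- \<mu> k * t) - 1) / t * coe f k - coe g k) \<longlongrightarrow> 0) (at_right 0)"
  proof (rule tendsto_rabs_zero_cancel, rule tendsto_zero_squeeze[OF lim])
    show "\<forall>\<^sub>F t in at_right 0. \<bar>(exp (- \<mu> k * t) - 1) / t * coe f k - coe g k\<bar> \<le> L2_nrm M (?r t)"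
      using eventually_at_right_less[of "0::real"]
    proof eventually_elim
      case (elim t)
      show ?case using coe_bound[OF rL[OF elim], of k] unfolding rc[OF elim] .
    qed
  qed simp
  ultimately have "- \<mu> k * coe f k - coe g k = 0" by (rule tendsto_unique[rotated]) simp
  then show "coe g k = - \<mu> k * coe f k" by simp
next
  assume *: "f \<in> L2_fun M \<and> g \<in> L2_fun M \<and> (\<forall>k. coe g k = - \<mu> k * coe f k)"
  then have f: "f \<in> L2_fun M" and g: "g \<in> L2_fun M" and c: "\<And>k. coe g k = - \<mu> k * coe f k" by auto
  let ?r = "\<lambda>t z. (S t f z - f z) / t - g z"
  (* the defect of the difference quotient relative to the derivative; at eigenvalue 0 both vanish *)
  let ?h = "\<lambda>t k. if \<mu> k = 0 then 0 else - ((exp (- \<mu> k * t) - 1) / t + \<mu> k) / \<mu> k"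
  have "((\<lambda>t. L2_nrm M (?r t)) \<longlongrightarrow> 0) (at_right 0)"
  proof (rule nrm_tendsto_0[OF _ g, where h = ?h])
    fix t :: real assume t: "0 < t"
    have e: "?r t = (\<lambda>z. (1 / t) * (S t f z - f z) - g z)" by auto
    have L: "(\<lambda>z. (1 / t) * (S t f z - f z)) \<in> L2_fun M"
      using t f by (intro L2_cmult L2_diff S) auto
    show "?r t \<in> L2_fun M" unfolding e by (intro L2_diff L g)
    fix k
    have "coe (?r t) k = ((exp (- \<mu> k * t) - 1) / t + \<mu> k) * coe f k"
      unfolding e coe_diff[OF L g] coe_cmult using t f by (simp add: coe_diff S diff_divide_distrib c distrib_right left_diff_distrib)
    moreover define X where "X = (exp (- \<mu> k * t) - 1) / t + \<mu> k"
    ultimately have "coe (?r t) k = X * coe f k" by simp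
    also have "\<dots> = (if \<mu> k = 0 then 0 else - X / \<mu> k) * coe g k" by (simp add: c) (simp add: X_def)
    finally show "coe (?r t) k = ?h t k * coe g k" unfolding X_def .
    have "exp (- \<mu> k * t) \<ge> 1 + (- \<mu> k * t)" by (rule exp_ge_add_one_self)
    then have "(exp (- \<mu> k * t) - 1) / t \<ge> - \<mu> k" using t by (simp add: field_simps)
    moreover have "(exp (- \<mu> k * t) - 1) / t \<le> 0" using t mu_nonneg[of k] by (simp add: divide_nonpos_pos)
    ultimately show "\<bar>?h t k\<bar> \<le> 1" using mu_nonneg[of k] by (auto simp: abs_le_iff field_simps)
  next
    fix k
    have "((\<lambda>t. - ((exp (- \<mu> k * t) - 1) / t + \<mu> k) / \<mu> k) \<longlongrightarrow> - (- \<mu> k + \<mu> k) / \<mu> k) (at_right 0)" if "\<mu> k \<noteq> 0"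
      using that by (intro tendsto_intros exp_quotient_tendsto)
    then show "((\<lambda>t. ?h t k) \<longlongrightarrow> 0) (at_right 0)" by (cases "\<mu> k = 0") simp_all
  qed
  then show "(f, g) \<in> L2_generator M S" using f g by (auto simp: L2_generator_def)
qed

text \<open>
  All properties but two can be read off from the coefficients. Conservation of mass asks that the
  constant function have no component outside the eigenvalue 0, and positivity has to come from
  elsewhere.
\<close>

lemma S_symmetric_markov:
  assumes one: "\<And>k. coe (\<lambda>_. 1) k \<noteq> 0 \<Longrightarrow> \<mu> k = 0"
    and pos: "\<And>t f. 0 \<le> t \<Longrightarrow> f \<in> L2_fun M \<Longrightarrow> AE z in M. 0 \<le> f z \<Longrightarrow> AE z in M. 0 \<le> S t f z"
  shows "symmetric_markov_semigroup M S"
proof -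
  have "AE z in M. S t (\<lambda>_. 1) z = 1" if t: "0 \<le> t" for t
  proof (rule eq_AE_if_coe)
    show "S t (\<lambda>_. 1) \<in> L2_fun M" using t L2_const by (rule S)
    show "coe (S t (\<lambda>_. 1)) k = coe (\<lambda>_. 1) k" for k
      using one[of k] by (auto simp: S[OF t L2_const[of 1]])
  qed (rule L2_const)
  then show ?thesis
    unfolding symmetric_markov_semigroup_def
    by (intro conjI allI ballI impI)
      (assumption | rule S_L2 S_contraction S_cong S_linear S_0 S_add S_continuous pos S_sym[unfolded L2_ip_def])+
qed

text \<open>
  An eigenvector of the generator is an eigenvector of the semigroup. Instead of differentiating
  \<open>t \<mapsto> P t e\<close>, split \<open>[0, t]\<close> into \<open>n\<close> steps: as \<open>P\<close> and \<open>exp (- \<mu> h)\<close> contract, the errors of the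
  steps add up at most linearly, and each of them is \<open>o(t / n)\<close> by the definition of the generator.
\<close>

lemma markov_eq_S_on_e:
  assumes P: "symmetric_markov_semigroup M P" and gen: "(e k, \<lambda>z. - \<mu> k * e k z) \<in> L2_generator M P"
    and t: "0 < t"
  shows "AE z in M. P t (e k) z = exp (- \<mu> k * t) * e k z"
proof -
  note P' = P[unfolded symmetric_markov_semigroup_def]
  note PL = P'[THEN conjunct1, rule_format, THEN conjunct1]
  note Pc = P'[THEN conjunct1, rule_format, THEN conjunct2]
  note Plin = P'[THEN conjunct2, THEN conjunct2, THEN conjunct1, rule_format]
  note P0 = P'[THEN conjunct2, THEN conjunct2, THEN conjunct2, THEN conjunct1, rule_format]
  note PS = P'[THEN conjunct2, THEN conjunct2, THEN conjunct2, THEN conjunct2, THEN conjunct1, rule_format]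
  let ?D = "\<lambda>h. L2_nrm M (\<lambda>z. P h (e k) z - exp (- \<mu> k * h) * e k z)"
  let ?E = "\<lambda>h z. P h (e k) z - exp (- \<mu> k * h) * e k z"
  have EL: "?E h \<in> L2_fun M" if "0 \<le> h" for h using that by (intro L2_diff L2_cmult PL e_L2)
  (* the error after n steps of length h is at most n times the error of one step *)
  have step: "?D (real n * h) \<le> real n * ?D h" if h: "0 \<le> h" for n h
  proof (induction n)
    case 0
    have "?D 0 = L2_nrm M (\<lambda>z. 0)"
      by (rule L2_nrm_cong_AE) (use P0[OF e_L2[of k]] EL[of 0] L2_meas in auto)
    then show ?case by (simp add: L2_nrm_def)
  next
    case (Suc n)
    let ?s = "real n * h"
    have s: "0 \<le> ?s" using h by simp
    have Ph: "P h (e k) \<in> L2_fun M" by (intro PL h e_L2)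
    have 1: "AE z in M. P (?s + h) (e k) z = P ?s (P h (e k)) z" using PS[OF s h e_L2] .
    have 2: "AE z in M. P ?s (\<lambda>u. 1 * P h (e k) u + (- exp (- \<mu> k * h)) * e k u) z
        = 1 * P ?s (P h (e k)) z + (- exp (- \<mu> k * h)) * P ?s (e k) z"
      using Plin[OF s Ph e_L2] .
    have eq: "AE z in M. ?E (?s + h) z = P ?s (?E h) z + exp (- \<mu> k * h) * ?E ?s z"
      using 1 2
    proof eventually_elim
      case (elim z)
      have "exp (- \<mu> k * (?s + h)) = exp (- \<mu> k * h) * exp (- \<mu> k * ?s)"
        by (simp add: exp_add[symmetric] algebra_simps)
      then show ?case using elim by (simp add: algebra_simps)
    qed
    have A: "P ?s (?E h) \<in> L2_fun M" by (intro PL s EL h)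
    have B: "(\<lambda>z. exp (- \<mu> k * h) * ?E ?s z) \<in> L2_fun M" by (intro L2_cmult EL s)
    have sh: "0 \<le> ?s + h" using s h by simp
    have "?D (?s + h) = L2_nrm M (\<lambda>z. P ?s (?E h) z + exp (- \<mu> k * h) * ?E ?s z)"
      by (rule L2_nrm_cong_AE[OF L2_meas[OF EL[OF sh]] L2_meas[OF L2_add[OF A B]] eq])
    also have "\<dots> \<le> L2_nrm M (P ?s (?E h)) + L2_nrm M (\<lambda>z. exp (- \<mu> k * h) * ?E ?s z)"
      by (rule L2_triangle[OF A B])
    also have "L2_nrm M (P ?s (?E h)) \<le> ?D h" by (rule Pc[OF s EL[OF h]])
    also have "L2_nrm M (\<lambda>z. exp (- \<mu> k * h) * ?E ?s z) \<le> 1 * ?D ?s"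
      unfolding L2_nrm_cmult using mu_nonneg[of k] h by (intro mult_right_mono) (auto simp: L2_nrm_ge0)
    also have "1 * ?D ?s \<le> real n * ?D h" using Suc.IH by simp
    finally show ?case by (simp add: algebra_simps)
  qed
  have small: "((\<lambda>h. ?D h / h) \<longlongrightarrow> 0) (at_right 0)"
  proof (rule tendsto_rabs_zero_cancel, rule tendsto_zero_squeeze)
    let ?r = "\<lambda>h. L2_nrm M (\<lambda>z. (P h (e k) z - e k z) / h - (- \<mu> k * e k z))"
    let ?q = "\<lambda>h. \<bar>- \<mu> k - (exp (- \<mu> k * h) - 1) / h\<bar> * L2_nrm M (e k)"
    have "(?r \<longlongrightarrow> 0) (at_right 0)" using gen by (simp add: L2_generator_def)
    moreover have "(?q \<longlongrightarrow> \<bar>- \<mu> k - (- \<mu> k)\<bar> * L2_nrm M (e k)) (at_right 0)"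
      by (intro tendsto_intros exp_quotient_tendsto)
    ultimately have "((\<lambda>h. ?r h + ?q h) \<longlongrightarrow> 0 + \<bar>- \<mu> k - (- \<mu> k)\<bar> * L2_nrm M (e k)) (at_right 0)"
      by (rule tendsto_add)
    then show "((\<lambda>h. ?r h + ?q h) \<longlongrightarrow> 0) (at_right 0)" by simp
    show "\<forall>\<^sub>F h in at_right 0. \<bar>?D h / h\<bar> \<le> ?r h + ?q h"
      using eventually_at_right_less[of "0::real"]
    proof eventually_elim
      case (elim h)
      have 1: "(\<lambda>z. (P h (e k) z - e k z) / h - (- \<mu> k * e k z)) \<in> L2_fun M"
      proof -
        have "(\<lambda>z. (1 / h) * (P h (e k) z - e k z) - (- \<mu> k) * e k z) \<in> L2_fun M"
          using elim by (intro L2_diff L2_cmult PL e_L2) auto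
        then show ?thesis by simp
      qed
      have 2: "(\<lambda>z. (- \<mu> k - (exp (- \<mu> k * h) - 1) / h) * e k z) \<in> L2_fun M" by (intro L2_cmult e_L2)
      have "\<bar>?D h / h\<bar> = L2_nrm M (\<lambda>z. (1 / h) * ?E h z)"
        unfolding L2_nrm_cmult using elim by (simp add: L2_nrm_ge0)
      also have "(\<lambda>z. (1 / h) * ?E h z) = (\<lambda>z. ((P h (e k) z - e k z) / h - (- \<mu> k * e k z))
          + (- \<mu> k - (exp (- \<mu> k * h) - 1) / h) * e k z)"
        using elim by (auto simp: fun_eq_iff field_simps)
      also have "L2_nrm M \<dots> \<le> ?r h + ?q h" using L2_triangle[OF 1 2] by (simp add: L2_nrm_cmult)
      finally show ?case .
    qed
  qed auto
  have "?D t \<le> 0"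
  proof (rule tendsto_lowerbound)
    have "filterlim (\<lambda>n. t / real (Suc n)) (at_right 0) sequentially"
      using t by (intro tendsto_imp_filterlim_at_right lim_const_over_n[THEN LIMSEQ_Suc]) auto
    then have "((\<lambda>n. ?D (t / real (Suc n)) / (t / real (Suc n))) \<longlonglongrightarrow> 0)"
      by (rule filterlim_compose[OF small])
    then show "((\<lambda>n. t * (?D (t / real (Suc n)) / (t / real (Suc n)))) \<longlonglongrightarrow> 0)"
      by (rule tendsto_mult_right_zero)
    have "?D t \<le> t * (?D (t / real (Suc n)) / (t / real (Suc n)))" for n
    proof -
      have "?D (real (Suc n) * (t / real (Suc n))) \<le> real (Suc n) * ?D (t / real (Suc n))"
        by (rule step) (use t in simp)
      moreover have "real (Suc n) * (t / real (Suc n)) = t" by simp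
      ultimately have "?D t \<le> real (Suc n) * ?D (t / real (Suc n))" by metis
      also have "\<dots> = t * (?D (t / real (Suc n)) / (t / real (Suc n)))" using t by (simp add: field_simps)
      finally show ?thesis .
    qed
    then show "\<forall>\<^sub>F n in sequentially. ?D t \<le> t * (?D (t / real (Suc n)) / (t / real (Suc n)))" by simp
  qed simp
  then have "?D t = 0" using L2_nrm_ge0[of M "?E t"] by linarith
  then have "AE z in M. ?E t z = 0" using L2_nrm_eq_0[OF EL[of t]] t by simp
  then show ?thesis by simp
qed

text \<open>
  Agreement on the basis extends to finite combinations by linearity and to L2 by contractivity.
\<close>

lemma markov_eq_S:
  assumes P: "symmetric_markov_semigroup M P" and gen: "\<And>k. (e k, \<lambda>z. - \<mu> k * e k z) \<in> L2_generator M P"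
    and t: "0 < t" and f: "f \<in> L2_fun M"
  shows "AE z in M. P t f z = S t f z"
proof -
  note P' = P[unfolded symmetric_markov_semigroup_def]
  have t0: "0 \<le> t" using t by simp
  note PL = P'[THEN conjunct1, rule_format, THEN conjunct1, OF t0]
  note Pc = P'[THEN conjunct1, rule_format, THEN conjunct2, OF t0]
  note Plin = P'[THEN conjunct2, THEN conjunct2, THEN conjunct1, rule_format, OF t0]
  have ek: "AE z in M. P t (e k) z = S t (e k) z" for k
  proof -
    have "AE z in M. S t (e k) z = exp (- \<mu> k * t) * e k z"
    proof (rule eq_AE_if_coe)
      fix j show "coe (S t (e k)) j = coe (\<lambda>z. exp (- \<mu> k * t) * e k z) j"
        using e_orth[of k j] by (cases "j = k") (auto simp: S[OF t0 e_L2] coe_cmult, simp add: coe_def)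
    qed (auto intro: S t0 e_L2 L2_cmult)
    with markov_eq_S_on_e[OF P gen t, of k] show ?thesis by eventually_elim simp
  qed
  have pL: "psum a N \<in> L2_fun M" for a N by (rule psum_L2)
  have fin: "AE z in M. P t (psum a N) z = S t (psum a N) z" for a N
  proof (induction N)
    case 0
    have "AE z in M. P t (\<lambda>u. 0 * e 0 u + 0 * e 0 u) z = 0 * P t (e 0) z + 0 * P t (e 0) z" by (rule Plin[OF e_L2 e_L2])
    moreover have "AE z in M. S t (\<lambda>u. 0 * e 0 u + 0 * e 0 u) z = 0 * S t (e 0) z + 0 * S t (e 0) z" by (rule S_linear[OF t0 e_L2 e_L2])
    ultimately have "AE z in M. P t (\<lambda>u. 0 * e 0 u + 0 * e 0 u) z = S t (\<lambda>u. 0 * e 0 u + 0 * e 0 u) z"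
      by eventually_elim (simp only: mult_zero_left)
    then show ?case by simp
  next
    case (Suc N)
    have "AE z in M. P t (\<lambda>u. 1 * psum a N u + a N * e N u) z = 1 * P t (psum a N) z + a N * P t (e N) z" by (rule Plin[OF pL e_L2])
    moreover have "AE z in M. S t (\<lambda>u. 1 * psum a N u + a N * e N u) z = 1 * S t (psum a N) z + a N * S t (e N) z" by (rule S_linear[OF t0 pL e_L2])
    ultimately have "AE z in M. P t (\<lambda>u. 1 * psum a N u + a N * e N u) z = S t (\<lambda>u. 1 * psum a N u + a N * e N u) z"
      using Suc.IH ek[of N] by eventually_elim simp
    then show ?case by simp
  qed
  have PfL: "P t f \<in> L2_fun M" and SfL: "S t f \<in> L2_fun M" using PL[OF f] S_L2[OF t0 f] by auto
  have "L2_nrm M (\<lambda>z. P t f z - S t f z) \<le> 0 + \<epsilon>" if "0 < \<epsilon>" for \<epsilon>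
  proof -
    obtain N a where N: "L2_nrm M (\<lambda>z. f z - psum a N z) < \<epsilon> / 2" using total[OF f, of "\<epsilon> / 2"] \<open>0 < \<epsilon>\<close> by auto
    let ?g = "psum a N"
    let ?h = "\<lambda>z. 1 * f z + (-1) * ?g z"
    have h: "?h \<in> L2_fun M" by (intro L2_add L2_cmult f pL)
    have "AE z in M. P t ?h z = 1 * P t f z + (-1) * P t ?g z" by (rule Plin[OF f pL])
    moreover have "AE z in M. S t ?h z = 1 * S t f z + (-1) * S t ?g z" by (rule S_linear[OF t0 f pL])
    ultimately have ae: "AE z in M. P t f z - S t f z = P t ?h z - S t ?h z"
      using fin[of a N] by eventually_elim simp
    have "L2_nrm M (\<lambda>z. P t f z - S t f z) = L2_nrm M (\<lambda>z. P t ?h z - S t ?h z)"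
      by (rule L2_nrm_cong_AE[OF _ _ ae]) (intro L2_meas L2_diff PL S_L2 t0 f h)+
    also have "\<dots> \<le> L2_nrm M (P t ?h) + L2_nrm M (\<lambda>z. - S t ?h z)"
      using L2_triangle[OF PL[OF h] L2_uminus[OF S_L2[OF t0 h]]] by simp
    also have "L2_nrm M (\<lambda>z. - S t ?h z) = L2_nrm M (S t ?h)" by (simp add: L2_nrm_def)
    also have "L2_nrm M (P t ?h) + L2_nrm M (S t ?h) \<le> L2_nrm M ?h + L2_nrm M ?h"
      by (intro add_mono Pc S_contraction t0 h)
    finally show ?thesis using N by simp
  qed
  then have "L2_nrm M (\<lambda>z. P t f z - S t f z) \<le> 0" by (rule field_le_epsilon)
  then have "L2_nrm M (\<lambda>z. P t f z - S t f z) = 0" using L2_nrm_ge0 by (rule antisym)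
  then have "AE z in M. P t f z - S t f z = 0" using L2_nrm_eq_0[OF L2_diff[OF PfL SfL]] by simp
  then show ?thesis by simp
qed

theorem generator_unique:
  assumes P: "symmetric_markov_semigroup M P" and gen: "\<And>k. (e k, \<lambda>z. - \<mu> k * e k z) \<in> L2_generator M P"
  shows "L2_generator M P = L2_generator M S"
proof -
  note PL = P[unfolded symmetric_markov_semigroup_def, THEN conjunct1, rule_format, THEN conjunct1]
  have "((\<lambda>t. L2_nrm M (\<lambda>z. (P t f z - f z) / t - g z)) \<longlongrightarrow> 0) (at_right 0) \<longleftrightarrow>
      ((\<lambda>t. L2_nrm M (\<lambda>z. (S t f z - f z) / t - g z)) \<longlongrightarrow> 0) (at_right 0)"
    if f: "f \<in> L2_fun M" and g: "g \<in> L2_fun M" for f g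
  proof (rule tendsto_cong)
    show "\<forall>\<^sub>F t in at_right 0. L2_nrm M (\<lambda>z. (P t f z - f z) / t - g z) = L2_nrm M (\<lambda>z. (S t f z - f z) / t - g z)"
      using eventually_at_right_less[of "0::real"]
    proof eventually_elim
      case (elim t)
      have [measurable]: "P t f \<in> borel_measurable M" "S t f \<in> borel_measurable M" "f \<in> borel_measurable M" "g \<in> borel_measurable M"
        using PL[of t f] S_L2[of t f] elim f g by (auto intro: L2_meas)
      show ?case
        by (rule L2_nrm_cong_AE) (use markov_eq_S[OF P gen elim f] in auto)
    qed
  qed
  then show ?thesis unfolding L2_generator_def by blast
qed

text \<open>
  The resolvent is the diagonal operator with entries \<open>1 / (l - \<mu> k)\<close>, which are bounded by
  \<open>1 / d\<close>.
\<close>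

lemma resolvent_if_gap:
  assumes "0 < d" "\<And>k. d \<le> \<bar>l - \<mu> k\<bar>"
  shows "l \<in> L2_resolvent_set M (op_neg (L2_generator M S))"
  unfolding L2_resolvent_set_def
proof (intro CollectI conjI)
  have nz: "l - \<mu> k \<noteq> 0" for k using assms(1) assms(2)[of k] by auto
  have "AE z in M. f z = 0" if fg: "(f, g') \<in> op_neg (L2_generator M S)" and z: "AE z in M. l * f z - g' z = 0" for f g'
  proof -
    obtain g where A: "(f, g) \<in> L2_generator M S" and g': "g' = (\<lambda>z. - g z)"
      using fg by (auto simp: op_neg_def)
    have f: "f \<in> L2_fun M" and g: "g \<in> L2_fun M" and c: "\<And>k. coe g k = - \<mu> k * coe f k"
      using A by (auto simp: generator_iff)
    have z': "AE z in M. l * f z + g z = 0" using z by (simp add: g')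
    show "AE z in M. f z = 0"
    proof (rule eq_AE_if_coe[OF f L2_zero])
      fix k
      have "coe (\<lambda>z. l * f z + g z) k = coe (\<lambda>z. 0) k"
        by (rule coe_cong[OF _ L2_zero z']) (intro L2_add L2_cmult f g)
      then have "(l - \<mu> k) * coe f k = coe (\<lambda>z. 0) k"
        by (simp add: coe_add L2_cmult f g coe_cmult c algebra_simps)
      then show "coe f k = coe (\<lambda>z. 0) k" using nz[of k] by (simp add: coe_def L2_ip_def)
    qed
  qed
  then show "\<forall>(f, g)\<in>op_neg (L2_generator M S). (AE z in M. l * f z - g z = 0) \<longrightarrow> (AE z in M. f z = 0)"
    by blast
  show "\<exists>C. \<forall>h\<in>L2_fun M. \<exists>(f, g)\<in>op_neg (L2_generator M S). (AE z in M. l * f z - g z = h z) \<and> L2_nrm M f \<le> C * L2_nrm M h"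
  proof (intro exI[of _ "1 / d"] ballI)
    fix h assume h: "h \<in> L2_fun M"
    have m: "\<bar>1 / (l - \<mu> k)\<bar> \<le> 1 / d" for k
      using assms(1) assms(2)[of k] by (simp add: abs_divide frac_le)
    define f where "f = diag (\<lambda>k. 1 / (l - \<mu> k)) h"
    note f = diag[where m = "\<lambda>k. 1 / (l - \<mu> k)", OF h m, folded f_def]
    define g where "g z = h z - l * f z" for z
    have g: "g \<in> L2_fun M" unfolding g_def by (rule L2_diff[OF h L2_cmult[OF f(1)]])
    have "coe g k = - \<mu> k * coe f k" for k
    proof -
      have "coe g k = coe h k - l * coe f k"
        unfolding g_def by (simp add: coe_diff coe_cmult h f(1) L2_cmult)
      also have "coe h k = (l - \<mu> k) * coe f k" using nz[of k] by (simp add: f(2))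
      finally show ?thesis by (simp add: algebra_simps)
    qed
    then have "(f, g) \<in> L2_generator M S" using f(1) g by (simp add: generator_iff)
    then have "(f, \<lambda>z. - g z) \<in> op_neg (L2_generator M S)" by (auto simp: op_neg_def)
    moreover have "AE z in M. l * f z - (- g z) = h z" by (simp add: g_def)
    ultimately show "\<exists>(f, g)\<in>op_neg (L2_generator M S). (AE z in M. l * f z - g z = h z) \<and> L2_nrm M f \<le> 1 / d * L2_nrm M h"
      using f(3) by (intro bexI[of _ "(f, \<lambda>z. - g z)"]) simp_all
  qed
qed

end

lemma eigenvalue_in_spectrum:
  assumes "(f, \<lambda>z. - l * f z) \<in> A" "\<not> (AE z in M. f z = 0)"
  shows "l \<in> L2_spectrum M (op_neg A)"
proof -
  have fg: "(f, \<lambda>z. - (- l * f z)) \<in> op_neg A" 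
    unfolding op_neg_def using assms(1) by (intro CollectI exI[of _ f] exI[of _ "\<lambda>z. - l * f z"] conjI refl)
  moreover have "AE z in M. l * f z - (- (- l * f z)) = 0"
    by (rule AE_I2) (simp only: mult_minus_left minus_minus diff_self)
  moreover have "(AE z in M. l * f z - (- (- l * f z)) = 0) \<longrightarrow> (AE z in M. f z = 0)"
    if "l \<in> L2_resolvent_set M (op_neg A)"
  proof -
    have "\<forall>(f, g)\<in>op_neg A. (AE z in M. l * f z - g z = 0) \<longrightarrow> (AE z in M. f z = 0)"
      using that unfolding L2_resolvent_set_def mem_Collect_eq by (rule conjunct1)
    from bspec[OF this fg] show ?thesis by (simp only: prod.case)
  qed
  ultimately have "l \<notin> L2_resolvent_set M (op_neg A)"
    using assms(2) by (simp only:) blast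
  then show ?thesis by (simp add: L2_spectrum_def)
qed

section \<open>Polynomials in finitely many variables\<close>

text \<open>
  A monomial is given by the list of its variables, repeated according to multiplicity and in any
  order. Thus the monomials of degree at most \<open>n\<close> are the image of a finite set of lists, and
  multiplication by a variable is \<open>Cons\<close>.
\<close>

definition mon :: "'v list \<Rightarrow> ('v \<Rightarrow> real) \<Rightarrow> real" where
  "mon xs \<zeta> = prod_list (map \<zeta> xs)"

definition Pol :: "nat \<Rightarrow> (('v \<Rightarrow> real) \<Rightarrow> real) set" where
  "Pol n = FV.span (mon ` {xs. length xs \<le> n})"

definition Polys :: "(('v \<Rightarrow> real) \<Rightarrow> real) set" where
  "Polys = (\<Union>n. Pol n)"

lemma mon_simps [simp]: "mon [] = (\<lambda>_. 1)" "mon (x # xs) \<zeta> = \<zeta> x * mon xs \<zeta>"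
  by (auto simp: mon_def)

lemma mon_Cons: "mon (x # xs) = (\<lambda>\<zeta>. \<zeta> x * mon xs \<zeta>)"
  by (rule ext) simp

lemma Pol_subspace: "FV.subspace (Pol n)"
  by (simp add: Pol_def)

lemma mon_Pol: "length xs \<le> n \<Longrightarrow> mon xs \<in> Pol n"
  unfolding Pol_def by (rule FV.span_base) auto

lemma Pol_mono: "m \<le> n \<Longrightarrow> Pol m \<subseteq> Pol n"
  unfolding Pol_def by (intro FV.span_mono image_mono) auto

lemma Pol_zero: "(\<lambda>_. 0) \<in> Pol n"
  using FV.subspace_0[OF Pol_subspace, of n] by (simp add: zero_fun_def)

lemma Pol_add: "f \<in> Pol n \<Longrightarrow> g \<in> Pol n \<Longrightarrow> (\<lambda>\<zeta>. f \<zeta> + g \<zeta>) \<in> Pol n"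
  using FV.subspace_add[OF Pol_subspace, of f n g] by (simp add: plus_fun_def)

lemma Pol_cmult: "f \<in> Pol n \<Longrightarrow> (\<lambda>\<zeta>. c * f \<zeta>) \<in> Pol n"
  using FV.subspace_scale[OF Pol_subspace, of f n c] by (simp add: scl_def)

lemma Pol_uminus: "f \<in> Pol n \<Longrightarrow> (\<lambda>\<zeta>. - f \<zeta>) \<in> Pol n"
  using Pol_cmult[of f n "-1"] by simp

lemma Pol_diff: "f \<in> Pol n \<Longrightarrow> g \<in> Pol n \<Longrightarrow> (\<lambda>\<zeta>. f \<zeta> - g \<zeta>) \<in> Pol n"
  using Pol_add[of f n "\<lambda>\<zeta>. - g \<zeta>"] Pol_uminus[of g n] by simp

lemma Pol_sum: "(\<And>i. i \<in> I \<Longrightarrow> h i \<in> Pol n) \<Longrightarrow> (\<lambda>\<zeta>. \<Sum>i\<in>I. h i \<zeta>) \<in> Pol n"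
  by (induction I rule: infinite_finite_induct) (auto simp: Pol_zero Pol_add)

lemma Pol_induct [consumes 1, case_names zero step]:
  assumes "f \<in> Pol n" "P (\<lambda>_. 0)"
    and "\<And>c xs g. length xs \<le> n \<Longrightarrow> g \<in> Pol n \<Longrightarrow> P g \<Longrightarrow> P (\<lambda>\<zeta>. c * mon xs \<zeta> + g \<zeta>)"
  shows "P f"
proof -
  have "f \<in> Pol n \<and> P f"
    using assms(1) unfolding Pol_def
  proof (rule FV.span_induct_alt)
    show "0 \<in> FV.span (mon ` {xs. length xs \<le> n}) \<and> P 0"
      using assms(2) FV.span_zero by (auto simp: zero_fun_def)
  next
    fix c and x y :: "('a \<Rightarrow> real) \<Rightarrow> real"
    assume x: "x \<in> mon ` {xs. length xs \<le> n}" and y: "y \<in> FV.span (mon ` {xs. length xs \<le> n}) \<and> P y"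
    then obtain xs where xs: "x = mon xs" "length xs \<le> n" by auto
    have "P (\<lambda>\<zeta>. c * mon xs \<zeta> + y \<zeta>)" using assms(3)[OF xs(2)] y by (simp add: Pol_def)
    then have "P (scl c x + y)" by (simp add: xs plus_fun_def)
    moreover have "scl c x + y \<in> FV.span (mon ` {xs. length xs \<le> n})"
      using x y by (intro FV.span_add FV.span_scale) (auto intro: FV.span_base)
    ultimately show "scl c x + y \<in> FV.span (mon ` {xs. length xs \<le> n}) \<and> P (scl c x + y)" by simp
  qed
  then show ?thesis ..
qed

lemma Pol_coord_mult: "f \<in> Pol n \<Longrightarrow> (\<lambda>\<zeta>. \<zeta> x * f \<zeta>) \<in> Pol (Suc n)"
proof (induction rule: Pol_induct)
  case zero then show ?case by (simp add: Pol_zero)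
next
  case (step c xs g)
  have "mon (x # xs) \<in> Pol (Suc n)" using step by (intro mon_Pol) simp
  then have "(\<lambda>\<zeta>. c * (\<zeta> x * mon xs \<zeta>) + \<zeta> x * g \<zeta>) \<in> Pol (Suc n)"
    using step mon_Cons[of x xs] by (intro Pol_add Pol_cmult) simp_all
  then show ?case by (simp add: algebra_simps)
qed

lemma Polys_add: "f \<in> Polys \<Longrightarrow> g \<in> Polys \<Longrightarrow> (\<lambda>\<zeta>. f \<zeta> + g \<zeta>) \<in> Polys"
proof -
  assume "f \<in> Polys" "g \<in> Polys"
  then obtain m n where "f \<in> Pol m" "g \<in> Pol n" by (auto simp: Polys_def)
  then have "f \<in> Pol (max m n)" "g \<in> Pol (max m n)" using Pol_mono[of m "max m n"] Pol_mono[of n "max m n"] by auto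
  then show ?thesis unfolding Polys_def UN_iff using Pol_add[of f "max m n" g] by blast
qed

lemma Polys_cmult: "f \<in> Polys \<Longrightarrow> (\<lambda>\<zeta>. c * f \<zeta>) \<in> Polys"
  using Pol_cmult[of f _ c] unfolding Polys_def UN_iff by blast

lemma Polys_coord_mult: "f \<in> Polys \<Longrightarrow> (\<lambda>\<zeta>. \<zeta> x * f \<zeta>) \<in> Polys"
  using Pol_coord_mult[of f _ x] unfolding Polys_def UN_iff by blast

lemma Polys_const: "(\<lambda>_. c) \<in> Polys"
  using Pol_cmult[OF mon_Pol[of "[]" 0], of c] by (auto simp: Polys_def)

lemma Polys_coord: "(\<lambda>\<zeta>. \<zeta> x) \<in> Polys"
  using Polys_coord_mult[OF Polys_const[of 1], of x] by simp

lemma Polys_diff: "f \<in> Polys \<Longrightarrow> g \<in> Polys \<Longrightarrow> (\<lambda>\<zeta>. f \<zeta> - g \<zeta>) \<in> Polys"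
  using Polys_add[of f "\<lambda>\<zeta>. (-1) * g \<zeta>"] Polys_cmult[of g "-1"] by simp

lemma Polys_sum: "(\<And>i. i \<in> I \<Longrightarrow> h i \<in> Polys) \<Longrightarrow> (\<lambda>\<zeta>. \<Sum>i\<in>I. h i \<zeta>) \<in> Polys"
  by (induction I rule: infinite_finite_induct) (auto simp: Polys_const Polys_add)

lemma Pol_Polys: "f \<in> Pol n \<Longrightarrow> f \<in> Polys"
  by (auto simp: Polys_def)

lemma Polys_induct [consumes 1, case_names const coord_mult add]:
  assumes "f \<in> Polys" "\<And>c. P (\<lambda>_. c)" "\<And>x f. f \<in> Polys \<Longrightarrow> P f \<Longrightarrow> P (\<lambda>\<zeta>. \<zeta> x * f \<zeta>)"
    "\<And>f g. f \<in> Polys \<Longrightarrow> g \<in> Polys \<Longrightarrow> P f \<Longrightarrow> P g \<Longrightarrow> P (\<lambda>\<zeta>. f \<zeta> + g \<zeta>)"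
  shows "P f"
proof -
  have m: "(\<lambda>\<zeta>. c * mon xs \<zeta>) \<in> Polys \<and> P (\<lambda>\<zeta>. c * mon xs \<zeta>)" for c xs
  proof (induction xs)
    case Nil then show ?case using assms(2) by (simp add: Polys_const)
  next
    case (Cons x xs)
    have "(\<lambda>\<zeta>. \<zeta> x * (c * mon xs \<zeta>)) \<in> Polys \<and> P (\<lambda>\<zeta>. \<zeta> x * (c * mon xs \<zeta>))"
      by (rule conjI[OF Polys_coord_mult[OF Cons.IH[THEN conjunct1]]
            assms(3)[OF Cons.IH[THEN conjunct1] Cons.IH[THEN conjunct2]]])
    then show ?case by (simp add: mult.left_commute)
  qed
  obtain n where "f \<in> Pol n" using assms(1) by (auto simp: Polys_def)
  then show ?thesis
  proof (induction rule: Pol_induct)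
    case zero then show ?case by (rule assms(2))
  next
    case (step c xs g)
    then show ?case using m[of c xs] by (intro assms(4)) (auto intro: Pol_Polys)
  qed
qed

lemma Polys_mult: "f \<in> Polys \<Longrightarrow> g \<in> Polys \<Longrightarrow> (\<lambda>\<zeta>. f \<zeta> * g \<zeta>) \<in> Polys"
proof (induction rule: Polys_induct)
  case (const c) then show ?case by (rule Polys_cmult)
next
  case (coord_mult x f)
  then show ?case using Polys_coord_mult[of "\<lambda>\<zeta>. f \<zeta> * g \<zeta>" x] by (simp add: mult.assoc)
next
  case (add f1 f2)
  then show ?case using Polys_add[of "\<lambda>\<zeta>. f1 \<zeta> * g \<zeta>" "\<lambda>\<zeta>. f2 \<zeta> * g \<zeta>"] by (simp add: distrib_right)
qed

lemma Polys_power: "f \<in> Polys \<Longrightarrow> (\<lambda>\<zeta>. f \<zeta> ^ n) \<in> Polys"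
  by (induction n) (auto intro: Polys_const Polys_mult)

lemma Polys_continuous: "f \<in> Polys \<Longrightarrow> continuous_on A f"
  by (induction rule: Polys_induct)
    (auto intro!: continuous_intros continuous_on_product_then_coordinatewise[OF continuous_on_id])

text \<open>
  Restriction to a line parallel to an axis; it gives access to the theory of univariate
  polynomials.
\<close>

lemma Polys_restrict: "f \<in> Polys \<Longrightarrow> \<exists>p. \<forall>t. f (\<zeta>(x := t)) = poly p t"
proof (induction rule: Polys_induct)
  case (const c) show ?case by (rule exI[of _ "[:c:]"]) simp
next
  case (coord_mult y f)
  then obtain p where p: "\<forall>t. f (\<zeta>(x := t)) = poly p t" by blast
  then have "\<forall>t. (\<zeta>(x := t)) y * f (\<zeta>(x := t)) = poly ((if y = x then [:0, 1:] else [:\<zeta> y:]) * p) t"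
    by (simp del: fun_upd_apply) (simp add: fun_upd_same fun_upd_other)
  then show ?case by blast
next
  case (add f g)
  then obtain p q where "\<forall>t. f (\<zeta>(x := t)) = poly p t" "\<forall>t. g (\<zeta>(x := t)) = poly q t" by blast
  then show ?case by (intro exI[of _ "p + q"]) (simp del: fun_upd_apply)
qed

text \<open>
  The sign condition is removed one coordinate at a time: in each coordinate the polynomial
  vanishes on a half-line, hence identically.
\<close>

lemma Polys_zero_of_orthant:
  fixes f :: "('v::finite \<Rightarrow> real) \<Rightarrow> real"
  assumes f: "f \<in> Polys" and z: "\<And>\<zeta>. (\<And>x. 0 < \<zeta> x) \<Longrightarrow> f \<zeta> = 0"
  shows "f \<zeta> = 0"
proof -
  (* A is the set of coordinates whose sign is no longer restricted *)
  have "\<forall>\<zeta>. (\<forall>x. x \<notin> A \<longrightarrow> 0 < \<zeta> x) \<longrightarrow> f \<zeta> = 0" if "finite A" for A :: "'v set"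
    using that
  proof (induction A)
    case empty then show ?case using z by auto
  next
    case (insert x A)
    show ?case
    proof (intro allI impI)
      fix \<zeta> :: "'v \<Rightarrow> real" assume \<zeta>: "\<forall>y. y \<notin> insert x A \<longrightarrow> 0 < \<zeta> y"
      obtain p where p: "\<And>t. f (\<zeta>(x := t)) = poly p t" using Polys_restrict[OF f] by metis
      have "poly p t = 0" if "0 < t" for t
        using insert.IH \<zeta> that unfolding p[symmetric] by auto
      then have "{0<..} \<subseteq> {t. poly p t = 0}" by auto
      then have "infinite {t. poly p t = 0}" using infinite_Ioi[of "0::real"] finite_subset by blast
      then have "p = 0" using poly_roots_finite by blast
      then show "f \<zeta> = 0" using p[of "\<zeta> x"] by simp
    qed
  qed
  from this[of UNIV] show ?thesis by simp
qed

section \<open>Polynomial growth\<close>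

lemma poly_growthI:
  assumes "\<And>\<zeta>. (\<forall>x. 0 \<le> \<zeta> x) \<Longrightarrow> \<bar>f \<zeta>\<bar> \<le> C * (1 + (\<Sum>x\<in>UNIV. \<zeta> x)) ^ n"
  shows "poly_growth f"
  using assms unfolding poly_growth_def by blast

lemma growth_bounds:
  fixes \<zeta> :: "'v::finite \<Rightarrow> real"
  assumes "\<forall>x. 0 \<le> \<zeta> x"
  shows "1 \<le> 1 + (\<Sum>x\<in>UNIV. \<zeta> x)" "\<zeta> y \<le> 1 + (\<Sum>x\<in>UNIV. \<zeta> x)"
proof -
  have "\<zeta> y \<le> (\<Sum>x\<in>UNIV. \<zeta> x)" using assms by (intro member_le_sum) auto
  then show "\<zeta> y \<le> 1 + (\<Sum>x\<in>UNIV. \<zeta> x)" by simp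
  show "1 \<le> 1 + (\<Sum>x\<in>UNIV. \<zeta> x)" using assms by (simp add: sum_nonneg)
qed

lemma poly_growth_obtain:
  fixes f :: "('v::finite \<Rightarrow> real) \<Rightarrow> real"
  assumes "poly_growth f"
  obtains C n where "0 \<le> C" "\<And>\<zeta>. (\<forall>x. 0 \<le> \<zeta> x) \<Longrightarrow> \<bar>f \<zeta>\<bar> \<le> C * (1 + (\<Sum>x\<in>UNIV. \<zeta> x)) ^ n"
proof -
  obtain C n where C: "\<And>\<zeta>. (\<forall>x. 0 \<le> \<zeta> x) \<Longrightarrow> \<bar>f \<zeta>\<bar> \<le> C * (1 + (\<Sum>x\<in>UNIV. \<zeta> x)) ^ n"
    using assms unfolding poly_growth_def by blast
  have "0 \<le> C" using C[of "\<lambda>_. 0"] by (simp add: order_trans[OF abs_ge_zero])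
  then show ?thesis using that C by blast
qed

lemma poly_growth_add:
  fixes f g :: "('v::finite \<Rightarrow> real) \<Rightarrow> real"
  assumes "poly_growth f" "poly_growth g" shows "poly_growth (\<lambda>\<zeta>. f \<zeta> + g \<zeta>)"
proof -
  obtain C n where C: "0 \<le> C" "\<And>\<zeta>. (\<forall>x. 0 \<le> \<zeta> x) \<Longrightarrow> \<bar>f \<zeta>\<bar> \<le> C * (1 + (\<Sum>x\<in>UNIV. \<zeta> x)) ^ n"
    using poly_growth_obtain[OF assms(1)] by metis
  obtain D m where D: "0 \<le> D" "\<And>\<zeta>. (\<forall>x. 0 \<le> \<zeta> x) \<Longrightarrow> \<bar>g \<zeta>\<bar> \<le> D * (1 + (\<Sum>x\<in>UNIV. \<zeta> x)) ^ m"
    using poly_growth_obtain[OF assms(2)] by metis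
  show ?thesis
  proof (rule poly_growthI)
    fix \<zeta> :: "'v \<Rightarrow> real" assume z: "\<forall>x. 0 \<le> \<zeta> x"
    let ?s = "1 + (\<Sum>x\<in>UNIV. \<zeta> x)"
    have s: "1 \<le> ?s" using growth_bounds[OF z] by simp
    have "\<bar>f \<zeta> + g \<zeta>\<bar> \<le> C * ?s ^ n + D * ?s ^ m" using C(2)[OF z] D(2)[OF z] by linarith
    also have "\<dots> \<le> C * ?s ^ (n + m) + D * ?s ^ (n + m)"
      using s C D by (intro add_mono mult_left_mono power_increasing) auto
    finally show "\<bar>f \<zeta> + g \<zeta>\<bar> \<le> (C + D) * ?s ^ (n + m)" by (simp add: algebra_simps)
  qed
qed

lemma poly_growth_mult:
  fixes f g :: "('v::finite \<Rightarrow> real) \<Rightarrow> real"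
  assumes "poly_growth f" "poly_growth g" shows "poly_growth (\<lambda>\<zeta>. f \<zeta> * g \<zeta>)"
proof -
  obtain C n where C: "0 \<le> C" "\<And>\<zeta>. (\<forall>x. 0 \<le> \<zeta> x) \<Longrightarrow> \<bar>f \<zeta>\<bar> \<le> C * (1 + (\<Sum>x\<in>UNIV. \<zeta> x)) ^ n"
    using poly_growth_obtain[OF assms(1)] by metis
  obtain D m where D: "0 \<le> D" "\<And>\<zeta>. (\<forall>x. 0 \<le> \<zeta> x) \<Longrightarrow> \<bar>g \<zeta>\<bar> \<le> D * (1 + (\<Sum>x\<in>UNIV. \<zeta> x)) ^ m"
    using poly_growth_obtain[OF assms(2)] by metis
  show ?thesis
  proof (rule poly_growthI)
    fix \<zeta> :: "'v \<Rightarrow> real" assume z: "\<forall>x. 0 \<le> \<zeta> x"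
    let ?s = "1 + (\<Sum>x\<in>UNIV. \<zeta> x)"
    have "\<bar>f \<zeta> * g \<zeta>\<bar> \<le> (C * ?s ^ n) * (D * ?s ^ m)"
      unfolding abs_mult using C(2)[OF z] D(2)[OF z] by (intro mult_mono') auto
    then show "\<bar>f \<zeta> * g \<zeta>\<bar> \<le> (C * D) * ?s ^ (n + m)" by (simp add: power_add mult_ac)
  qed
qed

lemma poly_growth_const: "poly_growth (\<lambda>_. c)"
  by (rule poly_growthI[of _ "\<bar>c\<bar>" 0]) simp

lemma poly_growth_coord: "poly_growth (\<lambda>\<zeta>::'v::finite \<Rightarrow> real. \<zeta> x)"
  by (rule poly_growthI[of _ 1 1]) (use growth_bounds(2) in auto)

lemma poly_growth_diff:
  fixes f g :: "('v::finite \<Rightarrow> real) \<Rightarrow> real"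
  assumes "poly_growth f" "poly_growth g" shows "poly_growth (\<lambda>\<zeta>. f \<zeta> - g \<zeta>)"
  using poly_growth_add[OF assms(1) poly_growth_mult[OF poly_growth_const[of "-1"] assms(2)]] by simp

lemma poly_growth_sum:
  fixes h :: "'i \<Rightarrow> ('v::finite \<Rightarrow> real) \<Rightarrow> real"
  assumes "\<And>i. i \<in> I \<Longrightarrow> poly_growth (h i)" shows "poly_growth (\<lambda>\<zeta>. \<Sum>i\<in>I. h i \<zeta>)"
  using assms by (induction I rule: infinite_finite_induct) (auto simp: poly_growth_const poly_growth_add)

lemma Polys_growth: "f \<in> Polys \<Longrightarrow> poly_growth f" for f :: "('v::finite \<Rightarrow> real) \<Rightarrow> real"
  by (induction rule: Polys_induct) (auto intro: poly_growth_const poly_growth_coord poly_growth_add poly_growth_mult)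

section \<open>Derivatives of polynomials\<close>

definition line :: "('v \<Rightarrow> real) \<Rightarrow> ('v \<Rightarrow> real) \<Rightarrow> real \<Rightarrow> 'v \<Rightarrow> real" where
  "line \<zeta> v s = (\<lambda>z. \<zeta> z + s * v z)"

lemma line_0 [simp]: "line \<zeta> v 0 = \<zeta>"
  by (simp add: line_def)

text \<open>
  Differentiability along all lines, with derivative linear in the direction. It is stronger than
  having partial derivatives, just enough to differentiate in the directions \<open>\<partial>\<^sub>x - \<partial>\<^sub>y\<close> and along
  rays, and stable under sums and products without any topology on the space of configurations.
\<close>

definition has_grad :: "(('v::finite \<Rightarrow> real) \<Rightarrow> real) \<Rightarrow> ('v \<Rightarrow> ('v \<Rightarrow> real) \<Rightarrow> real) \<Rightarrow> bool" where
  "has_grad f d \<longleftrightarrow> (\<forall>\<zeta> v s. ((\<lambda>s. f (line \<zeta> v s)) has_real_derivative (\<Sum>x\<in>UNIV. v x * d x (line \<zeta> v s))) (at s))"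

lemma has_grad_coord:
  assumes "has_grad f d"
  shows "((\<lambda>t. f (\<zeta>(x := t))) has_real_derivative d x \<zeta>) (at (\<zeta> x))" and "pderiv_at x f = d x"
proof -
  have *: "((\<lambda>t. f (\<zeta>(x := t))) has_real_derivative d x \<zeta>) (at (\<zeta> x))" for \<zeta>
  proof -
    let ?v = "\<lambda>z. if z = x then 1 else (0::real)"
    have l: "line (\<zeta>(x := 0)) ?v t = \<zeta>(x := t)" for t by (auto simp: line_def)
    have "((\<lambda>s. f (line (\<zeta>(x := 0)) ?v s)) has_real_derivative (\<Sum>y\<in>UNIV. ?v y * d y (line (\<zeta>(x := 0)) ?v (\<zeta> x)))) (at (\<zeta> x))"
      using assms unfolding has_grad_def by blast
    moreover have "(\<Sum>y\<in>UNIV. ?v y * d y \<zeta>) = (\<Sum>y\<in>UNIV. if y = x then d y \<zeta> else 0)"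
      by (intro sum.cong) auto
    ultimately show ?thesis unfolding l by simp
  qed
  show "((\<lambda>t. f (\<zeta>(x := t))) has_real_derivative d x \<zeta>) (at (\<zeta> x))" by (rule *)
  show "pderiv_at x f = d x" by (rule ext) (simp add: pderiv_at_def DERIV_imp_deriv[OF *])
qed

lemma has_grad_const: "has_grad (\<lambda>_. c) (\<lambda>_ _. 0)"
  by (simp add: has_grad_def)

lemma has_grad_add: "has_grad f d \<Longrightarrow> has_grad g d' \<Longrightarrow> has_grad (\<lambda>\<zeta>. f \<zeta> + g \<zeta>) (\<lambda>x \<zeta>. d x \<zeta> + d' x \<zeta>)"
  unfolding has_grad_def by (auto intro!: derivative_eq_intros simp: sum.distrib distrib_left)

lemma has_grad_mult:
  assumes "has_grad f d" "has_grad g d'"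
  shows "has_grad (\<lambda>\<zeta>. f \<zeta> * g \<zeta>) (\<lambda>x \<zeta>. d x \<zeta> * g \<zeta> + f \<zeta> * d' x \<zeta>)"
  unfolding has_grad_def
proof (intro allI)
  fix \<zeta> v s
  have 1: "((\<lambda>s. f (line \<zeta> v s)) has_real_derivative (\<Sum>x\<in>UNIV. v x * d x (line \<zeta> v s))) (at s)"
    and 2: "((\<lambda>s. g (line \<zeta> v s)) has_real_derivative (\<Sum>x\<in>UNIV. v x * d' x (line \<zeta> v s))) (at s)"
    using assms unfolding has_grad_def by blast+
  show "((\<lambda>s. f (line \<zeta> v s) * g (line \<zeta> v s)) has_real_derivative
     (\<Sum>x\<in>UNIV. v x * (d x (line \<zeta> v s) * g (line \<zeta> v s) + f (line \<zeta> v s) * d' x (line \<zeta> v s)))) (at s)"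
    by (rule DERIV_cong[OF DERIV_mult[OF 1 2]])
      (simp add: sum.distrib distrib_left sum_distrib_left sum_distrib_right mult_ac)
qed

lemma has_grad_coordinate: "has_grad (\<lambda>\<zeta>. \<zeta> y) (\<lambda>x \<zeta>. if x = y then 1 else 0)"
  unfolding has_grad_def
proof (intro allI)
  fix \<zeta> v :: "'a \<Rightarrow> real" and s
  have "(\<Sum>x\<in>UNIV. v x * (if x = y then 1 else 0)) = v y" by (simp add: if_distrib cong: if_cong)
  then show "((\<lambda>s. line \<zeta> v s y) has_real_derivative (\<Sum>x\<in>UNIV. v x * (if x = y then 1 else 0))) (at s)"
    by (auto simp: line_def intro!: derivative_eq_intros)
qed

text \<open>
  For \<open>n = 0\<close> truncated subtraction makes \<open>Pol (n - 1)\<close> the constants, so that the vanishing of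
  the derivatives has to be recorded separately.
\<close>

lemma Pol_has_grad:
  fixes f :: "('v::finite \<Rightarrow> real) \<Rightarrow> real"
  assumes "f \<in> Pol n"
  shows "\<exists>d. has_grad f d \<and> (\<forall>x. d x \<in> Pol (n - 1) \<and> (n = 0 \<longrightarrow> d x = (\<lambda>_. 0)))"
  using assms
proof (induction rule: Pol_induct)
  case zero
  show ?case by (intro exI[of _ "\<lambda>_ _. 0"]) (auto simp: has_grad_const Pol_zero)
next
  case (step c xs g)
  have m: "\<exists>d. has_grad (mon xs) d \<and> (\<forall>x. d x \<in> Pol (length xs - 1) \<and> (length xs = 0 \<longrightarrow> d x = (\<lambda>_. 0)))" for xs :: "'v list"
  proof (induction xs)
    case Nil
    show ?case by (intro exI[of _ "\<lambda>_ _. 0"]) (auto simp: has_grad_const Pol_zero)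
  next
    case (Cons y ys)
    then obtain d where d: "has_grad (mon ys) d" "\<And>x. d x \<in> Pol (length ys - 1)" "\<And>x. length ys = 0 \<longrightarrow> d x = (\<lambda>_. 0)" by blast
    have "mon (y # ys) = (\<lambda>\<zeta>. \<zeta> y * mon ys \<zeta>)" by auto
    then have "has_grad (mon (y # ys)) (\<lambda>x \<zeta>. (if x = y then 1 else 0) * mon ys \<zeta> + \<zeta> y * d x \<zeta>)"
      using has_grad_mult[OF has_grad_coordinate[of y] d(1)] by simp
    moreover have "(\<lambda>\<zeta>. (if x = y then 1 else 0) * mon ys \<zeta> + \<zeta> y * d x \<zeta>) \<in> Pol (length ys)" for x
    proof (intro Pol_add Pol_cmult mon_Pol)
      show "(\<lambda>\<zeta>. \<zeta> y * d x \<zeta>) \<in> Pol (length ys)"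
        using Pol_coord_mult[OF d(2)[of x], of y] d(3)[of x] by (cases ys) (auto simp: Pol_zero)
    qed simp
    ultimately show ?case by (intro exI[of _ "\<lambda>x \<zeta>. (if x = y then 1 else 0) * mon ys \<zeta> + \<zeta> y * d x \<zeta>"] conjI allI)
        (simp_all del: mon_simps)
  qed
  obtain d where d: "has_grad (mon xs) d" "\<And>x. d x \<in> Pol (length xs - 1)" "\<And>x. length xs = 0 \<longrightarrow> d x = (\<lambda>_. 0)" using m by blast
  obtain d' where d': "has_grad g d'" "\<And>x. d' x \<in> Pol (n - 1)" "\<And>x. n = 0 \<longrightarrow> d' x = (\<lambda>_. 0)" using step by blast
  have "has_grad (\<lambda>\<zeta>. c * mon xs \<zeta> + g \<zeta>) (\<lambda>x \<zeta>. (0 * mon xs \<zeta> + c * d x \<zeta>) + d' x \<zeta>)"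
    by (intro has_grad_add has_grad_mult has_grad_const d d')
  moreover have "d x \<in> Pol (n - 1)" for x 
    using subsetD[OF Pol_mono d(2)[of x], of "n - 1"] step(1) by (simp add: diff_le_mono)
  then have "(\<lambda>\<zeta>. (0 * mon xs \<zeta> + c * d x \<zeta>) + d' x \<zeta>) \<in> Pol (n - 1)" for x
    using d'(2)[of x] by (simp add: Pol_add Pol_cmult)
  ultimately show ?case using step(1) d(3) d'(3)
    by (intro exI[of _ "\<lambda>x \<zeta>. (0 * mon xs \<zeta> + c * d x \<zeta>) + d' x \<zeta>"]) auto
qed

lemma Pol_grad: "f \<in> Pol n \<Longrightarrow> has_grad f (\<lambda>x. pderiv_at x f)"
  and Pol_pderiv: "f \<in> Pol n \<Longrightarrow> pderiv_at x f \<in> Pol (n - 1)"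
  and Pol_0_pderiv: "f \<in> Pol 0 \<Longrightarrow> pderiv_at x f = (\<lambda>_. 0)"
  for f :: "('v::finite \<Rightarrow> real) \<Rightarrow> real"
proof -
  show "has_grad f (\<lambda>x. pderiv_at x f)" if f: "f \<in> Pol n"
  proof -
    obtain d where d: "has_grad f d" using Pol_has_grad[OF f] by blast
    moreover have "(\<lambda>x. pderiv_at x f) = d" by (rule ext) (rule has_grad_coord(2)[OF d])
    ultimately show ?thesis by simp
  qed
  show "f \<in> Pol n \<Longrightarrow> pderiv_at x f \<in> Pol (n - 1)" "f \<in> Pol 0 \<Longrightarrow> pderiv_at x f = (\<lambda>_. 0)"
    using Pol_has_grad[of f] has_grad_coord(2)[of f] by metis+
qed

lemma Polys_grad: "f \<in> Polys \<Longrightarrow> has_grad f (\<lambda>x. pderiv_at x f)"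
  and Polys_pderiv: "f \<in> Polys \<Longrightarrow> pderiv_at x f \<in> Polys"
  for f :: "('v::finite \<Rightarrow> real) \<Rightarrow> real"
  using Pol_grad[of f] Pol_pderiv[of f _ x] unfolding Polys_def UN_iff by blast+

lemma Polys_pderiv_add:
  fixes f g :: "('v::finite \<Rightarrow> real) \<Rightarrow> real"
  assumes "f \<in> Polys" "g \<in> Polys"
  shows "pderiv_at x (\<lambda>\<zeta>. f \<zeta> + g \<zeta>) = (\<lambda>\<zeta>. pderiv_at x f \<zeta> + pderiv_at x g \<zeta>)"
  using has_grad_coord(2)[OF has_grad_add[OF Polys_grad Polys_grad]] assms by blast

lemma Polys_pderiv_mult:
  fixes f g :: "('v::finite \<Rightarrow> real) \<Rightarrow> real"
  assumes "f \<in> Polys" "g \<in> Polys"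
  shows "pderiv_at x (\<lambda>\<zeta>. f \<zeta> * g \<zeta>) = (\<lambda>\<zeta>. pderiv_at x f \<zeta> * g \<zeta> + f \<zeta> * pderiv_at x g \<zeta>)"
  using has_grad_coord(2)[OF has_grad_mult[OF Polys_grad Polys_grad]] assms by blast

lemma pderiv_const: "pderiv_at x (\<lambda>_. c) = (\<lambda>_. 0)" for x :: "'v::finite"
  using has_grad_coord(2)[OF has_grad_const] .

lemma Polys_pderiv_cmult:
  fixes f :: "('v::finite \<Rightarrow> real) \<Rightarrow> real"
  assumes "f \<in> Polys"
  shows "pderiv_at x (\<lambda>\<zeta>. c * f \<zeta>) = (\<lambda>\<zeta>. c * pderiv_at x f \<zeta>)"
  using Polys_pderiv_mult[OF Polys_const[of c] assms, of x] by (simp add: pderiv_const)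

lemma Polys_pderiv_diff:
  fixes f g :: "('v::finite \<Rightarrow> real) \<Rightarrow> real"
  assumes "f \<in> Polys" "g \<in> Polys"
  shows "pderiv_at x (\<lambda>\<zeta>. f \<zeta> - g \<zeta>) = (\<lambda>\<zeta>. pderiv_at x f \<zeta> - pderiv_at x g \<zeta>)"
  using Polys_pderiv_add[OF assms(1) Polys_cmult[OF assms(2), of "-1"], of x] Polys_pderiv_cmult[OF assms(2), of x "-1"] by simp

lemma Polys_C1: "f \<in> Polys \<Longrightarrow> C1_fun f" for f :: "('v::finite \<Rightarrow> real) \<Rightarrow> real"
  unfolding C1_fun_def field_differentiable_def
  using Polys_continuous Polys_pderiv has_grad_coord(1)[OF Polys_grad] by blast

lemma Polys_test: "f \<in> Polys \<Longrightarrow> f \<in> bep_test_functions"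
  unfolding bep_test_functions_def
  by (simp add: Polys_C1 Polys_pderiv Polys_growth)

lemma pderiv_diff_Polys: "f \<in> Polys \<Longrightarrow> pderiv_diff x y f \<in> Polys" for f :: "('v::finite \<Rightarrow> real) \<Rightarrow> real"
  unfolding pderiv_diff_def[abs_def] by (intro Polys_diff Polys_pderiv)

lemma Pol_coord_pderiv:
  fixes f :: "('v::finite \<Rightarrow> real) \<Rightarrow> real"
  assumes "f \<in> Pol n" shows "(\<lambda>\<zeta>. \<zeta> y * pderiv_at x f \<zeta>) \<in> Pol n"
proof (cases n)
  case 0 then show ?thesis using Pol_0_pderiv[of f x] assms by (simp add: Pol_zero)
next
  case (Suc m) then show ?thesis using Pol_coord_mult[OF Pol_pderiv[OF assms, of x], of y] by simp
qed

lemma Pol_pderiv_le: "f \<in> Pol n \<Longrightarrow> pderiv_at x f \<in> Pol n" for f :: "('v::finite \<Rightarrow> real) \<Rightarrow> real"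
  using Pol_pderiv[of f n x] Pol_mono[of "n - 1" n] by auto

lemma Pol_coord2_pderiv2:
  fixes f :: "('v::finite \<Rightarrow> real) \<Rightarrow> real"
  assumes "f \<in> Pol n" shows "(\<lambda>\<zeta>. \<zeta> y * (\<zeta> u * pderiv_at x (pderiv_at w f) \<zeta>)) \<in> Pol n"
proof (cases n)
  case 0
  have "pderiv_at x (pderiv_at w f) = (\<lambda>_. 0)"
    using Pol_0_pderiv[of f w] assms 0 by (simp add: pderiv_const)
  then show ?thesis by (simp add: Pol_zero)
next
  case (Suc m)
  have "pderiv_at w f \<in> Pol m" using Pol_pderiv[OF assms, of w] Suc by simp
  from Pol_coord_mult[OF Pol_coord_pderiv[OF this, of u x], of y] show ?thesis by (simp add: Suc)
qed

lemma pderiv_diff2_Polys: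
  fixes f :: "('v::finite \<Rightarrow> real) \<Rightarrow> real"
  assumes "f \<in> Polys"
  shows "pderiv_diff x y (pderiv_diff x y f) \<zeta> = pderiv_at x (pderiv_at x f) \<zeta> - pderiv_at x (pderiv_at y f) \<zeta>
    - (pderiv_at y (pderiv_at x f) \<zeta> - pderiv_at y (pderiv_at y f) \<zeta>)"
  unfolding pderiv_diff_def[abs_def]
  by (simp add: Polys_pderiv_diff Polys_pderiv assms)

text \<open>
  Each derivative in \<open>L\<close> is accompanied by a coefficient of at most the same degree.
\<close>

lemma bep_operator_Pol:
  fixes f :: "('v::finite \<Rightarrow> real) \<Rightarrow> real"
  assumes "f \<in> Pol n" shows "bep_operator c \<alpha> \<omega> \<rho> f \<in> Pol n"
proof -
  have fP: "f \<in> Polys" using assms by (rule Pol_Polys)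
  have 1: "(\<lambda>\<zeta>. c x y * (- (\<alpha> y * \<zeta> x - \<alpha> x * \<zeta> y) * pderiv_diff x y f \<zeta>
          + \<zeta> x * \<zeta> y * pderiv_diff x y (pderiv_diff x y f) \<zeta>)) \<in> Pol n" for x y
  proof -
    let ?d = "\<lambda>u w. pderiv_at u (pderiv_at w f)"
    have "(\<lambda>\<zeta>. c x y * (((\<alpha> x * (\<zeta> y * pderiv_at x f \<zeta>) - \<alpha> x * (\<zeta> y * pderiv_at y f \<zeta>))
       - (\<alpha> y * (\<zeta> x * pderiv_at x f \<zeta>) - \<alpha> y * (\<zeta> x * pderiv_at y f \<zeta>)))
       + (((\<zeta> x * (\<zeta> y * ?d x x \<zeta>)) - (\<zeta> x * (\<zeta> y * ?d x y \<zeta>))) - ((\<zeta> x * (\<zeta> y * ?d y x \<zeta>)) - (\<zeta> x * (\<zeta> y * ?d y y \<zeta>)))))) \<in> Pol n"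
      by (intro Pol_cmult Pol_add Pol_diff Pol_coord_pderiv Pol_coord2_pderiv2 assms)
    then show ?thesis
      unfolding pderiv_diff2_Polys[OF fP] by (simp add: pderiv_diff_def algebra_simps)
  qed
  have 2: "(\<lambda>\<zeta>. \<omega> x * ((\<alpha> x * \<rho> - \<zeta> x) * pderiv_at x f \<zeta> + \<rho> * \<zeta> x * pderiv_at x (pderiv_at x f) \<zeta>)) \<in> Pol n" for x
  proof -
    have "(\<lambda>\<zeta>. \<omega> x * (((\<alpha> x * \<rho>) * pderiv_at x f \<zeta> - \<zeta> x * pderiv_at x f \<zeta>) + \<rho> * (\<zeta> x * pderiv_at x (pderiv_at x f) \<zeta>))) \<in> Pol n"
      by (intro Pol_cmult Pol_add Pol_diff Pol_coord_pderiv Pol_pderiv_le assms)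
    then show ?thesis by (simp add: algebra_simps)
  qed
  show ?thesis
    unfolding bep_operator_def[abs_def]
    by (rule Pol_add[OF Pol_cmult[OF Pol_sum[OF Pol_sum[OF 1]]] Pol_sum[OF 2]])
qed

lemma bep_operator_expand:
  fixes f :: "('v::finite \<Rightarrow> real) \<Rightarrow> real"
  assumes "f \<in> Polys"
  shows "bep_operator c \<alpha> \<omega> \<rho> f \<zeta> =
    1 / 2 * (\<Sum>x\<in>UNIV. \<Sum>y\<in>UNIV. c x y * (- (\<alpha> y * \<zeta> x - \<alpha> x * \<zeta> y) * (pderiv_at x f \<zeta> - pderiv_at y f \<zeta>)
       + \<zeta> x * \<zeta> y * (pderiv_at x (pderiv_at x f) \<zeta> - pderiv_at x (pderiv_at y f) \<zeta>
         - (pderiv_at y (pderiv_at x f) \<zeta> - pderiv_at y (pderiv_at y f) \<zeta>))))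
    + (\<Sum>x\<in>UNIV. \<omega> x * ((\<alpha> x * \<rho> - \<zeta> x) * pderiv_at x f \<zeta> + \<rho> * \<zeta> x * pderiv_at x (pderiv_at x f) \<zeta>))"
  unfolding bep_operator_def pderiv_diff2_Polys[OF assms] by (simp only: pderiv_diff_def)

lemma bep_operator_add:
  fixes f g :: "('v::finite \<Rightarrow> real) \<Rightarrow> real"
  assumes "f \<in> Polys" "g \<in> Polys"
  shows "bep_operator c \<alpha> \<omega> \<rho> (\<lambda>\<zeta>. f \<zeta> + g \<zeta>) = (\<lambda>\<zeta>. bep_operator c \<alpha> \<omega> \<rho> f \<zeta> + bep_operator c \<alpha> \<omega> \<rho> g \<zeta>)"
proof
  fix \<zeta>
  note d1 = Polys_pderiv_add[OF assms]
  note d2 = Polys_pderiv_add[OF Polys_pderiv[OF assms(1)] Polys_pderiv[OF assms(2)]]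
  have 1: "c x y * (A * ((p + p') - (q + q')) + B * ((s + s') - (t + t') - ((u + u') - (v + v'))))
    = c x y * (A * (p - q) + B * (s - t - (u - v))) + c x y * (A * (p' - q') + B * (s' - t' - (u' - v')))"
    for x y A B p p' q q' s s' t t' u u' v v' by (simp add: algebra_simps)
  have 2: "\<omega> x * (A * (p + p') + B * (q + q')) = \<omega> x * (A * p + B * q) + \<omega> x * (A * p' + B * q')"
    for x A B p p' q q' by (simp add: algebra_simps)
  show "bep_operator c \<alpha> \<omega> \<rho> (\<lambda>\<zeta>. f \<zeta> + g \<zeta>) \<zeta> = bep_operator c \<alpha> \<omega> \<rho> f \<zeta> + bep_operator c \<alpha> \<omega> \<rho> g \<zeta>"
    unfolding bep_operator_expand[OF Polys_add[OF assms]] bep_operator_expand[OF assms(1)] bep_operator_expand[OF assms(2)]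
      d1 d2 1 2 sum.distrib distrib_left[of "1/2"] by (simp only: add.assoc add.left_commute)
qed

lemma bep_operator_cmult:
  fixes f :: "('v::finite \<Rightarrow> real) \<Rightarrow> real"
  assumes "f \<in> Polys"
  shows "bep_operator c \<alpha> \<omega> \<rho> (\<lambda>\<zeta>. r * f \<zeta>) = (\<lambda>\<zeta>. r * bep_operator c \<alpha> \<omega> \<rho> f \<zeta>)"
proof
  fix \<zeta>
  note d1 = Polys_pderiv_cmult[OF assms]
  note d2 = Polys_pderiv_cmult[OF Polys_pderiv[OF assms]]
  have 1: "c x y * (A * (r * p - r * q) + B * (r * s - r * t - (r * u - r * v)))
    = r * (c x y * (A * (p - q) + B * (s - t - (u - v))))" for x y A B p q s t u v by (simp add: algebra_simps)
  have 2: "\<omega> x * (A * (r * p) + B * (r * q)) = r * (\<omega> x * (A * p + B * q))" for x A B p q by (simp add: algebra_simps)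
  show "bep_operator c \<alpha> \<omega> \<rho> (\<lambda>\<zeta>. r * f \<zeta>) \<zeta> = r * bep_operator c \<alpha> \<omega> \<rho> f \<zeta>"
    unfolding bep_operator_expand[OF Polys_cmult[OF assms]] bep_operator_expand[OF assms(1)]
      d1 d2 1 2 sum_distrib_left[symmetric] by (simp only: distrib_left mult.left_commute)
qed

section \<open>Homogeneous decomposition\<close>

text \<open>
  Homogeneity is expressed by scaling instead of monomials, which is the form in which it is used.
  The zero polynomial is homogeneous of every degree.
\<close>

definition hom_deg :: "nat \<Rightarrow> (('v \<Rightarrow> real) \<Rightarrow> real) \<Rightarrow> bool" where
  "hom_deg k F \<longleftrightarrow> F \<in> Polys \<and> (\<forall>r \<zeta>. F (\<lambda>z. r * \<zeta> z) = r ^ k * F \<zeta>)"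

lemma homogeneous_decomposition:
  assumes "f \<in> Polys"
  shows "\<exists>n F. (\<forall>k. hom_deg k (F k)) \<and> (\<forall>k>n. F k = (\<lambda>_. 0)) \<and> f = (\<lambda>\<zeta>. \<Sum>k\<le>n. F k \<zeta>)"
  using assms
proof (induction rule: Polys_induct)
  case (const c)
  show ?case
    by (rule exI[of _ 0], rule exI[of _ "\<lambda>k. if k = 0 then (\<lambda>_. c) else (\<lambda>_. 0)"])
      (auto simp: hom_deg_def Polys_const)
next
  case (coord_mult x f)
  then obtain n F where F: "\<And>k. hom_deg k (F k)" "\<And>k. k > n \<Longrightarrow> F k = (\<lambda>_. 0)" "f = (\<lambda>\<zeta>. \<Sum>k\<le>n. F k \<zeta>)" by blast
  let ?G = "\<lambda>k. case k of 0 \<Rightarrow> (\<lambda>_. 0) | Suc j \<Rightarrow> (\<lambda>\<zeta>. \<zeta> x * F j \<zeta>)"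
  have "hom_deg k (?G k)" for k
    using F(1) by (cases k) (auto simp: hom_deg_def Polys_const Polys_coord_mult)
  moreover have "?G k = (\<lambda>_. 0)" if "k > Suc n" for k using that F(2) by (cases k) auto
  moreover have "(\<lambda>\<zeta>. \<zeta> x * f \<zeta>) = (\<lambda>\<zeta>. \<Sum>k\<le>Suc n. ?G k \<zeta>)"
    unfolding F(3) sum.atMost_Suc_shift by (simp add: sum_distrib_left)
  ultimately show ?case by (intro exI[of _ "Suc n"] exI[of _ ?G]) auto
next
  case (add f g)
  then obtain n F where F: "\<And>k. hom_deg k (F k)" "\<And>k. k > n \<Longrightarrow> F k = (\<lambda>_. 0)" "f = (\<lambda>\<zeta>. \<Sum>k\<le>n. F k \<zeta>)" by blast
  from add obtain m G where G: "\<And>k. hom_deg k (G k)" "\<And>k. k > m \<Longrightarrow> G k = (\<lambda>_. 0)" "g = (\<lambda>\<zeta>. \<Sum>k\<le>m. G k \<zeta>)" by blast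
  let ?N = "max n m"
  have f: "f = (\<lambda>\<zeta>. \<Sum>k\<le>?N. F k \<zeta>)" unfolding F(3)
    by (rule ext, rule sum.mono_neutral_left) (auto simp: F(2))
  have g: "g = (\<lambda>\<zeta>. \<Sum>k\<le>?N. G k \<zeta>)" unfolding G(3)
    by (rule ext, rule sum.mono_neutral_left) (auto simp: G(2))
  have "hom_deg k (\<lambda>\<zeta>. F k \<zeta> + G k \<zeta>)" for k
    using F(1)[of k] G(1)[of k] by (auto simp: hom_deg_def Polys_add distrib_left)
  then show ?case unfolding f g using F(2) G(2)
    by (intro exI[of _ ?N] exI[of _ "\<lambda>k \<zeta>. F k \<zeta> + G k \<zeta>"]) (auto simp: sum.distrib)
qed

section \<open>Gamma laws and their products\<close>

definition gamma_density :: "real \<Rightarrow> real \<Rightarrow> real \<Rightarrow> real" where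
  "gamma_density a r z = (if 0 < z then z powr (a - 1) * exp (- z / r) / (Gamma a * r powr a) else 0)"

lemma gamma_distr_density: "gamma_distr a r = density lborel (\<lambda>z. ennreal (gamma_density a r z))"
  by (simp add: gamma_distr_def gamma_density_def)

lemma gamma_density_measurable [measurable]: "gamma_density a r \<in> borel_measurable borel"
  unfolding gamma_density_def[abs_def] by measurable

lemma gamma_density_nonneg: "0 < a \<Longrightarrow> 0 < r \<Longrightarrow> 0 \<le> gamma_density a r z"
  by (simp add: gamma_density_def Gamma_real_pos)

lemma sets_gamma_distr [measurable_cong, simp]: "sets (gamma_distr a r) = sets borel"
  and space_gamma_distr [simp]: "space (gamma_distr a r) = UNIV"
  by (auto simp: gamma_distr_def)

lemma nn_integral_gamma_density:
  assumes "0 < a" "0 < r"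
  shows "(\<integral>\<^sup>+z. ennreal (gamma_density a r z) \<partial>lborel) = 1"
proof -
  have G: "0 < Gamma a" using assms by (simp add: Gamma_real_pos)
  have "(\<integral>\<^sup>+z. ennreal (gamma_density a r z) \<partial>lborel)
      = ennreal \<bar>r\<bar> * (\<integral>\<^sup>+z. ennreal (gamma_density a r (0 + r * z)) \<partial>lborel)"
    by (rule nn_integral_real_affine) (use assms in auto)
  also have "\<dots> = (\<integral>\<^sup>+z. ennreal r * ennreal (gamma_density a r (r * z)) \<partial>lborel)"
    using assms by (subst nn_integral_cmult) auto
  also have "\<dots> = (\<integral>\<^sup>+z. ennreal (1 / Gamma a) * ennreal (indicator {0..} z * z powr (a - 1) / exp z) \<partial>lborel)"
  proof (rule nn_integral_cong_AE)
    have "AE z in lborel. z \<noteq> (0::real)" by (rule AE_lborel_singleton)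
    then show "AE z in lborel. ennreal r * ennreal (gamma_density a r (r * z))
        = ennreal (1 / Gamma a) * ennreal (indicator {0..} z * z powr (a - 1) / exp z)"
    proof eventually_elim
      case (elim z)
      show ?case
      proof (cases "0 < z")
        case True
        have e: "r powr a = r * r powr (a - 1)" using assms by (simp add: powr_mult_base)
        have "r * gamma_density a r (r * z) = 1 / Gamma a * (z powr (a - 1) / exp z)"
          using assms True G by (simp add: gamma_density_def powr_mult e exp_minus field_simps)
        then show ?thesis using assms True G
          by (simp add: ennreal_mult'[symmetric] gamma_density_nonneg)
      next
        case False
        then have "r * z < 0" using elim assms by (simp add: mult_less_0_iff)
        then show ?thesis using False elim by (simp add: gamma_density_def)
      qed
    qed
  qed
  also have "\<dots> = ennreal (1 / Gamma a) * ennreal (Gamma a)"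
    using Gamma_conv_nn_integral_real[OF assms(1)] by (subst nn_integral_cmult) auto
  also have "\<dots> = 1" using G by (simp add: ennreal_mult'[symmetric])
  finally show ?thesis .
qed

lemma prob_space_gamma_distr:
  assumes "0 < a" "0 < r" shows "prob_space (gamma_distr a r)"
proof
  show "emeasure (gamma_distr a r) (space (gamma_distr a r)) = 1"
    unfolding gamma_distr_density using nn_integral_gamma_density[OF assms] by (simp add: emeasure_density)
qed

lemma AE_gamma_distr_pos: "AE z in gamma_distr a r. 0 < z"
  unfolding gamma_distr_density by (subst AE_density) (auto simp: gamma_density_def)

text \<open>
  Exponential tilting turns a Gamma law into another one with the same shape and the scale
  \<open>r / (1 - \<delta> * r)\<close>; this yields the exponential moments.
\<close>

lemma gamma_density_exp:
  assumes "0 < a" "0 < r" "\<delta> < 1 / r"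
  shows "gamma_density a r z * exp (\<delta> * z) = ((r / (1 - \<delta> * r)) / r) powr a * gamma_density a (r / (1 - \<delta> * r)) z"
proof (cases "0 < z")
  case True
  define s where "s = r / (1 - \<delta> * r)"
  have d: "0 < 1 - \<delta> * r" using assms by (simp add: field_simps)
  have s: "0 < s" using d assms by (simp add: s_def)
  have "- z / r + \<delta> * z = - z / s" using assms d by (simp add: s_def field_simps)
  then have "exp (- z / r) * exp (\<delta> * z) = exp (- z / s)" by (simp add: exp_add[symmetric])
  then have "gamma_density a r z * exp (\<delta> * z) = z powr (a - 1) * exp (- z / s) / (Gamma a * r powr a)"
    using True by (simp add: gamma_density_def)
  also have "\<dots> = (s / r) powr a * gamma_density a s z"
    using True s assms by (simp add: gamma_density_def powr_divide)
  finally show ?thesis by (simp add: s_def)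
qed (simp add: gamma_density_def)

lemma integrable_gamma_density:
  assumes "0 < a" "0 < r" shows "integrable lborel (gamma_density a r)"
  using nn_integral_gamma_density[OF assms] gamma_density_nonneg[OF assms]
  by (intro integrableI_nn_integral_finite[where x = 1]) auto

lemma integrable_gamma_distr_iff:
  assumes "0 < a" "0 < r" "h \<in> borel_measurable borel"
  shows "integrable (gamma_distr a r) h \<longleftrightarrow> integrable lborel (\<lambda>z. gamma_density a r z * h z)"
  unfolding gamma_distr_density using assms gamma_density_nonneg[OF assms(1,2)]
  by (subst integrable_density) auto

lemma integral_gamma_distr:
  assumes "0 < a" "0 < r" "h \<in> borel_measurable borel"
  shows "(\<integral>z. h z \<partial>gamma_distr a r) = (\<integral>z. gamma_density a r z * h z \<partial>lborel)"
  unfolding gamma_distr_density using assms gamma_density_nonneg[OF assms(1,2)]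
  by (subst integral_density) auto

lemma integrable_exp_gamma_distr:
  assumes "0 < a" "0 < r" "\<delta> < 1 / r"
  shows "integrable (gamma_distr a r) (\<lambda>z. exp (\<delta> * z))"
proof -
  have d: "0 < r / (1 - \<delta> * r)" using assms by (simp add: field_simps)
  show ?thesis
    using integrable_gamma_density[OF assms(1) d] assms
    by (subst integrable_gamma_distr_iff) (auto simp: gamma_density_exp)
qed

text \<open>
  Stein's identity. If \<open>\<gamma>\<close> is the density, the integrand times \<open>\<gamma>\<close> is the derivative of
  \<open>z * \<gamma> z * u z\<close>, which vanishes at 0 since the shape is positive, and at infinity by the growth
  condition.
\<close>

lemma gamma_stein:
  fixes u u' :: "real \<Rightarrow> real"
  assumes a: "0 < a" and r: "0 < r" and \<delta>: "0 < \<delta>" "2 * \<delta> < 1 / r"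
    and u: "\<And>z. (u has_real_derivative u' z) (at z)" and u': "continuous_on UNIV u'"
    and bu: "\<And>z. 0 \<le> z \<Longrightarrow> \<bar>u z\<bar> \<le> K * exp (\<delta> * z)" and bu': "\<And>z. 0 \<le> z \<Longrightarrow> \<bar>u' z\<bar> \<le> K * exp (\<delta> * z)"
  shows "(\<integral>z. z * u' z + (a - z / r) * u z \<partial>gamma_distr a r) = 0"
proof -
  define h where "h z = z * u' z + (a - z / r) * u z" for z
  have uc: "continuous_on UNIV u" using u DERIV_isCont by (intro continuous_at_imp_continuous_on) blast
  have hc: "continuous_on UNIV h" unfolding h_def using r by (intro continuous_intros uc u') auto
  have hm [measurable]: "h \<in> borel_measurable borel" using hc by (rule borel_measurable_continuous_onI)
  have K: "0 \<le> K" using bu[of 0] by (simp add: order_trans[OF abs_ge_zero])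
  (* twice the exponential rate absorbs the linear factors z *)
  define C where "C = (K / \<delta> + (a + 1 / (r * \<delta>)) * K)"
  have bh: "\<bar>h z\<bar> \<le> C * exp (2 * \<delta> * z)" if z: "0 < z" for z
  proof -
    have e: "\<delta> * z \<le> exp (\<delta> * z)" using exp_ge_add_one_self[of "\<delta> * z"] by linarith
    have e1: "z \<le> exp (\<delta> * z) / \<delta>" using e \<delta> by (simp add: field_simps)
    have e2: "1 \<le> exp (\<delta> * z)" using \<delta> z by simp
    have ee: "exp (\<delta> * z) * exp (\<delta> * z) = exp (2 * \<delta> * z)" by (simp add: exp_add[symmetric])
    have "\<bar>z * u' z\<bar> \<le> (exp (\<delta> * z) / \<delta>) * (K * exp (\<delta> * z))"
      unfolding abs_mult using z e1 bu'[of z] by (intro mult_mono') auto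
    also have "\<dots> = K / \<delta> * exp (2 * \<delta> * z)" by (simp add: ee[symmetric])
    finally have 1: "\<bar>z * u' z\<bar> \<le> K / \<delta> * exp (2 * \<delta> * z)" .
    have "\<bar>a - z / r\<bar> \<le> a + z / r" using a r z by (simp add: abs_le_iff)
    also have "\<dots> \<le> a * exp (\<delta> * z) + (exp (\<delta> * z) / \<delta>) / r"
      using a r e1 e2 by (intro add_mono divide_right_mono) auto
    also have "\<dots> = (a + 1 / (r * \<delta>)) * exp (\<delta> * z)" by (simp add: field_simps)
    finally have "\<bar>(a - z / r) * u z\<bar> \<le> ((a + 1 / (r * \<delta>)) * exp (\<delta> * z)) * (K * exp (\<delta> * z))"
      unfolding abs_mult using z bu[of z] by (intro mult_mono') auto
    also have "\<dots> = (a + 1 / (r * \<delta>)) * K * exp (2 * \<delta> * z)" by (simp add: ee[symmetric])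
    finally show ?thesis using 1 abs_triangle_ineq[of "z * u' z" "(a - z / r) * u z"]
      by (simp add: h_def C_def distrib_right)
  qed
  have C0: "0 \<le> C" using K a r \<delta> by (simp add: C_def)
  have int: "integrable (gamma_distr a r) h"
  proof (rule Bochner_Integration.integrable_bound)
    show "integrable (gamma_distr a r) (\<lambda>z. C * exp (2 * \<delta> * z))"
      using integrable_exp_gamma_distr[OF a r \<delta>(2)] by simp
    show "AE z in gamma_distr a r. norm (h z) \<le> norm (C * exp (2 * \<delta> * z))"
      using AE_gamma_distr_pos by eventually_elim (use bh C0 in \<open>auto simp: abs_mult\<close>)
  qed simp
  define k where "k = Gamma a * r powr a"
  have k: "k \<noteq> 0" using a r by (simp add: k_def Gamma_real_pos less_imp_neq[symmetric])
  (* F is z times the density times u *)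
  define F where "F z = z powr a * exp (- z / r) * u z / k" for z
  define f where "f z = gamma_density a r z * h z" for z
  have intf: "integrable lborel f" using int integrable_gamma_distr_iff[OF a r hm] by (simp add: f_def[abs_def])
  have fdef: "f z = z powr (a - 1) * exp (- z / r) * h z / k" if "0 < z" for z
    using that by (simp add: f_def gamma_density_def k_def)
  have F': "(F has_real_derivative f z) (at z)" if z: "0 < z" for z
  proof -
    have e: "z powr a = z * z powr (a - 1)" using z by (simp add: powr_mult_base)
    have "((\<lambda>z. z powr a * exp (- z / r) * u z / k) has_real_derivative
        ((a * z powr (a - 1) * exp (- z / r) + z powr a * (exp (- z / r) * (- 1 / r))) * u z + z powr a * exp (- z / r) * u' z) / k) (at z)"
      using z r k by (auto intro!: derivative_eq_intros u simp: field_simps)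
    moreover have "((a * z powr (a - 1) * exp (- z / r) + z powr a * (exp (- z / r) * (- 1 / r))) * u z + z powr a * exp (- z / r) * u' z) / k = f z"
      unfolding fdef[OF z] h_def e by (simp add: algebra_simps)
    ultimately show ?thesis by (simp add: F_def[abs_def])
  qed
  have fc: "isCont f z" if z: "0 < z" for z
  proof -
    have "isCont (\<lambda>z. z powr (a - 1) * exp (- z / r) * h z / k) z"
      using z r k hc by (intro continuous_intros) (auto simp: continuous_on_eq_continuous_at)
    moreover have "\<forall>\<^sub>F y in nhds z. f y = y powr (a - 1) * exp (- y / r) * h y / k"
      using eventually_nhds_in_open[of "{0<..}" z] z by (auto elim!: eventually_mono simp: fdef)
    ultimately show ?thesis by (simp add: isCont_cong)
  qed
  have lim0: "(F \<longlongrightarrow> 0) (at_right 0)"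
  proof -
    have "((\<lambda>z. z powr a) \<longlongrightarrow> 0) (at_right (0::real))" using a by real_asymp
    moreover have "((\<lambda>z. exp (- z / r) * u z / k) \<longlongrightarrow> exp (- 0 / r) * u 0 / k) (at_right 0)"
      using uc k r by (intro tendsto_intros) (auto simp: continuous_on_def intro: tendsto_within_subset)
    ultimately have "((\<lambda>z. z powr a * (exp (- z / r) * u z / k)) \<longlongrightarrow> 0 * (exp (- 0 / r) * u 0 / k)) (at_right 0)"
      by (rule tendsto_mult)
    then show ?thesis by (simp add: F_def[abs_def] mult.assoc)
  qed
  have liminf: "(F \<longlongrightarrow> 0) at_top"
  proof (rule Lim_null_comparison)
    define b where "b = 1 / r - \<delta>"
    have b: "0 < b" using \<delta> r by (simp add: b_def)
    have "((\<lambda>z. z powr a * exp (- b * z)) \<longlongrightarrow> 0) at_top" using a b by real_asymp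
    then have "((\<lambda>z. K / \<bar>k\<bar> * (z powr a * exp (- b * z))) \<longlongrightarrow> K / \<bar>k\<bar> * 0) at_top" by (intro tendsto_intros)
    then show "((\<lambda>z. K / \<bar>k\<bar> * (z powr a * exp (- b * z))) \<longlongrightarrow> 0) at_top" by simp
    show "\<forall>\<^sub>F z in at_top. norm (F z) \<le> K / \<bar>k\<bar> * (z powr a * exp (- b * z))"
      using eventually_gt_at_top[of 0]
    proof eventually_elim
      case (elim z)
      have "exp (- b * z) = exp (- z / r) * exp (\<delta> * z)" by (simp add: exp_add[symmetric] b_def algebra_simps)
      then have "K / \<bar>k\<bar> * (z powr a * exp (- b * z)) = z powr a * exp (- z / r) * (K * exp (\<delta> * z)) / \<bar>k\<bar>" by simp
      moreover have "norm (F z) = z powr a * exp (- z / r) * \<bar>u z\<bar> / \<bar>k\<bar>" using elim by (simp add: F_def abs_mult)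
      moreover have "z powr a * exp (- z / r) * \<bar>u z\<bar> / \<bar>k\<bar> \<le> z powr a * exp (- z / r) * (K * exp (\<delta> * z)) / \<bar>k\<bar>"
        using elim bu[of z] by (intro divide_right_mono mult_left_mono) auto
      ultimately show ?case by (simp only:)
    qed
  qed
  have "(LBINT z=0..\<infinity>. f z) = 0 - 0"
  proof (rule interval_integral_FTC_integrable[where F = F])
    show "(F has_vector_derivative f x) (at x)" if "0 < ereal x" for x
      using F'[of x] that by (simp add: has_real_derivative_iff_has_vector_derivative)
    show "isCont f x" if "0 < ereal x" for x using fc[of x] that by simp
    show "set_integrable lborel (einterval 0 \<infinity>) f"
      using intf unfolding set_integrable_def by (intro integrable_mult_indicator) auto
    show "((F \<circ> real_of_ereal) \<longlongrightarrow> 0) (at_right 0)"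
      using lim0 unfolding zero_ereal_def ereal_tendsto_simps by simp
    show "((F \<circ> real_of_ereal) \<longlongrightarrow> 0) (at_left \<infinity>)"
      using liminf unfolding ereal_tendsto_simps by simp
  qed simp_all
  moreover have "(LBINT z=0..\<infinity>. f z) = (\<integral>z. f z \<partial>lborel)"
  proof -
    have "indicator (einterval 0 \<infinity>) z *\<^sub>R f z = f z" for z
      by (auto simp: einterval_def indicator_def f_def gamma_density_def)
    then show ?thesis by (simp only: interval_lebesgue_integral_def set_lebesgue_integral_def) simp
  qed
  ultimately show ?thesis using integral_gamma_distr[OF a r hm] by (simp add: f_def h_def)
qed

text \<open>
  The \<open>n\<close>-th term of the exponential series at \<open>\<delta> * (1 + s)\<close>.
\<close>

lemma power_le_exp:
  fixes \<delta> s :: real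
  assumes "0 < \<delta>" "0 \<le> s"
  shows "(1 + s) ^ n \<le> fact n / \<delta> ^ n * exp \<delta> * exp (\<delta> * s)"
proof -
  let ?x = "\<delta> * (1 + s)"
  have x: "0 \<le> ?x" using assms by (intro mult_nonneg_nonneg) auto
  have "?x ^ n / fact n \<le> (\<Sum>k. ?x ^ k /\<^sub>R fact k)"
  proof -
    have "(\<Sum>k\<in>{n}. ?x ^ k /\<^sub>R fact k) \<le> (\<Sum>k. ?x ^ k /\<^sub>R fact k)"
      by (rule sum_le_suminf[OF summable_exp_generic]) (use x in auto)
    then show ?thesis by (simp add: divide_inverse mult.commute)
  qed
  then have "?x ^ n \<le> fact n * exp ?x" by (simp add: exp_def field_simps)
  then have "(1 + s) ^ n \<le> fact n / \<delta> ^ n * exp ?x" 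
    unfolding power_mult_distrib using assms by (simp add: pos_le_divide_eq mult.commute)
  also have "exp ?x = exp \<delta> * exp (\<delta> * s)" by (simp add: exp_add[symmetric] algebra_simps)
  finally show ?thesis by (simp add: mult.assoc)
qed

locale gamma_setting =
  fixes \<alpha> :: "'v::finite \<Rightarrow> real" and \<rho> :: real
  assumes alpha: "0 < \<alpha> x" and rho: "0 < \<rho>"
begin

abbreviation "M \<equiv> gamma_product \<alpha> \<rho>"

lemma prob_component: "prob_space (gamma_distr (\<alpha> x) \<rho>)"
  by (rule prob_space_gamma_distr[OF alpha rho])

sublocale P: product_prob_space "\<lambda>x. gamma_distr (\<alpha> x) \<rho>" UNIV
  by (intro product_prob_spaceI prob_component)

lemma prob_M: "prob_space M"
  unfolding gamma_product_def by (rule P.prob_space_axioms)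

sublocale prob_space M by (rule prob_M)

lemma sets_M [measurable_cong, simp]: "sets M = sets borel"
proof -
  have "sets M = sets (PiM UNIV (\<lambda>x::'v. borel :: real measure))"
    unfolding gamma_product_def by (intro sets_PiM_cong) auto
  then show ?thesis by (simp add: sets_PiM_equal_borel)
qed

lemma space_M [simp]: "space M = UNIV"
  unfolding gamma_product_def by (simp add: space_PiM)

lemma measurable_continuous: "continuous_on UNIV f \<Longrightarrow> f \<in> borel_measurable M"
  using borel_measurable_continuous_onI measurable_cong_sets[OF sets_M refl] by blast

lemma measurable_coord [measurable]: "(\<lambda>\<zeta>. \<zeta> x) \<in> borel_measurable M"
  by (intro measurable_continuous) (rule continuous_on_product_then_coordinatewise[OF continuous_on_id])

lemma AE_pos: "AE \<zeta> in M. \<forall>x. 0 < \<zeta> x"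
proof -
  have "AE \<zeta> in M. 0 < \<zeta> x" for x
    unfolding gamma_product_def by (rule AE_PiM_component) (auto intro: prob_component AE_gamma_distr_pos)
  then show ?thesis by (simp add: AE_all_countable)
qed

lemma AE_nonneg: "AE \<zeta> in M. \<forall>x. 0 \<le> \<zeta> x"
  using AE_pos by eventually_elim (auto intro: less_imp_le)

lemma integrable_exp_sum:
  assumes "\<delta> < 1 / \<rho>" shows "integrable M (\<lambda>\<zeta>. exp (\<delta> * (\<Sum>x\<in>UNIV. \<zeta> x)))"
proof -
  have "integrable (PiM UNIV (\<lambda>x. gamma_distr (\<alpha> x) \<rho>)) (\<lambda>\<zeta>. \<Prod>x\<in>UNIV. exp (\<delta> * \<zeta> x))"
    by (rule P.product_integrable_prod) (auto intro: integrable_exp_gamma_distr alpha rho assms)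
  then show ?thesis by (simp add: exp_sum[symmetric] sum_distrib_left gamma_product_def)
qed

lemma integrable_growth:
  assumes "poly_growth f" "f \<in> borel_measurable M" shows "integrable M f"
proof -
  obtain C n where C: "0 \<le> C" "\<And>\<zeta>. (\<forall>x. 0 \<le> \<zeta> x) \<Longrightarrow> \<bar>f \<zeta>\<bar> \<le> C * (1 + (\<Sum>x\<in>UNIV. \<zeta> x)) ^ n"
    using poly_growth_obtain[OF assms(1)] by metis
  define \<delta> where "\<delta> = 1 / (2 * \<rho>)"
  have d: "0 < \<delta>" "\<delta> < 1 / \<rho>" using rho by (auto simp: \<delta>_def field_simps)
  define K where "K = C * (fact n / \<delta> ^ n * exp \<delta>)"
  show ?thesis
  proof (rule Bochner_Integration.integrable_bound[OF _ assms(2)])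
    show "integrable M (\<lambda>\<zeta>. K * exp (\<delta> * (\<Sum>x\<in>UNIV. \<zeta> x)))" using integrable_exp_sum[OF d(2)] by simp
    show "AE \<zeta> in M. norm (f \<zeta>) \<le> norm (K * exp (\<delta> * (\<Sum>x\<in>UNIV. \<zeta> x)))"
      using AE_nonneg
    proof eventually_elim
      case (elim \<zeta>)
      have "\<bar>f \<zeta>\<bar> \<le> C * (1 + (\<Sum>x\<in>UNIV. \<zeta> x)) ^ n" using C elim by blast
      also have "\<dots> \<le> C * (fact n / \<delta> ^ n * exp \<delta> * exp (\<delta> * (\<Sum>x\<in>UNIV. \<zeta> x)))"
        using C d elim by (intro mult_left_mono power_le_exp) (auto intro: sum_nonneg)
      also have "\<dots> = K * exp (\<delta> * (\<Sum>x\<in>UNIV. \<zeta> x))" by (simp add: K_def mult_ac)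
      also have "\<dots> \<le> \<bar>K * exp (\<delta> * (\<Sum>x\<in>UNIV. \<zeta> x))\<bar>" by (rule abs_ge_self)
      finally show ?case by simp
    qed
  qed
qed

lemma growth_L2: "poly_growth f \<Longrightarrow> f \<in> borel_measurable M \<Longrightarrow> f \<in> L2_fun M"
  using integrable_growth[OF poly_growth_mult[of f f]] by (simp add: L2_fun_def power2_eq_square)

lemma Polys_L2: "f \<in> Polys \<Longrightarrow> f \<in> L2_fun M"
  by (intro growth_L2 Polys_growth measurable_continuous Polys_continuous)

text \<open>
  By Fubini it suffices to integrate in the variable \<open>\<zeta> x\<close> with the others frozen, where
  \<open>gamma_stein\<close> applies.
\<close>

lemma stein:
  assumes u: "\<And>\<zeta>. ((\<lambda>t. u (\<zeta>(x := t))) has_real_derivative u' \<zeta>) (at (\<zeta> x))"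
    and cu: "continuous_on UNIV u" and cu': "continuous_on UNIV u'"
    and gu: "poly_growth u" and gu': "poly_growth u'"
  shows "(\<integral>\<zeta>. \<zeta> x * u' \<zeta> + (\<alpha> x - \<zeta> x / \<rho>) * u \<zeta> \<partial>M) = 0"
proof -
  let ?G = "\<lambda>\<zeta>. \<zeta> x * u' \<zeta> + (\<alpha> x - \<zeta> x / \<rho>) * u \<zeta>"
  have cx: "continuous_on UNIV (\<lambda>\<zeta>::'v\<Rightarrow>real. \<zeta> x)" by (rule continuous_on_product_then_coordinatewise[OF continuous_on_id])
  have Gm: "?G \<in> borel_measurable M"
    using rho by (intro measurable_continuous continuous_intros cx cu cu') auto
  have "poly_growth (\<lambda>\<zeta>. \<zeta> x * u' \<zeta> + (\<alpha> x - (1 / \<rho>) * \<zeta> x) * u \<zeta>)"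
    by (intro poly_growth_add poly_growth_mult poly_growth_diff poly_growth_const poly_growth_coord gu gu')
  then have Gi: "integrable M ?G" using Gm by (intro integrable_growth) simp_all
  let ?I = "UNIV - {x}"
  have "(\<integral>\<zeta>. ?G \<zeta> \<partial>M) = (\<integral>\<zeta>. (\<integral>t. ?G (\<zeta>(x := t)) \<partial>gamma_distr (\<alpha> x) \<rho>) \<partial>PiM ?I (\<lambda>x. gamma_distr (\<alpha> x) \<rho>))"
    using P.product_integral_insert[of ?I x ?G] Gi by (simp add: gamma_product_def insert_absorb)
  also have "\<dots> = 0"
  proof (rule integral_eq_zero_AE)
    have "AE \<zeta> in PiM ?I (\<lambda>x. gamma_distr (\<alpha> x) \<rho>). \<forall>y\<in>?I. 0 < \<zeta> y"
      by (intro AE_finite_allI) (auto intro!: AE_PiM_component intro: prob_component AE_gamma_distr_pos)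
    then show "AE \<zeta> in PiM ?I (\<lambda>x. gamma_distr (\<alpha> x) \<rho>). (\<integral>t. ?G (\<zeta>(x := t)) \<partial>gamma_distr (\<alpha> x) \<rho>) = 0"
    proof eventually_elim
      case (elim \<zeta>)
      (* any rate with 2 \<delta> \<rho> < 1 will do *)
      define \<delta> where "\<delta> = 1 / (3 * \<rho>)"
      have d: "0 < \<delta>" "2 * \<delta> < 1 / \<rho>" using rho by (auto simp: \<delta>_def field_simps)
      have bound: "\<exists>K. \<forall>t\<ge>0. \<bar>w (\<zeta>(x := t))\<bar> \<le> K * exp (\<delta> * t)" if w: "poly_growth w" for w
      proof -
        obtain C n where C: "0 \<le> C" "\<And>\<zeta>. (\<forall>x. 0 \<le> \<zeta> x) \<Longrightarrow> \<bar>w \<zeta>\<bar> \<le> C * (1 + (\<Sum>x\<in>UNIV. \<zeta> x)) ^ n"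
          using poly_growth_obtain[OF w] by metis
        define s where "s = (\<Sum>y\<in>?I. \<zeta> y)"
        have s: "0 \<le> s" unfolding s_def using elim by (intro sum_nonneg) (auto intro: less_imp_le)
        have "\<bar>w (\<zeta>(x := t))\<bar> \<le> C * (fact n / \<delta> ^ n * exp \<delta> * exp (\<delta> * s)) * exp (\<delta> * t)" if t: "0 \<le> t" for t
        proof -
          have "(\<Sum>y\<in>UNIV. (\<zeta>(x := t)) y) = t + s" unfolding s_def
            by (subst sum.remove[of _ x]) (auto intro!: sum.cong)
          moreover have "\<forall>y. 0 \<le> (\<zeta>(x := t)) y" using t elim by (auto intro: less_imp_le)
          ultimately have "\<bar>w (\<zeta>(x := t))\<bar> \<le> C * (1 + (t + s)) ^ n" using C(2)[of "\<zeta>(x := t)"] by simp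
          also have "\<dots> \<le> C * (fact n / \<delta> ^ n * exp \<delta> * exp (\<delta> * (t + s)))"
            using C d s t by (intro mult_left_mono power_le_exp) auto
          also have "exp (\<delta> * (t + s)) = exp (\<delta> * s) * exp (\<delta> * t)" by (simp add: exp_add[symmetric] algebra_simps)
          finally show ?thesis by (simp add: mult_ac del: fun_upd_apply)
        qed
        then show ?thesis by blast
      qed
      obtain K1 where K1: "\<And>t. 0 \<le> t \<Longrightarrow> \<bar>u (\<zeta>(x := t))\<bar> \<le> K1 * exp (\<delta> * t)" using bound[OF gu] by blast
      obtain K2 where K2: "\<And>t. 0 \<le> t \<Longrightarrow> \<bar>u' (\<zeta>(x := t))\<bar> \<le> K2 * exp (\<delta> * t)" using bound[OF gu'] by blast
      have "(\<integral>t. t * u' (\<zeta>(x := t)) + (\<alpha> x - t / \<rho>) * u (\<zeta>(x := t)) \<partial>gamma_distr (\<alpha> x) \<rho>) = 0"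
      proof (rule gamma_stein[OF alpha rho d])
        show "((\<lambda>t. u (\<zeta>(x := t))) has_real_derivative u' (\<zeta>(x := z))) (at z)" for z
          using u[of "\<zeta>(x := z)"] by simp
        have "continuous_on UNIV (\<lambda>t y. (\<zeta>(x := t)) y)"
        proof (rule continuous_on_coordinatewise_then_product)
          show "continuous_on UNIV (\<lambda>t. (\<zeta>(x := t)) y)" for y by (cases "y = x") auto
        qed
        then show "continuous_on UNIV (\<lambda>t. u' (\<zeta>(x := t)))"
          by (rule continuous_on_compose2[OF cu']) auto
        show "\<bar>u (\<zeta>(x := t))\<bar> \<le> max K1 K2 * exp (\<delta> * t)" if "0 \<le> t" for t
          by (rule order_trans[OF K1[OF that] mult_right_mono]) auto
        show "\<bar>u' (\<zeta>(x := t))\<bar> \<le> max K1 K2 * exp (\<delta> * t)" if "0 \<le> t" for t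
          by (rule order_trans[OF K2[OF that] mult_right_mono]) auto
      qed
      then show ?case by simp
    qed
  qed
  finally show ?thesis .
qed

end

section \<open>Integration by parts and symmetry of the generator\<close>

text \<open>
  What integration by parts needs of each of its two functions. A test function and its first
  derivatives are tame.
\<close>

definition tame :: "(('v::finite \<Rightarrow> real) \<Rightarrow> real) \<Rightarrow> bool" where
  "tame f \<longleftrightarrow> C1_fun f \<and> poly_growth f \<and> (\<forall>x. poly_growth (pderiv_at x f))"

lemma test_tame:
  assumes "f \<in> bep_test_functions" shows "tame f" "tame (pderiv_at x f)"
  using assms by (auto simp: bep_test_functions_def tame_def)

lemma tame_deriv: "tame f \<Longrightarrow> ((\<lambda>t. f (\<zeta>(x := t))) has_real_derivative pderiv_at x f \<zeta>) (at (\<zeta> x))"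
  unfolding tame_def C1_fun_def pderiv_at_def by (simp add: DERIV_deriv_iff_field_differentiable)

lemma tame_continuous: "tame f \<Longrightarrow> continuous_on UNIV f" "tame f \<Longrightarrow> continuous_on UNIV (pderiv_at x f)"
  unfolding tame_def C1_fun_def by auto

lemma tame_growth: "tame f \<Longrightarrow> poly_growth f" "tame f \<Longrightarrow> poly_growth (pderiv_at x f)"
  unfolding tame_def by auto

lemma pderiv_eqI:
  assumes "\<And>\<zeta>. ((\<lambda>t. f (\<zeta>(x := t))) has_real_derivative d \<zeta>) (at (\<zeta> x))"
  shows "pderiv_at x f = d"
  using DERIV_imp_deriv[OF assms] by (auto simp: pderiv_at_def)

lemma pderiv_at_diff_tame:
  assumes "tame f" "tame g" shows "pderiv_at x (\<lambda>\<zeta>. f \<zeta> - g \<zeta>) = (\<lambda>\<zeta>. pderiv_at x f \<zeta> - pderiv_at x g \<zeta>)"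
  by (rule pderiv_eqI) (rule DERIV_diff[OF tame_deriv[OF assms(1)] tame_deriv[OF assms(2)]])

lemma tame_diff: assumes "tame f" "tame g" shows "tame (\<lambda>\<zeta>. f \<zeta> - g \<zeta>)"
proof -
  have "((\<lambda>t. f (\<zeta>(x := t)) - g (\<zeta>(x := t))) has_real_derivative pderiv_at x f \<zeta> - pderiv_at x g \<zeta>) (at (\<zeta> x))" for x \<zeta>
    by (rule DERIV_diff[OF tame_deriv[OF assms(1)] tame_deriv[OF assms(2)]])
  then show ?thesis
    unfolding tame_def C1_fun_def pderiv_at_diff_tame[OF assms] field_differentiable_def
    using assms by (auto intro!: continuous_intros poly_growth_diff simp: tame_continuous tame_growth)
qed

lemma integral_double_sum:
  fixes B :: "'v::finite \<Rightarrow> 'v \<Rightarrow> 'a \<Rightarrow> real" and R :: "'v \<Rightarrow> 'a \<Rightarrow> real"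
  assumes "\<And>x y. integrable M (B x y)" "\<And>x. integrable M (R x)"
  shows "(\<integral>z. 1 / 2 * (\<Sum>x\<in>UNIV. \<Sum>y\<in>UNIV. c x y * B x y z) + (\<Sum>x\<in>UNIV. w x * R x z) \<partial>M)
    = 1 / 2 * (\<Sum>x\<in>UNIV. \<Sum>y\<in>UNIV. c x y * (\<integral>z. B x y z \<partial>M)) + (\<Sum>x\<in>UNIV. w x * (\<integral>z. R x z \<partial>M))"
  using assms by simp

context gamma_setting
begin

lemma continuous_coord: "continuous_on UNIV (\<lambda>\<zeta>::'v \<Rightarrow> real. \<zeta> x)"
  by (rule continuous_on_product_then_coordinatewise[OF continuous_on_id])

lemma integrable_continuous_growth: "continuous_on UNIV f \<Longrightarrow> poly_growth f \<Longrightarrow> integrable M f"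
  by (intro integrable_growth measurable_continuous)

text \<open>
  Stein's identity for the product \<open>g * h\<close>.
\<close>

lemma reservoir_ibp:
  assumes h: "tame h" and g: "tame g"
  shows "(\<integral>\<zeta>. g \<zeta> * ((\<alpha> x * \<rho> - \<zeta> x) * h \<zeta> + \<rho> * \<zeta> x * pderiv_at x h \<zeta>) \<partial>M)
    = - (\<integral>\<zeta>. \<rho> * \<zeta> x * (h \<zeta> * pderiv_at x g \<zeta>) \<partial>M)"
proof -
  note c = continuous_intros continuous_coord tame_continuous[OF h] tame_continuous[OF g]
  note gr = poly_growth_add poly_growth_mult poly_growth_diff poly_growth_const poly_growth_coord tame_growth[OF h] tame_growth[OF g]
  have "(\<integral>\<zeta>. \<zeta> x * (pderiv_at x g \<zeta> * h \<zeta> + g \<zeta> * pderiv_at x h \<zeta>) + (\<alpha> x - \<zeta> x / \<rho>) * (g \<zeta> * h \<zeta>) \<partial>M) = 0"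
  proof (rule stein)
    show "((\<lambda>t. g (\<zeta>(x := t)) * h (\<zeta>(x := t))) has_real_derivative pderiv_at x g \<zeta> * h \<zeta> + g \<zeta> * pderiv_at x h \<zeta>) (at (\<zeta> x))" for \<zeta>
      using DERIV_mult[OF tame_deriv[OF g] tame_deriv[OF h], of \<zeta> x \<zeta>] by (simp add: mult.commute add.commute)
  qed (intro c gr)+
  then have "0 = \<rho> * (\<integral>\<zeta>. \<zeta> x * (pderiv_at x g \<zeta> * h \<zeta> + g \<zeta> * pderiv_at x h \<zeta>) + (\<alpha> x - \<zeta> x / \<rho>) * (g \<zeta> * h \<zeta>) \<partial>M)" by simp
  also have "\<dots> = (\<integral>\<zeta>. \<rho> * (\<zeta> x * (pderiv_at x g \<zeta> * h \<zeta> + g \<zeta> * pderiv_at x h \<zeta>) + (\<alpha> x - \<zeta> x / \<rho>) * (g \<zeta> * h \<zeta>)) \<partial>M)" by simp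
  also have "\<dots> = (\<integral>\<zeta>. g \<zeta> * ((\<alpha> x * \<rho> - \<zeta> x) * h \<zeta> + \<rho> * \<zeta> x * pderiv_at x h \<zeta>) + \<rho> * \<zeta> x * (h \<zeta> * pderiv_at x g \<zeta>) \<partial>M)"
    using rho by (intro Bochner_Integration.integral_cong) (auto simp: field_simps)
  also have "\<dots> = (\<integral>\<zeta>. g \<zeta> * ((\<alpha> x * \<rho> - \<zeta> x) * h \<zeta> + \<rho> * \<zeta> x * pderiv_at x h \<zeta>) \<partial>M) + (\<integral>\<zeta>. \<rho> * \<zeta> x * (h \<zeta> * pderiv_at x g \<zeta>) \<partial>M)"
    by (intro Bochner_Integration.integral_add integrable_continuous_growth c gr)
  finally show ?thesis by simp
qed

lemma exchange_stein:
  assumes xy: "x \<noteq> y" and h: "tame h" and g: "tame g"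
  shows "(\<integral>\<zeta>. \<zeta> x * (\<zeta> y * (pderiv_at x h \<zeta> * g \<zeta> + h \<zeta> * pderiv_at x g \<zeta>)) + (\<alpha> x - \<zeta> x / \<rho>) * (\<zeta> y * (h \<zeta> * g \<zeta>)) \<partial>M) = 0"
proof -
  note c = continuous_intros continuous_coord tame_continuous[OF h] tame_continuous[OF g]
  note gr = poly_growth_add poly_growth_mult poly_growth_diff poly_growth_const poly_growth_coord tame_growth[OF h] tame_growth[OF g]
  show ?thesis
  proof (rule stein)
    fix \<zeta> :: "'v \<Rightarrow> real"
    have "((\<lambda>t. h (\<zeta>(x := t)) * g (\<zeta>(x := t))) has_real_derivative pderiv_at x h \<zeta> * g \<zeta> + h \<zeta> * pderiv_at x g \<zeta>) (at (\<zeta> x))"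
      using DERIV_mult[OF tame_deriv[OF h] tame_deriv[OF g], of \<zeta> x \<zeta>] by (simp add: mult.commute add.commute)
    from DERIV_cmult[OF this, of "\<zeta> y"]
    show "((\<lambda>t. (\<zeta>(x := t)) y * (h (\<zeta>(x := t)) * g (\<zeta>(x := t)))) has_real_derivative
        \<zeta> y * (pderiv_at x h \<zeta> * g \<zeta> + h \<zeta> * pderiv_at x g \<zeta>)) (at (\<zeta> x))"
      unfolding fun_upd_other[OF xy[symmetric]] .
  qed (intro c gr)+
qed

text \<open>
  The difference of Stein's identities for \<open>\<zeta> y * h * g\<close> in direction \<open>x\<close> and for \<open>\<zeta> x * h * g\<close> in
  direction \<open>y\<close>. The terms with \<open>1 / \<rho>\<close> cancel: the exchange preserves the product law for every
  value of \<open>\<rho>\<close>.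
\<close>

lemma exchange_ibp:
  assumes xy: "x \<noteq> y" and h: "tame h" and g: "tame g"
  shows "(\<integral>\<zeta>. g \<zeta> * (- (\<alpha> y * \<zeta> x - \<alpha> x * \<zeta> y) * h \<zeta> + \<zeta> x * \<zeta> y * (pderiv_at x h \<zeta> - pderiv_at y h \<zeta>)) \<partial>M)
    = - (\<integral>\<zeta>. \<zeta> x * \<zeta> y * (h \<zeta> * (pderiv_at x g \<zeta> - pderiv_at y g \<zeta>)) \<partial>M)"
proof -
  note c = continuous_intros continuous_coord tame_continuous[OF h] tame_continuous[OF g]
  note gr = poly_growth_add poly_growth_mult poly_growth_diff poly_growth_const poly_growth_coord tame_growth[OF h] tame_growth[OF g]
  let ?S = "\<lambda>x y \<zeta>. \<zeta> x * (\<zeta> y * (pderiv_at x h \<zeta> * g \<zeta> + h \<zeta> * pderiv_at x g \<zeta>)) + (\<alpha> x - (1 / \<rho>) * \<zeta> x) * (\<zeta> y * (h \<zeta> * g \<zeta>))"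
  have S0: "(\<integral>\<zeta>. ?S x y \<zeta> \<partial>M) = 0" "(\<integral>\<zeta>. ?S y x \<zeta> \<partial>M) = 0"
    using exchange_stein[OF xy h g] exchange_stein[OF xy[symmetric] h g] by simp_all
  have "0 = (\<integral>\<zeta>. ?S x y \<zeta> \<partial>M) - (\<integral>\<zeta>. ?S y x \<zeta> \<partial>M)" unfolding S0 by simp
  also have "\<dots> = (\<integral>\<zeta>. ?S x y \<zeta> - ?S y x \<zeta> \<partial>M)"
    by (intro Bochner_Integration.integral_diff[symmetric] integrable_continuous_growth c gr)
  also have "\<dots> = (\<integral>\<zeta>. g \<zeta> * (- (\<alpha> y * \<zeta> x - \<alpha> x * \<zeta> y) * h \<zeta> + \<zeta> x * \<zeta> y * (pderiv_at x h \<zeta> - pderiv_at y h \<zeta>))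
      + \<zeta> x * \<zeta> y * (h \<zeta> * (pderiv_at x g \<zeta> - pderiv_at y g \<zeta>)) \<partial>M)"
    by (intro Bochner_Integration.integral_cong) (auto simp: algebra_simps)
  also have "\<dots> = (\<integral>\<zeta>. g \<zeta> * (- (\<alpha> y * \<zeta> x - \<alpha> x * \<zeta> y) * h \<zeta> + \<zeta> x * \<zeta> y * (pderiv_at x h \<zeta> - pderiv_at y h \<zeta>)) \<partial>M)
      + (\<integral>\<zeta>. \<zeta> x * \<zeta> y * (h \<zeta> * (pderiv_at x g \<zeta> - pderiv_at y g \<zeta>)) \<partial>M)"
  proof (rule Bochner_Integration.integral_add)
    have "integrable M (\<lambda>\<zeta>. g \<zeta> * ((\<alpha> x * \<zeta> y - \<alpha> y * \<zeta> x) * h \<zeta> + \<zeta> x * \<zeta> y * (pderiv_at x h \<zeta> - pderiv_at y h \<zeta>)))"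
      by (intro integrable_continuous_growth c gr)
    then show "integrable M (\<lambda>\<zeta>. g \<zeta> * (- (\<alpha> y * \<zeta> x - \<alpha> x * \<zeta> y) * h \<zeta> + \<zeta> x * \<zeta> y * (pderiv_at x h \<zeta> - pderiv_at y h \<zeta>)))" by simp
    show "integrable M (\<lambda>\<zeta>. \<zeta> x * \<zeta> y * (h \<zeta> * (pderiv_at x g \<zeta> - pderiv_at y g \<zeta>)))"
      by (intro integrable_continuous_growth c gr)
  qed
  finally show ?thesis by simp
qed

text \<open>
  The Dirichlet form of the process, written with the integrated carre du champ.
\<close>

definition Gamma_form :: "('v \<Rightarrow> 'v \<Rightarrow> real) \<Rightarrow> ('v \<Rightarrow> real) \<Rightarrow> (('v \<Rightarrow> real) \<Rightarrow> real) \<Rightarrow> (('v \<Rightarrow> real) \<Rightarrow> real) \<Rightarrow> real" where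
  "Gamma_form c \<omega> f g =
     1 / 2 * (\<Sum>x\<in>UNIV. \<Sum>y\<in>UNIV. c x y * (\<integral>\<zeta>. \<zeta> x * \<zeta> y * (pderiv_diff x y f \<zeta> * pderiv_diff x y g \<zeta>) \<partial>M))
     + (\<Sum>x\<in>UNIV. \<omega> x * (\<integral>\<zeta>. \<rho> * \<zeta> x * (pderiv_at x f \<zeta> * pderiv_at x g \<zeta>) \<partial>M))"

lemma Gamma_form_sym: "Gamma_form c \<omega> f g = Gamma_form c \<omega> g f"
  by (simp add: Gamma_form_def mult.commute)

lemma test_operator_L2:
  assumes f: "f \<in> bep_test_functions" shows "f \<in> L2_fun M" and "bep_operator c \<alpha> \<omega> \<rho> f \<in> L2_fun M"
proof -
  note t = test_tame[OF f]
  show "f \<in> L2_fun M" by (intro growth_L2 measurable_continuous tame_growth(1)[OF t(1)] tame_continuous(1)[OF t(1)])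
  have d: "tame (pderiv_diff x y f)" for x y
    unfolding pderiv_diff_def[abs_def] by (intro tame_diff t)
  have e: "pderiv_diff x y (pderiv_diff x y f) = (\<lambda>\<zeta>. pderiv_at x (pderiv_diff x y f) \<zeta> - pderiv_at y (pderiv_diff x y f) \<zeta>)" for x y
    by (simp add: pderiv_diff_def[abs_def])
  have u: "- (\<alpha> y * \<zeta> x - \<alpha> x * \<zeta> y) = \<alpha> x * \<zeta> y - \<alpha> y * \<zeta> x" for x y and \<zeta> :: "'v \<Rightarrow> real" by simp
  show "bep_operator c \<alpha> \<omega> \<rho> f \<in> L2_fun M"
    unfolding bep_operator_def[abs_def] e u
    by (intro growth_L2 measurable_continuous continuous_intros continuous_coord tame_continuous[OF t(1)] tame_continuous[OF t(2)] tame_continuous[OF d]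
        poly_growth_add poly_growth_mult poly_growth_diff poly_growth_const poly_growth_coord poly_growth_sum
        tame_growth[OF t(1)] tame_growth[OF t(2)] tame_growth[OF d])
qed

text \<open>
  Edge by edge and site by site, with \<open>h\<close> in the identities above equal to \<open>(\<partial>\<^sub>x - \<partial>\<^sub>y) f\<close>
  and \<open>\<partial>\<^sub>x f\<close>.
\<close>

theorem bep_ibp:
  assumes f: "f \<in> bep_test_functions" and g: "g \<in> bep_test_functions"
  shows "L2_ip M (bep_operator c \<alpha> \<omega> \<rho> f) g = - Gamma_form c \<omega> f g"
proof -
  note t = test_tame[OF f] and tg = test_tame[OF g]
  have d: "tame (pderiv_diff x y f)" for x y
    unfolding pderiv_diff_def[abs_def] by (intro tame_diff t)
  have e: "pderiv_diff x y (pderiv_diff x y f) = (\<lambda>\<zeta>. pderiv_at x (pderiv_diff x y f) \<zeta> - pderiv_at y (pderiv_diff x y f) \<zeta>)" for x y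
    by (simp add: pderiv_diff_def[abs_def])
  have u: "- (\<alpha> y * \<zeta> x - \<alpha> x * \<zeta> y) = \<alpha> x * \<zeta> y - \<alpha> y * \<zeta> x" for x y and \<zeta> :: "'v \<Rightarrow> real" by simp
  let ?B = "\<lambda>x y \<zeta>. g \<zeta> * (- (\<alpha> y * \<zeta> x - \<alpha> x * \<zeta> y) * pderiv_diff x y f \<zeta> + \<zeta> x * \<zeta> y * pderiv_diff x y (pderiv_diff x y f) \<zeta>)"
  let ?R = "\<lambda>x \<zeta>. g \<zeta> * ((\<alpha> x * \<rho> - \<zeta> x) * pderiv_at x f \<zeta> + \<rho> * \<zeta> x * pderiv_at x (pderiv_at x f) \<zeta>)"
  have Bi: "integrable M (?B x y)" for x y
    unfolding e u
    by (intro integrable_continuous_growth continuous_intros continuous_coord tame_continuous[OF t(1)] tame_continuous[OF t(2)]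
        tame_continuous[OF d] tame_continuous[OF tg(1)]
        poly_growth_add poly_growth_mult poly_growth_diff poly_growth_const poly_growth_coord
        tame_growth[OF t(1)] tame_growth[OF t(2)] tame_growth[OF d] tame_growth[OF tg(1)])
  have Ri: "integrable M (?R x)" for x
    by (intro integrable_continuous_growth continuous_intros continuous_coord tame_continuous[OF t(1)] tame_continuous[OF t(2)]
        tame_continuous[OF d] tame_continuous[OF tg(1)]
        poly_growth_add poly_growth_mult poly_growth_diff poly_growth_const poly_growth_coord
        tame_growth[OF t(1)] tame_growth[OF t(2)] tame_growth[OF d] tame_growth[OF tg(1)])
  have B: "(\<integral>\<zeta>. ?B x y \<zeta> \<partial>M) = - (\<integral>\<zeta>. \<zeta> x * \<zeta> y * (pderiv_diff x y f \<zeta> * pderiv_diff x y g \<zeta>) \<partial>M)" for x y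
  proof (cases "x = y")
    case True
    then show ?thesis by (simp add: pderiv_diff_def)
  next
    case False
    show ?thesis unfolding e using exchange_ibp[OF False d[of x y] tg(1)] by (simp add: pderiv_diff_def[of x y g])
  qed
  have R: "(\<integral>\<zeta>. ?R x \<zeta> \<partial>M) = - (\<integral>\<zeta>. \<rho> * \<zeta> x * (pderiv_at x f \<zeta> * pderiv_at x g \<zeta>) \<partial>M)" for x
    by (rule reservoir_ibp[OF t(2) tg(1)])
  have "L2_ip M (bep_operator c \<alpha> \<omega> \<rho> f) g =
     (\<integral>\<zeta>. 1 / 2 * (\<Sum>x\<in>UNIV. \<Sum>y\<in>UNIV. c x y * ?B x y \<zeta>) + (\<Sum>x\<in>UNIV. \<omega> x * ?R x \<zeta>) \<partial>M)"
    unfolding L2_ip_def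
  proof (rule Bochner_Integration.integral_cong[OF refl])
    fix \<zeta>
    have 1: "C * X * g \<zeta> = C * (g \<zeta> * X)" for C X by simp
    show "bep_operator c \<alpha> \<omega> \<rho> f \<zeta> * g \<zeta> = 1 / 2 * (\<Sum>x\<in>UNIV. \<Sum>y\<in>UNIV. c x y * ?B x y \<zeta>) + (\<Sum>x\<in>UNIV. \<omega> x * ?R x \<zeta>)"
      unfolding bep_operator_def distrib_right mult.assoc[of "1/2"] sum_distrib_right by (simp only: 1)
  qed
  also have "\<dots> = 1 / 2 * (\<Sum>x\<in>UNIV. \<Sum>y\<in>UNIV. c x y * (\<integral>\<zeta>. ?B x y \<zeta> \<partial>M)) + (\<Sum>x\<in>UNIV. \<omega> x * (\<integral>\<zeta>. ?R x \<zeta> \<partial>M))"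
    by (rule integral_double_sum[OF Bi Ri])
  also have "\<dots> = - Gamma_form c \<omega> f g"
    unfolding B R Gamma_form_def by (simp add: sum_negf)
  finally show ?thesis .
qed

corollary bep_symmetric:
  assumes "f \<in> bep_test_functions" "g \<in> bep_test_functions"
  shows "L2_ip M (bep_operator c \<alpha> \<omega> \<rho> f) g = L2_ip M f (bep_operator c \<alpha> \<omega> \<rho> g)"
  using bep_ibp[OF assms, of c \<omega>] bep_ibp[OF assms(2,1), of c \<omega>] Gamma_form_sym[of c \<omega> f g] L2_ip_sym[of M f "bep_operator c \<alpha> \<omega> \<rho> g"]
  by simp

text \<open>
  The product law charges every nonempty open box in the open orthant.
\<close>

lemma Polys_zero_if_AE_zero:
  assumes f: "f \<in> Polys" and ae: "AE \<zeta> in M. f \<zeta> = 0"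
  shows "f \<zeta> = 0"
proof (rule Polys_zero_of_orthant[OF f], rule ccontr)
  fix \<zeta> :: "'v \<Rightarrow> real" assume pos: "\<And>x. 0 < \<zeta> x" and nz: "f \<zeta> \<noteq> 0"
  have "open {\<xi>. f \<xi> \<noteq> 0}"
    using open_vimage[OF open_Compl[OF closed_singleton[of 0]] Polys_continuous[OF f]] by (simp add: vimage_def)
  then have op: "openin (product_topology (\<lambda>i. euclidean) UNIV) {\<xi>. f \<xi> \<noteq> 0}"
    by (simp only: euclidean_product_topology open_openin)
  have mem: "\<zeta> \<in> {\<xi>. f \<xi> \<noteq> 0}" using nz by simp
  (* an open box around \<zeta> on which f does not vanish *)
  obtain X where "\<zeta> \<in> (\<Pi>\<^sub>E i\<in>UNIV. X i) \<and> (\<forall>i. openin euclidean (X i)) \<and>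
      finite {i. X i \<noteq> topspace euclidean} \<and> (\<Pi>\<^sub>E i\<in>UNIV. X i) \<subseteq> {\<xi>. f \<xi> \<noteq> 0}"
    using product_topology_open_contains_basis[OF op mem] by (rule exE)
  then have X: "\<zeta> \<in> (\<Pi>\<^sub>E i\<in>UNIV. X i)" "\<And>i. open (X i)" "(\<Pi>\<^sub>E i\<in>UNIV. X i) \<subseteq> {\<xi>. f \<xi> \<noteq> 0}"
    by (auto simp only: open_openin[symmetric])
  have Xm: "X i \<in> sets (gamma_distr (\<alpha> i) \<rho>)" for i using X(2)[of i] by simp
  have pos_i: "0 < emeasure (gamma_distr (\<alpha> i) \<rho>) (X i)" for i
  proof (rule ccontr)
    assume "\<not> 0 < emeasure (gamma_distr (\<alpha> i) \<rho>) (X i)"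
    then have "X i \<in> null_sets (gamma_distr (\<alpha> i) \<rho>)" using Xm by (auto simp: null_sets_def)
    then have "AE z in lborel. z \<in> X i \<longrightarrow> ennreal (gamma_density (\<alpha> i) \<rho> z) = 0"
      unfolding gamma_distr_density by (subst (asm) null_sets_density_iff) auto
    then have "AE z in lborel. z \<notin> X i \<inter> {0<..}"
      by eventually_elim (use alpha[of i] rho less_imp_neq[OF Gamma_real_pos[OF alpha[of i]]] in \<open>auto simp: gamma_density_def\<close>)
    moreover have op: "open (X i \<inter> {0<..})" using X(2) by auto
    then have "X i \<inter> {0<..} \<in> sets lborel" by simp
    ultimately have "X i \<inter> {0<..} \<in> null_sets lborel" by (simp only: AE_iff_null_sets)
    then have "emeasure lborel (X i \<inter> {0<..}) = 0" by (rule null_setsD1)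
    moreover have "\<zeta> i \<in> X i \<inter> {0<..}" using X(1) pos by auto
    then obtain e where "0 < e" "ball (\<zeta> i) e \<subseteq> X i \<inter> {0<..}" using op open_contains_ball by blast
    then have "{\<zeta> i<..<\<zeta> i + e} \<subseteq> X i \<inter> {0<..}" by (auto simp: dist_real_def subset_iff)
    then have "emeasure lborel {\<zeta> i<..<\<zeta> i + e} \<le> emeasure lborel (X i \<inter> {0<..})"
      using op by (intro emeasure_mono) auto
    ultimately show False using \<open>0 < e\<close> by simp
  qed
  have "(\<Pi>\<^sub>E i\<in>UNIV. X i) \<in> sets M" unfolding gamma_product_def by (rule sets_PiM_I_finite) (use Xm in auto)
  moreover have "AE \<xi> in M. \<xi> \<notin> (\<Pi>\<^sub>E i\<in>UNIV. X i)" using ae by eventually_elim (use X(3) in auto)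
  ultimately have "(\<Pi>\<^sub>E i\<in>UNIV. X i) \<in> null_sets M" by (simp only: AE_iff_null_sets)
  then have "emeasure M (\<Pi>\<^sub>E i\<in>UNIV. X i) = 0" by (rule null_setsD1)
  moreover have "emeasure M (\<Pi>\<^sub>E i\<in>UNIV. X i) = (\<Prod>i\<in>UNIV. emeasure (gamma_distr (\<alpha> i) \<rho>) (X i))"
    unfolding gamma_product_def by (rule P.emeasure_PiM) (use Xm in auto)
  moreover have "(\<Prod>i\<in>UNIV. emeasure (gamma_distr (\<alpha> i) \<rho>) (X i)) \<noteq> 0"
    using pos_i by (simp add: less_imp_neq[symmetric] zero_less_iff_neq_zero)
  ultimately show False by simp
qed

end

section \<open>Density of polynomials under exponential moments\<close>

lemma L2_dominated_convergence:
  fixes s :: "nat \<Rightarrow> 'a \<Rightarrow> real"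
  assumes s: "\<And>n. s n \<in> borel_measurable M" and f: "f \<in> borel_measurable M"
    and lim: "AE z in M. (\<lambda>n. s n z) \<longlonglongrightarrow> f z" and w: "integrable M w"
    and bd: "\<And>n. AE z in M. (f z - s n z)\<^sup>2 \<le> w z"
  shows "(\<lambda>n. L2_nrm M (\<lambda>z. f z - s n z)) \<longlonglongrightarrow> 0"
proof -
  note [measurable] = s f
  have "(\<lambda>n. \<integral>z. (f z - s n z)\<^sup>2 \<partial>M) \<longlonglongrightarrow> (\<integral>z. 0 \<partial>M)"
  proof (rule integral_dominated_convergence[where w = w])
    show "AE z in M. (\<lambda>n. (f z - s n z)\<^sup>2) \<longlonglongrightarrow> 0" using lim
    proof eventually_elim
      case (elim z)
      have "(\<lambda>n. (f z - s n z)\<^sup>2) \<longlonglongrightarrow> (f z - f z)\<^sup>2" by (intro tendsto_intros elim)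
      then show ?case by simp
    qed
    show "AE z in M. norm ((f z - s n z)\<^sup>2) \<le> w z" for n using bd[of n] by simp
  qed (use w in auto)
  then have "(\<lambda>n. sqrt (\<integral>z. (f z - s n z)\<^sup>2 \<partial>M)) \<longlonglongrightarrow> sqrt 0" by (intro tendsto_real_sqrt) simp
  then show ?thesis by (simp add: L2_nrm_def)
qed

text \<open>
  A measure on the closed orthant with an exponential moment of the total mass; it is automatically
  finite. The product of Gamma laws is an example, and so is its reweighting by the modulus of an
  L2-function.
\<close>

locale exp_moments =
  fixes \<nu> :: "('v::finite \<Rightarrow> real) measure" and \<delta> :: real
  assumes sets_nu [measurable_cong, simp]: "sets \<nu> = sets borel" and delta: "0 < \<delta>"
    and nonneg: "AE \<zeta> in \<nu>. \<forall>x. 0 \<le> \<zeta> x"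
    and exp_int: "integrable \<nu> (\<lambda>\<zeta>. exp (\<delta> * (\<Sum>x\<in>UNIV. \<zeta> x)))"
begin

lemma space_nu [simp]: "space \<nu> = UNIV"
  using sets_eq_imp_space_eq[OF sets_nu] by simp

lemma nu_measurable_continuous: "continuous_on UNIV f \<Longrightarrow> f \<in> borel_measurable \<nu>"
  using borel_measurable_continuous_onI measurable_cong_sets[OF sets_nu refl] by blast

lemma nu_coord [measurable]: "(\<lambda>\<zeta>. \<zeta> x) \<in> borel_measurable \<nu>"
  by (intro nu_measurable_continuous) (rule continuous_on_product_then_coordinatewise[OF continuous_on_id])

lemma Polys_measurable: "p \<in> Polys \<Longrightarrow> p \<in> borel_measurable \<nu>"
  by (intro nu_measurable_continuous Polys_continuous)

lemma integrable_growth_exp: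
  assumes p: "p \<in> Polys"
  shows "integrable \<nu> (\<lambda>\<zeta>. (p \<zeta>)\<^sup>2 * exp (\<delta> / 2 * (\<Sum>x\<in>UNIV. \<zeta> x)))"
proof -
  have pg: "poly_growth (\<lambda>\<zeta>. p \<zeta> * p \<zeta>)" by (intro poly_growth_mult Polys_growth p)
  obtain C n where C: "0 \<le> C" "\<And>\<zeta>. (\<forall>x. 0 \<le> \<zeta> x) \<Longrightarrow> \<bar>p \<zeta> * p \<zeta>\<bar> \<le> C * (1 + (\<Sum>x\<in>UNIV. \<zeta> x)) ^ n"
    using poly_growth_obtain[OF pg] by metis
  define K where "K = C * (fact n / (\<delta> / 2) ^ n * exp (\<delta> / 2))"
  note [measurable] = Polys_measurable[OF p]
  show ?thesis
  proof (rule Bochner_Integration.integrable_bound)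
    show "integrable \<nu> (\<lambda>\<zeta>. K * exp (\<delta> * (\<Sum>x\<in>UNIV. \<zeta> x)))" using exp_int by simp
    show "AE \<zeta> in \<nu>. norm ((p \<zeta>)\<^sup>2 * exp (\<delta> / 2 * (\<Sum>x\<in>UNIV. \<zeta> x))) \<le> norm (K * exp (\<delta> * (\<Sum>x\<in>UNIV. \<zeta> x)))"
      using nonneg
    proof eventually_elim
      case (elim \<zeta>)
      let ?s = "\<Sum>x\<in>UNIV. \<zeta> x"
      have s: "0 \<le> ?s" using elim by (simp add: sum_nonneg)
      have "(p \<zeta>)\<^sup>2 \<le> C * (1 + ?s) ^ n" using C(2)[of \<zeta>] elim by (simp add: power2_eq_square)
      also have "\<dots> \<le> C * (fact n / (\<delta> / 2) ^ n * exp (\<delta> / 2) * exp (\<delta> / 2 * ?s))"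
        using C delta s by (intro mult_left_mono power_le_exp) auto
      finally have "(p \<zeta>)\<^sup>2 * exp (\<delta> / 2 * ?s) \<le> (C * (fact n / (\<delta> / 2) ^ n * exp (\<delta> / 2) * exp (\<delta> / 2 * ?s))) * exp (\<delta> / 2 * ?s)"
        by (rule mult_right_mono) simp
      also have "\<dots> = K * (exp (\<delta> / 2 * ?s) * exp (\<delta> / 2 * ?s))" by (simp add: K_def mult_ac)
      also have "exp (\<delta> / 2 * ?s) * exp (\<delta> / 2 * ?s) = exp (\<delta> * ?s)"
        unfolding exp_add[symmetric] by (simp add: algebra_simps)
      finally have "(p \<zeta>)\<^sup>2 * exp (\<delta> / 2 * ?s) \<le> K * exp (\<delta> * ?s)" .
      then show ?case by (simp add: abs_mult) (use abs_ge_self[of "K"] in \<open>meson mult_right_mono exp_ge_zero order_trans\<close>)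
    qed
  qed measurable
qed

lemma Polys_nu_L2:
  assumes p: "p \<in> Polys" shows "p \<in> L2_fun \<nu>"
proof -
  note [measurable] = Polys_measurable[OF p]
  have "integrable \<nu> (\<lambda>\<zeta>. (p \<zeta>)\<^sup>2)"
  proof (rule Bochner_Integration.integrable_bound[OF integrable_growth_exp[OF p]])
    show "AE \<zeta> in \<nu>. norm ((p \<zeta>)\<^sup>2) \<le> norm ((p \<zeta>)\<^sup>2 * exp (\<delta> / 2 * (\<Sum>x\<in>UNIV. \<zeta> x)))"
      using nonneg
    proof eventually_elim
      case (elim \<zeta>)
      have "1 \<le> exp (\<delta> / 2 * (\<Sum>x\<in>UNIV. \<zeta> x))" using elim delta by (simp add: sum_nonneg)
      then show ?case using mult_left_mono[of 1 "exp (\<delta> / 2 * (\<Sum>x\<in>UNIV. \<zeta> x))" "(p \<zeta>)\<^sup>2"] by simp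
    qed
  qed measurable
  then show ?thesis by (simp add: L2_fun_def)
qed

text \<open>
  The closure of the polynomials in L2. It is shown to be everything by enlarging step by step the
  algebra of bounded functions that multiply it into itself: exponentials of one coordinate,
  continuous functions of these, indicators of half-spaces, indicators of Borel sets.
\<close>

definition Polys_cl :: "(('v \<Rightarrow> real) \<Rightarrow> real) set" where
  "Polys_cl = {f \<in> L2_fun \<nu>. \<forall>\<epsilon>>0. \<exists>p\<in>Polys. L2_nrm \<nu> (\<lambda>\<zeta>. f \<zeta> - p \<zeta>) < \<epsilon>}"

lemma Polys_cl_L2: "f \<in> Polys_cl \<Longrightarrow> f \<in> L2_fun \<nu>"
  by (simp add: Polys_cl_def)

lemma Polys_cl_approx:
  assumes "f \<in> Polys_cl" "0 < \<epsilon>" obtains p where "p \<in> Polys" "L2_nrm \<nu> (\<lambda>\<zeta>. f \<zeta> - p \<zeta>) < \<epsilon>"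
  using assms unfolding Polys_cl_def by blast

lemma Polys_cl_poly: "p \<in> Polys \<Longrightarrow> p \<in> Polys_cl"
  by (auto simp: Polys_cl_def Polys_nu_L2 L2_nrm_def intro!: bexI[of _ p])

lemma Polys_cl_closed:
  assumes f: "f \<in> L2_fun \<nu>" and a: "\<And>\<epsilon>. 0 < \<epsilon> \<Longrightarrow> \<exists>g\<in>Polys_cl. L2_nrm \<nu> (\<lambda>\<zeta>. f \<zeta> - g \<zeta>) < \<epsilon>"
  shows "f \<in> Polys_cl"
proof -
  have "\<exists>p\<in>Polys. L2_nrm \<nu> (\<lambda>\<zeta>. f \<zeta> - p \<zeta>) < \<epsilon>" if "0 < \<epsilon>" for \<epsilon>
  proof -
    have e2: "0 < \<epsilon> / 2" using that by simp
    obtain g where g: "g \<in> Polys_cl" "L2_nrm \<nu> (\<lambda>\<zeta>. f \<zeta> - g \<zeta>) < \<epsilon> / 2" using a[OF e2] by blast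
    obtain p where p: "p \<in> Polys" "L2_nrm \<nu> (\<lambda>\<zeta>. g \<zeta> - p \<zeta>) < \<epsilon> / 2"
      using Polys_cl_approx[OF g(1) e2] .
    have "L2_nrm \<nu> (\<lambda>\<zeta>. f \<zeta> - p \<zeta>) < \<epsilon>"
      using L2_triangle_diff[OF f Polys_cl_L2[OF g(1)] Polys_nu_L2[OF p(1)]] g p by simp
    then show ?thesis using p by blast
  qed
  then show ?thesis using f by (simp add: Polys_cl_def)
qed

lemma Polys_cl_limit:
  assumes "f \<in> L2_fun \<nu>" "\<And>n. g n \<in> Polys_cl" "(\<lambda>n. L2_nrm \<nu> (\<lambda>\<zeta>. f \<zeta> - g n \<zeta>)) \<longlonglongrightarrow> 0"
  shows "f \<in> Polys_cl"
proof (rule Polys_cl_closed[OF assms(1)])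
  fix \<epsilon> :: real assume "0 < \<epsilon>"
  then have "\<forall>\<^sub>F n in sequentially. L2_nrm \<nu> (\<lambda>\<zeta>. f \<zeta> - g n \<zeta>) < \<epsilon>" using assms(3) by (rule order_tendstoD(2)[rotated])
  then obtain n where "L2_nrm \<nu> (\<lambda>\<zeta>. f \<zeta> - g n \<zeta>) < \<epsilon>" by (auto simp: eventually_sequentially)
  then show "\<exists>g\<in>Polys_cl. L2_nrm \<nu> (\<lambda>\<zeta>. f \<zeta> - g \<zeta>) < \<epsilon>" using assms(2) by blast
qed

lemma Polys_cl_add: assumes "f \<in> Polys_cl" "g \<in> Polys_cl" shows "(\<lambda>\<zeta>. f \<zeta> + g \<zeta>) \<in> Polys_cl"
proof -
  have "\<exists>p\<in>Polys. L2_nrm \<nu> (\<lambda>\<zeta>. f \<zeta> + g \<zeta> - p \<zeta>) < \<epsilon>" if e: "0 < \<epsilon>" for \<epsilon>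
  proof -
    have e2: "0 < \<epsilon> / 2" using e by simp
    obtain p where p: "p \<in> Polys" "L2_nrm \<nu> (\<lambda>\<zeta>. f \<zeta> - p \<zeta>) < \<epsilon> / 2"
      using Polys_cl_approx[OF assms(1) e2] .
    obtain q where q: "q \<in> Polys" "L2_nrm \<nu> (\<lambda>\<zeta>. g \<zeta> - q \<zeta>) < \<epsilon> / 2"
      using Polys_cl_approx[OF assms(2) e2] .
    have "L2_nrm \<nu> (\<lambda>\<zeta>. (f \<zeta> - p \<zeta>) + (g \<zeta> - q \<zeta>)) \<le> L2_nrm \<nu> (\<lambda>\<zeta>. f \<zeta> - p \<zeta>) + L2_nrm \<nu> (\<lambda>\<zeta>. g \<zeta> - q \<zeta>)"
      using assms p q by (intro L2_triangle L2_diff) (auto intro: Polys_cl_L2 Polys_nu_L2)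
    then have "L2_nrm \<nu> (\<lambda>\<zeta>. f \<zeta> + g \<zeta> - (p \<zeta> + q \<zeta>)) < \<epsilon>" using p q by (simp add: algebra_simps)
    then show ?thesis by (rule bexI[OF _ Polys_add[OF p(1) q(1)]])
  qed
  then show ?thesis using assms by (simp add: Polys_cl_def L2_add)
qed

lemma Polys_cl_cmult: assumes "f \<in> Polys_cl" shows "(\<lambda>\<zeta>. c * f \<zeta>) \<in> Polys_cl"
proof (rule Polys_cl_closed[OF L2_cmult[OF Polys_cl_L2[OF assms]]])
  fix \<epsilon> :: real assume e: "0 < \<epsilon>"
  have "0 < \<epsilon> / (\<bar>c\<bar> + 1)" using e by (simp add: field_simps)
  with assms obtain p where p: "p \<in> Polys" "L2_nrm \<nu> (\<lambda>\<zeta>. f \<zeta> - p \<zeta>) < \<epsilon> / (\<bar>c\<bar> + 1)"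
    by (rule Polys_cl_approx)
  have "L2_nrm \<nu> (\<lambda>\<zeta>. c * f \<zeta> - c * p \<zeta>) = \<bar>c\<bar> * L2_nrm \<nu> (\<lambda>\<zeta>. f \<zeta> - p \<zeta>)"
    using L2_nrm_cmult[of \<nu> c "\<lambda>\<zeta>. f \<zeta> - p \<zeta>"] by (simp add: right_diff_distrib)
  also have "\<dots> \<le> (\<bar>c\<bar> + 1) * L2_nrm \<nu> (\<lambda>\<zeta>. f \<zeta> - p \<zeta>)" by (intro mult_right_mono) (auto simp: L2_nrm_ge0)
  also have "\<dots> < \<epsilon>" using p by (simp add: field_simps)
  finally show "\<exists>g\<in>Polys_cl. L2_nrm \<nu> (\<lambda>\<zeta>. c * f \<zeta> - g \<zeta>) < \<epsilon>" using Polys_cl_poly[OF Polys_cmult[OF p(1), of c]] by (rule bexI)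
qed

lemma Polys_cl_sum: "(\<And>i. i \<in> I \<Longrightarrow> h i \<in> Polys_cl) \<Longrightarrow> (\<lambda>\<zeta>. \<Sum>i\<in>I. h i \<zeta>) \<in> Polys_cl"
  by (induction I rule: infinite_finite_induct) (auto simp: Polys_cl_poly Polys_const Polys_cl_add)

definition multipliers :: "(('v \<Rightarrow> real) \<Rightarrow> real) set" where
  "multipliers = {\<phi> \<in> borel_measurable \<nu>. (\<exists>B. AE \<zeta> in \<nu>. \<bar>\<phi> \<zeta>\<bar> \<le> B) \<and> (\<forall>g\<in>Polys_cl. (\<lambda>\<zeta>. \<phi> \<zeta> * g \<zeta>) \<in> Polys_cl)}"

lemma multiplier_measurable: "\<phi> \<in> multipliers \<Longrightarrow> \<phi> \<in> borel_measurable \<nu>"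
  by (simp add: multipliers_def)

lemma multiplier_const: "(\<lambda>_. c) \<in> multipliers"
  by (auto simp: multipliers_def intro: Polys_cl_cmult exI[of _ "\<bar>c\<bar>"])

lemma multiplier_add: assumes "\<phi> \<in> multipliers" "\<psi> \<in> multipliers" shows "(\<lambda>\<zeta>. \<phi> \<zeta> + \<psi> \<zeta>) \<in> multipliers"
proof -
  obtain A where A: "AE \<zeta> in \<nu>. \<bar>\<phi> \<zeta>\<bar> \<le> A" using assms by (auto simp: multipliers_def)
  obtain B where B: "AE \<zeta> in \<nu>. \<bar>\<psi> \<zeta>\<bar> \<le> B" using assms by (auto simp: multipliers_def)
  have "AE \<zeta> in \<nu>. \<bar>\<phi> \<zeta> + \<psi> \<zeta>\<bar> \<le> A + B" using A B by eventually_elim linarith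
  moreover have "(\<lambda>\<zeta>. (\<phi> \<zeta> + \<psi> \<zeta>) * g \<zeta>) \<in> Polys_cl" if "g \<in> Polys_cl" for g
    using Polys_cl_add[of "\<lambda>\<zeta>. \<phi> \<zeta> * g \<zeta>" "\<lambda>\<zeta>. \<psi> \<zeta> * g \<zeta>"] assms that by (simp add: multipliers_def distrib_right)
  ultimately show ?thesis using assms by (auto simp: multipliers_def)
qed

lemma multiplier_mult: assumes "\<phi> \<in> multipliers" "\<psi> \<in> multipliers" shows "(\<lambda>\<zeta>. \<phi> \<zeta> * \<psi> \<zeta>) \<in> multipliers"
proof -
  obtain A where A: "AE \<zeta> in \<nu>. \<bar>\<phi> \<zeta>\<bar> \<le> A" using assms by (auto simp: multipliers_def)
  obtain B where B: "AE \<zeta> in \<nu>. \<bar>\<psi> \<zeta>\<bar> \<le> B" using assms by (auto simp: multipliers_def)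
  have "AE \<zeta> in \<nu>. \<bar>\<phi> \<zeta> * \<psi> \<zeta>\<bar> \<le> A * B" using A B by eventually_elim (auto simp: abs_mult intro: mult_mono')
  moreover have "(\<lambda>\<zeta>. (\<phi> \<zeta> * \<psi> \<zeta>) * g \<zeta>) \<in> Polys_cl" if "g \<in> Polys_cl" for g
  proof -
    have "(\<lambda>\<zeta>. \<psi> \<zeta> * g \<zeta>) \<in> Polys_cl" using assms(2) that by (simp add: multipliers_def)
    then have "(\<lambda>\<zeta>. \<phi> \<zeta> * (\<psi> \<zeta> * g \<zeta>)) \<in> Polys_cl" using assms(1) by (simp add: multipliers_def)
    then show ?thesis by (simp add: mult.assoc)
  qed
  ultimately show ?thesis using assms by (auto simp: multipliers_def)
qed

lemma multiplier_diff: assumes "\<phi> \<in> multipliers" "\<psi> \<in> multipliers" shows "(\<lambda>\<zeta>. \<phi> \<zeta> - \<psi> \<zeta>) \<in> multipliers"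
  using multiplier_add[OF assms(1) multiplier_mult[OF multiplier_const[of "-1"] assms(2)]] by simp

lemma multiplier_power: "\<phi> \<in> multipliers \<Longrightarrow> (\<lambda>\<zeta>. \<phi> \<zeta> ^ n) \<in> multipliers"
  by (induction n) (auto intro: multiplier_const multiplier_mult)

lemma multiplier_sum: "(\<And>i. i \<in> I \<Longrightarrow> h i \<in> multipliers) \<Longrightarrow> (\<lambda>\<zeta>. \<Sum>i\<in>I. h i \<zeta>) \<in> multipliers"
  by (induction I rule: infinite_finite_induct) (auto simp: multiplier_const multiplier_add)

lemma L2_bounded_mult: assumes "\<phi> \<in> borel_measurable \<nu>" "AE \<zeta> in \<nu>. \<bar>\<phi> \<zeta>\<bar> \<le> B" "g \<in> L2_fun \<nu>"
  shows "(\<lambda>\<zeta>. \<phi> \<zeta> * g \<zeta>) \<in> L2_fun \<nu>"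
proof -
  note [measurable] = assms(1) L2_meas[OF assms(3)]
  have "integrable \<nu> (\<lambda>\<zeta>. (\<phi> \<zeta> * g \<zeta>)\<^sup>2)"
  proof (rule Bochner_Integration.integrable_bound)
    show "integrable \<nu> (\<lambda>\<zeta>. B\<^sup>2 * (g \<zeta>)\<^sup>2)" using L2_int[OF assms(3)] by simp
    show "AE \<zeta> in \<nu>. norm ((\<phi> \<zeta> * g \<zeta>)\<^sup>2) \<le> norm (B\<^sup>2 * (g \<zeta>)\<^sup>2)"
      using assms(2)
    proof eventually_elim
      case (elim \<zeta>)
      have "\<bar>\<phi> \<zeta>\<bar>\<^sup>2 \<le> B\<^sup>2" using elim by (intro power_mono) auto
      then show ?case by (simp add: power_mult_distrib mult_right_mono)
    qed
  qed measurable
  then show ?thesis by (simp add: L2_fun_def)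
qed

text \<open>
  Bounded pointwise limits of multipliers are multipliers, by dominated convergence; the set of
  multipliers thus admits a monotone class argument.
\<close>

lemma multiplier_limit:
  assumes \<phi>: "\<And>n. \<phi> n \<in> multipliers" and \<psi>: "\<psi> \<in> borel_measurable \<nu>"
    and bd: "\<And>n. AE \<zeta> in \<nu>. \<bar>\<phi> n \<zeta>\<bar> \<le> B" and lim: "AE \<zeta> in \<nu>. (\<lambda>n. \<phi> n \<zeta>) \<longlonglongrightarrow> \<psi> \<zeta>"
  shows "\<psi> \<in> multipliers"
proof -
  have bd': "AE \<zeta> in \<nu>. \<forall>n. \<bar>\<phi> n \<zeta>\<bar> \<le> B" using bd by (simp add: AE_all_countable)
  have bpsi: "AE \<zeta> in \<nu>. \<bar>\<psi> \<zeta>\<bar> \<le> B" using bd' lim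
  proof eventually_elim
    case (elim \<zeta>)
    have "(\<lambda>n. \<bar>\<phi> n \<zeta>\<bar>) \<longlonglongrightarrow> \<bar>\<psi> \<zeta>\<bar>" by (intro tendsto_rabs elim)
    then show ?case by (rule LIMSEQ_le_const2) (use elim in auto)
  qed
  have "(\<lambda>\<zeta>. \<psi> \<zeta> * g \<zeta>) \<in> Polys_cl" if g: "g \<in> Polys_cl" for g
  proof (rule Polys_cl_limit)
    note [measurable] = L2_meas[OF Polys_cl_L2[OF g]] \<psi> multiplier_measurable[OF \<phi>]
    show "(\<lambda>\<zeta>. \<psi> \<zeta> * g \<zeta>) \<in> L2_fun \<nu>" by (rule L2_bounded_mult[OF \<psi> bpsi Polys_cl_L2[OF g]])
    show "(\<lambda>\<zeta>. \<phi> n \<zeta> * g \<zeta>) \<in> Polys_cl" for n using \<phi>[of n] g by (simp add: multipliers_def)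
    show "(\<lambda>n. L2_nrm \<nu> (\<lambda>\<zeta>. \<psi> \<zeta> * g \<zeta> - \<phi> n \<zeta> * g \<zeta>)) \<longlonglongrightarrow> 0"
    proof (rule L2_dominated_convergence)
      show "AE \<zeta> in \<nu>. (\<lambda>n. \<phi> n \<zeta> * g \<zeta>) \<longlonglongrightarrow> \<psi> \<zeta> * g \<zeta>"
        using lim by eventually_elim (intro tendsto_intros)
      show "integrable \<nu> (\<lambda>\<zeta>. (2 * B)\<^sup>2 * (g \<zeta>)\<^sup>2)" using L2_int[OF Polys_cl_L2[OF g]] by simp
      show "AE \<zeta> in \<nu>. (\<psi> \<zeta> * g \<zeta> - \<phi> n \<zeta> * g \<zeta>)\<^sup>2 \<le> (2 * B)\<^sup>2 * (g \<zeta>)\<^sup>2" for n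
        using bd[of n] bpsi
      proof eventually_elim
        case (elim \<zeta>)
        then have "\<bar>\<psi> \<zeta> - \<phi> n \<zeta>\<bar>\<^sup>2 \<le> (2 * B)\<^sup>2" by (intro power_mono) auto
        then have "(\<psi> \<zeta> - \<phi> n \<zeta>)\<^sup>2 * (g \<zeta>)\<^sup>2 \<le> (2 * B)\<^sup>2 * (g \<zeta>)\<^sup>2" by (intro mult_right_mono) auto
        then show ?case by (simp only: left_diff_distrib[symmetric] power_mult_distrib)
      qed
    qed measurable
  qed
  then show ?thesis using \<psi> bpsi by (auto simp: multipliers_def)
qed

text \<open>
  The rate is small enough for the squares of the Taylor polynomials of this function, times the
  square of any polynomial, to be dominated by an integrable function.
\<close>

definition exp_coord :: "'v \<Rightarrow> ('v \<Rightarrow> real) \<Rightarrow> real" where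
  "exp_coord x \<zeta> = exp (- (\<delta> / 4) * \<zeta> x)"

lemma exp_coord_measurable [measurable]: "exp_coord x \<in> borel_measurable \<nu>"
  unfolding exp_coord_def[abs_def] by measurable

lemma exp_coord_range: "AE \<zeta> in \<nu>. 0 < exp_coord x \<zeta> \<and> exp_coord x \<zeta> \<le> 1"
  using nonneg by eventually_elim (use delta in \<open>auto simp: exp_coord_def\<close>)

text \<open>
  For a polynomial \<open>p\<close> the products of \<open>p\<close> with the Taylor polynomials of the exponential are
  polynomials. They converge in L2 because they are dominated by \<open>|p|\<close> times the exponential with
  the opposite sign. The general case follows as multiplication by a function with values in
  \<open>[0, 1]\<close> is a contraction.
\<close>

lemma exp_coord_multiplier: "exp_coord x \<in> multipliers"
proof -
  have b: "AE \<zeta> in \<nu>. \<bar>exp_coord x \<zeta>\<bar> \<le> 1" using exp_coord_range[of x] by eventually_elim auto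
  have poly: "(\<lambda>\<zeta>. exp_coord x \<zeta> * p \<zeta>) \<in> Polys_cl" if p: "p \<in> Polys" for p
  proof (rule Polys_cl_limit)
    note [measurable] = Polys_measurable[OF p]
    let ?T = "\<lambda>n \<zeta>. \<Sum>j<n. (- (\<delta> / 4) * \<zeta> x) ^ j /\<^sub>R fact j"
    have "(\<lambda>\<zeta>. p \<zeta> * (\<Sum>j<n. (1 / fact j) * ((- (\<delta> / 4)) * \<zeta> x) ^ j)) \<in> Polys" for n
      by (intro Polys_mult p Polys_sum Polys_cmult Polys_power Polys_coord)
    then have Tp: "(\<lambda>\<zeta>. p \<zeta> * ?T n \<zeta>) \<in> Polys" for n
      unfolding real_scaleR_def inverse_eq_divide .
    show "(\<lambda>\<zeta>. exp_coord x \<zeta> * p \<zeta>) \<in> L2_fun \<nu>" by (rule L2_bounded_mult[OF exp_coord_measurable b Polys_nu_L2[OF p]])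
    show "(\<lambda>\<zeta>. p \<zeta> * ?T n \<zeta>) \<in> Polys_cl" for n by (rule Polys_cl_poly[OF Tp])
    show "(\<lambda>n. L2_nrm \<nu> (\<lambda>\<zeta>. exp_coord x \<zeta> * p \<zeta> - p \<zeta> * ?T n \<zeta>)) \<longlonglongrightarrow> 0"
    proof (rule L2_dominated_convergence)
      show "(\<lambda>\<zeta>. p \<zeta> * ?T n \<zeta>) \<in> borel_measurable \<nu>" for n by (rule Polys_measurable[OF Tp])
      have "(\<lambda>n. p \<zeta> * ?T n \<zeta>) \<longlonglongrightarrow> p \<zeta> * exp (- (\<delta> / 4) * \<zeta> x)" for \<zeta>
        by (intro tendsto_mult_left) (use summable_LIMSEQ[OF summable_exp_generic[of "- (\<delta> / 4) * \<zeta> x"]] in \<open>simp add: exp_def\<close>)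
      then show "AE \<zeta> in \<nu>. (\<lambda>n. p \<zeta> * ?T n \<zeta>) \<longlonglongrightarrow> exp_coord x \<zeta> * p \<zeta>" by (simp add: exp_coord_def mult.commute)
      show "integrable \<nu> (\<lambda>\<zeta>. 4 * ((p \<zeta>)\<^sup>2 * exp (\<delta> / 2 * (\<Sum>x\<in>UNIV. \<zeta> x))))" using integrable_growth_exp[OF p] by simp
      show "AE \<zeta> in \<nu>. (exp_coord x \<zeta> * p \<zeta> - p \<zeta> * ?T n \<zeta>)\<^sup>2 \<le> 4 * ((p \<zeta>)\<^sup>2 * exp (\<delta> / 2 * (\<Sum>x\<in>UNIV. \<zeta> x)))" for n
        using nonneg exp_coord_range[of x]
      proof eventually_elim
        case (elim \<zeta>)
        let ?y = "\<delta> / 4 * \<zeta> x" and ?s = "\<Sum>x\<in>UNIV. \<zeta> x"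
        have y: "0 \<le> ?y" using elim delta by simp
        have zx: "0 \<le> \<zeta> x" using elim by simp
        have "\<bar>?T n \<zeta>\<bar> \<le> (\<Sum>j<n. ?y ^ j /\<^sub>R fact j)"
          using zx delta by (intro order_trans[OF sum_abs] sum_mono) (simp add: power_abs abs_mult)
        also have "\<dots> \<le> (\<Sum>j. ?y ^ j /\<^sub>R fact j)"
          using y by (intro sum_le_suminf summable_exp_generic) auto
        also have "\<dots> = exp ?y" by (simp add: exp_def)
        also have "\<dots> \<le> exp (\<delta> / 4 * ?s)"
          using delta elim by (auto intro!: member_le_sum)
        finally have T: "\<bar>?T n \<zeta>\<bar> \<le> exp (\<delta> / 4 * ?s)" .
        have "1 \<le> exp (\<delta> / 4 * ?s)" using elim delta by (simp add: sum_nonneg)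
        then have "\<bar>exp_coord x \<zeta> - ?T n \<zeta>\<bar> \<le> 2 * exp (\<delta> / 4 * ?s)" using T elim by linarith
        then have "\<bar>exp_coord x \<zeta> - ?T n \<zeta>\<bar>\<^sup>2 \<le> (2 * exp (\<delta> / 4 * ?s))\<^sup>2" by (intro power_mono) auto
        also have "(2 * exp (\<delta> / 4 * ?s))\<^sup>2 = 4 * exp (\<delta> / 2 * ?s)"
          by (simp add: power_mult_distrib exp_double[symmetric])
        finally have "(p \<zeta>)\<^sup>2 * (exp_coord x \<zeta> - ?T n \<zeta>)\<^sup>2 \<le> (p \<zeta>)\<^sup>2 * (4 * exp (\<delta> / 2 * ?s))"
          by (intro mult_left_mono) auto
        moreover have "exp_coord x \<zeta> * p \<zeta> - p \<zeta> * ?T n \<zeta> = p \<zeta> * (exp_coord x \<zeta> - ?T n \<zeta>)" by (simp only: right_diff_distrib mult.commute)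
        ultimately show ?case by (simp only: power_mult_distrib mult_ac)
      qed
    qed measurable
  qed
  have "(\<lambda>\<zeta>. exp_coord x \<zeta> * g \<zeta>) \<in> Polys_cl" if g: "g \<in> Polys_cl" for g
  proof (rule Polys_cl_closed)
    show "(\<lambda>\<zeta>. exp_coord x \<zeta> * g \<zeta>) \<in> L2_fun \<nu>" by (rule L2_bounded_mult[OF exp_coord_measurable b Polys_cl_L2[OF g]])
    fix \<epsilon> :: real assume "0 < \<epsilon>"
    with g obtain p where p: "p \<in> Polys" "L2_nrm \<nu> (\<lambda>\<zeta>. g \<zeta> - p \<zeta>) < \<epsilon>" by (rule Polys_cl_approx)
    have d: "(\<lambda>\<zeta>. g \<zeta> - p \<zeta>) \<in> L2_fun \<nu>" by (intro L2_diff Polys_cl_L2 g Polys_nu_L2 p)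
    have "L2_nrm \<nu> (\<lambda>\<zeta>. exp_coord x \<zeta> * g \<zeta> - exp_coord x \<zeta> * p \<zeta>) = L2_nrm \<nu> (\<lambda>\<zeta>. exp_coord x \<zeta> * (g \<zeta> - p \<zeta>))" by (simp add: right_diff_distrib)
    also have "\<dots> \<le> L2_nrm \<nu> (\<lambda>\<zeta>. g \<zeta> - p \<zeta>)"
    proof -
      have "(\<integral>\<zeta>. (exp_coord x \<zeta> * (g \<zeta> - p \<zeta>))\<^sup>2 \<partial>\<nu>) \<le> (\<integral>\<zeta>. (g \<zeta> - p \<zeta>)\<^sup>2 \<partial>\<nu>)"
      proof (rule integral_mono_AE[OF L2_int[OF L2_bounded_mult[OF exp_coord_measurable b d]] L2_int[OF d]])
        show "AE \<zeta> in \<nu>. (exp_coord x \<zeta> * (g \<zeta> - p \<zeta>))\<^sup>2 \<le> (g \<zeta> - p \<zeta>)\<^sup>2" using exp_coord_range[of x]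
        proof eventually_elim
          case (elim \<zeta>)
          then have "(exp_coord x \<zeta>)\<^sup>2 \<le> 1" by (simp add: abs_square_le_1)
          then show ?case using mult_right_mono[of "(exp_coord x \<zeta>)\<^sup>2" 1 "(g \<zeta> - p \<zeta>)\<^sup>2"] by (simp add: power_mult_distrib)
        qed
      qed
      then show ?thesis by (simp add: L2_nrm_def)
    qed
    also have "\<dots> < \<epsilon>" by (rule p(2))
    finally show "\<exists>f\<in>Polys_cl. L2_nrm \<nu> (\<lambda>\<zeta>. exp_coord x \<zeta> * g \<zeta> - f \<zeta>) < \<epsilon>" using poly[OF p(1)] by (rule bexI)
  qed
  then show ?thesis using b by (auto simp: multipliers_def)
qed

text \<open>
  Uniform approximation by Bernstein polynomials on \<open>[0, 1]\<close>, the range of \<open>exp_coord\<close>.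
\<close>

lemma continuous_exp_coord_multiplier:
  fixes f :: "real \<Rightarrow> real"
  assumes f: "continuous_on UNIV f"
  shows "(\<lambda>\<zeta>. f (exp_coord x \<zeta>)) \<in> multipliers"
proof -
  have f01: "continuous_on {0..1} f" using f continuous_on_subset by blast
  let ?B = "\<lambda>n t. \<Sum>k\<le>n. f (real k / real n) * Bernstein n k t"
  have "\<exists>N. \<forall>t\<in>{0..1}. \<bar>f t - ?B N t\<bar> < 1 / Suc m" for m
  proof -
    obtain N where "\<forall>n t. N \<le> n \<and> t \<in> {0..1} \<longrightarrow> \<bar>f t - ?B n t\<bar> < 1 / Suc m"
      using Bernstein_Weierstrass[OF f01, of "1 / Suc m"] by auto
    then show ?thesis by (intro exI[of _ N]) auto
  qed
  then obtain N where N: "\<And>m t. t \<in> {0..1} \<Longrightarrow> \<bar>f t - ?B (N m) t\<bar> < 1 / Suc m" by metis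
  have "compact (f ` {0..1})" using f01 by (intro compact_continuous_image) auto
  then obtain C where C: "\<And>t. t \<in> {0..1} \<Longrightarrow> \<bar>f t\<bar> \<le> C" using compact_imp_bounded bounded_iff by (metis image_eqI real_norm_def)
  show ?thesis
  proof (rule multiplier_limit[where \<phi> = "\<lambda>m \<zeta>. ?B (N m) (exp_coord x \<zeta>)" and B = "C + 1"])
    show "(\<lambda>\<zeta>. ?B (N m) (exp_coord x \<zeta>)) \<in> multipliers" for m
      unfolding Bernstein_def by (intro multiplier_sum multiplier_mult multiplier_const multiplier_power multiplier_diff exp_coord_multiplier)
    have [measurable]: "f \<in> borel_measurable borel" using f by (rule borel_measurable_continuous_onI)
    show "(\<lambda>\<zeta>. f (exp_coord x \<zeta>)) \<in> borel_measurable \<nu>" by measurable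
    show "AE \<zeta> in \<nu>. \<bar>?B (N m) (exp_coord x \<zeta>)\<bar> \<le> C + 1" for m
      using exp_coord_range[of x]
    proof eventually_elim
      case (elim \<zeta>)
      then have "\<bar>f (exp_coord x \<zeta>) - ?B (N m) (exp_coord x \<zeta>)\<bar> < 1 / Suc m" "\<bar>f (exp_coord x \<zeta>)\<bar> \<le> C" using N[of "exp_coord x \<zeta>" m] C[of "exp_coord x \<zeta>"] by auto
      moreover have "1 / real (Suc m) \<le> 1" by simp
      ultimately show ?case by linarith
    qed
    show "AE \<zeta> in \<nu>. (\<lambda>m. ?B (N m) (exp_coord x \<zeta>)) \<longlonglongrightarrow> f (exp_coord x \<zeta>)"
      using exp_coord_range[of x]
    proof eventually_elim
      case (elim \<zeta>)
      have "(\<lambda>m. f (exp_coord x \<zeta>) - ?B (N m) (exp_coord x \<zeta>)) \<longlonglongrightarrow> 0"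
      proof (rule Lim_null_comparison)
        show "\<forall>\<^sub>F m in sequentially. norm (f (exp_coord x \<zeta>) - ?B (N m) (exp_coord x \<zeta>)) \<le> 1 / real (Suc m)"
          using N[of "exp_coord x \<zeta>"] elim by (intro always_eventually allI) (auto intro: less_imp_le)
        show "(\<lambda>m. 1 / real (Suc m)) \<longlonglongrightarrow> 0" by (rule LIMSEQ_Suc[OF lim_1_over_n])
      qed
      then have "(\<lambda>m. f (exp_coord x \<zeta>) - (f (exp_coord x \<zeta>) - ?B (N m) (exp_coord x \<zeta>))) \<longlonglongrightarrow> f (exp_coord x \<zeta>) - 0" by (intro tendsto_intros)
      then show ?case by simp
    qed
  qed
qed

lemma indicator_Iio_multiplier: "(\<lambda>\<zeta>. indicator {..<b} (\<zeta> x)) \<in> multipliers"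
proof (rule multiplier_limit[where B = 1])
  define t where "t = exp (- (\<delta> / 4) * b)"
  (* since exp_coord decreases in the coordinate, \<zeta> x < b means exp_coord x \<zeta> > t *)
  let ?f = "\<lambda>n s. min 1 (max 0 (real n * (s - t)))"
  show "(\<lambda>\<zeta>. ?f n (exp_coord x \<zeta>)) \<in> multipliers" for n
    by (rule continuous_exp_coord_multiplier) (intro continuous_intros)
  show "AE \<zeta> in \<nu>. \<bar>?f n (exp_coord x \<zeta>)\<bar> \<le> 1" for n by auto
  have "(\<lambda>n. ?f n (exp_coord x \<zeta>)) \<longlonglongrightarrow> indicator {..<b} (\<zeta> x)" for \<zeta>
  proof (cases "\<zeta> x < b")
    case True
    then have pos: "exp_coord x \<zeta> - t > 0" using delta by (simp add: exp_coord_def t_def)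
    obtain N where N: "1 / (exp_coord x \<zeta> - t) \<le> real N" using real_arch_simple by blast
    have "?f n (exp_coord x \<zeta>) = 1" if "n \<ge> N" for n
    proof -
      have "1 / (exp_coord x \<zeta> - t) \<le> real n" using N that by simp
      then have "1 \<le> real n * (exp_coord x \<zeta> - t)" using pos by (simp add: field_simps)
      then show ?thesis by simp
    qed
    then have "\<forall>\<^sub>F n in sequentially. ?f n (exp_coord x \<zeta>) = 1" by (auto simp: eventually_sequentially)
    then show ?thesis using True by (simp add: tendsto_eventually)
  next
    case False
    then have "exp_coord x \<zeta> - t \<le> 0" using delta by (simp add: exp_coord_def t_def)
    then have "?f n (exp_coord x \<zeta>) = 0" for n by (simp add: mult_nonneg_nonpos)
    then show ?thesis using False by simp
  qed
  then show "AE \<zeta> in \<nu>. (\<lambda>n. ?f n (exp_coord x \<zeta>)) \<longlonglongrightarrow> indicator {..<b} (\<zeta> x)" by simp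
qed measurable

definition multiplier_sets :: "('v \<Rightarrow> real) set set" where
  "multiplier_sets = {A. A \<in> sets \<nu> \<and> (\<lambda>\<zeta>. indicator A \<zeta>) \<in> multipliers}"

lemma multiplier_sets_Compl: "A \<in> multiplier_sets \<Longrightarrow> - A \<in> multiplier_sets"
proof -
  assume A: "A \<in> multiplier_sets"
  have "(\<lambda>\<zeta>. 1 - indicator A \<zeta>) \<in> multipliers" using A by (intro multiplier_diff multiplier_const) (simp add: multiplier_sets_def)
  moreover have "(\<lambda>\<zeta>. 1 - indicator A \<zeta>) = (\<lambda>\<zeta>. indicator (- A) \<zeta> :: real)" by (auto simp: indicator_def)
  ultimately show ?thesis using A sets.compl_sets[of A \<nu>] by (simp add: multiplier_sets_def Compl_eq_Diff_UNIV)
qed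

lemma multiplier_sets_empty: "{} \<in> multiplier_sets"
proof -
  have "indicat_real {} = (\<lambda>_::'v \<Rightarrow> real. 0)" by auto
  then show ?thesis using multiplier_const[of 0] by (simp add: multiplier_sets_def)
qed

lemma multiplier_sets_Un: assumes "A \<in> multiplier_sets" "B \<in> multiplier_sets" shows "A \<union> B \<in> multiplier_sets"
proof -
  have "(\<lambda>\<zeta>. indicator A \<zeta> + indicator B \<zeta> - indicator A \<zeta> * indicator B \<zeta>) \<in> multipliers"
    using assms by (intro multiplier_diff multiplier_add multiplier_mult) (auto simp: multiplier_sets_def)
  moreover have "(\<lambda>\<zeta>. indicator A \<zeta> + indicator B \<zeta> - indicator A \<zeta> * indicator B \<zeta>) = (\<lambda>\<zeta>. indicator (A \<union> B) \<zeta> :: real)"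
    by (auto simp: indicator_def)
  ultimately show ?thesis using assms by (auto simp: multiplier_sets_def)
qed

lemma multiplier_sets_UN: assumes "\<And>i::nat. A i \<in> multiplier_sets" shows "(\<Union>i. A i) \<in> multiplier_sets"
proof -
  have fin: "(\<Union>i<n. A i) \<in> multiplier_sets" for n
    by (induction n) (auto simp: multiplier_sets_empty lessThan_Suc intro: multiplier_sets_Un assms)
  have m: "(\<Union>i. A i) \<in> sets \<nu>" using assms by (auto simp: multiplier_sets_def)
  moreover have "(\<lambda>\<zeta>. indicator (\<Union>i. A i) \<zeta>) \<in> multipliers"
  proof (rule multiplier_limit[where B = 1])
    show "(\<lambda>\<zeta>. indicator (\<Union>i<n. A i) \<zeta>) \<in> multipliers" for n using fin[of n] by (simp add: multiplier_sets_def)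
    show "(\<lambda>\<zeta>. indicator (\<Union>i. A i) \<zeta>) \<in> borel_measurable \<nu>" using m by measurable
    show "AE \<zeta> in \<nu>. (\<lambda>n. indicator (\<Union>i<n. A i) \<zeta>) \<longlonglongrightarrow> (indicator (\<Union>i. A i) \<zeta> :: real)"
      by (rule AE_I2) (rule LIMSEQ_indicator_UN)
  qed (auto simp: indicator_def)
  ultimately show ?thesis by (simp add: multiplier_sets_def)
qed

text \<open>
  The sets whose indicators are multipliers form a sigma-algebra that contains the half-spaces
  \<open>\<zeta> x < b\<close>.
\<close>

lemma sets_multiplier_sets: "A \<in> sets \<nu> \<Longrightarrow> A \<in> multiplier_sets"
proof -
  have coord: "{\<zeta>. \<zeta> x \<in> B} \<in> multiplier_sets" if "B \<in> sets borel" for x and B :: "real set"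
  proof -
    have "B \<in> sigma_sets UNIV (range lessThan)"
      using that unfolding borel_Iio by (subst (asm) sets_measure_of) auto
    then show ?thesis
    proof (induction rule: sigma_sets.induct)
      case (Basic a)
      then obtain b where b: "a = {..<b}" by auto
      have "(\<lambda>\<zeta>. indicator {\<zeta>. \<zeta> x \<in> a} \<zeta>) = (\<lambda>\<zeta>. indicator {..<b} (\<zeta> x) :: real)" by (auto simp: b indicator_def)
      moreover have "{\<zeta>. \<zeta> x \<in> a} \<in> sets \<nu>"
        using measurable_sets[OF nu_coord[of x], of a] b by (simp add: vimage_def)
      ultimately show ?case using indicator_Iio_multiplier[of b x] by (simp add: multiplier_sets_def)
    next
      case Empty then show ?case by (simp add: multiplier_sets_empty)
    next
      case (Compl a)
      have "{\<zeta>. \<zeta> x \<in> UNIV - a} = - {\<zeta>. \<zeta> x \<in> a}" by auto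
      then show ?case using multiplier_sets_Compl[OF Compl.IH] by simp
    next
      case (Union a)
      have "{\<zeta>. \<zeta> x \<in> (\<Union>i. a i)} = (\<Union>i. {\<zeta>. \<zeta> x \<in> a i})" by auto
      then show ?case using multiplier_sets_UN[OF Union.IH] by simp
    qed
  qed
  assume "A \<in> sets \<nu>"
  then have "A \<in> sets (PiM UNIV (\<lambda>x::'v. borel :: real measure))" by (simp add: sets_PiM_equal_borel)
  then have "A \<in> sigma_sets UNIV {{f. f i \<in> B} | i B. B \<in> sets (borel :: real measure)}"
    by (simp add: sets_PiM_single)
  then show "A \<in> multiplier_sets"
  proof (induction rule: sigma_sets.induct)
    case (Basic a) then show ?case using coord by auto
  next
    case Empty then show ?case by (rule multiplier_sets_empty)
  next
    case (Compl a) then show ?case using multiplier_sets_Compl by (simp add: Compl_eq_Diff_UNIV)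
  next
    case (Union a) then show ?case by (intro multiplier_sets_UN)
  qed
qed

text \<open>
  Apply the indicator multipliers to the constant 1 to obtain all simple functions.
\<close>

theorem Polys_dense:
  assumes f: "f \<in> L2_fun \<nu>" and \<epsilon>: "0 < \<epsilon>"
  shows "\<exists>p\<in>Polys. L2_nrm \<nu> (\<lambda>\<zeta>. f \<zeta> - p \<zeta>) < \<epsilon>"
proof -
  note [measurable] = L2_meas[OF f]
  obtain s where s: "\<And>i. simple_function \<nu> (s i)" "\<And>z. (\<lambda>i. s i z) \<longlonglongrightarrow> f z" "\<And>i z. \<bar>s i z\<bar> \<le> 2 * \<bar>f z\<bar>"
    using borel_measurable_implies_sequence_metric[OF L2_meas[OF f], of 0] by (auto simp: dist_real_def)
  have sm: "s i \<in> borel_measurable \<nu>" for i using s(1) by (rule borel_measurable_simple_function)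
  have "s i \<in> Polys_cl" for i
  proof -
    have "s i = (\<lambda>z. \<Sum>y\<in>s i ` UNIV. y * (indicator (s i -` {y}) z * 1))"
    proof
      fix z
      show "s i z = (\<Sum>y\<in>s i ` UNIV. y * (indicator (s i -` {y}) z * 1))"
        using simple_function_indicator_representation_banach[OF s(1)[of i], of z]
        by (simp only: space_nu UNIV_I Int_UNIV_right real_scaleR_def mult_1_right mult.commute[of _ "indicator _ _"] simp_thms)
    qed
    moreover have "(\<lambda>z. \<Sum>y\<in>s i ` UNIV. y * (indicator (s i -` {y}) z * 1)) \<in> Polys_cl"
    proof (intro Polys_cl_sum Polys_cl_cmult)
      fix y
      have "s i -` {y} \<in> sets \<nu>" using simple_functionD(2)[OF s(1)[of i], of "{y}"] by simp
      then have "s i -` {y} \<in> multiplier_sets" by (rule sets_multiplier_sets)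
      then show "(\<lambda>z. indicator (s i -` {y}) z * 1) \<in> Polys_cl" using Polys_cl_poly[OF Polys_const[of 1]] by (auto simp: multiplier_sets_def multipliers_def)
    qed
    ultimately show ?thesis by simp
  qed
  moreover have "(\<lambda>n. L2_nrm \<nu> (\<lambda>z. f z - s n z)) \<longlonglongrightarrow> 0"
  proof (rule L2_dominated_convergence[OF sm L2_meas[OF f]])
    show "AE z in \<nu>. (\<lambda>n. s n z) \<longlonglongrightarrow> f z" using s by simp
    show "integrable \<nu> (\<lambda>z. 9 * (f z)\<^sup>2)" using L2_int[OF f] by simp
    have "(f z - s n z)\<^sup>2 \<le> 9 * (f z)\<^sup>2" for n z
    proof -
      have "\<bar>f z - s n z\<bar>\<^sup>2 \<le> (3 * \<bar>f z\<bar>)\<^sup>2" using s(3)[of n z] by (intro power_mono) auto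
      then show ?thesis by (simp add: power_mult_distrib)
    qed
    then show "AE z in \<nu>. (f z - s n z)\<^sup>2 \<le> 9 * (f z)\<^sup>2" for n by simp
  qed
  ultimately have "f \<in> Polys_cl" using Polys_cl_limit[OF f] by blast
  then show ?thesis using \<epsilon> by (simp add: Polys_cl_def)
qed

end

section \<open>Positivity tested on squares of polynomials\<close>

context gamma_setting
begin

text \<open>
  Approximate the indicator of \<open>w < 0\<close> by polynomials \<open>p\<close>, not in L2 of the law itself but of the
  law weighted by \<open>|w|\<close>, which still has exponential moments. In the limit the hypothesis says
  that the integral of \<open>w\<close> over the set \<open>w < 0\<close> is not negative, so this set is null.
\<close>

lemma nonneg_if_nonneg_on_squares:
  assumes w: "w \<in> L2_fun M" and sq: "\<And>p. p \<in> Polys \<Longrightarrow> 0 \<le> (\<integral>\<zeta>. (p \<zeta>)\<^sup>2 * w \<zeta> \<partial>M)"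
  shows "AE \<zeta> in M. 0 \<le> w \<zeta>"
proof -
  note [measurable] = L2_meas[OF w]
  define \<nu> where "\<nu> = density M (\<lambda>\<zeta>. ennreal \<bar>w \<zeta>\<bar>)"
  (* the rate leaves room for one application of Cauchy-Schwarz *)
  define \<delta> where "\<delta> = 1 / (4 * \<rho>)"
  have d: "0 < \<delta>" "2 * \<delta> < 1 / \<rho>" using rho by (auto simp: \<delta>_def field_simps)
  have absw: "(\<lambda>\<zeta>. \<bar>w \<zeta>\<bar>) \<in> L2_fun M" using w by (auto simp: L2_fun_def)
  have nu_int: "integrable \<nu> h \<longleftrightarrow> integrable M (\<lambda>\<zeta>. \<bar>w \<zeta>\<bar> * h \<zeta>)" if [measurable]: "h \<in> borel_measurable M" for h :: "('v \<Rightarrow> real) \<Rightarrow> real"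
    unfolding \<nu>_def by (subst integrable_density) auto
  have nu_integral: "(\<integral>\<zeta>. h \<zeta> \<partial>\<nu>) = (\<integral>\<zeta>. \<bar>w \<zeta>\<bar> * h \<zeta> \<partial>M)" if [measurable]: "h \<in> borel_measurable M" for h :: "('v \<Rightarrow> real) \<Rightarrow> real"
    unfolding \<nu>_def by (subst integral_density) auto
  have em: "(\<lambda>\<zeta>. exp (\<delta> * (\<Sum>x\<in>UNIV. \<zeta> x))) \<in> borel_measurable M" by measurable
  interpret N: exp_moments \<nu> \<delta>
  proof
    show "sets \<nu> = sets borel" by (simp add: \<nu>_def)
    show "AE \<zeta> in \<nu>. \<forall>x. 0 \<le> \<zeta> x"
      unfolding \<nu>_def using AE_nonneg by (subst AE_density) auto
    have "(\<lambda>\<zeta>. exp (\<delta> * (\<Sum>x\<in>UNIV. \<zeta> x))) \<in> L2_fun M"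
      using integrable_exp_sum[OF d(2)] em by (simp add: L2_fun_def exp_double[symmetric] mult.assoc)
    then have "integrable M (\<lambda>\<zeta>. \<bar>w \<zeta>\<bar> * exp (\<delta> * (\<Sum>x\<in>UNIV. \<zeta> x)))" by (rule L2_prod_int[OF absw])
    then show "integrable \<nu> (\<lambda>\<zeta>. exp (\<delta> * (\<Sum>x\<in>UNIV. \<zeta> x)))" using nu_int[OF em] by simp
  qed (rule d)
  have meas_eq: "h \<in> borel_measurable \<nu> \<longleftrightarrow> h \<in> borel_measurable M" for h :: "('v \<Rightarrow> real) \<Rightarrow> real"
    by (simp add: \<nu>_def)
  define f where "f \<zeta> = (if w \<zeta> < 0 then 1 else 0 :: real)" for \<zeta>
  have fm [measurable]: "f \<in> borel_measurable M" unfolding f_def by measurable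
  have wi: "integrable M (\<lambda>\<zeta>. \<bar>w \<zeta>\<bar>)" using L2_prod_int[OF absw L2_const[of 1]] by simp
  have f2: "(\<lambda>\<zeta>. (f \<zeta>)\<^sup>2) = f" by (auto simp: f_def)
  have fi: "integrable M (\<lambda>\<zeta>. \<bar>w \<zeta>\<bar> * f \<zeta>)"
    by (rule Bochner_Integration.integrable_bound[OF wi]) (auto simp: f_def)
  have fL: "f \<in> L2_fun \<nu>" using fi nu_int[OF fm] meas_eq[of f] fm by (simp add: L2_fun_def f2)
  have key: "L2_nrm \<nu> f \<le> 2 * \<epsilon>" if e: "0 < \<epsilon>" for \<epsilon>
  proof (cases "L2_nrm \<nu> f \<le> \<epsilon>")
    case True then show ?thesis using e by simp
  next
    case False
    obtain p where p: "p \<in> Polys" and n: "L2_nrm \<nu> (\<lambda>\<zeta>. f \<zeta> - p \<zeta>) < \<epsilon>" using N.Polys_dense[OF fL e] by blast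
    have [measurable]: "p \<in> borel_measurable M" using L2_meas[OF Polys_L2[OF p]] .
    have pL: "p \<in> L2_fun \<nu>" by (rule N.Polys_nu_L2[OF p])
    have fpm: "(\<lambda>\<zeta>. f \<zeta> * p \<zeta>) \<in> L2_fun \<nu>" and gpm: "(\<lambda>\<zeta>. (1 - f \<zeta>) * p \<zeta>) \<in> L2_fun \<nu>"
      by (rule N.L2_bounded_mult[where B = 1]; use pL meas_eq in \<open>auto simp: f_def\<close>)+
    have dL: "(\<lambda>\<zeta>. f \<zeta> - p \<zeta>) \<in> L2_fun \<nu>" by (rule L2_diff[OF fL pL])
    (* the integral of p^2 w is the mass of p^2 where w is nonnegative minus that where w is negative *)
    have "(L2_nrm \<nu> (\<lambda>\<zeta>. (1 - f \<zeta>) * p \<zeta>))\<^sup>2 - (L2_nrm \<nu> (\<lambda>\<zeta>. f \<zeta> * p \<zeta>))\<^sup>2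
        = (\<integral>\<zeta>. ((1 - f \<zeta>) * p \<zeta>)\<^sup>2 - (f \<zeta> * p \<zeta>)\<^sup>2 \<partial>\<nu>)"
      unfolding L2_nrm_sq_integral by (rule Bochner_Integration.integral_diff[symmetric, OF L2_int[OF gpm] L2_int[OF fpm]])
    also have "\<dots> = (\<integral>\<zeta>. \<bar>w \<zeta>\<bar> * (((1 - f \<zeta>) * p \<zeta>)\<^sup>2 - (f \<zeta> * p \<zeta>)\<^sup>2) \<partial>M)"
      by (rule nu_integral) measurable
    also have "\<dots> = (\<integral>\<zeta>. (p \<zeta>)\<^sup>2 * w \<zeta> \<partial>M)"
      by (rule Bochner_Integration.integral_cong) (auto simp: f_def)
    finally have pos: "(L2_nrm \<nu> (\<lambda>\<zeta>. f \<zeta> * p \<zeta>))\<^sup>2 \<le> (L2_nrm \<nu> (\<lambda>\<zeta>. (1 - f \<zeta>) * p \<zeta>))\<^sup>2" using sq[OF p] by linarith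
    have mono: "L2_nrm \<nu> h \<le> L2_nrm \<nu> (\<lambda>\<zeta>. f \<zeta> - p \<zeta>)" if "\<And>\<zeta>. (h \<zeta>)\<^sup>2 \<le> (f \<zeta> - p \<zeta>)\<^sup>2" "h \<in> L2_fun \<nu>" for h
      unfolding L2_nrm_def using that by (intro real_sqrt_le_mono integral_mono L2_int dL)
    have 1: "L2_nrm \<nu> (\<lambda>\<zeta>. (1 - f \<zeta>) * p \<zeta>) \<le> L2_nrm \<nu> (\<lambda>\<zeta>. f \<zeta> - p \<zeta>)"
      by (rule mono[OF _ gpm]) (auto simp: f_def)
    have fdL: "(\<lambda>\<zeta>. f \<zeta> - f \<zeta> * p \<zeta>) \<in> L2_fun \<nu>" by (rule L2_diff[OF fL fpm])
    have 2: "L2_nrm \<nu> (\<lambda>\<zeta>. f \<zeta> - f \<zeta> * p \<zeta>) \<le> L2_nrm \<nu> (\<lambda>\<zeta>. f \<zeta> - p \<zeta>)"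
      by (rule mono[OF _ fdL]) (auto simp: f_def)
    have "L2_nrm \<nu> f \<le> L2_nrm \<nu> (\<lambda>\<zeta>. f \<zeta> - f \<zeta> * p \<zeta>) + L2_nrm \<nu> (\<lambda>\<zeta>. f \<zeta> * p \<zeta>)"
      using L2_triangle[OF fdL fpm] by simp
    moreover have "L2_nrm \<nu> (\<lambda>\<zeta>. f \<zeta> * p \<zeta>) \<le> L2_nrm \<nu> (\<lambda>\<zeta>. (1 - f \<zeta>) * p \<zeta>)"
      using pos by (rule power2_le_imp_le) (rule L2_nrm_ge0)
    ultimately show ?thesis using 1 2 n by linarith
  qed
  have "L2_nrm \<nu> f \<le> 0"
  proof (rule field_le_epsilon)
    fix e :: real assume "0 < e" then show "L2_nrm \<nu> f \<le> 0 + e" using key[of "e / 2"] by simp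
  qed
  then have "L2_nrm \<nu> f = 0" using L2_nrm_ge0 by (rule antisym)
  then have "(\<integral>\<zeta>. \<bar>w \<zeta>\<bar> * f \<zeta> \<partial>M) = 0"
    using nu_integral[OF fm] L2_nrm_sq_integral[of \<nu> f] by (simp add: f2)
  then have "AE \<zeta> in M. \<bar>w \<zeta>\<bar> * f \<zeta> = 0"
    using integral_nonneg_eq_0_iff_AE[OF fi] by (auto simp: f_def)
  then show ?thesis by eventually_elim (auto simp: f_def split: if_splits)
qed

end

section \<open>Minima of polynomials over the orthant\<close>

lemma deriv_at_right_min:
  fixes \<phi> :: "real \<Rightarrow> real"
  assumes "(\<phi> has_real_derivative D) (at 0)" "0 < d" "\<And>s. 0 < s \<Longrightarrow> s < d \<Longrightarrow> \<phi> 0 \<le> \<phi> s"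
  shows "0 \<le> D"
proof (rule ccontr)
  assume "\<not> 0 \<le> D"
  then obtain e where e: "0 < e" "\<And>h. 0 < h \<Longrightarrow> h < e \<Longrightarrow> \<phi> (0 + h) < \<phi> 0" using DERIV_neg_dec_right[OF assms(1)] by auto
  define s where "s = min d e / 2"
  have "0 < s" "s < d" "s < e" using assms(2) e(1) by (auto simp: s_def)
  then show False using e(2)[of s] assms(3)[of s] by simp
qed

lemma deriv_at_left_min:
  fixes \<phi> :: "real \<Rightarrow> real"
  assumes "(\<phi> has_real_derivative D) (at t)" "0 < d" "\<And>s. 0 < s \<Longrightarrow> s < d \<Longrightarrow> \<phi> t \<le> \<phi> (t - s)"
  shows "D \<le> 0"
proof (rule ccontr)
  assume "\<not> D \<le> 0"
  then obtain e where e: "0 < e" "\<And>h. 0 < h \<Longrightarrow> h < e \<Longrightarrow> \<phi> (t - h) < \<phi> t" using DERIV_pos_inc_left[OF assms(1)] by auto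
  define s where "s = min d e / 2"
  have "0 < s" "s < d" "s < e" using assms(2) e(1) by (auto simp: s_def)
  then show False using e(2)[of s] assms(3)[of s] by simp
qed

lemma second_deriv_at_min:
  fixes \<phi> :: "real \<Rightarrow> real"
  assumes d1: "\<And>s. (\<phi> has_real_derivative \<phi>' s) (at s)" and d2: "(\<phi>' has_real_derivative D) (at 0)"
    and d: "0 < d" and min: "\<And>s. \<bar>s\<bar> < d \<Longrightarrow> \<phi> 0 \<le> \<phi> s"
  shows "\<phi>' 0 = 0" "0 \<le> D"
proof -
  show 0: "\<phi>' 0 = 0" by (rule DERIV_local_min[OF d1 d]) (use min in auto)
  show "0 \<le> D"
  proof (rule ccontr)
    assume "\<not> 0 \<le> D"
    then obtain e where e: "0 < e" "\<And>h. 0 < h \<Longrightarrow> h < e \<Longrightarrow> \<phi>' (0 + h) < \<phi>' 0" using DERIV_neg_dec_right[OF d2] by auto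
    define s where "s = min d e / 2"
    have s: "0 < s" "s < d" "s < e" using d e by (auto simp: s_def)
    (* a negative second derivative would make the function decrease on the right *)
    obtain z where z: "0 < z" "z < s" "\<phi> s - \<phi> 0 = (s - 0) * \<phi>' z"
      using MVT2[OF s(1), of \<phi> \<phi>'] d1 by blast
    have "\<phi>' z < 0" using e(2)[of z] z s 0 by simp
    then have "\<phi> s - \<phi> 0 < 0" using z s by (simp add: mult_pos_neg)
    then show False using min[of s] s by simp
  qed
qed

text \<open>
  The direction in which mass is moved from \<open>y\<close> to \<open>x\<close>.
\<close>

definition dvec :: "'v \<Rightarrow> 'v \<Rightarrow> 'v \<Rightarrow> real" where
  "dvec x y z = (if z = x then 1 else 0) - (if z = y then 1 else 0)"

lemma Polys_line_dvec:
  fixes F :: "('v::finite \<Rightarrow> real) \<Rightarrow> real"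
  assumes "F \<in> Polys"
  shows "((\<lambda>s. F (line \<zeta> (dvec x y) s)) has_real_derivative pderiv_diff x y F (line \<zeta> (dvec x y) s)) (at s)"
proof -
  have "(\<Sum>z\<in>UNIV. dvec x y z * g z) = g x - g y" for g :: "'v \<Rightarrow> real"
    by (simp add: dvec_def left_diff_distrib sum_subtractf if_distrib[of "\<lambda>a. a * _"] cong: if_cong)
  moreover have "((\<lambda>s. F (line \<zeta> (dvec x y) s)) has_real_derivative
      (\<Sum>z\<in>UNIV. dvec x y z * pderiv_at z F (line \<zeta> (dvec x y) s))) (at s)"
    using Polys_grad[OF assms] unfolding has_grad_def by blast
  ultimately show ?thesis by (simp only: pderiv_diff_def)
qed

lemma Polys_line_coord:
  fixes F :: "('v::finite \<Rightarrow> real) \<Rightarrow> real"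
  assumes "F \<in> Polys"
  shows "((\<lambda>s. F (line \<zeta> (\<lambda>z. if z = x then 1 else 0) s)) has_real_derivative pderiv_at x F (line \<zeta> (\<lambda>z. if z = x then 1 else 0) s)) (at s)"
proof -
  have "(\<Sum>z\<in>UNIV. (if z = x then 1 else 0) * g z) = g x" for g :: "'v \<Rightarrow> real"
    by (simp add: if_distrib[of "\<lambda>a. a * _"] cong: if_cong)
  moreover have "((\<lambda>s. F (line \<zeta> (\<lambda>z. if z = x then 1 else 0) s)) has_real_derivative
      (\<Sum>z\<in>UNIV. (if z = x then 1 else 0) * pderiv_at z F (line \<zeta> (\<lambda>z. if z = x then 1 else 0) s))) (at s)"
    using Polys_grad[OF assms] unfolding has_grad_def by blast
  ultimately show ?thesis by (simp only:)
qed

text \<open>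
  First and second order conditions at a minimum over the closed orthant, at the boundary as well.
  There the diffusion coefficients vanish and the drift points inwards, so every single term of \<open>L\<close>
  is nonnegative.
\<close>

locale orthant_minimum =
  fixes F :: "('v::finite \<Rightarrow> real) \<Rightarrow> real" and \<zeta> :: "'v \<Rightarrow> real"
  assumes F: "F \<in> Polys" and \<zeta>: "\<And>x. 0 \<le> \<zeta> x" and minimal: "\<And>\<xi>. (\<And>x. 0 \<le> \<xi> x) \<Longrightarrow> F \<zeta> \<le> F \<xi>"
begin

lemma coord_deriv_nonneg: "0 \<le> pderiv_at x F \<zeta>"
proof -
  let ?v = "\<lambda>z. if z = x then 1 else (0::real)"
  have "((\<lambda>s. F (line \<zeta> ?v s)) has_real_derivative pderiv_at x F \<zeta>) (at 0)" using Polys_line_coord[OF F, of \<zeta> x 0] by simp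
  then show ?thesis
  proof (rule deriv_at_right_min[where d = 1])
    show "F (line \<zeta> ?v 0) \<le> F (line \<zeta> ?v s)" if "0 < s" for s
      unfolding line_0 by (rule minimal) (use \<zeta> that in \<open>auto simp: line_def\<close>)
  qed simp
qed

lemma coord_interior:
  assumes "0 < \<zeta> x" shows "pderiv_at x F \<zeta> = 0" "0 \<le> pderiv_at x (pderiv_at x F) \<zeta>"
proof -
  let ?v = "\<lambda>z. if z = x then 1 else (0::real)"
  have d1: "((\<lambda>s. F (line \<zeta> ?v s)) has_real_derivative pderiv_at x F (line \<zeta> ?v s)) (at s)" for s by (rule Polys_line_coord[OF F])
  have d2: "((\<lambda>s. pderiv_at x F (line \<zeta> ?v s)) has_real_derivative pderiv_at x (pderiv_at x F) \<zeta>) (at 0)"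
    using Polys_line_coord[OF Polys_pderiv[OF F, of x], of \<zeta> x 0] by simp
  have m: "F (line \<zeta> ?v 0) \<le> F (line \<zeta> ?v s)" if "\<bar>s\<bar> < \<zeta> x" for s
    unfolding line_0 by (rule minimal) (use \<zeta> that in \<open>auto simp: line_def\<close>)
  from second_deriv_at_min[OF d1 d2 assms m]
  show "pderiv_at x F \<zeta> = 0" "0 \<le> pderiv_at x (pderiv_at x F) \<zeta>" by simp_all
qed

lemma killing_zero: "\<zeta> x * pderiv_at x F \<zeta> = 0"
  using coord_interior(1)[of x] \<zeta>[of x] by (cases "\<zeta> x = 0") auto

lemma reservoir_nonneg:
  assumes "0 < a" "0 < \<rho>"
  shows "0 \<le> (a * \<rho> - \<zeta> x) * pderiv_at x F \<zeta> + \<rho> * \<zeta> x * pderiv_at x (pderiv_at x F) \<zeta>"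
proof (cases "\<zeta> x = 0")
  case True then show ?thesis using coord_deriv_nonneg[of x] assms by simp
next
  case False
  then have "0 < \<zeta> x" using \<zeta>[of x] by simp
  then show ?thesis using coord_interior[of x] assms by simp
qed

lemma diff_deriv_nonneg: assumes "0 < \<zeta> y" "x \<noteq> y" shows "0 \<le> pderiv_diff x y F \<zeta>"
proof -
  have "((\<lambda>s. F (line \<zeta> (dvec x y) s)) has_real_derivative pderiv_diff x y F \<zeta>) (at 0)" using Polys_line_dvec[OF F, of \<zeta> x y 0] by simp
  then show ?thesis
  proof (rule deriv_at_right_min[OF _ assms(1)])
    show "F (line \<zeta> (dvec x y) 0) \<le> F (line \<zeta> (dvec x y) s)" if "0 < s" "s < \<zeta> y" for s
      unfolding line_0 by (rule minimal) (use \<zeta> that in \<open>auto simp: line_def dvec_def\<close>)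
  qed
qed

text \<open>
  If both sites carry mass, both directions of exchange are allowed and the usual second derivative
  test applies along \<open>dvec x y\<close>. If only one of them does, the second order term vanishes and mass
  can still be moved to the empty site, which fixes the sign of the drift term.
\<close>

lemma exchange_nonneg:
  assumes "0 < a" "0 < b"
  shows "0 \<le> - (b * \<zeta> x - a * \<zeta> y) * pderiv_diff x y F \<zeta> + \<zeta> x * \<zeta> y * pderiv_diff x y (pderiv_diff x y F) \<zeta>"
proof (cases "x = y")
  case True then show ?thesis by (simp add: pderiv_diff_def)
next
  case xy: False
  have anti: "pderiv_diff y x F \<zeta> = - pderiv_diff x y F \<zeta>" by (simp add: pderiv_diff_def)
  consider "\<zeta> x = 0" "\<zeta> y = 0" | "\<zeta> x = 0" "0 < \<zeta> y" | "0 < \<zeta> x" "\<zeta> y = 0" | "0 < \<zeta> x" "0 < \<zeta> y"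
    using \<zeta>[of x] \<zeta>[of y] by (metis order_le_less)
  then show ?thesis
  proof cases
    case 2 then show ?thesis using diff_deriv_nonneg[of y x] xy assms by simp
  next
    case 3 then show ?thesis using diff_deriv_nonneg[of x y] xy assms by (simp add: anti mult_nonneg_nonpos)
  next
    case 4
    have d1: "((\<lambda>s. F (line \<zeta> (dvec x y) s)) has_real_derivative pderiv_diff x y F (line \<zeta> (dvec x y) s)) (at s)" for s
      by (rule Polys_line_dvec[OF F])
    have d2: "((\<lambda>s. pderiv_diff x y F (line \<zeta> (dvec x y) s)) has_real_derivative pderiv_diff x y (pderiv_diff x y F) \<zeta>) (at 0)"
      using Polys_line_dvec[OF pderiv_diff_Polys[OF F, of x y], of \<zeta> x y 0] by simp
    have d: "0 < min (\<zeta> x) (\<zeta> y)" using 4 by simp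
    have m: "F (line \<zeta> (dvec x y) 0) \<le> F (line \<zeta> (dvec x y) s)" if "\<bar>s\<bar> < min (\<zeta> x) (\<zeta> y)" for s
      unfolding line_0 by (rule minimal) (use \<zeta> that in \<open>auto simp: line_def dvec_def\<close>)
    from second_deriv_at_min[OF d1 d2 d m] have "pderiv_diff x y F \<zeta> = 0" "0 \<le> pderiv_diff x y (pderiv_diff x y F) \<zeta>" by simp_all
    then show ?thesis using 4 by simp
  qed simp
qed

end

section \<open>A parabolic minimum principle for polynomials\<close>

lemma compact_box: "compact {\<zeta> :: 'v::finite \<Rightarrow> real. \<forall>x. 0 \<le> \<zeta> x \<and> \<zeta> x \<le> R}"
proof -
  have "compactin (product_topology (\<lambda>_. euclidean) UNIV) (\<Pi>\<^sub>E x\<in>(UNIV::'v set). {0..R})"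
    by (subst compactin_PiE) auto
  moreover have "(\<Pi>\<^sub>E x\<in>(UNIV::'v set). {0..R}) = {\<zeta>. \<forall>x. 0 \<le> \<zeta> x \<and> \<zeta> x \<le> R}" by (auto simp: PiE_def)
  ultimately show ?thesis by (simp add: euclidean_product_topology compactin_euclidean_iff)
qed

lemma Pol_growth:
  fixes f :: "('v::finite \<Rightarrow> real) \<Rightarrow> real"
  assumes "f \<in> Pol n"
  shows "\<exists>C\<ge>0. \<forall>\<zeta>. (\<forall>x. 0 \<le> \<zeta> x) \<longrightarrow> \<bar>f \<zeta>\<bar> \<le> C * (1 + (\<Sum>x\<in>UNIV. \<zeta> x)) ^ n"
  using assms
proof (induction rule: Pol_induct)
  case zero
  then show ?case by (intro exI[of _ 0]) simp
next
  case (step c xs g)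
  then obtain C where C: "0 \<le> C" "\<And>\<zeta>. (\<forall>x. 0 \<le> \<zeta> x) \<Longrightarrow> \<bar>g \<zeta>\<bar> \<le> C * (1 + (\<Sum>x\<in>UNIV. \<zeta> x)) ^ n" by blast
  have m: "0 \<le> mon xs \<zeta> \<and> mon xs \<zeta> \<le> (1 + (\<Sum>x\<in>UNIV. \<zeta> x)) ^ length xs" if z: "\<forall>x. 0 \<le> \<zeta> x" for \<zeta> :: "'v \<Rightarrow> real" and xs
  proof (induction xs)
    case (Cons x xs)
    then show ?case using growth_bounds[OF z] z by (auto intro!: mult_mono')
  qed simp
  have "\<bar>c * mon xs \<zeta> + g \<zeta>\<bar> \<le> (\<bar>c\<bar> + C) * (1 + (\<Sum>x\<in>UNIV. \<zeta> x)) ^ n" if z: "\<forall>x. 0 \<le> \<zeta> x" for \<zeta>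
  proof -
    have "mon xs \<zeta> \<le> (1 + (\<Sum>x\<in>UNIV. \<zeta> x)) ^ n"
      using m[OF z, of xs] power_increasing[OF step(1) growth_bounds(1)[OF z]] by linarith
    then have "\<bar>c * mon xs \<zeta>\<bar> \<le> \<bar>c\<bar> * (1 + (\<Sum>x\<in>UNIV. \<zeta> x)) ^ n"
      using m[OF z, of xs] by (simp add: abs_mult mult_left_mono)
    then show ?thesis using C(2)[OF z] by (simp add: distrib_right)
  qed
  then show ?case using C(1) by (intro exI[of _ "\<bar>c\<bar> + C"]) auto
qed

lemma Pol_total_power: "(\<lambda>\<zeta>. (1 + (\<Sum>x\<in>(UNIV::'v::finite set). \<zeta> x)) ^ n) \<in> Pol n"
proof (induction n)
  case 0 then show ?case using mon_Pol[of "[]" 0] by simp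
next
  case (Suc n)
  have "(\<lambda>\<zeta>. (1 + (\<Sum>x\<in>(UNIV::'v set). \<zeta> x)) ^ n + (\<Sum>x\<in>(UNIV::'v set). \<zeta> x * (1 + (\<Sum>x\<in>(UNIV::'v set). \<zeta> x)) ^ n)) \<in> Pol (Suc n)"
    using Suc Pol_mono[of n "Suc n"] by (intro Pol_add Pol_sum Pol_coord_mult) auto
  then show ?case by (simp add: distrib_right sum_distrib_right)
qed

locale bep_setting = gamma_setting \<alpha> \<rho> for \<alpha> :: "'v::finite \<Rightarrow> real" and \<rho> :: real +
  fixes c :: "'v \<Rightarrow> 'v \<Rightarrow> real" and \<omega> :: "'v \<Rightarrow> real"
  assumes connected: "connected_conductances c" and omega: "0 \<le> \<omega> x" and omega_nz: "\<exists>x. \<omega> x \<noteq> 0"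
begin

abbreviation "L \<equiv> bep_operator c \<alpha> \<omega> \<rho>"

lemma c_sym: "c x y = c y x" and c_nonneg: "0 \<le> c x y"
  and c_connected: "x \<noteq> y \<Longrightarrow> (\<lambda>u v. 0 < c u v)\<^sup>*\<^sup>* x y"
  using connected by (auto simp: connected_conductances_def)

lemma L_nonneg_at_minimum:
  assumes "orthant_minimum F \<zeta>" shows "0 \<le> L F \<zeta>"
proof -
  interpret orthant_minimum F \<zeta> by fact
  show ?thesis unfolding bep_operator_def
    by (intro add_nonneg_nonneg mult_nonneg_nonneg sum_nonneg c_nonneg omega exchange_nonneg reservoir_nonneg alpha rho) simp
qed

lemma L_sum_Polys:
  assumes "finite E" "\<And>l. l \<in> E \<Longrightarrow> g l \<in> Polys"
  shows "L (\<lambda>\<zeta>. \<Sum>l\<in>E. a l * g l \<zeta>) = (\<lambda>\<zeta>. \<Sum>l\<in>E. a l * L (g l) \<zeta>)"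
  using assms
proof (induction E)
  case empty
  have "L (\<lambda>\<zeta>. 0 * 0) = (\<lambda>\<zeta>. 0 * L (\<lambda>_. 0) \<zeta>)" using bep_operator_cmult[OF Polys_const[of 0], of c \<alpha> \<omega> \<rho> 0] .
  then show ?case by simp
next
  case (insert l E)
  have 1: "(\<lambda>\<zeta>. a l * g l \<zeta>) \<in> Polys" using insert by (intro Polys_cmult) auto
  have 2: "(\<lambda>\<zeta>. \<Sum>l\<in>E. a l * g l \<zeta>) \<in> Polys" using insert by (intro Polys_sum Polys_cmult) auto
  have 3: "g l \<in> Polys" using insert by auto
  show ?case using insert bep_operator_add[OF 1 2, of c \<alpha> \<omega> \<rho>] bep_operator_cmult[OF 3, of c \<alpha> \<omega> \<rho> "a l"] by simp
qed

text \<open>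
  The sum over eigenfunctions is the solution of the heat equation with a nonnegative polynomial
  as initial value. The orthant is not compact and solutions grow, so a small multiple of
  \<open>exp (k * t) * W\<close> is added, with \<open>W\<close> a power of \<open>1 +\<close> total mass that dominates the solution at
  infinity. As \<open>L W \<le> D * W < k * W\<close>, this barrier is a strict supersolution, and a negative minimum of
  the sum of both over \<open>[0, t0]\<close> and the orthant would contradict the equation.
\<close>

theorem heat_flow_nonneg:
  assumes E: "finite E" and g: "\<And>l. l \<in> E \<Longrightarrow> g l \<in> Polys" and eig: "\<And>l. l \<in> E \<Longrightarrow> L (g l) = (\<lambda>\<zeta>. - l * g l \<zeta>)"
    and init: "\<And>\<zeta>. (\<forall>x. 0 \<le> \<zeta> x) \<Longrightarrow> 0 \<le> (\<Sum>l\<in>E. g l \<zeta>)"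
    and t0: "0 \<le> t0" and \<zeta>0: "\<forall>x. 0 \<le> \<zeta>0 x"
  shows "0 \<le> (\<Sum>l\<in>E. exp (- l * t0) * g l \<zeta>0)"
proof (rule ccontr)
  define u where "u t \<zeta> = (\<Sum>l\<in>E. exp (- l * t) * g l \<zeta>)" for t \<zeta>
  assume "\<not> 0 \<le> (\<Sum>l\<in>E. exp (- l * t0) * g l \<zeta>0)"
  then have neg: "u t0 \<zeta>0 < 0" by (simp add: u_def)
  let ?S = "\<lambda>\<zeta>::'v \<Rightarrow> real. 1 + (\<Sum>x\<in>UNIV. \<zeta> x)"
  have "\<exists>n. \<exists>C\<ge>0. \<forall>t \<zeta>. 0 \<le> t \<longrightarrow> t \<le> t0 \<longrightarrow> (\<forall>x. 0 \<le> \<zeta> x) \<longrightarrow> \<bar>u t \<zeta>\<bar> \<le> C * ?S \<zeta> ^ n"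
  proof -
    have "poly_growth (\<lambda>\<zeta>. \<Sum>l\<in>E. exp (\<bar>l\<bar> * t0) * \<bar>g l \<zeta>\<bar>)"
    proof (intro poly_growth_sum poly_growth_mult poly_growth_const)
      fix l assume "l \<in> E"
      then have "poly_growth (g l)" by (intro Polys_growth g)
      then show "poly_growth (\<lambda>\<zeta>. \<bar>g l \<zeta>\<bar>)" by (simp add: poly_growth_def)
    qed
    then obtain C n where C: "0 \<le> C" "\<And>\<zeta>. (\<forall>x. 0 \<le> \<zeta> x) \<Longrightarrow> \<bar>\<Sum>l\<in>E. exp (\<bar>l\<bar> * t0) * \<bar>g l \<zeta>\<bar>\<bar> \<le> C * ?S \<zeta> ^ n"
      by (rule poly_growth_obtain) blast
    have "\<bar>u t \<zeta>\<bar> \<le> C * ?S \<zeta> ^ n" if "0 \<le> t" "t \<le> t0" "\<forall>x. 0 \<le> \<zeta> x" for t \<zeta>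
    proof -
      have "\<bar>u t \<zeta>\<bar> \<le> (\<Sum>l\<in>E. \<bar>exp (- l * t) * g l \<zeta>\<bar>)" unfolding u_def by (rule sum_abs)
      also have "\<dots> \<le> (\<Sum>l\<in>E. exp (\<bar>l\<bar> * t0) * \<bar>g l \<zeta>\<bar>)"
      proof (rule sum_mono)
        fix l
        have "- l * t \<le> \<bar>l\<bar> * t" using that by (intro mult_right_mono) auto
        also have "\<dots> \<le> \<bar>l\<bar> * t0" using that by (intro mult_left_mono) auto
        finally show "\<bar>exp (- l * t) * g l \<zeta>\<bar> \<le> exp (\<bar>l\<bar> * t0) * \<bar>g l \<zeta>\<bar>"
          by (simp add: abs_mult mult_right_mono)
      qed
      also have "\<dots> \<le> C * ?S \<zeta> ^ n" using C(2)[OF that(3)] by linarith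
      finally show ?thesis .
    qed
    then show ?thesis using C(1) by blast
  qed
  then obtain n C where C: "0 \<le> C" "\<And>t \<zeta>. 0 \<le> t \<Longrightarrow> t \<le> t0 \<Longrightarrow> (\<forall>x. 0 \<le> \<zeta> x) \<Longrightarrow> \<bar>u t \<zeta>\<bar> \<le> C * ?S \<zeta> ^ n" by blast
  (* one degree more than the growth of u *)
  define W where "W \<zeta> = ?S \<zeta> ^ Suc n" for \<zeta>
  have WPol: "W \<in> Pol (Suc n)" unfolding W_def[abs_def] by (rule Pol_total_power)
  have WP: "W \<in> Polys" using WPol by (rule Pol_Polys)
  obtain D where D: "\<And>\<zeta>. (\<forall>x. 0 \<le> \<zeta> x) \<Longrightarrow> \<bar>L W \<zeta>\<bar> \<le> D * W \<zeta>"
    using Pol_growth[OF bep_operator_Pol[OF WPol, of c \<alpha> \<omega> \<rho>]] unfolding W_def by blast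
  have W1: "1 \<le> W \<zeta>" if "\<forall>x. 0 \<le> \<zeta> x" for \<zeta> unfolding W_def using growth_bounds(1)[OF that] by (rule one_le_power)
  define k where "k = D + 1"
  (* so small that the barrier takes away only half of the negative value *)
  define \<epsilon> where "\<epsilon> = - u t0 \<zeta>0 / (2 * exp (k * t0) * W \<zeta>0)"
  have \<epsilon>: "0 < \<epsilon>" using neg W1[OF \<zeta>0] by (simp add: \<epsilon>_def divide_neg_pos)
  define v where "v t \<zeta> = u t \<zeta> + \<epsilon> * exp (k * t) * W \<zeta>" for t \<zeta>
  have v0: "v t0 \<zeta>0 < 0"
  proof -
    have "\<epsilon> * exp (k * t0) * W \<zeta>0 = - u t0 \<zeta>0 / 2" using W1[OF \<zeta>0] by (simp add: \<epsilon>_def)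
    then show ?thesis using neg by (simp add: v_def)
  qed
  (* beyond R the barrier dominates, at all times, whatever the sign of k *)
  define R where "R = C / (\<epsilon> * min 1 (exp (k * t0)))"
  have far: "0 < v t \<zeta>" if t: "0 \<le> t" "t \<le> t0" and z: "\<forall>x. 0 \<le> \<zeta> x" and x: "R < \<zeta> x" for t \<zeta> x
  proof -
    have m: "min 1 (exp (k * t0)) \<le> exp (k * t)"
    proof (cases "0 \<le> k")
      case True then show ?thesis using t by (simp add: min.coboundedI1)
    next
      case False
      then have "k * t0 \<le> k * t" using t by (intro mult_left_mono_neg) auto
      then show ?thesis by (simp add: min.coboundedI2)
    qed
    have mp: "0 < min 1 (exp (k * t0))" by simp
    have "R < ?S \<zeta>" using x growth_bounds(2)[OF z, of x] by linarith
    then have "C < \<epsilon> * min 1 (exp (k * t0)) * ?S \<zeta>"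
      using \<epsilon> mp unfolding R_def by (simp add: pos_divide_less_eq mult.commute)
    also have "\<dots> \<le> \<epsilon> * exp (k * t) * ?S \<zeta>"
      using \<epsilon> m growth_bounds(1)[OF z] by (intro mult_right_mono mult_left_mono) auto
    finally have "C * ?S \<zeta> ^ n < \<epsilon> * exp (k * t) * ?S \<zeta> * ?S \<zeta> ^ n"
      using growth_bounds(1)[OF z] by (intro mult_strict_right_mono) auto
    then have "C * ?S \<zeta> ^ n < \<epsilon> * exp (k * t) * W \<zeta>" by (simp add: W_def mult.assoc)
    then show ?thesis using C(2)[OF t z] by (simp add: v_def)
  qed
  define X where "X = {0..t0} \<times> {\<zeta>::'v \<Rightarrow> real. \<forall>x. 0 \<le> \<zeta> x \<and> \<zeta> x \<le> R}"
  have X: "compact X" unfolding X_def by (intro compact_Times compact_Icc compact_box)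
  have in_X: "(t0, \<zeta>0) \<in> X" unfolding X_def using \<zeta>0 t0 v0 far[of t0 \<zeta>0] by (auto simp: not_less[symmetric])
  have "continuous_on X (\<lambda>q. v (fst q) (snd q))"
    unfolding v_def u_def
    by (intro continuous_intros continuous_on_compose2[OF Polys_continuous[OF g]] continuous_on_compose2[OF Polys_continuous[OF WP]])
      (auto intro: subset_UNIV)
  then obtain q where q: "q \<in> X" "\<And>q'. q' \<in> X \<Longrightarrow> v (fst q) (snd q) \<le> v (fst q') (snd q')"
    using continuous_attains_inf[OF X] in_X by blast
  define t \<zeta> where "t = fst q" and "\<zeta> = snd q"
  have t: "0 \<le> t" "t \<le> t0" and z: "\<forall>x. 0 \<le> \<zeta> x \<and> \<zeta> x \<le> R" using q(1) by (auto simp: X_def t_def \<zeta>_def)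
  have z0: "\<forall>x. 0 \<le> \<zeta> x" using z by simp
  have vneg: "v t \<zeta> < 0" using q(2)[OF in_X] v0 by (simp add: t_def \<zeta>_def)
  have min: "v t \<zeta> \<le> v s \<xi>" if s: "0 \<le> s" "s \<le> t0" and x: "\<forall>x. 0 \<le> \<xi> x" for s \<xi>
  proof (cases "(s, \<xi>) \<in> X")
    case True then show ?thesis using q(2)[OF True] by (simp add: t_def \<zeta>_def)
  next
    case False
    then obtain y where "R < \<xi> y" using s x by (auto simp: X_def not_le)
    then show ?thesis using far[OF s x] vneg by fastforce
  qed
  have "t \<noteq> 0"
  proof
    assume "t = 0"
    then have "0 \<le> u t \<zeta>" using init[OF z0] by (simp add: u_def)
    moreover have "0 \<le> \<epsilon> * exp (k * t) * W \<zeta>" using \<epsilon> W1[OF z0] by simp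
    ultimately show False using vneg by (simp add: v_def)
  qed
  then have tpos: "0 < t" using t by simp
  have vP: "v t \<in> Polys" unfolding v_def[abs_def] u_def by (intro Polys_add Polys_sum Polys_cmult g WP)
  have "orthant_minimum (v t) \<zeta>" by standard (use vP z0 min[OF t] in auto)
  then have Lv: "0 \<le> L (v t) \<zeta>" by (rule L_nonneg_at_minimum)
  have Lv_eq: "L (v t) \<zeta> = (\<Sum>l\<in>E. exp (- l * t) * (- l * g l \<zeta>)) + \<epsilon> * exp (k * t) * L W \<zeta>"
  proof -
    have 1: "(\<lambda>\<zeta>. \<Sum>l\<in>E. exp (- l * t) * g l \<zeta>) \<in> Polys" by (intro Polys_sum Polys_cmult g)
    have 2: "(\<lambda>\<zeta>. \<epsilon> * exp (k * t) * W \<zeta>) \<in> Polys" by (intro Polys_cmult WP)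
    have 3: "L (\<lambda>\<zeta>. \<Sum>l\<in>E. exp (- l * t) * g l \<zeta>) = (\<lambda>\<zeta>. \<Sum>l\<in>E. exp (- l * t) * L (g l) \<zeta>)"
      by (rule L_sum_Polys[OF E g])
    have "(\<Sum>l\<in>E. exp (- l * t) * L (g l) \<zeta>) = (\<Sum>l\<in>E. exp (- l * t) * (- l * g l \<zeta>))"
      by (rule sum.cong) (simp_all add: eig)
    then show ?thesis
      unfolding v_def[abs_def] u_def bep_operator_add[OF 1 2] bep_operator_cmult[OF WP] 3 by simp
  qed
  (* the minimum over earlier times makes the time derivative nonpositive at t *)
  have "((\<lambda>s. v s \<zeta>) has_real_derivative ((\<Sum>l\<in>E. exp (- l * t) * (- l * g l \<zeta>)) + \<epsilon> * exp (k * t) * (k * W \<zeta>))) (at t)"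
    unfolding v_def u_def by (auto intro!: derivative_eq_intros sum.cong simp: algebra_simps)
  then have "(\<Sum>l\<in>E. exp (- l * t) * (- l * g l \<zeta>)) + \<epsilon> * exp (k * t) * (k * W \<zeta>) \<le> 0"
    by (rule deriv_at_left_min[OF _ tpos]) (use t in \<open>auto intro!: min z0\<close>)
  then have "\<epsilon> * exp (k * t) * (k * W \<zeta>) \<le> \<epsilon> * exp (k * t) * L W \<zeta>" using Lv Lv_eq by linarith
  then have "k * W \<zeta> \<le> L W \<zeta>" using \<epsilon> by (simp add: mult_le_cancel_left_pos)
  moreover have "L W \<zeta> \<le> D * W \<zeta>" using D[OF z0] by linarith
  ultimately have "W \<zeta> \<le> 0" by (simp add: k_def algebra_simps)
  then show False using W1[OF z0] by simp
qed

end

section \<open>The random walk with killing\<close>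

lemma pderiv_linear: "pderiv_at x (\<lambda>\<zeta>. \<Sum>y\<in>UNIV. a y * \<zeta> y) = (\<lambda>_. a x)" for x :: "'v::finite"
proof (rule pderiv_eqI)
  fix \<zeta> :: "'v \<Rightarrow> real"
  have "(\<Sum>y\<in>UNIV. a y * (\<zeta>(x := t)) y) = a x * t + (\<Sum>y\<in>UNIV - {x}. a y * \<zeta> y)" for t
    by (subst sum.remove[of _ x]) (auto intro!: sum.cong)
  then show "((\<lambda>t. \<Sum>y\<in>UNIV. a y * (\<zeta>(x := t)) y) has_real_derivative a x) (at (\<zeta> x))"
    by (auto intro!: derivative_eq_intros simp del: fun_upd_apply)
qed

lemma pderiv_total: "pderiv_at x (\<lambda>\<zeta>. \<Sum>y\<in>UNIV. \<zeta> y) = (\<lambda>_. 1)" for x :: "'v::finite"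
  using pderiv_linear[of x "\<lambda>_. 1"] by simp

context bep_setting
begin

definition wip :: "('v \<Rightarrow> real) \<Rightarrow> ('v \<Rightarrow> real) \<Rightarrow> real" where
  "wip f g = (\<Sum>x\<in>UNIV. \<alpha> x * (f x * g x))"

text \<open>
  The Dirichlet form of the walk on the weighted space given by \<open>wip\<close>.
\<close>

definition energy :: "('v \<Rightarrow> real) \<Rightarrow> ('v \<Rightarrow> real) \<Rightarrow> real" where
  "energy f g = 1 / 2 * (\<Sum>x\<in>UNIV. \<Sum>y\<in>UNIV. c x y * \<alpha> x * \<alpha> y * ((f x - f y) * (g x - g y)))
     + (\<Sum>x\<in>UNIV. \<alpha> x * \<omega> x * (f x * g x))"

abbreviation "T \<equiv> rw_operator c \<alpha> \<omega>"

lemma wip_T: "wip (T f) g = energy f g"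
proof -
  let ?h = "\<lambda>x y. c x y * \<alpha> x * \<alpha> y * ((f x - f y) * g x)"
  (* symmetrise in x and y *)
  have "(\<Sum>x\<in>UNIV. \<Sum>y\<in>UNIV. ?h x y) = (\<Sum>x\<in>UNIV. \<Sum>y\<in>UNIV. ?h y x)" by (rule sum.swap)
  then have "(\<Sum>x\<in>UNIV. \<Sum>y\<in>UNIV. ?h x y) = 1 / 2 * (\<Sum>x\<in>UNIV. \<Sum>y\<in>UNIV. ?h x y + ?h y x)"
    by (simp add: sum.distrib)
  also have "(\<Sum>x\<in>UNIV. \<Sum>y\<in>UNIV. ?h x y + ?h y x) = (\<Sum>x\<in>UNIV. \<Sum>y\<in>UNIV. c x y * \<alpha> x * \<alpha> y * ((f x - f y) * (g x - g y)))"
    by (intro sum.cong refl) (simp add: c_sym algebra_simps)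
  finally have "(\<Sum>x\<in>UNIV. \<Sum>y\<in>UNIV. ?h x y) = 1 / 2 * (\<Sum>x\<in>UNIV. \<Sum>y\<in>UNIV. c x y * \<alpha> x * \<alpha> y * ((f x - f y) * (g x - g y)))" .
  moreover have "wip (T f) g = (\<Sum>x\<in>UNIV. \<Sum>y\<in>UNIV. ?h x y) + (\<Sum>x\<in>UNIV. \<alpha> x * \<omega> x * (f x * g x))"
    unfolding wip_def rw_operator_def sum.distrib[symmetric]
  proof (rule sum.cong[OF refl])
    fix x
    have "\<alpha> x * (- (\<Sum>y\<in>UNIV. c x y * \<alpha> y * (f y - f x)) * g x) = (\<Sum>y\<in>UNIV. ?h x y)"
      unfolding sum_negf[symmetric] sum_distrib_left sum_distrib_right by (rule sum.cong) (simp_all add: algebra_simps)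
    then show "\<alpha> x * ((- (\<Sum>y\<in>UNIV. c x y * \<alpha> y * (f y - f x)) + \<omega> x * f x) * g x) = (\<Sum>y\<in>UNIV. ?h x y) + \<alpha> x * \<omega> x * (f x * g x)"
      by (simp only: distrib_right distrib_left mult.assoc)
  qed
  ultimately show ?thesis by (simp add: energy_def)
qed

lemma wip_sym: "wip f g = wip g f" and energy_sym: "energy f g = energy g f"
  by (simp_all add: wip_def energy_def mult.commute)

lemma wip_nonneg: "0 \<le> wip f f"
  unfolding wip_def by (intro sum_nonneg mult_nonneg_nonneg[OF less_imp_le[OF alpha] zero_le_square])

lemma wip_zero: assumes "wip f f = 0" shows "f = 0"
proof
  fix x
  have "\<forall>x\<in>UNIV. \<alpha> x * (f x * f x) = 0"
    using assms unfolding wip_def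
    by (subst (asm) sum_nonneg_eq_0_iff) (auto intro!: mult_nonneg_nonneg[OF less_imp_le[OF alpha] zero_le_square])
  then have "\<alpha> x * (f x * f x) = 0" by blast
  then show "f x = 0 x" using alpha[of x] by simp
qed

definition unit :: "'v \<Rightarrow> 'v \<Rightarrow> real" where
  "unit x = (\<lambda>z. if z = x then 1 else 0)"

interpretation RW: symmetric_operator UNIV "range unit" T wip
proof
  show "FV.subspace (UNIV :: ('v \<Rightarrow> real) set)" by (rule FV.subspace_UNIV)
  show "finite (range unit)" by simp
  show "UNIV \<subseteq> FV.span (range unit)"
  proof
    fix f :: "'v \<Rightarrow> real"
    have "f = (\<Sum>x\<in>UNIV. scl (f x) (unit x))"
      by (rule ext) (simp add: sum_fun_apply unit_def if_distrib[of "\<lambda>a. _ * a"] cong: if_cong)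
    moreover have "(\<Sum>x\<in>UNIV. scl (f x) (unit x)) \<in> FV.span (range unit)"
      by (intro FV.span_sum FV.span_scale FV.span_base) auto
    ultimately show "f \<in> FV.span (range unit)" by simp
  qed
  show "T (f + g) = T f + T g" for f g
    by (rule ext) (simp add: rw_operator_def algebra_simps sum.distrib sum_subtractf sum_distrib_left)
  show "T (scl r f) = scl r (T f)" for r f
    by (rule ext) (simp add: rw_operator_def algebra_simps sum_distrib_left sum_subtractf)
  show "wip f g = wip g f" for f g by (rule wip_sym)
  show "wip (f + g) h = wip f h + wip g h" for f g h by (simp add: wip_def algebra_simps sum.distrib)
  show "wip (scl r f) h = r * wip f h" for r f h by (simp add: wip_def algebra_simps sum_distrib_left)
  show "0 \<le> wip f f" for f by (rule wip_nonneg)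
  show "wip f f = 0 \<Longrightarrow> f = 0" for f by (rule wip_zero)
  show "wip (T f) g = wip f (T g)" for f g
    using wip_T[of f g] wip_T[of g f] energy_sym[of f g] wip_sym[of f "T g"] by simp
qed auto

definition rw_eigenvalues :: "real set" where
  "rw_eigenvalues = {l. \<exists>f. f \<noteq> (\<lambda>_. 0) \<and> (\<forall>x. T f x = l * f x)}"

lemma gap_RW_eq: "gap_RW c \<alpha> \<omega> = Min rw_eigenvalues"
  by (simp add: gap_RW_def rw_eigenvalues_def)

lemma rw_eigenvaluesI: "T f = scl l f \<Longrightarrow> f \<noteq> 0 \<Longrightarrow> l \<in> rw_eigenvalues"
  by (auto simp: rw_eigenvalues_def zero_fun_def)

lemma rw_eigenvaluesE: assumes "l \<in> rw_eigenvalues" obtains f where "T f = scl l f" "f \<noteq> 0"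
  using assms by (auto simp: rw_eigenvalues_def zero_fun_def fun_eq_iff)

lemma rw_decomposition: "\<exists>E g. finite E \<and> (\<forall>l\<in>E. T (g l) = scl l (g l)) \<and> f = sum g E"
  by (rule RW.spectral_decomposition[OF UNIV_I, of f]) blast

text \<open>
  The unit vectors are finite sums of eigenvectors. An eigenvector whose eigenvalue does not occur
  in any of these sums would be orthogonal to all of them.
\<close>

lemma rw_eigenvalues_finite: "finite rw_eigenvalues" and rw_eigenvalues_nonempty: "rw_eigenvalues \<noteq> {}"
proof -
  have "\<forall>x. \<exists>E g. finite E \<and> (\<forall>l\<in>E. T (g l) = scl l (g l)) \<and> unit x = sum g E"
    using rw_decomposition by blast
  then obtain E g where E: "\<And>x. finite (E x)" "\<And>x l. l \<in> E x \<Longrightarrow> T (g x l) = scl l (g x l)" "\<And>x. unit x = sum (g x) (E x)"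
    by metis
  have sub: "rw_eigenvalues \<subseteq> (\<Union>x. E x)"
  proof
    fix l assume "l \<in> rw_eigenvalues"
    then obtain f where f: "T f = scl l f" "f \<noteq> 0" by (rule rw_eigenvaluesE)
    show "l \<in> (\<Union>x. E x)"
    proof (rule ccontr)
      assume l: "l \<notin> (\<Union>x. E x)"
      have "f x = 0" for x
      proof -
        have "wip (unit x) f = (\<Sum>m\<in>E x. wip (g x m) f)" unfolding E(3)[of x] by (rule RW.ip_sum) auto
        also have "\<dots> = 0"
          using E(2)[of _ x] f(1) l by (intro sum.neutral ballI RW.eigen_orthogonal[of _ _ _ l]) auto
        finally have "wip (unit x) f = 0" .
        moreover have "wip (unit x) f = \<alpha> x * f x"
          by (simp add: wip_def unit_def if_distrib[of "\<lambda>a. a * _"] if_distrib[of "\<lambda>a. _ * a"] cong: if_cong)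
        ultimately show "f x = 0" using alpha[of x] by simp
      qed
      then show False using f(2) by (auto simp: fun_eq_iff)
    qed
  qed
  show "finite rw_eigenvalues" by (rule finite_subset[OF sub]) (simp add: E(1))
  obtain x :: 'v where True by simp
  have "unit x \<noteq> 0" by (auto simp: unit_def fun_eq_iff)
  then obtain l where "l \<in> E x" "g x l \<noteq> 0" using E(3)[of x] by (metis sum.neutral)
  then have "l \<in> rw_eigenvalues" using E(2) by (intro rw_eigenvaluesI) auto
  then show "rw_eigenvalues \<noteq> {}" by auto
qed

definition lam :: real where "lam = Min rw_eigenvalues"

lemma lam_mem: "lam \<in> rw_eigenvalues" and lam_le: "l \<in> rw_eigenvalues \<Longrightarrow> lam \<le> l"
  unfolding lam_def using rw_eigenvalues_finite rw_eigenvalues_nonempty by auto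

text \<open>
  The variational characterisation of the lowest eigenvalue, with the case of equality, by
  expanding \<open>f\<close> into eigenvectors.
\<close>

lemma rayleigh:
  shows "lam * wip f f \<le> wip (T f) f" and "wip (T f) f = lam * wip f f \<Longrightarrow> T f = scl lam f"
proof -
  obtain E g where E: "finite E" "\<And>l. l \<in> E \<Longrightarrow> T (g l) = scl l (g l)" "f = sum g E"
    using rw_decomposition[of f] by blast
  have ort: "wip (g l) (g m) = 0" if "l \<in> E" "m \<in> E" "l \<noteq> m" for l m
    using RW.eigen_orthogonal[of "g l" "g m" l m] E(2) that by auto
  have ff: "wip (g l) f = wip (g l) (g l)" if "l \<in> E" for l
  proof -
    have "wip f (g l) = (\<Sum>m\<in>E. wip (g m) (g l))" unfolding E(3) by (rule RW.ip_sum) auto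
    also have "\<dots> = wip (g l) (g l)" using E(1) that ort by (subst sum.remove[of _ l]) (auto intro!: sum.neutral)
    finally show ?thesis by (simp add: wip_sym)
  qed
  have d: "T f - scl lam f = (\<Sum>l\<in>E. scl (l - lam) (g l))"
  proof -
    have "T f = (\<Sum>l\<in>E. scl l (g l))" unfolding E(3) using E(2) by (subst RW.T_sum) (auto intro: sum.cong)
    then show ?thesis
      by (simp add: fun_eq_iff sum_fun_apply E(3) sum_distrib_left sum_subtractf[symmetric] left_diff_distrib)
  qed
  have eq: "wip (T f) f - lam * wip f f = (\<Sum>l\<in>E. (l - lam) * wip (g l) (g l))"
  proof -
    have "wip (T f) f - lam * wip f f = wip (T f - scl lam f) f" by (simp add: RW.ip_diff RW.ip_scl)
    also have "\<dots> = (\<Sum>l\<in>E. wip (scl (l - lam) (g l)) f)" unfolding d by (rule RW.ip_sum) auto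
    also have "\<dots> = (\<Sum>l\<in>E. (l - lam) * wip (g l) (g l))" by (rule sum.cong) (auto simp: RW.ip_scl ff)
    finally show ?thesis .
  qed
  have nn: "0 \<le> (l - lam) * wip (g l) (g l)" if "l \<in> E" for l
  proof (cases "g l = 0")
    case True then show ?thesis using RW.ip_0 by simp
  next
    case False
    then have "lam \<le> l" using E(2)[OF that] by (intro lam_le rw_eigenvaluesI) auto
    then show ?thesis using wip_nonneg by simp
  qed
  show "lam * wip f f \<le> wip (T f) f" using eq sum_nonneg[of E "\<lambda>l. (l - lam) * wip (g l) (g l)"] nn by simp
  assume "wip (T f) f = lam * wip f f"
  then have "(\<Sum>l\<in>E. (l - lam) * wip (g l) (g l)) = 0" using eq by simp
  then have z: "(l - lam) * wip (g l) (g l) = 0" if "l \<in> E" for l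
    using sum_nonneg_eq_0_iff[OF E(1) nn] that by simp
  have "scl (l - lam) (g l) = 0" if "l \<in> E" for l
    using z[OF that] wip_zero[of "g l"] by (cases "l = lam") auto
  then have "T f - scl lam f = 0" unfolding d by (intro sum.neutral) auto
  then show "T f = scl lam f" by simp
qed

text \<open>
  The modulus of an eigenvector to the lowest eigenvalue has no larger energy, so it is again an
  eigenvector. By the eigenvalue equation its zero set is closed under passing to neighbours, hence
  empty by connectedness.
\<close>

lemma rw_ground_state: "\<exists>a. (\<forall>x. 0 < a x) \<and> (\<forall>x. T a x = lam * a x)"
proof -
  obtain f where f: "T f = scl lam f" "f \<noteq> 0" using lam_mem by (rule rw_eigenvaluesE)
  define a where "a x = \<bar>f x\<bar>" for x
  have a0: "0 \<le> a x" for x by (simp add: a_def)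
  have "energy a a \<le> energy f f"
  proof -
    have "(\<bar>f x\<bar> - \<bar>f y\<bar>) * (\<bar>f x\<bar> - \<bar>f y\<bar>) \<le> (f x - f y) * (f x - f y)" for x y
    proof -
      have "\<bar>\<bar>f x\<bar> - \<bar>f y\<bar>\<bar>\<^sup>2 \<le> \<bar>f x - f y\<bar>\<^sup>2" by (intro power_mono abs_triangle_ineq3) simp
      then show ?thesis by (simp add: power2_eq_square)
    qed
    then show ?thesis unfolding energy_def a_def
      using alpha c_nonneg omega
      by (intro add_mono mult_left_mono sum_mono) (auto intro!: mult_nonneg_nonneg less_imp_le[OF alpha])
  qed
  moreover have "wip a a = wip f f" by (simp add: wip_def a_def)
  moreover have "energy f f = lam * wip f f" using wip_T[of f f] f by (simp add: RW.ip_scl)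
  ultimately have "wip (T a) a = lam * wip a a" using rayleigh(1)[of a] wip_T[of a a] by simp
  then have Ta: "T a = scl lam a" by (rule rayleigh(2))
  have nb: "a y = 0" if "a x = 0" "0 < c x y" for x y
  proof -
    have "(\<Sum>y\<in>UNIV. c x y * \<alpha> y * a y) = 0" using fun_cong[OF Ta, of x] that(1) by (simp add: rw_operator_def)
    then have "\<forall>y\<in>UNIV. c x y * \<alpha> y * a y = 0"
      by (subst (asm) sum_nonneg_eq_0_iff) (auto intro!: mult_nonneg_nonneg c_nonneg less_imp_le[OF alpha] a0)
    then have "c x y * \<alpha> y * a y = 0" by blast
    then show ?thesis using that(2) alpha[of y] by simp
  qed
  have "a x \<noteq> 0" for x
  proof
    assume x: "a x = 0"
    have "a y = 0" for y
    proof (cases "x = y")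
      case False
      have "(\<lambda>u v. 0 < c u v)\<^sup>*\<^sup>* x y" by (rule c_connected[OF False])
      then show ?thesis by (induction rule: rtranclp_induct) (use x nb in auto)
    qed (use x in simp)
    then show False using f(2) by (auto simp: a_def fun_eq_iff)
  qed
  then have "0 < a x" for x using a0[of x] by (simp add: less_le)
  then show ?thesis using Ta by (intro exI[of _ a]) simp
qed

text \<open>
  Test the eigenvalue equation of the ground state against the constants: the exchange terms cancel
  and the killing remains.
\<close>

lemma lam_pos: "0 < lam"
proof -
  obtain a where a: "\<And>x. 0 < a x" "\<And>x. T a x = lam * a x" using rw_ground_state by blast
  have "wip (T a) (\<lambda>_. 1) = energy a (\<lambda>_. 1)" by (rule wip_T)
  then have "lam * (\<Sum>x\<in>UNIV. \<alpha> x * a x) = (\<Sum>x\<in>UNIV. \<alpha> x * \<omega> x * a x)"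
    by (simp add: wip_def energy_def a sum_distrib_left mult.left_commute)
  moreover have "0 < (\<Sum>x\<in>UNIV. \<alpha> x * \<omega> x * a x)"
  proof -
    obtain x where "\<omega> x \<noteq> 0" using omega_nz by blast
    then have "0 < \<omega> x" using omega[of x] by simp
    then show ?thesis using alpha a omega
      by (intro sum_pos2[of UNIV x]) (auto intro!: mult_nonneg_nonneg less_imp_le[OF alpha] less_imp_le[OF a(1)])
  qed
  moreover have "0 < (\<Sum>x\<in>UNIV. \<alpha> x * a x)" using alpha a by (intro sum_pos) auto
  ultimately show ?thesis by (metis zero_less_mult_pos2)
qed

section \<open>The spectral gap of polynomials\<close>

text \<open>
  Differentiate the scaling relation. It is stated with the factor \<open>r\<close> on the left to avoid
  \<open>k - 1\<close>.
\<close>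

lemma hom_deg_pderiv:
  fixes F :: "('v \<Rightarrow> real) \<Rightarrow> real"
  assumes "F \<in> Polys" "\<And>r \<zeta>. F (\<lambda>z. r * \<zeta> z) = r ^ k * F \<zeta>"
  shows "r * pderiv_at x F (\<lambda>z. r * \<zeta> z) = r ^ k * pderiv_at x F \<zeta>"
proof -
  have "has_grad (\<lambda>\<zeta>. F (\<lambda>z. r * \<zeta> z)) (\<lambda>x \<zeta>. r * pderiv_at x F (\<lambda>z. r * \<zeta> z))"
    unfolding has_grad_def
  proof (intro allI)
    fix \<zeta> v :: "'v \<Rightarrow> real" and s
    have l: "(\<lambda>z. r * line \<zeta> v s z) = line (\<lambda>z. r * \<zeta> z) (\<lambda>z. r * v z) s" for s by (auto simp: line_def algebra_simps)
    have "((\<lambda>s. F (line (\<lambda>z. r * \<zeta> z) (\<lambda>z. r * v z) s)) has_real_derivative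
        (\<Sum>x\<in>UNIV. r * v x * pderiv_at x F (line (\<lambda>z. r * \<zeta> z) (\<lambda>z. r * v z) s))) (at s)"
      using Polys_grad[OF assms(1)] unfolding has_grad_def by blast
    then show "((\<lambda>s. F (\<lambda>z. r * line \<zeta> v s z)) has_real_derivative (\<Sum>x\<in>UNIV. v x * (r * pderiv_at x F (\<lambda>z. r * line \<zeta> v s z)))) (at s)"
      unfolding l by (simp add: mult_ac)
  qed
  from has_grad_coord(2)[OF this, of x]
  have 1: "pderiv_at x (\<lambda>\<zeta>. F (\<lambda>z. r * \<zeta> z)) = (\<lambda>\<zeta>. r * pderiv_at x F (\<lambda>z. r * \<zeta> z))" .
  have 2: "pderiv_at x (\<lambda>\<zeta>. F (\<lambda>z. r * \<zeta> z)) = (\<lambda>\<zeta>. r ^ k * pderiv_at x F \<zeta>)"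
    unfolding assms(2) by (rule Polys_pderiv_cmult[OF assms(1)])
  show ?thesis using fun_cong[OF 1, of \<zeta>] fun_cong[OF 2, of \<zeta>] by simp
qed

lemma hom_deg_pderiv2:
  fixes F :: "('v \<Rightarrow> real) \<Rightarrow> real"
  assumes "F \<in> Polys" "\<And>r \<zeta>. F (\<lambda>z. r * \<zeta> z) = r ^ k * F \<zeta>"
  shows "r * (r * pderiv_at y (pderiv_at x F) (\<lambda>z. r * \<zeta> z)) = r ^ k * pderiv_at y (pderiv_at x F) \<zeta>"
proof -
  have P: "pderiv_at x F \<in> Polys" by (rule Polys_pderiv[OF assms(1)])
  have "has_grad (\<lambda>\<zeta>. r * pderiv_at x F (\<lambda>z. r * \<zeta> z)) (\<lambda>y \<zeta>. r * (r * pderiv_at y (pderiv_at x F) (\<lambda>z. r * \<zeta> z)))"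
    unfolding has_grad_def
  proof (intro allI)
    fix \<zeta> v :: "'v \<Rightarrow> real" and s
    have l: "(\<lambda>z. r * line \<zeta> v s z) = line (\<lambda>z. r * \<zeta> z) (\<lambda>z. r * v z) s" for s by (auto simp: line_def algebra_simps)
    have "((\<lambda>s. pderiv_at x F (line (\<lambda>z. r * \<zeta> z) (\<lambda>z. r * v z) s)) has_real_derivative
        (\<Sum>y\<in>UNIV. r * v y * pderiv_at y (pderiv_at x F) (line (\<lambda>z. r * \<zeta> z) (\<lambda>z. r * v z) s))) (at s)"
      using Polys_grad[OF P] unfolding has_grad_def by blast
    from DERIV_cmult[OF this, of r]
    show "((\<lambda>s. r * pderiv_at x F (\<lambda>z. r * line \<zeta> v s z)) has_real_derivative (\<Sum>y\<in>UNIV. v y * (r * (r * pderiv_at y (pderiv_at x F) (\<lambda>z. r * line \<zeta> v s z))))) (at s)"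
      unfolding l by (simp add: mult_ac sum_distrib_left)
  qed
  from has_grad_coord(2)[OF this, of y]
  have 1: "pderiv_at y (\<lambda>\<zeta>. r * pderiv_at x F (\<lambda>z. r * \<zeta> z)) = (\<lambda>\<zeta>. r * (r * pderiv_at y (pderiv_at x F) (\<lambda>z. r * \<zeta> z)))" .
  have 2: "pderiv_at y (\<lambda>\<zeta>. r * pderiv_at x F (\<lambda>z. r * \<zeta> z)) = (\<lambda>\<zeta>. r ^ k * pderiv_at y (pderiv_at x F) \<zeta>)"
    unfolding hom_deg_pderiv[OF assms] by (rule Polys_pderiv_cmult[OF P])
  show ?thesis using fun_cong[OF 1, of \<zeta>] fun_cong[OF 2, of \<zeta>] by simp
qed

text \<open>
  The conservative part of the generator. Together with \<open>killing\<close> it preserves homogeneity, whereas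
  \<open>noise\<close>, the part that is proportional to \<open>\<rho>\<close>, lowers the degree by one.
\<close>

definition bulk :: "(('v \<Rightarrow> real) \<Rightarrow> real) \<Rightarrow> ('v \<Rightarrow> real) \<Rightarrow> real" where
  "bulk F \<zeta> = 1 / 2 * (\<Sum>x\<in>UNIV. \<Sum>y\<in>UNIV. c x y *
        (- (\<alpha> y * \<zeta> x - \<alpha> x * \<zeta> y) * pderiv_diff x y F \<zeta>
          + \<zeta> x * \<zeta> y * pderiv_diff x y (pderiv_diff x y F) \<zeta>))"

definition killing :: "(('v \<Rightarrow> real) \<Rightarrow> real) \<Rightarrow> ('v \<Rightarrow> real) \<Rightarrow> real" where
  "killing F \<zeta> = (\<Sum>x\<in>UNIV. \<omega> x * (\<zeta> x * pderiv_at x F \<zeta>))"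

definition noise :: "(('v \<Rightarrow> real) \<Rightarrow> real) \<Rightarrow> ('v \<Rightarrow> real) \<Rightarrow> real" where
  "noise F \<zeta> = (\<Sum>x\<in>UNIV. \<omega> x * (\<alpha> x * \<rho> * pderiv_at x F \<zeta> + \<rho> * \<zeta> x * pderiv_at x (pderiv_at x F) \<zeta>))"

lemma L_split: "L F \<zeta> = bulk F \<zeta> - killing F \<zeta> + noise F \<zeta>"
proof -
  have "(\<Sum>x\<in>UNIV. \<omega> x * ((\<alpha> x * \<rho> - \<zeta> x) * pderiv_at x F \<zeta> + \<rho> * \<zeta> x * pderiv_at x (pderiv_at x F) \<zeta>)) = noise F \<zeta> - killing F \<zeta>"
    unfolding noise_def killing_def sum_subtractf[symmetric] by (rule sum.cong) (simp_all add: algebra_simps)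
  then show ?thesis by (simp add: bep_operator_def bulk_def)
qed

lemma bulk_scaling:
  assumes F: "hom_deg k F" shows "bulk F (\<lambda>z. r * \<zeta> z) = r ^ k * bulk F \<zeta>"
proof -
  have P: "F \<in> Polys" and h: "\<And>r \<zeta>. F (\<lambda>z. r * \<zeta> z) = r ^ k * F \<zeta>" using F by (auto simp: hom_deg_def)
  have d1: "r * pderiv_diff x y F (\<lambda>z. r * \<zeta> z) = r ^ k * pderiv_diff x y F \<zeta>" for x y
    using hom_deg_pderiv[OF P h, of r x \<zeta>] hom_deg_pderiv[OF P h, of r y \<zeta>] by (simp add: pderiv_diff_def right_diff_distrib)
  have d2: "r * (r * pderiv_diff x y (pderiv_diff x y F) (\<lambda>z. r * \<zeta> z)) = r ^ k * pderiv_diff x y (pderiv_diff x y F) \<zeta>" for x y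
    unfolding pderiv_diff2_Polys[OF P] right_diff_distrib hom_deg_pderiv2[OF P h] by simp
  have "c x y * (- (\<alpha> y * (r * \<zeta> x) - \<alpha> x * (r * \<zeta> y)) * A + (r * \<zeta> x) * (r * \<zeta> y) * B)
     = c x y * (- (\<alpha> y * \<zeta> x - \<alpha> x * \<zeta> y) * (r * A) + \<zeta> x * \<zeta> y * (r * (r * B)))" for x y A B
    by (simp add: algebra_simps)
  then show ?thesis unfolding bulk_def
    by (simp only: d1 d2 sum_distrib_left) (simp only: algebra_simps)
qed

lemma killing_scaling:
  assumes F: "hom_deg k F" shows "killing F (\<lambda>z. r * \<zeta> z) = r ^ k * killing F \<zeta>"
proof -
  have P: "F \<in> Polys" and h: "\<And>r \<zeta>. F (\<lambda>z. r * \<zeta> z) = r ^ k * F \<zeta>" using F by (auto simp: hom_deg_def)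
  have "\<omega> x * (r * \<zeta> x * A) = \<omega> x * \<zeta> x * (r * A)" for x A by (simp add: mult_ac)
  then show ?thesis unfolding killing_def
    by (simp only: hom_deg_pderiv[OF P h] sum_distrib_left) (simp only: mult_ac)
qed

lemma noise_scaling:
  assumes F: "hom_deg k F" shows "r * noise F (\<lambda>z. r * \<zeta> z) = r ^ k * noise F \<zeta>"
proof -
  have P: "F \<in> Polys" and h: "\<And>r \<zeta>. F (\<lambda>z. r * \<zeta> z) = r ^ k * F \<zeta>" using F by (auto simp: hom_deg_def)
  have "r * (\<omega> x * (\<alpha> x * \<rho> * A + \<rho> * (r * \<zeta> x) * B)) = \<omega> x * (\<alpha> x * \<rho> * (r * A) + \<rho> * \<zeta> x * (r * (r * B)))" for x A B
    by (simp add: algebra_simps)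
  then show ?thesis unfolding noise_def
    by (simp only: hom_deg_pderiv[OF P h] hom_deg_pderiv2[OF P h] sum_distrib_left) (simp only: algebra_simps)
qed

text \<open>
  Evaluate the eigenvalue equation at \<open>r * \<zeta>\<close>: it becomes an identity of polynomials in \<open>r\<close>, whose
  leading coefficient is the claim. Multiplying by \<open>r\<close> first makes the exponents of the noise
  terms nonnegative.
\<close>

lemma top_degree_eigen:
  assumes F: "\<And>k. hom_deg k (F k)" and f: "f = (\<lambda>\<zeta>. \<Sum>k\<le>n. F k \<zeta>)" and eig: "L f = (\<lambda>\<zeta>. - l * f \<zeta>)"
  shows "bulk (F n) \<zeta> - killing (F n) \<zeta> = - l * F n \<zeta>"
proof -
  have FP: "F k \<in> Polys" and Fh: "F k (\<lambda>z. r * \<zeta> z) = r ^ k * F k \<zeta>" for k r \<zeta> using F[of k] by (auto simp: hom_deg_def)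
  have Lf: "L f = (\<lambda>\<zeta>. \<Sum>k\<le>n. L (F k) \<zeta>)"
    using L_sum_Polys[of "{..n}" F "\<lambda>_. 1"] FP by (simp add: f)
  define A where "A k = bulk (F k) \<zeta> - killing (F k) \<zeta> + l * F k \<zeta>" for k
  (* r times the eigenvalue equation at r * \<zeta>, as a polynomial in r *)
  define q where "q = (\<Sum>k\<le>n. monom (A k) (Suc k) + monom (noise (F k) \<zeta>) k)"
  have "poly q r = 0" for r
  proof -
    have "0 = r * (L f (\<lambda>z. r * \<zeta> z) + l * f (\<lambda>z. r * \<zeta> z))" by (simp add: eig)
    also have "\<dots> = (\<Sum>k\<le>n. r * (L (F k) (\<lambda>z. r * \<zeta> z) + l * F k (\<lambda>z. r * \<zeta> z)))"
      unfolding Lf by (simp add: f sum.distrib sum_distrib_left distrib_left)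
    also have "\<dots> = (\<Sum>k\<le>n. A k * r ^ Suc k + noise (F k) \<zeta> * r ^ k)"
    proof (rule sum.cong[OF refl])
      fix k
      have "r * (L (F k) (\<lambda>z. r * \<zeta> z) + l * F k (\<lambda>z. r * \<zeta> z))
          = r * (r ^ k * (bulk (F k) \<zeta> - killing (F k) \<zeta>)) + r * noise (F k) (\<lambda>z. r * \<zeta> z) + r * (l * (r ^ k * F k \<zeta>))"
        unfolding L_split bulk_scaling[OF F] killing_scaling[OF F] Fh by (simp add: algebra_simps)
      then show "r * (L (F k) (\<lambda>z. r * \<zeta> z) + l * F k (\<lambda>z. r * \<zeta> z)) = A k * r ^ Suc k + noise (F k) \<zeta> * r ^ k"
        unfolding noise_scaling[OF F] by (simp add: A_def algebra_simps)
    qed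
    also have "\<dots> = poly q r" by (simp add: q_def poly_sum poly_monom)
    finally show ?thesis by simp
  qed
  then have "q = 0" using poly_all_0_iff_0[of q] by blast
  then have "coeff q (Suc n) = 0" by simp
  moreover have "coeff q (Suc n) = (\<Sum>k\<le>n. (if k = n then A k else 0))"
    unfolding q_def by (simp add: coeff_sum)
  ultimately have "A n = 0" by simp
  then show ?thesis by (simp add: A_def)
qed

text \<open>
  All partial derivatives of a power of the total mass coincide, so that it is annihilated by
  \<open>\<partial>\<^sub>x - \<partial>\<^sub>y\<close>.
\<close>

lemma total_power_pderiv:
  "\<exists>R\<in>Polys. (\<forall>x. pderiv_at x (\<lambda>\<zeta>::'v \<Rightarrow> real. (\<Sum>x\<in>UNIV. \<zeta> x) ^ m) = R) \<and> (\<forall>\<zeta>. (\<forall>x. 0 \<le> \<zeta> x) \<longrightarrow> 0 \<le> R \<zeta>)"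
proof (induction m)
  case 0
  show ?case by (rule bexI[of _ "\<lambda>_. 0"]) (simp_all add: pderiv_const Polys_const)
next
  case (Suc m)
  then obtain R where R: "R \<in> Polys" "\<And>x. pderiv_at x (\<lambda>\<zeta>::'v \<Rightarrow> real. (\<Sum>x\<in>UNIV. \<zeta> x) ^ m) = R" "\<And>\<zeta>. (\<forall>x. 0 \<le> \<zeta> x) \<Longrightarrow> 0 \<le> R \<zeta>" by blast
  let ?S = "\<lambda>\<zeta>::'v \<Rightarrow> real. (\<Sum>x\<in>UNIV. \<zeta> x)"
  have S: "?S \<in> Polys" by (intro Polys_sum Polys_coord)
  have dS: "pderiv_at x ?S = (\<lambda>_. 1)" for x by (rule pderiv_total)
  have "pderiv_at x (\<lambda>\<zeta>. ?S \<zeta> ^ Suc m) = (\<lambda>\<zeta>. ?S \<zeta> ^ m + ?S \<zeta> * R \<zeta>)" for x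
    using Polys_pderiv_mult[OF S Polys_power[OF S, of m], of x] by (simp add: dS R(2))
  moreover have "(\<lambda>\<zeta>. ?S \<zeta> ^ m + ?S \<zeta> * R \<zeta>) \<in> Polys" by (intro Polys_add Polys_mult Polys_power S R)
  moreover have "0 \<le> ?S \<zeta> ^ m + ?S \<zeta> * R \<zeta>" if "\<forall>x. 0 \<le> \<zeta> x" for \<zeta>
    using R(3)[OF that] that by (simp add: sum_nonneg)
  ultimately show ?case by (intro bexI[of _ "\<lambda>\<zeta>. ?S \<zeta> ^ m + ?S \<zeta> * R \<zeta>"]) auto
qed

text \<open>
  The exchange acts on the coefficients of a linear function as the generator \<open>- (T - \<omega>)\<close> of the
  walk without killing.
\<close>

lemma linear_bulk:
  assumes "\<And>x. T a x = lam * a x"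
  shows "1 / 2 * (\<Sum>x\<in>UNIV. \<Sum>y\<in>UNIV. c x y * (- (\<alpha> y * \<zeta> x - \<alpha> x * \<zeta> y) * (a x - a y)))
    = (\<Sum>x\<in>UNIV. (\<omega> x * a x - lam * a x) * \<zeta> x)"
proof -
  let ?g = "\<lambda>x y. c x y * \<alpha> y * \<zeta> x * (a y - a x)"
  have half_double: "1 / 2 * (A + B) = A" if "B = A" for A B :: real using that by simp
  have "(\<Sum>x\<in>UNIV. \<Sum>y\<in>UNIV. c x y * (- (\<alpha> y * \<zeta> x - \<alpha> x * \<zeta> y) * (a x - a y))) = (\<Sum>x\<in>UNIV. \<Sum>y\<in>UNIV. ?g x y + ?g y x)"
    by (intro sum.cong refl) (simp add: c_sym algebra_simps)
  moreover have "(\<Sum>x\<in>UNIV. \<Sum>y\<in>UNIV. ?g y x) = (\<Sum>x\<in>UNIV. \<Sum>y\<in>UNIV. ?g x y)" by (rule sum.swap)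
  then have "1 / 2 * (\<Sum>x\<in>UNIV. \<Sum>y\<in>UNIV. ?g x y + ?g y x) = (\<Sum>x\<in>UNIV. \<Sum>y\<in>UNIV. ?g x y)"
    unfolding sum.distrib by (rule half_double)
  moreover have "(\<Sum>x\<in>UNIV. \<Sum>y\<in>UNIV. ?g x y) = (\<Sum>x\<in>UNIV. (\<omega> x * a x - lam * a x) * \<zeta> x)"
  proof (rule sum.cong[OF refl])
    fix x
    have "(\<Sum>y\<in>UNIV. c x y * \<alpha> y * (a y - a x)) = \<omega> x * a x - lam * a x"
      using assms[of x] by (simp add: rw_operator_def)
    moreover have "(\<Sum>y\<in>UNIV. ?g x y) = (\<Sum>y\<in>UNIV. c x y * \<alpha> y * (a y - a x)) * \<zeta> x"
      unfolding sum_distrib_right by (rule sum.cong) simp_all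
    ultimately show "(\<Sum>y\<in>UNIV. ?g x y) = (\<omega> x * a x - lam * a x) * \<zeta> x" by simp
  qed
  ultimately show ?thesis by (simp only:)
qed

text \<open>
  The exchange sees the power of the total mass as a constant and multiplies the linear factor as
  in \<open>linear_bulk\<close>. The killing of the linear factor restores the eigenvalue \<open>- lam\<close>, and the
  killing of the power only decreases the result.
\<close>

lemma supersolution:
  assumes a: "\<And>x. 0 < a x" "\<And>x. T a x = lam * a x" and z: "\<And>x. 0 \<le> \<zeta> x"
  shows "bulk (\<lambda>\<zeta>. (\<Sum>x\<in>UNIV. a x * \<zeta> x) * (\<Sum>x\<in>UNIV. \<zeta> x) ^ m) \<zeta>
       - killing (\<lambda>\<zeta>. (\<Sum>x\<in>UNIV. a x * \<zeta> x) * (\<Sum>x\<in>UNIV. \<zeta> x) ^ m) \<zeta>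
     \<le> - lam * ((\<Sum>x\<in>UNIV. a x * \<zeta> x) * (\<Sum>x\<in>UNIV. \<zeta> x) ^ m)"
proof -
  let ?A = "\<lambda>\<zeta>::'v \<Rightarrow> real. (\<Sum>x\<in>UNIV. a x * \<zeta> x)" and ?Sm = "\<lambda>\<zeta>::'v \<Rightarrow> real. (\<Sum>x\<in>UNIV. \<zeta> x) ^ m"
  let ?H = "\<lambda>\<zeta>. ?A \<zeta> * ?Sm \<zeta>"
  obtain R where R: "R \<in> Polys" "\<And>x. pderiv_at x ?Sm = R" "\<And>\<zeta>. (\<forall>x. 0 \<le> \<zeta> x) \<Longrightarrow> 0 \<le> R \<zeta>"
    using total_power_pderiv[of m] by blast
  have AP: "?A \<in> Polys" by (intro Polys_sum Polys_cmult Polys_coord)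
  have SP: "?Sm \<in> Polys" by (intro Polys_power Polys_sum Polys_coord)
  have dA: "pderiv_at x ?A = (\<lambda>_. a x)" for x by (rule pderiv_linear)
  have dH: "pderiv_at x ?H = (\<lambda>\<zeta>. a x * ?Sm \<zeta> + ?A \<zeta> * R \<zeta>)" for x
    using Polys_pderiv_mult[OF AP SP, of x] by (simp add: dA R(2))
  have dd: "pderiv_diff x y ?H = (\<lambda>\<zeta>. (a x - a y) * ?Sm \<zeta>)" for x y
    by (rule ext) (unfold pderiv_diff_def dH, simp add: algebra_simps)
  have ddd: "pderiv_diff x y (pderiv_diff x y ?H) = (\<lambda>_. 0)" for x y
    unfolding dd by (rule ext) (simp add: pderiv_diff_def Polys_pderiv_cmult[OF SP] R(2))
  have bulk: "bulk ?H \<zeta> = (\<Sum>x\<in>UNIV. (\<omega> x * a x - lam * a x) * \<zeta> x) * ?Sm \<zeta>"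
  proof -
    have "c x y * (- (\<alpha> y * \<zeta> x - \<alpha> x * \<zeta> y) * ((a x - a y) * s) + \<zeta> x * \<zeta> y * 0)
        = c x y * (- (\<alpha> y * \<zeta> x - \<alpha> x * \<zeta> y) * (a x - a y)) * s" for x y s
      by (simp only: mult_zero_right add_0_right mult.assoc)
    then show ?thesis
      unfolding bulk_def ddd unfolding dd linear_bulk[OF a(2), symmetric] by (simp only: sum_distrib_right mult.assoc)
  qed
  have "killing ?H \<zeta> = (\<Sum>x\<in>UNIV. \<omega> x * a x * \<zeta> x) * ?Sm \<zeta> + (\<Sum>x\<in>UNIV. \<omega> x * \<zeta> x) * (?A \<zeta> * R \<zeta>)"
  proof -
    have "(\<Sum>x\<in>UNIV. \<omega> x * (\<zeta> x * (a x * s + B))) = (\<Sum>x\<in>UNIV. \<omega> x * a x * \<zeta> x) * s + (\<Sum>x\<in>UNIV. \<omega> x * \<zeta> x) * B" for s B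
      by (simp add: distrib_left sum.distrib sum_distrib_left mult_ac)
    then show ?thesis unfolding killing_def dH .
  qed
  moreover have "0 \<le> (\<Sum>x\<in>UNIV. \<omega> x * \<zeta> x) * (?A \<zeta> * R \<zeta>)"
    using z omega a(1) R(3)[of \<zeta>]
    by (intro mult_nonneg_nonneg sum_nonneg) (auto intro: less_imp_le)
  moreover have "(\<Sum>x\<in>UNIV. (\<omega> x * a x - lam * a x) * \<zeta> x) * ?Sm \<zeta>
     = (\<Sum>x\<in>UNIV. \<omega> x * a x * \<zeta> x) * ?Sm \<zeta> - lam * ?H \<zeta>"
    by (simp add: left_diff_distrib sum_subtractf sum_distrib_left mult.assoc)
  ultimately show ?thesis unfolding bulk by simp
qed

lemma bulk_killing_linear:
  assumes "F \<in> Polys" "G \<in> Polys"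
  shows "bulk (\<lambda>\<zeta>. k * F \<zeta> - G \<zeta>) \<zeta> = k * bulk F \<zeta> - bulk G \<zeta>"
    and "killing (\<lambda>\<zeta>. k * F \<zeta> - G \<zeta>) \<zeta> = k * killing F \<zeta> - killing G \<zeta>"
proof -
  have b: "bulk F = bep_operator c \<alpha> (\<lambda>_. 0) \<rho> F" for F by (rule ext) (simp add: bulk_def bep_operator_def)
  have "bulk (\<lambda>\<zeta>. k * F \<zeta> + (-1) * G \<zeta>) \<zeta> = k * bulk F \<zeta> + (-1) * bulk G \<zeta>"
    unfolding b bep_operator_add[OF Polys_cmult[OF assms(1)] Polys_cmult[OF assms(2)]] bep_operator_cmult[OF assms(1)] bep_operator_cmult[OF assms(2)] ..
  then show "bulk (\<lambda>\<zeta>. k * F \<zeta> - G \<zeta>) \<zeta> = k * bulk F \<zeta> - bulk G \<zeta>" by simp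
  have "pderiv_at x (\<lambda>\<zeta>. k * F \<zeta> - G \<zeta>) = (\<lambda>\<zeta>. k * pderiv_at x F \<zeta> - pderiv_at x G \<zeta>)" for x
    using Polys_pderiv_diff[OF Polys_cmult[OF assms(1)] assms(2)] Polys_pderiv_cmult[OF assms(1)] by simp
  then show "killing (\<lambda>\<zeta>. k * F \<zeta> - G \<zeta>) \<zeta> = k * killing F \<zeta> - killing G \<zeta>"
    by (simp add: killing_def algebra_simps sum_subtractf sum_distrib_left)
qed

text \<open>
  Comparison with the supersolution \<open>H\<close>. Both functions have the same degree of homogeneity, so
  the smallest \<open>k\<close> with \<open>G \<le> k * H\<close> on the orthant is the maximum of \<open>G / H\<close> over the simplex, and
  the point where it is attained is a minimum of \<open>k * H - G\<close>.
\<close>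

lemma top_degree_gap:
  assumes F: "hom_deg (Suc m) F" and nz: "F \<zeta>1 \<noteq> 0"
    and eig: "\<And>\<zeta>. bulk F \<zeta> - killing F \<zeta> = - l * F \<zeta>"
  shows "lam \<le> l"
proof -
  let ?S = "\<lambda>\<zeta>::'v \<Rightarrow> real. (\<Sum>x\<in>UNIV. \<zeta> x)"
  have FP: "F \<in> Polys" using F by (simp add: hom_deg_def)
  (* a point of the open orthant where F does not vanish *)
  obtain \<zeta>2 where z2: "\<And>x. 0 < \<zeta>2 x" "F \<zeta>2 \<noteq> 0" using Polys_zero_of_orthant[OF FP, of \<zeta>1] nz by blast
  define e where "e = sgn (F \<zeta>2)"
  (* F up to a sign that makes it positive somewhere in the orthant *)
  define G where "G \<zeta> = e * F \<zeta>" for \<zeta>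
  have GP: "G \<in> Polys" unfolding G_def[abs_def] by (intro Polys_cmult FP)
  have Gh: "G (\<lambda>z. r * \<zeta> z) = r ^ Suc m * G \<zeta>" for r \<zeta> using F by (simp add: hom_deg_def G_def)
  have G2: "0 < G \<zeta>2" using z2(2) by (simp add: G_def e_def sgn_if)
  have Geig: "bulk G \<zeta> - killing G \<zeta> = - l * G \<zeta>" for \<zeta>
    using bulk_killing_linear[OF FP Polys_const[of 0], of e \<zeta>] bulk_killing_linear[OF Polys_const[of 0] Polys_const[of 0], of 0 \<zeta>]
      eig[of \<zeta>] by (simp add: G_def[abs_def] right_diff_distrib[symmetric])
  obtain a where a: "\<And>x. 0 < a x" "\<And>x. T a x = lam * a x" using rw_ground_state by blast
  let ?A = "\<lambda>\<zeta>::'v \<Rightarrow> real. (\<Sum>x\<in>UNIV. a x * \<zeta> x)"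
  define H where "H \<zeta> = ?A \<zeta> * ?S \<zeta> ^ m" for \<zeta>
  have HP: "H \<in> Polys" unfolding H_def[abs_def] by (intro Polys_mult Polys_power Polys_sum Polys_cmult Polys_coord)
  have Hh: "H (\<lambda>z. r * \<zeta> z) = r ^ Suc m * H \<zeta>" for r \<zeta>
  proof -
    have "?A (\<lambda>z. r * \<zeta> z) = r * ?A \<zeta>" by (simp add: sum_distrib_left mult_ac)
    moreover have "?S (\<lambda>z. r * \<zeta> z) = r * ?S \<zeta>" by (simp add: sum_distrib_left)
    ultimately show ?thesis by (simp add: H_def power_mult_distrib)
  qed
  (* the unit simplex *)
  define X where "X = {\<zeta>::'v \<Rightarrow> real. \<forall>x. 0 \<le> \<zeta> x \<and> \<zeta> x \<le> 1} \<inter> {\<zeta>. ?S \<zeta> = 1}"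
  have "continuous_on UNIV ?S" by (rule Polys_continuous) (intro Polys_sum Polys_coord)
  then have "closed {\<zeta>. ?S \<zeta> = 1}" by (intro closed_Collect_eq continuous_on_const)
  then have X: "compact X" unfolding X_def by (intro compact_Int_closed compact_box)
  have Hpos: "0 < H \<zeta>" if "\<zeta> \<in> X" for \<zeta>
  proof -
    have z: "\<And>x. 0 \<le> \<zeta> x" "?S \<zeta> = 1" using that by (auto simp: X_def)
    have "\<exists>x. \<zeta> x \<noteq> 0" using z(2) by (metis sum.neutral zero_neq_one)
    then obtain x where "0 < \<zeta> x" using z(1) by (metis order_le_less)
    then have "0 < ?A \<zeta>" using a(1) z(1)
      by (intro sum_pos2[of UNIV x]) (auto intro!: mult_nonneg_nonneg less_imp_le[OF a(1)])
    then show ?thesis by (simp add: H_def z(2))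
  qed
  have norm_X: "(\<lambda>z. (1 / ?S \<zeta>) * \<zeta> z) \<in> X" if z: "\<And>x. 0 \<le> \<zeta> x" and s: "0 < ?S \<zeta>" for \<zeta>
  proof -
    have "\<zeta> x \<le> ?S \<zeta>" for x using z by (intro member_le_sum) auto
    then show ?thesis using z s by (auto simp: X_def sum_divide_distrib[symmetric])
  qed
  have s2: "0 < ?S \<zeta>2" using z2(1) by (intro sum_pos) auto
  have z2': "\<And>x. 0 \<le> \<zeta>2 x" using z2(1) less_imp_le by blast
  have "continuous_on X (\<lambda>\<zeta>. G \<zeta> / H \<zeta>)"
    using Hpos by (intro continuous_intros Polys_continuous GP HP) force
  moreover have "X \<noteq> {}" using norm_X[OF z2' s2] by blast
  ultimately obtain q where q: "q \<in> X" "\<And>\<zeta>. \<zeta> \<in> X \<Longrightarrow> G \<zeta> / H \<zeta> \<le> G q / H q"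
    using continuous_attains_sup[OF X] by blast
  define k where "k = G q / H q"
  have "0 < G (\<lambda>z. (1 / ?S \<zeta>2) * \<zeta>2 z)" unfolding Gh using G2 s2 by simp
  then have k: "0 < k" using q(2)[OF norm_X[OF z2' s2]] Hpos[OF norm_X[OF z2' s2]] unfolding k_def
    by (meson divide_pos_pos less_le_trans)
  define Q where "Q \<zeta> = k * H \<zeta> - G \<zeta>" for \<zeta>
  have QP: "Q \<in> Polys" unfolding Q_def[abs_def] by (intro Polys_diff Polys_cmult HP GP)
  have Qq: "Q q = 0" using Hpos[OF q(1)] by (simp add: Q_def k_def)
  have Qnn: "0 \<le> Q \<zeta>" if z: "\<And>x. 0 \<le> \<zeta> x" for \<zeta>
  proof (cases "?S \<zeta> = 0")
    case True
    then have "\<zeta> = (\<lambda>z. 0 * \<zeta> z)" using z by (simp add: sum_nonneg_eq_0_iff fun_eq_iff)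
    then have "G \<zeta> = 0" "H \<zeta> = 0" using Gh[of 0 \<zeta>] Hh[of 0 \<zeta>] by simp_all
    then show ?thesis by (simp add: Q_def)
  next
    case False
    then have s: "0 < ?S \<zeta>" using z by (simp add: sum_nonneg less_le)
    define \<xi> where "\<xi> = (\<lambda>z. (1 / ?S \<zeta>) * \<zeta> z)"
    have xi: "\<xi> \<in> X" unfolding \<xi>_def by (rule norm_X[OF z s])
    have "G \<xi> \<le> k * H \<xi>" using q(2)[OF xi] Hpos[OF xi] by (simp add: k_def pos_divide_le_eq)
    then have "?S \<zeta> ^ Suc m * G \<xi> \<le> ?S \<zeta> ^ Suc m * (k * H \<xi>)" using s by (intro mult_left_mono) auto
    moreover have "\<zeta> = (\<lambda>z. ?S \<zeta> * \<xi> z)" using s by (auto simp: \<xi>_def)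
    then have "G \<zeta> = ?S \<zeta> ^ Suc m * G \<xi>" "H \<zeta> = ?S \<zeta> ^ Suc m * H \<xi>" using Gh[of "?S \<zeta>" \<xi>] Hh[of "?S \<zeta>" \<xi>] by simp_all
    ultimately show ?thesis by (simp add: Q_def mult.left_commute)
  qed
  have qz: "\<And>x. 0 \<le> q x" using q(1) by (auto simp: X_def)
  interpret orthant_minimum Q q by standard (use QP qz Qq Qnn in auto)
  have "0 \<le> bulk Q q" unfolding bulk_def
    by (intro mult_nonneg_nonneg sum_nonneg c_nonneg exchange_nonneg alpha) simp
  moreover have "killing Q q = 0" unfolding killing_def killing_zero by simp
  ultimately have "0 \<le> bulk Q q - killing Q q" by simp
  also have "\<dots> = k * (bulk H q - killing H q) - (bulk G q - killing G q)"
    unfolding Q_def[abs_def] bulk_killing_linear[OF HP GP] by (simp add: right_diff_distrib)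
  also have "\<dots> \<le> k * (- lam * H q) - (- l * G q)"
  proof -
    have "bulk H q - killing H q \<le> - lam * H q"
      unfolding H_def[abs_def] by (rule supersolution[OF a]) (rule qz)
    then have "k * (bulk H q - killing H q) \<le> k * (- lam * H q)" using k by (intro mult_left_mono) auto
    then show ?thesis unfolding Geig by linarith
  qed
  also have "G q = k * H q" using Qq by (simp add: Q_def)
  finally have "0 \<le> (l - lam) * (k * H q)" by (simp add: algebra_simps)
  moreover have "0 < k * H q" using k Hpos[OF q(1)] by simp
  ultimately show ?thesis by (simp only: zero_le_mult_iff) linarith
qed

theorem eigenpolynomial_gap:
  assumes f: "f \<in> Polys" and nz: "f \<noteq> (\<lambda>_. 0)" and eig: "L f = (\<lambda>\<zeta>. - l * f \<zeta>)"
  shows "l = 0 \<or> lam \<le> l"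
proof -
  let ?D = "\<lambda>n. \<exists>F. (\<forall>k. hom_deg k (F k)) \<and> f = (\<lambda>\<zeta>. \<Sum>k\<le>n. F k \<zeta>)"
  (* the least n guarantees that the top part is not 0 *)
  have "\<exists>n. ?D n" using homogeneous_decomposition[OF f] by blast
  then have ex: "?D (LEAST n. ?D n)" by (rule LeastI_ex)
  define n where "n = (LEAST n. ?D n)"
  obtain F where F: "\<And>k. hom_deg k (F k)" "f = (\<lambda>\<zeta>. \<Sum>k\<le>n. F k \<zeta>)" using ex unfolding n_def by blast
  have top: "bulk (F n) \<zeta> - killing (F n) \<zeta> = - l * F n \<zeta>" for \<zeta> by (rule top_degree_eigen[OF F eig])
  show ?thesis
  proof (cases n)
    case 0
    have "f \<zeta> = F 0 (\<lambda>_. 0)" for \<zeta>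
    proof -
      have "F 0 (\<lambda>z. 0 * \<zeta> z) = 0 ^ 0 * F 0 \<zeta>" using F(1)[of 0] unfolding hom_deg_def by blast
      then show ?thesis by (simp add: F(2) 0)
    qed
    then have "f = (\<lambda>_. F 0 (\<lambda>_. 0))" by auto
    then obtain d where d: "f = (\<lambda>_. d)" by blast
    have "L f = (\<lambda>_. 0)" unfolding d bep_operator_def[abs_def] by (simp add: pderiv_diff_def[abs_def] pderiv_const)
    then have "0 = - l * d" using fun_cong[OF eig, of "\<lambda>_. 0"] by (simp add: d)
    then show ?thesis using nz d by auto
  next
    case (Suc m)
    have "F n \<noteq> (\<lambda>_. 0)"
    proof
      assume 0: "F n = (\<lambda>_. 0)"
      have "?D m" by (rule exI[of _ F]) (use F 0 Suc in auto)
      then have "n \<le> m" unfolding n_def by (rule Least_le)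
      then show False using Suc by simp
    qed
    then obtain \<zeta>1 where "F n \<zeta>1 \<noteq> 0" by auto
    then have "lam \<le> l" using top_degree_gap[of m "F n"] F(1)[of n] top Suc by blast
    then show ?thesis ..
  qed
qed

end

section \<open>An orthonormal basis of eigenpolynomials\<close>

context bep_setting
begin

lemma L_sym: "f \<in> Polys \<Longrightarrow> g \<in> Polys \<Longrightarrow> L2_ip M (L f) g = L2_ip M f (L g)"
  by (intro bep_symmetric Polys_test)

lemma Polys_definite: "f \<in> Polys \<Longrightarrow> L2_ip M f f = 0 \<Longrightarrow> f = (\<lambda>_. 0)"
proof -
  assume f: "f \<in> Polys" and 0: "L2_ip M f f = 0"
  have "AE \<zeta> in M. f \<zeta> = 0"
    using L2_nrm_eq_0[OF Polys_L2[OF f]] 0 L2_nrm_sq[of M f] by simp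
  then show ?thesis by (intro ext Polys_zero_if_AE_zero[OF f])
qed

text \<open>
  The finite-dimensional spectral theorem for \<open>- L\<close> on the polynomials of degree at most \<open>n\<close>. The
  form is definite there because a polynomial that vanishes almost everywhere is 0.
\<close>

lemma Polys_eigen_decomposition:
  assumes "f \<in> Polys"
  shows "\<exists>E g. finite E \<and> (\<forall>l\<in>E. g l \<in> Polys \<and> L (g l) = (\<lambda>\<zeta>. - l * g l \<zeta>)) \<and> f = (\<lambda>\<zeta>. \<Sum>l\<in>E. g l \<zeta>)"
proof -
  obtain n where n: "f \<in> Pol n" using assms by (auto simp: Polys_def)
  have PP: "h \<in> Pol n \<Longrightarrow> h \<in> Polys" for h by (rule Pol_Polys)
  interpret D: symmetric_operator "Pol n" "mon ` {xs. length xs \<le> n}" "\<lambda>f \<zeta>. - L f \<zeta>" "L2_ip M"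
  proof
    show "FV.subspace (Pol n :: (('v \<Rightarrow> real) \<Rightarrow> real) set)" by (rule Pol_subspace)
    have "finite {xs :: 'v list. length xs \<le> n}" using finite_lists_length_le[of "UNIV :: 'v set" n] by simp
    then show "finite (mon ` {xs :: 'v list. length xs \<le> n})" by simp
    show "(Pol n :: (('v \<Rightarrow> real) \<Rightarrow> real) set) \<subseteq> FV.span (mon ` {xs. length xs \<le> n})" by (simp add: Pol_def)
    show "(\<lambda>\<zeta>. - L h \<zeta>) \<in> Pol n" if "h \<in> Pol n" for h using that by (intro Pol_uminus bep_operator_Pol)
    show "(\<lambda>\<zeta>. - L (h + k) \<zeta>) = (\<lambda>\<zeta>. - L h \<zeta>) + (\<lambda>\<zeta>. - L k \<zeta>)" if "h \<in> Pol n" "k \<in> Pol n" for h k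
      using bep_operator_add[OF PP PP, OF that, of c \<alpha> \<omega> \<rho>] by (simp add: plus_fun_def)
    show "(\<lambda>\<zeta>. - L (scl r h) \<zeta>) = scl r (\<lambda>\<zeta>. - L h \<zeta>)" if "h \<in> Pol n" for r h
      using bep_operator_cmult[OF PP[OF that], of c \<alpha> \<omega> \<rho> r] by (simp add: scl_def)
    show "L2_ip M h k = L2_ip M k h" for h k by (rule L2_ip_sym)
    show "L2_ip M (h + k) w = L2_ip M h w + L2_ip M k w" if "h \<in> Pol n" "k \<in> Pol n" "w \<in> Pol n" for h k w
      using L2_ip_add[of h M k w] that by (simp add: plus_fun_def Polys_L2 PP)
    show "L2_ip M (scl r h) w = r * L2_ip M h w" for r h w by (simp add: scl_def L2_ip_cmult)
    show "0 \<le> L2_ip M h h" for h by (metis L2_nrm_sq zero_le_power2)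
    show "h = 0" if "h \<in> Pol n" "L2_ip M h h = 0" for h
      using Polys_definite[OF PP[OF that(1)] that(2)] by (simp add: zero_fun_def)
    show "L2_ip M (\<lambda>\<zeta>. - L h \<zeta>) k = L2_ip M h (\<lambda>\<zeta>. - L k \<zeta>)" if "h \<in> Pol n" "k \<in> Pol n" for h k
      using L_sym[OF PP PP, OF that] by (simp add: L2_ip_def)
  qed
  obtain E g where E: "finite E" "\<And>l. l \<in> E \<Longrightarrow> g l \<in> Pol n" "\<And>l. l \<in> E \<Longrightarrow> (\<lambda>\<zeta>. - L (g l) \<zeta>) = scl l (g l)" "f = sum g E"
    using D.spectral_decomposition[OF n] by blast
  have "L (g l) = (\<lambda>\<zeta>. - l * g l \<zeta>)" if "l \<in> E" for l
    using E(3)[OF that] by (auto simp: fun_eq_iff scl_def) (metis minus_minus)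
  moreover have "g l \<in> Polys" if "l \<in> E" for l using E(2)[OF that] by (rule PP)
  moreover have "f = (\<lambda>\<zeta>. \<Sum>l\<in>E. g l \<zeta>)" unfolding E(4) by (rule ext) (rule sum_fun_apply)
  ultimately show ?thesis using E(1) by (intro exI[of _ E] exI[of _ g]) blast
qed

lemma eigen_orthogonal:
  assumes "f \<in> Polys" "g \<in> Polys" "L f = (\<lambda>\<zeta>. - l * f \<zeta>)" "L g = (\<lambda>\<zeta>. - m * g \<zeta>)" "l \<noteq> m"
  shows "L2_ip M f g = 0"
proof -
  have "- l * L2_ip M f g = L2_ip M (L f) g" unfolding assms(3) by (rule L2_ip_cmult[symmetric])
  also have "\<dots> = L2_ip M f (L g)" by (rule L_sym[OF assms(1,2)])
  also have "\<dots> = - m * L2_ip M f g" unfolding assms(4) using L2_ip_cmult[of M "-m" g f] L2_ip_sym[of M f] L2_ip_sym[of M g f] by metis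
  finally show ?thesis using assms(5) by simp
qed

text \<open>
  The countably many eigenpolynomials that occur in the decompositions of all monomials, arranged in
  one sequence.
\<close>

lemma eigen_sequence:
  "\<exists>G ev. (\<forall>k::nat. G k \<in> Polys \<and> L (G k) = (\<lambda>\<zeta>. - ev k * G k \<zeta>)) \<and>
     (\<forall>xs. \<exists>N a. mon xs = (\<lambda>\<zeta>. \<Sum>k<N. a k * G k \<zeta>))"
proof -
  have "\<forall>xs. \<exists>E g. finite E \<and> (\<forall>l\<in>E. g l \<in> Polys \<and> L (g l) = (\<lambda>\<zeta>. - l * g l \<zeta>)) \<and> mon xs = (\<lambda>\<zeta>. \<Sum>l\<in>E. g l \<zeta>)"
    using Polys_eigen_decomposition[OF Pol_Polys[OF mon_Pol[OF order_refl]]] by blast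
  then obtain E g where E: "\<And>xs. finite (E xs)" "\<And>xs l. l \<in> E xs \<Longrightarrow> g xs l \<in> Polys"
    "\<And>xs l. l \<in> E xs \<Longrightarrow> L (g xs l) = (\<lambda>\<zeta>. - l * g xs l \<zeta>)" "\<And>xs. mon xs = (\<lambda>\<zeta>. \<Sum>l\<in>E xs. g xs l \<zeta>)" by metis
  (* the first element only ensures that the index set is not empty *)
  define I where "I = insert ([], 0) (Sigma UNIV E)"
  define gg where "gg q = (if snd q \<in> E (fst q) then g (fst q) (snd q) else (\<lambda>_. 0))" for q :: "'v list \<times> real"
  have cI: "countable I" unfolding I_def using E(1) by (intro countable_insert countable_SIGMA) (auto intro: countable_finite)
  define en where "en = from_nat_into I"
  have surj: "\<exists>k. en k = q" if "q \<in> I" for q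
    using from_nat_into_surj[OF cI that] by (simp add: en_def)
  define G where "G k = gg (en k)" for k
  define ev where "ev k = snd (en k)" for k
  have L0: "L (\<lambda>_. 0) = (\<lambda>_. 0)"
    using bep_operator_cmult[OF Polys_const[of 0], of c \<alpha> \<omega> \<rho> 0] by simp
  have "G k \<in> Polys \<and> L (G k) = (\<lambda>\<zeta>. - ev k * G k \<zeta>)" for k
    using E(2,3)[of "snd (en k)" "fst (en k)"] by (simp add: G_def ev_def gg_def Polys_const L0)
  moreover have "\<exists>N a. mon xs = (\<lambda>\<zeta>. \<Sum>k<N. a k * G k \<zeta>)" for xs
  proof -
    have "\<forall>l\<in>E xs. \<exists>k. en k = (xs, l)" using surj by (auto simp: I_def)
    then obtain ix where ix: "\<And>l. l \<in> E xs \<Longrightarrow> en (ix l) = (xs, l)" by metis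
    have inj: "inj_on ix (E xs)" using ix by (intro inj_onI) (metis prod.inject)
    obtain N where N: "\<And>l. l \<in> E xs \<Longrightarrow> ix l < N"
      using finite_nat_set_iff_bounded[of "ix ` E xs"] E(1) by auto
    have "mon xs \<zeta> = (\<Sum>k<N. (if k \<in> ix ` E xs then 1 else 0) * G k \<zeta>)" for \<zeta>
    proof -
      have "(\<Sum>k<N. (if k \<in> ix ` E xs then 1 else 0) * G k \<zeta>) = (\<Sum>k\<in>ix ` E xs. G k \<zeta>)"
        using N by (intro sum.mono_neutral_cong_right) auto
      also have "\<dots> = (\<Sum>l\<in>E xs. G (ix l) \<zeta>)" by (simp add: sum.reindex[OF inj])
      also have "\<dots> = (\<Sum>l\<in>E xs. g xs l \<zeta>)" by (rule sum.cong) (simp_all add: G_def gg_def ix)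
      finally show ?thesis by (simp add: E(4))
    qed
    then have "mon xs = (\<lambda>\<zeta>. \<Sum>k<N. (if k \<in> ix ` E xs then 1 else 0) * G k \<zeta>)" by (rule ext)
    then show ?thesis by (intro exI)
  qed
  ultimately show ?thesis by blast
qed

text \<open>
  Division by 0 yields 0, so a polynomial that depends on its predecessors contributes a null
  vector.
\<close>

primrec gram_schmidt :: "(nat \<Rightarrow> ('v \<Rightarrow> real) \<Rightarrow> real) \<Rightarrow> nat \<Rightarrow> (('v \<Rightarrow> real) \<Rightarrow> real) list" where
  "gram_schmidt G 0 = []"
| "gram_schmidt G (Suc k) = gram_schmidt G k @
    [let h = (\<lambda>\<zeta>. G k \<zeta> - (\<Sum>e\<leftarrow>gram_schmidt G k. L2_ip M (G k) e * e \<zeta>))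
     in (\<lambda>\<zeta>. 1 / sqrt (L2_ip M h h) * h \<zeta>)]"

lemma gram_schmidt_sequence:
  fixes G :: "nat \<Rightarrow> ('v \<Rightarrow> real) \<Rightarrow> real"
  shows "\<exists>e. \<forall>k. \<exists>h. h = (\<lambda>\<zeta>. G k \<zeta> - (\<Sum>j<k. L2_ip M (G k) (e j) * e j \<zeta>)) \<and> e k = (\<lambda>\<zeta>. 1 / sqrt (L2_ip M h h) * h \<zeta>)"
proof -
  define e where "e k = gram_schmidt G (Suc k) ! k" for k
  have len: "length (gram_schmidt G k) = k" for k by (induction k) (auto simp: Let_def)
  have gs: "gram_schmidt G k = map e [0..<k]" for k
  proof (induction k)
    case (Suc k)
    have "gram_schmidt G (Suc k) = gram_schmidt G k @ [gram_schmidt G (Suc k) ! k]"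
      using len[of k] by (simp add: nth_append Let_def)
    then show ?case using Suc by (simp add: e_def)
  qed simp
  have sl: "(\<Sum>e\<leftarrow>gram_schmidt G k. L2_ip M (G k) e * e \<zeta>) = (\<Sum>j<k. L2_ip M (G k) (e j) * e j \<zeta>)" for k \<zeta>
    unfolding gs by (simp add: interv_sum_list_conv_sum_set_nat atLeast0LessThan o_def)
  show ?thesis
  proof (intro exI allI conjI)
    fix k
    show "e k = (\<lambda>\<zeta>. 1 / sqrt (L2_ip M (\<lambda>\<zeta>. G k \<zeta> - (\<Sum>j<k. L2_ip M (G k) (e j) * e j \<zeta>)) (\<lambda>\<zeta>. G k \<zeta> - (\<Sum>j<k. L2_ip M (G k) (e j) * e j \<zeta>)))
        * (G k \<zeta> - (\<Sum>j<k. L2_ip M (G k) (e j) * e j \<zeta>)))"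
      unfolding e_def[of k] using len[of k] by (simp add: nth_append Let_def sl)
  qed (rule refl)
qed

lemma psum_closed:
  fixes e :: "nat \<Rightarrow> 'b \<Rightarrow> real"
  assumes "\<exists>N a. f = (\<lambda>z. \<Sum>k<N. a k * e k z)" "\<exists>N a. g = (\<lambda>z. \<Sum>k<N. a k * e k z)"
  shows "\<exists>N a. (\<lambda>z. r * f z + g z) = (\<lambda>z. \<Sum>k<N. a k * e k z)"
proof -
  obtain N a where f: "f = (\<lambda>z. \<Sum>k<N. a k * e k z)" using assms(1) by blast
  obtain K b where g: "g = (\<lambda>z. \<Sum>k<K. b k * e k z)" using assms(2) by blast
  let ?m = "max N K"
  have f': "f z = (\<Sum>k<?m. (if k < N then a k else 0) * e k z)" for z
    unfolding f by (intro sum.mono_neutral_cong_left) auto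
  have g': "g z = (\<Sum>k<?m. (if k < K then b k else 0) * e k z)" for z
    unfolding g by (intro sum.mono_neutral_cong_left) auto
  have "r * f z + g z = (\<Sum>k<?m. (r * (if k < N then a k else 0) + (if k < K then b k else 0)) * e k z)" for z
    unfolding f' g' by (simp add: sum_distrib_left sum.distrib distrib_right mult.assoc)
  then show ?thesis by (intro exI[of _ ?m] exI[of _ "\<lambda>k. r * (if k < N then a k else 0) + (if k < K then b k else 0)"] ext)
qed

text \<open>
  Gram-Schmidt respects eigenspaces: eigenpolynomials of different eigenvalues are orthogonal
  already, so only those with the same eigenvalue are combined.
\<close>

lemma orthonormal_eigenbasis:
  "\<exists>e ev. (\<forall>k::nat. e k \<in> Polys \<and> L (e k) = (\<lambda>\<zeta>. - ev k * e k \<zeta>) \<and> L2_ip M (e k) (e k) \<in> {0, 1}) \<and>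
     (\<forall>j k. j \<noteq> k \<longrightarrow> L2_ip M (e j) (e k) = 0) \<and>
     (\<forall>p\<in>Polys. \<exists>N a. p = (\<lambda>\<zeta>. \<Sum>k<N. a k * e k \<zeta>))"
proof -
  obtain G ev where G: "\<And>k::nat. G k \<in> Polys" "\<And>k. L (G k) = (\<lambda>\<zeta>. - ev k * G k \<zeta>)"
    and span: "\<And>xs. \<exists>N a. mon xs = (\<lambda>\<zeta>. \<Sum>k<N. a k * G k \<zeta>)"
    using eigen_sequence by blast
  obtain e where e0: "\<forall>k. \<exists>h. h = (\<lambda>\<zeta>. G k \<zeta> - (\<Sum>j<k. L2_ip M (G k) (e j) * e j \<zeta>)) \<and> e k = (\<lambda>\<zeta>. 1 / sqrt (L2_ip M h h) * h \<zeta>)"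
    using gram_schmidt_sequence[of G] by (rule exE)
  define h where "h k = (\<lambda>\<zeta>. G k \<zeta> - (\<Sum>j<k. L2_ip M (G k) (e j) * e j \<zeta>))" for k
  have e: "e k = (\<lambda>\<zeta>. 1 / sqrt (L2_ip M (h k) (h k)) * h k \<zeta>)" for k
  proof -
    obtain h' where h': "h' = h k" "e k = (\<lambda>\<zeta>. 1 / sqrt (L2_ip M h' h') * h' \<zeta>)"
      using spec[OF e0, of k] unfolding h_def[symmetric] by (elim exE conjE)
    show ?thesis using h'(2) unfolding h'(1) .
  qed
  have ipnn: "0 \<le> L2_ip M f f" for f by (metis L2_nrm_sq zero_le_power2)
  have main: "(e k \<in> Polys \<and> L (e k) = (\<lambda>\<zeta>. - ev k * e k \<zeta>) \<and> L2_ip M (e k) (e k) \<in> {0, 1} \<and> (\<forall>j<k. L2_ip M (e k) (e j) = 0))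
      \<and> h k \<in> Polys" for k
  proof (induction k rule: less_induct)
    case (less k)
    have eP: "\<And>j. j < k \<Longrightarrow> e j \<in> Polys" and eL: "\<And>j. j < k \<Longrightarrow> L (e j) = (\<lambda>\<zeta>. - ev j * e j \<zeta>)"
      and en: "\<And>j. j < k \<Longrightarrow> L2_ip M (e j) (e j) \<in> {0, 1}" and eo: "\<And>i j. j < k \<Longrightarrow> i < j \<Longrightarrow> L2_ip M (e j) (e i) = 0"
      using less by blast+
    have eo': "L2_ip M (e i) (e j) = 0" if "i < k" "j < k" "i \<noteq> j" for i j
      using eo[of i j] eo[of j i] that L2_ip_sym[of M "e i" "e j"] by (cases "i < j") auto
    have sumP: "(\<lambda>\<zeta>. \<Sum>j<k. L2_ip M (G k) (e j) * e j \<zeta>) \<in> Polys" by (intro Polys_sum Polys_cmult eP) simp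
    have hP: "h k \<in> Polys" unfolding h_def by (intro Polys_diff G sumP)
    (* the coefficient vanishes unless the eigenvalues agree *)
    have coef: "L2_ip M (G k) (e j) * ev j = L2_ip M (G k) (e j) * ev k" if "j < k" for j
      using eigen_orthogonal[OF G(1)[of k] eP[OF that] G(2) eL[OF that]] by (cases "ev k = ev j") auto
    have Lsum: "L (\<lambda>\<zeta>. \<Sum>j<k. L2_ip M (G k) (e j) * e j \<zeta>) = (\<lambda>\<zeta>. - ev k * (\<Sum>j<k. L2_ip M (G k) (e j) * e j \<zeta>))"
    proof -
      have "L (\<lambda>\<zeta>. \<Sum>j<k. L2_ip M (G k) (e j) * e j \<zeta>) = (\<lambda>\<zeta>. \<Sum>j<k. L2_ip M (G k) (e j) * L (e j) \<zeta>)"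
        by (rule L_sum_Polys) (auto intro: eP)
      also have "\<dots> = (\<lambda>\<zeta>. \<Sum>j<k. - ev k * (L2_ip M (G k) (e j) * e j \<zeta>))"
      proof (intro ext sum.cong refl)
        fix \<zeta> j assume "j \<in> {..<k}"
        then have j: "j < k" by simp
        have "L2_ip M (G k) (e j) * L (e j) \<zeta> = - (L2_ip M (G k) (e j) * ev j) * e j \<zeta>" unfolding eL[OF j] by simp
        then show "L2_ip M (G k) (e j) * L (e j) \<zeta> = - ev k * (L2_ip M (G k) (e j) * e j \<zeta>)" unfolding coef[OF j] by simp
      qed
      finally show ?thesis by (simp add: sum_distrib_left)
    qed
    have Lh: "L (h k) = (\<lambda>\<zeta>. - ev k * h k \<zeta>)"
    proof -
      have "h k = (\<lambda>\<zeta>. G k \<zeta> + (-1) * (\<Sum>j<k. L2_ip M (G k) (e j) * e j \<zeta>))" by (simp add: h_def)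
      then show ?thesis
        using bep_operator_add[OF G(1)[of k] Polys_cmult[OF sumP, of "-1"], of c \<alpha> \<omega> \<rho>] bep_operator_cmult[OF sumP, of c \<alpha> \<omega> \<rho> "-1"]
        by (simp add: G(2) Lsum right_diff_distrib)
    qed
    have ho: "L2_ip M (h k) (e j) = 0" if j: "j < k" for j
    proof -
      have "L2_ip M (\<lambda>\<zeta>. \<Sum>i<k. L2_ip M (G k) (e i) * e i \<zeta>) (e j) = (\<Sum>i<k. L2_ip M (G k) (e i) * L2_ip M (e i) (e j))"
        by (subst L2_ip_sum) (auto simp: L2_cmult Polys_L2 eP j L2_ip_cmult)
      also have "\<dots> = L2_ip M (G k) (e j) * L2_ip M (e j) (e j)"
        using j by (subst sum.remove[of _ j]) (auto intro!: sum.neutral eo')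
      also have "\<dots> = L2_ip M (G k) (e j)"
      proof (cases "L2_ip M (e j) (e j) = 0")
        case True
        then have "e j = (\<lambda>_. 0)" using Polys_definite[OF eP[OF j]] by blast
        then show ?thesis by (simp add: L2_ip_def)
      qed (use en[OF j] in auto)
      finally show ?thesis
        unfolding h_def using L2_ip_diff[OF Polys_L2[OF G(1)[of k]] Polys_L2[OF sumP] Polys_L2[OF eP[OF j]]] by simp
    qed
    have 1: "e k \<in> Polys" unfolding e[of k] by (intro Polys_cmult hP)
    have 2: "L (e k) = (\<lambda>\<zeta>. - ev k * e k \<zeta>)" unfolding e[of k] bep_operator_cmult[OF hP] Lh by (simp add: mult.left_commute)
    have 3: "L2_ip M (e k) (e k) \<in> {0, 1}"
    proof -
      let ?q = "L2_ip M (h k) (h k)"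
      have "L2_ip M (e k) (e k) = 1 / sqrt ?q * (1 / sqrt ?q * ?q)"
        unfolding e[of k] L2_ip_cmult by (subst L2_ip_sym) (simp only: L2_ip_cmult)
      also have "\<dots> \<in> {0, 1}" using ipnn[of "h k"] by (cases "?q = 0") (auto simp: real_div_sqrt)
      finally show ?thesis .
    qed
    have 4: "L2_ip M (e k) (e j) = 0" if "j < k" for j unfolding e[of k] L2_ip_cmult ho[OF that] by simp
    show ?case using 1 2 3 4 hP by blast
  qed
  have orth: "L2_ip M (e j) (e k) = 0" if "j \<noteq> k" for j k
    using main[of j] main[of k] that L2_ip_sym[of M "e j" "e k"] by (cases "j < k") auto
  have G_span: "\<exists>N a. G k = (\<lambda>\<zeta>. \<Sum>j<N. a j * e j \<zeta>)" for k
  proof -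
    let ?q = "L2_ip M (h k) (h k)"
    have hk: "h k \<zeta> = sqrt ?q * e k \<zeta>" for \<zeta>
    proof (cases "?q = 0")
      case True
      then have "h k = (\<lambda>_. 0)" using Polys_definite main by blast
      then show ?thesis using True by simp
    next
      case False then show ?thesis using ipnn[of "h k"] by (simp add: e[of k])
    qed
    have "G k \<zeta> = (\<Sum>j<Suc k. (if j = k then sqrt ?q else L2_ip M (G k) (e j)) * e j \<zeta>)" for \<zeta>
    proof -
      have "G k \<zeta> = (\<Sum>j<k. L2_ip M (G k) (e j) * e j \<zeta>) + h k \<zeta>" by (simp add: h_def)
      also have "(\<Sum>j<k. L2_ip M (G k) (e j) * e j \<zeta>) = (\<Sum>j<k. (if j = k then sqrt ?q else L2_ip M (G k) (e j)) * e j \<zeta>)"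
        by (rule sum.cong) auto
      also have "h k \<zeta> = (if k = k then sqrt ?q else L2_ip M (G k) (e k)) * e k \<zeta>"
        unfolding hk[of \<zeta>] by (simp only: if_True simp_thms)
      finally show ?thesis unfolding sum.lessThan_Suc .
    qed
    then have "G k = (\<lambda>\<zeta>. \<Sum>j<Suc k. (if j = k then sqrt ?q else L2_ip M (G k) (e j)) * e j \<zeta>)" by (rule ext)
    then show ?thesis by (intro exI)
  qed
  have zero_span: "\<exists>N a. (\<lambda>_. 0) = (\<lambda>\<zeta>. \<Sum>j<N. a j * e j \<zeta>)" by (intro exI[of _ 0]) simp
  have comb: "\<exists>N a. (\<lambda>\<zeta>. \<Sum>k<K. b k * G k \<zeta>) = (\<lambda>\<zeta>. \<Sum>j<N. a j * e j \<zeta>)" for K and b :: "nat \<Rightarrow> real"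
  proof (induction K)
    case 0 then show ?case using zero_span by simp
  next
    case (Suc K)
    show ?case using psum_closed[OF G_span[of K] Suc.IH, of "b K"] by (simp add: add.commute)
  qed
  have "\<exists>N a. p = (\<lambda>\<zeta>. \<Sum>k<N. a k * e k \<zeta>)" if pP: "p \<in> Polys" for p
  proof -
    obtain n where "p \<in> Pol n" using pP by (auto simp: Polys_def)
    then show ?thesis
    proof (induction rule: Pol_induct)
      case zero show ?case by (rule zero_span)
    next
      case (step r xs g)
      obtain K b where "mon xs = (\<lambda>\<zeta>. \<Sum>k<K. b k * G k \<zeta>)" using span by blast
      then have "\<exists>N a. mon xs = (\<lambda>\<zeta>. \<Sum>j<N. a j * e j \<zeta>)" using comb[of b K] by simp
      then show ?case using step.IH by (rule psum_closed)
    qed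
  qed
  then show ?thesis using main orth by blast
qed

section \<open>The semigroup and its generator\<close>

text \<open>
  Null basis elements carry a meaningless eigenvalue, which is replaced by 0.
\<close>

lemma bep_spectral_semigroup:
  "\<exists>e \<mu>. spectral_semigroup M e \<mu> \<and> (\<forall>k. e k \<in> Polys \<and> L (e k) = (\<lambda>\<zeta>. - \<mu> k * e k \<zeta>) \<and> (\<mu> k = 0 \<or> lam \<le> \<mu> k))"
proof -
  obtain e ev where E: "(\<forall>k::nat. e k \<in> Polys \<and> L (e k) = (\<lambda>\<zeta>. - ev k * e k \<zeta>) \<and> L2_ip M (e k) (e k) \<in> {0, 1}) \<and>
     (\<forall>j k. j \<noteq> k \<longrightarrow> L2_ip M (e j) (e k) = 0) \<and>
     (\<forall>p\<in>Polys. \<exists>N a. p = (\<lambda>\<zeta>. \<Sum>k<N. a k * e k \<zeta>))"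
    using orthonormal_eigenbasis by (elim exE)
  note e = E[THEN conjunct1, rule_format, THEN conjunct1]
    E[THEN conjunct1, rule_format, THEN conjunct2, THEN conjunct1]
    E[THEN conjunct1, rule_format, THEN conjunct2, THEN conjunct2]
  note orth = E[THEN conjunct2, THEN conjunct1, rule_format]
  note span = E[THEN conjunct2, THEN conjunct2, rule_format]
  define \<mu> where "\<mu> k = (if e k = (\<lambda>_. 0) then 0 else ev k)" for k
  have eL: "L (e k) = (\<lambda>\<zeta>. - \<mu> k * e k \<zeta>)" for k
    using e(2)[of k] by (auto simp: \<mu>_def)
  have gap: "\<mu> k = 0 \<or> lam \<le> \<mu> k" for k
    using eigenpolynomial_gap[OF e(1)[of k] _ e(2)[of k]] by (auto simp: \<mu>_def)
  interpret X: exp_moments M "1 / (2 * \<rho>)"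
  proof
    show "integrable M (\<lambda>\<zeta>. exp (1 / (2 * \<rho>) * (\<Sum>x\<in>UNIV. \<zeta> x)))"
      using rho by (intro integrable_exp_sum) (simp add: field_simps)
  qed (use rho AE_nonneg in auto)
  have "spectral_semigroup M e \<mu>"
  proof
    show "e k \<in> L2_fun M" for k by (rule Polys_L2[OF e(1)])
    show "0 \<le> \<mu> k" for k using gap[of k] lam_pos by auto
    show "\<exists>N a. L2_nrm M (\<lambda>z. f z - (\<Sum>k<N. a k * e k z)) < \<epsilon>" if "f \<in> L2_fun M" "0 < \<epsilon>" for f \<epsilon>
    proof -
      obtain p where p: "p \<in> Polys" "L2_nrm M (\<lambda>\<zeta>. f \<zeta> - p \<zeta>) < \<epsilon>" using X.Polys_dense[OF \<open>f \<in> L2_fun M\<close> \<open>0 < \<epsilon>\<close>] by blast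
      obtain N a where "p = (\<lambda>\<zeta>. \<Sum>k<N. a k * e k \<zeta>)" using span[OF p(1)] by blast
      then show ?thesis using p(2) by blast
    qed
  qed (use e(3) orth in auto)
  then show ?thesis using e(1) eL gap by blast
qed

end

locale bep_semigroup = bep_setting \<alpha> \<rho> c \<omega> + spectral_semigroup "gamma_product \<alpha> \<rho>" e \<mu>
  for \<alpha> :: "'v::finite \<Rightarrow> real" and \<rho> c \<omega> e \<mu> +
  assumes e_Polys: "e k \<in> Polys" and e_eigen: "bep_operator c \<alpha> \<omega> \<rho> (e k) = (\<lambda>\<zeta>. - \<mu> k * e k \<zeta>)"
    and mu_gap: "\<mu> k = 0 \<or> lam \<le> \<mu> k"
begin

text \<open>
  By symmetry of \<open>L\<close> on test functions, the coefficients of \<open>L f\<close> with respect to eigenpolynomials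
  are those that \<open>generator_iff\<close> requires.
\<close>

lemma test_in_generator:
  assumes f: "f \<in> bep_test_functions" shows "(f, L f) \<in> L2_generator M S"
proof -
  have "coe (L f) k = - \<mu> k * coe f k" for k
  proof -
    have "L2_ip M (L f) (e k) = L2_ip M f (L (e k))" by (rule bep_symmetric[OF f Polys_test[OF e_Polys]])
    also have "\<dots> = - \<mu> k * L2_ip M f (e k)"
      unfolding e_eigen using L2_ip_cmult[of M "- \<mu> k" "e k" f] L2_ip_sym[of M f] by metis
    finally show ?thesis by (simp add: coe_def)
  qed
  then show ?thesis using test_operator_L2[OF f] by (simp add: generator_iff)
qed

lemma S_eigen_sum:
  assumes E: "finite E" and g: "\<And>l. l \<in> E \<Longrightarrow> g l \<in> Polys" and eig: "\<And>l. l \<in> E \<Longrightarrow> L (g l) = (\<lambda>\<zeta>. - l * g l \<zeta>)"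
    and t: "0 \<le> t"
  shows "AE \<zeta> in M. S t (\<lambda>\<zeta>. \<Sum>l\<in>E. g l \<zeta>) \<zeta> = (\<Sum>l\<in>E. exp (- l * t) * g l \<zeta>)"
proof (rule eq_AE_if_coe)
  have sL: "(\<lambda>\<zeta>. \<Sum>l\<in>E. g l \<zeta>) \<in> L2_fun M" by (intro L2_sum Polys_L2 g)
  show "S t (\<lambda>\<zeta>. \<Sum>l\<in>E. g l \<zeta>) \<in> L2_fun M" by (rule S_L2[OF t sL])
  show "(\<lambda>\<zeta>. \<Sum>l\<in>E. exp (- l * t) * g l \<zeta>) \<in> L2_fun M" by (intro L2_sum L2_cmult Polys_L2 g)
  fix k
  have key: "exp (- \<mu> k * t) * coe (g l) k = exp (- l * t) * coe (g l) k" if "l \<in> E" for l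
    using eigen_orthogonal[OF g[OF that] e_Polys[of k] eig[OF that] e_eigen[of k]] by (cases "l = \<mu> k") (auto simp: coe_def)
  have "exp (- \<mu> k * t) * (\<Sum>l\<in>E. coe (g l) k) = (\<Sum>l\<in>E. exp (- l * t) * coe (g l) k)"
    unfolding sum_distrib_left by (rule sum.cong[OF refl]) (rule key)
  then show "coe (S t (\<lambda>\<zeta>. \<Sum>l\<in>E. g l \<zeta>)) k = coe (\<lambda>\<zeta>. \<Sum>l\<in>E. exp (- l * t) * g l \<zeta>) k"
    unfolding coe_S[OF t sL] by (simp add: coe_def L2_ip_sum L2_ip_cmult L2_cmult Polys_L2 g e_L2)
qed

text \<open>
  The heat flow of the polynomial \<open>p\<^sup>2\<close> is again polynomial and nonnegative on the orthant, and
  symmetry moves the semigroup from \<open>p\<^sup>2\<close> to \<open>f\<close>.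
\<close>

lemma S_positive:
  assumes t: "0 \<le> t" and f: "f \<in> L2_fun M" and pos: "AE \<zeta> in M. 0 \<le> f \<zeta>"
  shows "AE \<zeta> in M. 0 \<le> S t f \<zeta>"
proof (rule nonneg_if_nonneg_on_squares[OF S_L2[OF t f]])
  fix p :: "('v \<Rightarrow> real) \<Rightarrow> real" assume p: "p \<in> Polys"
  let ?q = "\<lambda>\<zeta>. (p \<zeta>)\<^sup>2"
  have qP: "?q \<in> Polys" by (rule Polys_power[OF p])
  obtain E g where E: "finite E" "\<And>l. l \<in> E \<Longrightarrow> g l \<in> Polys" "\<And>l. l \<in> E \<Longrightarrow> L (g l) = (\<lambda>\<zeta>. - l * g l \<zeta>)"
    and q: "?q = (\<lambda>\<zeta>. \<Sum>l\<in>E. g l \<zeta>)"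
    using Polys_eigen_decomposition[OF qP] by blast
  have nn: "0 \<le> (\<Sum>l\<in>E. exp (- l * t) * g l \<zeta>)" if "\<forall>x. 0 \<le> \<zeta> x" for \<zeta>
  proof (rule heat_flow_nonneg[OF E _ t that])
    fix \<xi> show "0 \<le> (\<Sum>l\<in>E. g l \<xi>)" unfolding fun_cong[OF q, of \<xi>, symmetric] by (rule zero_le_power2)
  qed
  have "AE \<zeta> in M. S t ?q \<zeta> = (\<Sum>l\<in>E. exp (- l * t) * g l \<zeta>)"
    unfolding q by (rule S_eigen_sum[OF E(1) _ _ t]) (use E(2,3) in auto)
  then have "AE \<zeta> in M. 0 \<le> S t ?q \<zeta> * f \<zeta>"
    using AE_nonneg pos
  proof eventually_elim
    case (elim \<zeta>)
    show ?case unfolding elim(1) using nn[OF elim(2)] elim(3) by (rule mult_nonneg_nonneg)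
  qed
  then have "0 \<le> L2_ip M (S t ?q) f" unfolding L2_ip_def by (rule integral_nonneg_AE)
  also have "\<dots> = L2_ip M ?q (S t f)" by (rule S_sym[OF t Polys_L2[OF qP] f])
  finally show "0 \<le> (\<integral>\<zeta>. (p \<zeta>)\<^sup>2 * S t f \<zeta> \<partial>M)" by (simp add: L2_ip_def)
qed

lemma S_markov: "symmetric_markov_semigroup M S"
proof (rule S_symmetric_markov)
  show "\<mu> k = 0" if nz: "coe (\<lambda>_. 1) k \<noteq> 0" for k
  proof (rule ccontr)
    assume "\<mu> k \<noteq> 0"
    have "L (\<lambda>_. 1) = (\<lambda>_. 0)" unfolding bep_operator_def[abs_def] by (simp add: pderiv_diff_def[abs_def] pderiv_const)
    then have L1: "L (\<lambda>_. 1) = (\<lambda>\<zeta>. - 0 * 1)" by simp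
    have "L2_ip M (\<lambda>_. 1) (e k) = 0"
      by (rule eigen_orthogonal[OF Polys_const e_Polys L1 e_eigen]) (use \<open>\<mu> k \<noteq> 0\<close> in simp)
    then show False using nz by (simp add: coe_def)
  qed
qed (rule S_positive)

lemma bep_generator_eq: "bep_generator c \<alpha> \<omega> \<rho> = L2_generator M S"
  unfolding bep_generator_def
proof (rule the_equality)
  show "\<exists>P. symmetric_markov_semigroup M P \<and> L2_generator M S = L2_generator M P \<and> (\<forall>f\<in>bep_test_functions. (f, L f) \<in> L2_generator M S)"
    using S_markov test_in_generator by blast
next
  fix A assume "\<exists>P. symmetric_markov_semigroup M P \<and> A = L2_generator M P \<and> (\<forall>f\<in>bep_test_functions. (f, L f) \<in> A)"
  then obtain P where P: "symmetric_markov_semigroup M P" "A = L2_generator M P" "\<And>f. f \<in> bep_test_functions \<Longrightarrow> (f, L f) \<in> A" by blast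
  have "(e k, \<lambda>\<zeta>. - \<mu> k * e k \<zeta>) \<in> L2_generator M P" for k
    using P(3)[OF Polys_test[OF e_Polys[of k]]] unfolding e_eigen P(2) .
  then show "A = L2_generator M S" unfolding P(2) by (rule generator_unique[OF P(1)])
qed

section \<open>The spectral gap of the process\<close>

text \<open>
  The ground state of the walk, read as a linear function on configurations and centred so as to
  absorb the injection of mass by the reservoirs.
\<close>

lemma lam_in_spectrum: "lam \<in> L2_spectrum M (op_neg (L2_generator M S))"
proof -
  obtain a where a: "\<And>x. 0 < a x" "\<And>x. T a x = lam * a x" using rw_ground_state by blast
  let ?A = "\<lambda>\<zeta>::'v \<Rightarrow> real. (\<Sum>x\<in>UNIV. a x * \<zeta> x)"
  (* the constant that balances the injection, since - L \<kappa> = 0 *)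
  define \<kappa> where "\<kappa> = (\<Sum>x\<in>UNIV. \<omega> x * (\<alpha> x * \<rho> * a x)) / lam"
  define f where "f \<zeta> = ?A \<zeta> + - \<kappa>" for \<zeta>
  have AP: "?A \<in> Polys" by (intro Polys_sum Polys_cmult Polys_coord)
  have fP: "f \<in> Polys" unfolding f_def[abs_def] by (intro Polys_add AP Polys_const)
  have dA: "pderiv_at x ?A = (\<lambda>_. a x)" for x by (rule pderiv_linear)
  have "L f \<zeta> = - lam * f \<zeta>" for \<zeta>
  proof -
    have df: "pderiv_at x f = (\<lambda>_. a x)" for x
      unfolding f_def[abs_def] Polys_pderiv_add[OF AP Polys_const] by (simp add: dA pderiv_const)
    have dd: "pderiv_diff x y f = (\<lambda>_. a x - a y)" for x y by (rule ext) (simp add: pderiv_diff_def df)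
    have ddd: "pderiv_diff x y (pderiv_diff x y f) = (\<lambda>_. 0)" for x y
      unfolding dd by (rule ext) (simp add: pderiv_diff_def pderiv_const)
    have lin: "bulk f \<zeta> - killing f \<zeta> = - lam * ?A \<zeta>"
    proof -
      have "bulk f \<zeta> = (\<Sum>x\<in>UNIV. (\<omega> x * a x - lam * a x) * \<zeta> x)"
        unfolding bulk_def ddd unfolding dd mult_zero_right add_0_right by (rule linear_bulk[OF a(2)])
      moreover have "killing f \<zeta> = (\<Sum>x\<in>UNIV. \<omega> x * a x * \<zeta> x)"
        unfolding killing_def df by (rule sum.cong) simp_all
      ultimately show ?thesis by (simp add: left_diff_distrib sum_subtractf sum_distrib_left sum_negf mult.assoc)
    qed
    have "noise f \<zeta> = lam * \<kappa>" unfolding noise_def df using lam_pos by (simp add: pderiv_const \<kappa>_def)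
    then show ?thesis unfolding L_split lin by (simp add: f_def algebra_simps)
  qed
  then have Lf: "L f = (\<lambda>\<zeta>. - lam * f \<zeta>)" by auto
  have "(f, \<lambda>\<zeta>. - lam * f \<zeta>) \<in> L2_generator M S"
    using test_in_generator[OF Polys_test[OF fP]] unfolding Lf .
  moreover have "\<not> (AE \<zeta> in M. f \<zeta> = 0)"
  proof
    assume "AE \<zeta> in M. f \<zeta> = 0"
    then have z: "f \<zeta> = 0" for \<zeta> using Polys_zero_if_AE_zero[OF fP] by blast
    have "f (\<lambda>_. 1) - f (\<lambda>_. 0) = (\<Sum>x\<in>UNIV. a x)" by (simp add: f_def)
    moreover have "0 < (\<Sum>x\<in>UNIV. a x)" using a(1) by (intro sum_pos) auto
    ultimately show False using z by simp
  qed
  ultimately show ?thesis by (rule eigenvalue_in_spectrum)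
qed

theorem gap_BEP_eq: "gap_BEP c \<alpha> \<omega> \<rho> = lam"
  unfolding gap_BEP_def bep_generator_eq
proof (rule cInf_eq_minimum)
  show "lam \<in> L2_spectrum M (op_neg (L2_generator M S)) - {0}" using lam_in_spectrum lam_pos by simp
  fix l assume l: "l \<in> L2_spectrum M (op_neg (L2_generator M S)) - {0}"
  show "lam \<le> l"
  proof (rule ccontr)
    assume "\<not> lam \<le> l"
    (* the distance of l to the eigenvalues, which are 0 or at least lam *)
    then have "min \<bar>l\<bar> (lam - l) > 0" using l by auto
    moreover have "min \<bar>l\<bar> (lam - l) \<le> \<bar>l - \<mu> k\<bar>" for k using mu_gap[of k] by auto
    ultimately have "l \<in> L2_resolvent_set M (op_neg (L2_generator M S))" by (rule resolvent_if_gap)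
    then show False using l by (simp add: L2_spectrum_def)
  qed
qed

end

theorem corollary8p2:
  fixes c :: "'v::finite \<Rightarrow> 'v \<Rightarrow> real" and \<alpha> \<omega> :: "'v \<Rightarrow> real"
  assumes "connected_conductances c"
    and "\<And>x. 0 < \<alpha> x"
    and "\<And>x. 0 \<le> \<omega> x"
    and "\<exists>x. \<omega> x \<noteq> 0"
  shows "\<forall>\<rho>>0. gap_BEP c \<alpha> \<omega> \<rho> = gap_RW c \<alpha> \<omega>"
proof (intro allI impI)
  fix \<rho> :: real assume \<rho>: "0 < \<rho>"
  interpret bep_setting \<alpha> \<rho> c \<omega> by standard (use assms \<rho> in auto)
  obtain e \<mu> where X: "spectral_semigroup (gamma_product \<alpha> \<rho>) e \<mu>"
    and e: "\<forall>k. e k \<in> Polys \<and> bep_operator c \<alpha> \<omega> \<rho> (e k) = (\<lambda>\<zeta>. - \<mu> k * e k \<zeta>) \<and> (\<mu> k = 0 \<or> lam \<le> \<mu> k)"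
    using bep_spectral_semigroup by blast
  interpret X: spectral_semigroup "gamma_product \<alpha> \<rho>" e \<mu> by (rule X)
  interpret bep_semigroup \<alpha> \<rho> c \<omega> e \<mu> by standard (use e in auto)
  show "gap_BEP c \<alpha> \<omega> \<rho> = gap_RW c \<alpha> \<omega>" unfolding gap_BEP_eq gap_RW_eq lam_def ..
qed

end
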